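(* Let $\{\tau_i\}\subset\mathbb{R}^+$ be a sequence of positive numbers with $\lim_{i\to\infty}\tau_i=0$. Let $u\in L^2(0,T;L^2(\Omega))$, $y_0\in H^1_0(\Omega)$ and $y_1\in L^2(\Omega)$ be given. Let $\{y_{\tau_i}\}\subset Y(0,T)$ be the sequence of unique weak solutions of the Cattaneo equation with delay $\tau_i$, right-hand side $u$ and initial data $y_0,y_1$, and let $y\in W(0,T)$ be the unique weak solution of the heat equation with right-hand side $u$ and initial datum $y_0$. Then, as $i\to\infty$, $$y_{\tau_i}\to y \text{ in } L^2(0,T;L^2(\Omega)),\qquad y_{\tau_i}\rightharpoonup y\text{ in } L^2(0,T;H^1_0(\Omega)),\qquad y_{\tau_i}'\rightharpoonup y'\text{ in } L^2(0,T;L^2(\Omega)).$$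
   Context: $\Omega\subset\mathbb{R}^d$ is a bounded Lipschitz domain with boundary $\partial\Omega$, and $T>0$ is fixed. A prime denotes the (weak) time derivative; $\rightharpoonup$ denotes weak convergence. $(\cdot,\cdot)$ is the $L^2(\Omega)$ scalar product, $\langle\cdot,\cdot\rangle$ is the duality pairing between $H^{-1}(\Omega)$ and $H^1_0(\Omega)$, and $a[y,v]:=(\nabla y,\nabla v)$ for $y,v\in H^1_0(\Omega)$. Cattaneo equation (delay $\tau>0$, right-hand side $u$): $\tau y_\tau''+y_\tau'-\Delta y_\tau=u$ in $(0,T)\times\Omega$, $y_\tau=0$ on $(0,T)\times\partial\Omega$, $y_\tau(0)=y_0$, $y_\tau'(0)=y_1$. Its weak solution is the unique $y_\tau\in Y(0,T):=\{v\in L^2(0,T;H^1_0(\Omega)) : v'\in L^2(0,T;L^2(\Omega)),\ v''\in L^2(0,T;H^{-1}(\Omega))\}$ satisfying the initial conditions and $$\int_0^T \tau\langle y_\tau'',v\rangle+(y_\tau',v)+a[y_\tau,v]\,dt=\int_0^T(u,v)\,dt\quad\text{for all } v\in L^2(0,T;H^1_0(\Omega)).$$ Heat equation: $y'-\Delta y=u$ in $(0,T)\times\Omega$, $y=0$ on $(0,T)\times\partial\Omega$, $y(0)=y_0$. Its weak solution is the unique $y\in W(0,T):=\{v\in L^2(0,T;H^1_0(\Omega)) : v'\in L^2(0,T;L^2(\Omega))\}$ satisfying $y(0)=y_0$ and $$\int_0^T (y',v)+a[y,v]\,dt=\int_0^T(u,v)\,dt\quad\text{for all } v\in L^2(0,T;H^1_0(\Omega)).$$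 *)

theory Defs
  imports "HOL-Analysis.Analysis" "HOL-Library.Function_Algebras"
begin

text \<open>
  Elements of the spaces \<open>L\<^sup>2(\<Omega>)\<close>, \<open>H\<^sup>1\<^sub>0(\<Omega>)\<close>, \<open>L\<^sup>2(0,T;X)\<close>, ... are represented by
  functions, not by classes of functions modulo null sets; accordingly the ``norms'' below
  are seminorms, and two functions at seminorm distance 0 represent the same element.
  All vector space operations are the pointwise ones.
\<close>

instantiation "fun" :: (type, real_vector) real_vector
begin

definition scaleR_fun :: "real \<Rightarrow> ('a \<Rightarrow> 'b) \<Rightarrow> 'a \<Rightarrow> 'b"
  where "scaleR_fun c f = (\<lambda>x. c *\<^sub>R f x)"

instance
  by standard (auto simp: scaleR_fun_def fun_eq_iff scaleR_add_right scaleR_add_left)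

end


section \<open>Normed spaces given by a carrier and a seminorm\<close>

record 'v normed_sp =
  car :: "'v set"
  nrm :: "'v \<Rightarrow> real"

definition converges_in :: "'v::real_vector normed_sp \<Rightarrow> (nat \<Rightarrow> 'v) \<Rightarrow> 'v \<Rightarrow> bool"
  where "converges_in X x l \<longleftrightarrow>
    (\<forall>n. x n \<in> car X) \<and> l \<in> car X \<and> (\<lambda>n. nrm X (x n - l)) \<longlonglongrightarrow> 0"

text \<open>Functionals are total functions, of which only the values on the carrier matter.\<close>

definition dual :: "'v::real_vector normed_sp \<Rightarrow> ('v \<Rightarrow> real) normed_sp"
  where "dual X =
    \<lparr>car = {F. (\<forall>x\<in>car X. \<forall>y\<in>car X. F (x + y) = F x + F y) \<and>
               (\<forall>c. \<forall>x\<in>car X. F (c *\<^sub>R x) = c * F x) \<and>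
               (\<exists>C. \<forall>x\<in>car X. \<bar>F x\<bar> \<le> C * nrm X x)},
     nrm = (\<lambda>F. SUP x\<in>{x \<in> car X. nrm X x \<le> 1}. \<bar>F x\<bar>)\<rparr>"

definition converges_weakly_in :: "'v::real_vector normed_sp \<Rightarrow> (nat \<Rightarrow> 'v) \<Rightarrow> 'v \<Rightarrow> bool"
  where "converges_weakly_in X x l \<longleftrightarrow>
    (\<forall>n. x n \<in> car X) \<and> l \<in> car X \<and> (\<forall>F\<in>car (dual X). (\<lambda>n. F (x n)) \<longlonglongrightarrow> F l)"


section \<open>Bochner spaces\<close>

text \<open>
  The Bochner theory of the library needs a type of class \<open>real_normed_vector\<close>; the
  following are its definitions transcribed to a space given by a carrier and a seminorm.
\<close>

definition strongly_measurable ::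
  "'t measure \<Rightarrow> 'v::real_vector normed_sp \<Rightarrow> ('t \<Rightarrow> 'v) \<Rightarrow> bool"
  where "strongly_measurable M X f \<longleftrightarrow>
    (AE t in M. f t \<in> car X) \<and>
    (\<exists>s. (\<forall>n. simple_function M (s n) \<and> s n ` space M \<subseteq> car X) \<and>
         (AE t in M. (\<lambda>n. nrm X (f t - s n t)) \<longlonglongrightarrow> 0))"

definition has_bochner_integral_in ::
  "'t measure \<Rightarrow> 'v::real_vector normed_sp \<Rightarrow> ('t \<Rightarrow> 'v) \<Rightarrow> 'v \<Rightarrow> bool"
  where "has_bochner_integral_in M X f I \<longleftrightarrow>
    strongly_measurable M X f \<and> I \<in> car X \<and>
    (\<exists>s. (\<forall>n. Bochner_Integration.simple_bochner_integrable M (s n) \<and> s n ` space M \<subseteq> car X) \<and>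
         (\<lambda>n. \<integral>\<^sup>+t. ennreal (nrm X (f t - s n t)) \<partial>M) \<longlonglongrightarrow> 0 \<and>
         (\<lambda>n. nrm X (Bochner_Integration.simple_bochner_integral M (s n) - I)) \<longlonglongrightarrow> 0)"

abbreviation time_measure :: "real \<Rightarrow> real measure"
  where "time_measure T \<equiv> lebesgue_on {0<..<T}"

definition L2_time :: "real \<Rightarrow> 'v::real_vector normed_sp \<Rightarrow> (real \<Rightarrow> 'v) normed_sp"
  where "L2_time T X =
    \<lparr>car = {f. strongly_measurable (time_measure T) X f \<and>
               integrable (time_measure T) (\<lambda>t. (nrm X (f t))\<^sup>2)},
     nrm = (\<lambda>f. sqrt (LINT t|time_measure T. (nrm X (f t))\<^sup>2))\<rparr>"


section \<open>Test functions\<close>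

fun C_k :: "nat \<Rightarrow> ('a::euclidean_space \<Rightarrow> real) \<Rightarrow> bool" where
  "C_k 0 f \<longleftrightarrow> continuous_on UNIV f"
| "C_k (Suc k) f \<longleftrightarrow>
    (\<forall>x. f differentiable (at x)) \<and>
    (\<forall>e\<in>Basis. C_k k (\<lambda>x. frechet_derivative f (at x) e))"

text \<open>\<open>C\<^sub>c\<^sup>\<infinity>(U)\<close>, the functions being extended by 0 to the whole space.\<close>

definition test_functions :: "'a::euclidean_space set \<Rightarrow> ('a \<Rightarrow> real) set"
  where "test_functions U =
    {\<phi>. (\<forall>k. C_k k \<phi>) \<and> compact (closure {x. \<phi> x \<noteq> 0}) \<and> closure {x. \<phi> x \<noteq> 0} \<subseteq> U}"


section \<open>Weak time derivative and initial values\<close>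

definition has_weak_time_deriv ::
  "real \<Rightarrow> 'v::real_vector normed_sp \<Rightarrow> (real \<Rightarrow> 'v) \<Rightarrow> (real \<Rightarrow> 'v) \<Rightarrow> bool"
  where "has_weak_time_deriv T X v w \<longleftrightarrow>
    (\<forall>\<phi>\<in>test_functions {0<..<T}. \<exists>I.
       has_bochner_integral_in (time_measure T) X (\<lambda>t. deriv \<phi> t *\<^sub>R v t) I \<and>
       has_bochner_integral_in (time_measure T) X (\<lambda>t. \<phi> t *\<^sub>R w t) (- I))"

definition weakly_time_differentiable ::
  "real \<Rightarrow> 'v::real_vector normed_sp \<Rightarrow> (real \<Rightarrow> 'v) \<Rightarrow> bool"
  where "weakly_time_differentiable T X v \<longleftrightarrow>
    (\<exists>w\<in>car (L2_time T X). has_weak_time_deriv T X v w)"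

text \<open>The choice is unique up to a null set of times and seminorm distance 0.\<close>

definition time_deriv ::
  "real \<Rightarrow> 'v::real_vector normed_sp \<Rightarrow> (real \<Rightarrow> 'v) \<Rightarrow> real \<Rightarrow> 'v"
  where "time_deriv T X v = (SOME w. w \<in> car (L2_time T X) \<and> has_weak_time_deriv T X v w)"

text \<open>The value at time 0 is that of the continuous representative \<open>[0,T] \<rightarrow> X\<close>.\<close>

definition has_initial_value ::
  "real \<Rightarrow> 'v::real_vector normed_sp \<Rightarrow> (real \<Rightarrow> 'v) \<Rightarrow> 'v \<Rightarrow> bool"
  where "has_initial_value T X v v0 \<longleftrightarrow>
    (\<exists>c. (\<forall>t\<in>{0..T}. c t \<in> car X) \<and>
         (\<forall>t\<in>{0..T}. ((\<lambda>s. nrm X (c s - c t)) \<longlongrightarrow> 0) (at t within {0..T})) \<and>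
         (AE t in time_measure T. nrm X (v t - c t) = 0) \<and>
         nrm X (c 0 - v0) = 0)"


section \<open>Function spaces on the domain\<close>

definition bounded_lipschitz_domain :: "'a::euclidean_space set \<Rightarrow> bool"
  where "bounded_lipschitz_domain \<Omega> \<longleftrightarrow>
    \<Omega> \<noteq> {} \<and> open \<Omega> \<and> connected \<Omega> \<and> bounded \<Omega> \<and>
    (\<forall>p\<in>frontier \<Omega>. \<exists>r>0. \<exists>e. norm e = 1 \<and>
       (\<exists>\<gamma> :: 'a \<Rightarrow> real. \<exists>L. L-lipschitz_on {z. z \<bullet> e = 0} \<gamma> \<and>
          \<Omega> \<inter> ball p r = {x \<in> ball p r. \<gamma> (x - (x \<bullet> e) *\<^sub>R e) < x \<bullet> e}))"

definition L2_inner ::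
  "'a::euclidean_space set \<Rightarrow> ('a \<Rightarrow> 'b::euclidean_space) \<Rightarrow> ('a \<Rightarrow> 'b) \<Rightarrow> real"
  where "L2_inner \<Omega> f g = (LINT x|lebesgue_on \<Omega>. f x \<bullet> g x)"

definition L2 :: "'a::euclidean_space set \<Rightarrow> ('a \<Rightarrow> 'b::euclidean_space) normed_sp"
  where "L2 \<Omega> =
    \<lparr>car = {f \<in> borel_measurable (lebesgue_on \<Omega>).
              integrable (lebesgue_on \<Omega>) (\<lambda>x. (norm (f x))\<^sup>2)},
     nrm = (\<lambda>f. sqrt (L2_inner \<Omega> f f))\<rparr>"

definition has_weak_grad ::
  "'a::euclidean_space set \<Rightarrow> ('a \<Rightarrow> real) \<Rightarrow> ('a \<Rightarrow> 'a) \<Rightarrow> bool"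
  where "has_weak_grad \<Omega> f g \<longleftrightarrow>
    (\<forall>\<phi>\<in>test_functions \<Omega>. \<forall>e\<in>Basis.
       (LINT x|lebesgue_on \<Omega>. f x * frechet_derivative \<phi> (at x) e) =
       - (LINT x|lebesgue_on \<Omega>. (g x \<bullet> e) * \<phi> x))"

text \<open>The choice is unique up to a null set.\<close>

definition grad :: "'a::euclidean_space set \<Rightarrow> ('a \<Rightarrow> real) \<Rightarrow> 'a \<Rightarrow> 'a"
  where "grad \<Omega> f = (SOME g. g \<in> car (L2 \<Omega>) \<and> has_weak_grad \<Omega> f g)"

definition H1 :: "'a::euclidean_space set \<Rightarrow> ('a \<Rightarrow> real) normed_sp"
  where "H1 \<Omega> =
    \<lparr>car = {f \<in> car (L2 \<Omega>). \<exists>g\<in>car (L2 \<Omega>). has_weak_grad \<Omega> f g},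
     nrm = (\<lambda>f. sqrt ((nrm (L2 \<Omega>) f)\<^sup>2 + (nrm (L2 \<Omega>) (grad \<Omega> f))\<^sup>2))\<rparr>"

definition H10 :: "'a::euclidean_space set \<Rightarrow> ('a \<Rightarrow> real) normed_sp"
  where "H10 \<Omega> =
    \<lparr>car = {f \<in> car (H1 \<Omega>). \<exists>\<phi>. (\<forall>n. \<phi> n \<in> test_functions \<Omega>) \<and> converges_in (H1 \<Omega>) \<phi> f},
     nrm = nrm (H1 \<Omega>)\<rparr>"

definition Hm1 :: "'a::euclidean_space set \<Rightarrow> (('a \<Rightarrow> real) \<Rightarrow> real) normed_sp"
  where "Hm1 \<Omega> = dual (H10 \<Omega>)"

definition dirichlet_form :: "'a::euclidean_space set \<Rightarrow> ('a \<Rightarrow> real) \<Rightarrow> ('a \<Rightarrow> real) \<Rightarrow> real"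
  where "dirichlet_form \<Omega> y v = L2_inner \<Omega> (grad \<Omega> y) (grad \<Omega> v)"


section \<open>Weak solutions\<close>

abbreviation L2L2 :: "'a::euclidean_space set \<Rightarrow> real \<Rightarrow> (real \<Rightarrow> 'a \<Rightarrow> real) normed_sp"
  where "L2L2 \<Omega> T \<equiv> L2_time T (L2 \<Omega>)"

abbreviation L2H10 :: "'a::euclidean_space set \<Rightarrow> real \<Rightarrow> (real \<Rightarrow> 'a \<Rightarrow> real) normed_sp"
  where "L2H10 \<Omega> T \<equiv> L2_time T (H10 \<Omega>)"

definition time_d1 :: "'a::euclidean_space set \<Rightarrow> real \<Rightarrow> (real \<Rightarrow> 'a \<Rightarrow> real) \<Rightarrow> real \<Rightarrow> 'a \<Rightarrow> real"
  where "time_d1 \<Omega> T y = time_deriv T (L2 \<Omega>) y"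

text \<open>The first derivative regarded as \<open>H\<^sup>-\<^sup>1\<close>-valued, \<open>L\<^sup>2(\<Omega>)\<close> being embedded by \<open>f \<mapsto> (f, \<cdot>)\<close>.\<close>

definition time_d1_Hm1 ::
  "'a::euclidean_space set \<Rightarrow> real \<Rightarrow> (real \<Rightarrow> 'a \<Rightarrow> real) \<Rightarrow> real \<Rightarrow> ('a \<Rightarrow> real) \<Rightarrow> real"
  where "time_d1_Hm1 \<Omega> T y = (\<lambda>t. L2_inner \<Omega> (time_d1 \<Omega> T y t))"

definition time_d2 ::
  "'a::euclidean_space set \<Rightarrow> real \<Rightarrow> (real \<Rightarrow> 'a \<Rightarrow> real) \<Rightarrow> real \<Rightarrow> ('a \<Rightarrow> real) \<Rightarrow> real"
  where "time_d2 \<Omega> T y = time_deriv T (Hm1 \<Omega>) (time_d1_Hm1 \<Omega> T y)"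

definition W_space :: "'a::euclidean_space set \<Rightarrow> real \<Rightarrow> (real \<Rightarrow> 'a \<Rightarrow> real) set"
  where "W_space \<Omega> T = {v \<in> car (L2H10 \<Omega> T). weakly_time_differentiable T (L2 \<Omega>) v}"

definition Y_space :: "'a::euclidean_space set \<Rightarrow> real \<Rightarrow> (real \<Rightarrow> 'a \<Rightarrow> real) set"
  where "Y_space \<Omega> T =
    {v \<in> W_space \<Omega> T. weakly_time_differentiable T (Hm1 \<Omega>) (time_d1_Hm1 \<Omega> T v)}"

definition cattaneo_weak_solution ::
  "'a::euclidean_space set \<Rightarrow> real \<Rightarrow> real \<Rightarrow> (real \<Rightarrow> 'a \<Rightarrow> real) \<Rightarrow> ('a \<Rightarrow> real) \<Rightarrow> ('a \<Rightarrow> real) \<Rightarrow>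
   (real \<Rightarrow> 'a \<Rightarrow> real) \<Rightarrow> bool"
  where "cattaneo_weak_solution \<Omega> T \<tau> u y0 y1 y \<longleftrightarrow>
    y \<in> Y_space \<Omega> T \<and>
    has_initial_value T (L2 \<Omega>) y y0 \<and>
    has_initial_value T (Hm1 \<Omega>) (time_d1_Hm1 \<Omega> T y) (L2_inner \<Omega> y1) \<and>
    (\<forall>v\<in>car (L2H10 \<Omega> T).
      (LINT t|time_measure T. \<tau> * time_d2 \<Omega> T y t (v t) + L2_inner \<Omega> (time_d1 \<Omega> T y t) (v t)
          + dirichlet_form \<Omega> (y t) (v t)) =
      (LINT t|time_measure T. L2_inner \<Omega> (u t) (v t)))"

definition heat_weak_solution ::
  "'a::euclidean_space set \<Rightarrow> real \<Rightarrow> (real \<Rightarrow> 'a \<Rightarrow> real) \<Rightarrow> ('a \<Rightarrow> real) \<Rightarrow>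
   (real \<Rightarrow> 'a \<Rightarrow> real) \<Rightarrow> bool"
  where "heat_weak_solution \<Omega> T u y0 y \<longleftrightarrow>
    y \<in> W_space \<Omega> T \<and>
    has_initial_value T (L2 \<Omega>) y y0 \<and>
    (\<forall>v\<in>car (L2H10 \<Omega> T).
      (LINT t|time_measure T. L2_inner \<Omega> (time_d1 \<Omega> T y t) (v t)
          + dirichlet_form \<Omega> (y t) (v t)) =
      (LINT t|time_measure T. L2_inner \<Omega> (u t) (v t)))"

end

theory Submission
  imports Defs
begin

text \<open>
  The limit equation is obtained from two estimates. Testing the Cattaneo equation with its own
  velocity \<open>y'\<close> bounds \<open>y'\<close> in \<open>L\<^sup>2(0,T;L\<^sup>2)\<close> and \<open>\<nabla>y\<close> in \<open>L\<^sup>2(0,T;L\<^sup>2)\<close> uniformly in the delay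
  \<open>\<tau>\<close> (\<open>energy_estimate\<close>). Testing the difference of the Cattaneo and the heat equation with the
  error \<open>e\<close>, and moving one time derivative in \<open>\<tau> y''\<close> onto \<open>e\<close>, bounds \<open>e\<close> by the velocities of
  the two solutions with a factor \<open>\<tau>\<close> (\<open>error_estimate\<close>): strong convergence holds at the rate
  \<open>\<tau>\<close> for the square of the norm. In both cases the test function carries a decreasing affine
  weight, \<open>T + 1 - t\<close> or \<open>T - t\<close>, whose derivative produces the integrals over time to be bounded.

  The velocity only has values in \<open>L\<^sup>2\<close> and is not an admissible test function. It is therefore
  smoothed in space by the resolvent \<open>J = (I - \<epsilon>\<Delta>)\<^sup>-\<^sup>1\<close>, which maps \<open>H\<^sup>-\<^sup>1\<close> to \<open>H\<^sup>1\<^sub>0\<close>, is symmetric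
  and commutes with the Laplacian. Every term of the tested equation then is a bounded bilinear
  form of a function of time and its weak derivative, to which the product rule
  (\<open>product_rule\<close>) applies. The resulting estimates are uniform in \<open>\<epsilon>\<close>, and Fatou's lemma lets
  \<open>\<epsilon>\<close> tend to 0.

  Weak convergence follows from the strong convergence of \<open>y\<close> and the bounds on \<open>\<nabla>y\<close> and \<open>y'\<close>,
  by integration by parts in space (\<open>weak_null_L2H10\<close>) and in time (\<open>weak_null_time_deriv\<close>).
  Arbitrary functionals on the Bochner spaces are reduced to inner products by the argument of
  Banach and Saks (\<open>weak_null_of_ip_null\<close>), which needs neither completeness nor a representation
  of the functionals. The same economy applies elsewhere: the elliptic problems that define the
  resolvent are solved by minimising sequences of test functions (\<open>approximate_riesz\<close>), and their
  density in \<open>L\<^sup>2\<close> comes from the fundamental lemma of the calculus of variations.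
\<close>


section \<open>Linear functionals and semi-inner products on a carrier\<close>

definition lin_on :: "'v::real_vector set \<Rightarrow> ('v \<Rightarrow> real) \<Rightarrow> bool"
  where "lin_on V F \<longleftrightarrow>
    (\<forall>x\<in>V. \<forall>y\<in>V. F (x + y) = F x + F y) \<and> (\<forall>c. \<forall>x\<in>V. F (c *\<^sub>R x) = c * F x)"

lemma lin_onI:
  assumes "\<And>x y. x \<in> V \<Longrightarrow> y \<in> V \<Longrightarrow> F (x + y) = F x + F y"
    and "\<And>c x. x \<in> V \<Longrightarrow> F (c *\<^sub>R x) = c * F x"
  shows "lin_on V F"
  using assms by (auto simp: lin_on_def)

lemma lin_on_add: "lin_on V F \<Longrightarrow> x \<in> V \<Longrightarrow> y \<in> V \<Longrightarrow> F (x + y) = F x + F y"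
  by (simp add: lin_on_def)

lemma lin_on_scale: "lin_on V F \<Longrightarrow> x \<in> V \<Longrightarrow> F (c *\<^sub>R x) = c * F x"
  by (simp add: lin_on_def)

lemma lin_on_minus: "lin_on V F \<Longrightarrow> x \<in> V \<Longrightarrow> F (- x) = - F x"
  using lin_on_scale[of V F x "-1"] by simp

lemma lin_on_diff:
  assumes "subspace V" "lin_on V F" "x \<in> V" "y \<in> V"
  shows "F (x - y) = F x - F y"
  using lin_on_add[OF assms(2,3), of "- y"] lin_on_minus[OF assms(2,4)] assms
  by (simp add: subspace_neg)

lemma lin_on_zero: "subspace V \<Longrightarrow> lin_on V F \<Longrightarrow> F 0 = 0"
  using lin_on_scale[of V F 0 0] by (simp add: subspace_0)

lemma lin_on_sum:
  assumes "subspace V" "lin_on V F" "finite I" "\<And>i. i \<in> I \<Longrightarrow> x i \<in> V"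
  shows "F (\<Sum>i\<in>I. x i) = (\<Sum>i\<in>I. F (x i))"
  using assms(3,4)
proof (induction I rule: finite_induct)
  case empty
  then show ?case by (simp add: lin_on_zero[OF assms(1,2)])
next
  case (insert i I)
  then show ?case
    by (simp add: lin_on_add[OF assms(2)] subspace_sum[OF assms(1)])
qed

lemma dual_iff:
  "F \<in> car (dual X) \<longleftrightarrow> lin_on (car X) F \<and> (\<exists>C. \<forall>x\<in>car X. \<bar>F x\<bar> \<le> C * nrm X x)"
  by (auto simp: dual_def lin_on_def)

locale seminormed =
  fixes X :: "'v::real_vector normed_sp"
  assumes sub: "subspace (car X)"
    and nrm_nonneg: "\<And>x. x \<in> car X \<Longrightarrow> 0 \<le> nrm X x"
    and nrm_triangle: "\<And>x y. x \<in> car X \<Longrightarrow> y \<in> car X \<Longrightarrow> nrm X (x + y) \<le> nrm X x + nrm X y"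
    and nrm_scale: "\<And>c x. x \<in> car X \<Longrightarrow> nrm X (c *\<^sub>R x) = \<bar>c\<bar> * nrm X x"
begin

lemmas mem_add = subspace_add[OF sub]
lemmas mem_diff = subspace_diff[OF sub]
lemmas mem_scale = subspace_scale[OF sub]
lemmas mem_zero = subspace_0[OF sub]
lemmas mem_neg = subspace_neg[OF sub]
lemmas mem_sum = subspace_sum[OF sub]

lemma nrm_zero [simp]: "nrm X 0 = 0"
  using nrm_scale[of 0 0] mem_zero by simp

lemma nrm_minus: "x \<in> car X \<Longrightarrow> nrm X (- x) = nrm X x"
  using nrm_scale[of x "-1"] by simp

lemma nrm_commute: "x \<in> car X \<Longrightarrow> y \<in> car X \<Longrightarrow> nrm X (x - y) = nrm X (y - x)"
  using nrm_minus[of "x - y"] mem_diff by simp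

lemma nrm_diff_le: "x \<in> car X \<Longrightarrow> y \<in> car X \<Longrightarrow> nrm X (x - y) \<le> nrm X x + nrm X y"
  using nrm_triangle[of x "- y"] nrm_minus[of y] mem_neg by simp

lemma nrm_le_diff: "x \<in> car X \<Longrightarrow> y \<in> car X \<Longrightarrow> nrm X x \<le> nrm X y + nrm X (x - y)"
  using nrm_triangle[of y "x - y"] mem_diff by simp

lemma abs_nrm_diff: "x \<in> car X \<Longrightarrow> y \<in> car X \<Longrightarrow> \<bar>nrm X x - nrm X y\<bar> \<le> nrm X (x - y)"
  using nrm_le_diff[of x y] nrm_le_diff[of y x] nrm_commute[of x y] by linarith

lemma nrm_diff_triangle:
  "x \<in> car X \<Longrightarrow> y \<in> car X \<Longrightarrow> z \<in> car X \<Longrightarrow> nrm X (x - z) \<le> nrm X (x - y) + nrm X (y - z)"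
  using nrm_triangle[of "x - y" "y - z"] mem_diff by simp

lemma nrm_cong:
  assumes "x \<in> car X" "y \<in> car X" "nrm X (x - y) = 0"
  shows "nrm X x = nrm X y"
  using abs_nrm_diff[OF assms(1,2)] assms(3) by simp

lemma dual_cong:
  assumes "F \<in> car (dual X)" "x \<in> car X" "y \<in> car X" "nrm X (x - y) = 0"
  shows "F x = F y"
proof -
  obtain C where C: "\<forall>x\<in>car X. \<bar>F x\<bar> \<le> C * nrm X x" and F: "lin_on (car X) F"
    using assms(1) by (auto simp: dual_iff)
  have "\<bar>F (x - y)\<bar> \<le> C * nrm X (x - y)" using C mem_diff assms by blast
  then show ?thesis using lin_on_diff[OF sub F assms(2,3)] assms(4) by simp
qed

lemma dual_le_nrm:
  assumes "F \<in> car (dual X)" "x \<in> car X"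
  shows "\<bar>F x\<bar> \<le> nrm (dual X) F * nrm X x"
proof -
  obtain C where C: "\<forall>x\<in>car X. \<bar>F x\<bar> \<le> C * nrm X x" and F: "lin_on (car X) F"
    using assms(1) by (auto simp: dual_iff)
  have bdd: "bdd_above ((\<lambda>x. \<bar>F x\<bar>) ` {x \<in> car X. nrm X x \<le> 1})"
  proof (rule bdd_aboveI2)
    fix x assume "x \<in> {x \<in> car X. nrm X x \<le> 1}"
    then have x: "x \<in> car X" "nrm X x \<le> 1" by auto
    have "\<bar>F x\<bar> \<le> C * nrm X x" using C x by auto
    also have "\<dots> \<le> \<bar>C\<bar> * 1"
      using x nrm_nonneg[OF x(1)] by (intro mult_mono) auto
    finally show "\<bar>F x\<bar> \<le> \<bar>C\<bar>" by simp
  qed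
  show ?thesis
  proof (cases "nrm X x = 0")
    case True
    then show ?thesis using C assms(2) by fastforce
  next
    case False
    then have pos: "nrm X x > 0" using nrm_nonneg[OF assms(2)] by simp
    define z where "z = (1 / nrm X x) *\<^sub>R x"
    have z: "z \<in> {x \<in> car X. nrm X x \<le> 1}"
      using pos assms(2) by (auto simp: z_def nrm_scale mem_scale)
    have "\<bar>F z\<bar> \<le> nrm (dual X) F"
      unfolding dual_def by (simp, rule cSUP_upper[OF z bdd])
    then show ?thesis
      using pos by (simp add: z_def lin_on_scale[OF F assms(2)] field_simps)
  qed
qed

lemma dual_nrm_le:
  assumes "\<And>x. x \<in> car X \<Longrightarrow> \<bar>F x\<bar> \<le> C * nrm X x" and "0 \<le> C"
  shows "nrm (dual X) F \<le> C"
  unfolding dual_def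
proof (simp, rule cSUP_least)
  show "{x \<in> car X. nrm X x \<le> 1} \<noteq> {}" using mem_zero by (auto intro!: exI[of _ 0])
  fix x assume "x \<in> {x \<in> car X. nrm X x \<le> 1}"
  then have x: "x \<in> car X" "nrm X x \<le> 1" by auto
  have "\<bar>F x\<bar> \<le> C * nrm X x" using assms x by auto
  also have "\<dots> \<le> C * 1" using x assms(2) by (intro mult_left_mono) auto
  finally show "\<bar>F x\<bar> \<le> C" by simp
qed

lemma subspace_dual: "subspace (car (dual X))"
proof (rule subspaceI)
  show "0 \<in> car (dual X)" by (auto simp: dual_iff lin_on_def intro!: exI[of _ 0])
next
  fix F G assume FG: "F \<in> car (dual X)" "G \<in> car (dual X)"
  then obtain C D where C: "\<forall>x\<in>car X. \<bar>F x\<bar> \<le> C * nrm X x" and D: "\<forall>x\<in>car X. \<bar>G x\<bar> \<le> D * nrm X x"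
    by (auto simp: dual_iff)
  have "\<bar>F x + G x\<bar> \<le> C * nrm X x + D * nrm X x" if "x \<in> car X" for x
    using C D that by (smt (verit))
  then show "F + G \<in> car (dual X)"
    using FG by (auto simp: dual_iff lin_on_def algebra_simps intro!: exI[of _ "C + D"])
next
  fix c F assume F: "F \<in> car (dual X)"
  then obtain C where C: "\<forall>x\<in>car X. \<bar>F x\<bar> \<le> C * nrm X x"
    by (auto simp: dual_iff)
  have "\<bar>c * F x\<bar> \<le> (\<bar>c\<bar> * C) * nrm X x" if "x \<in> car X" for x
  proof -
    have "\<bar>c\<bar> * \<bar>F x\<bar> \<le> \<bar>c\<bar> * (C * nrm X x)"
      using C that by (intro mult_left_mono) auto
    then show ?thesis by (simp add: abs_mult)
  qed
  then show "c *\<^sub>R F \<in> car (dual X)"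
    using F by (auto simp: dual_iff lin_on_def scaleR_fun_def algebra_simps intro!: exI[of _ "\<bar>c\<bar> * C"])
qed

lemma seminormed_dual: "seminormed (dual X)"
proof (rule seminormed.intro)
  show "subspace (car (dual X))" by (rule subspace_dual)
  show nn: "0 \<le> nrm (dual X) F" if F: "F \<in> car (dual X)" for F
  proof -
    obtain C where C: "\<forall>x\<in>car X. \<bar>F x\<bar> \<le> C * nrm X x" using F by (auto simp: dual_iff)
    have bdd: "bdd_above ((\<lambda>x. \<bar>F x\<bar>) ` {x \<in> car X. nrm X x \<le> 1})"
    proof (rule bdd_aboveI2)
      fix x assume "x \<in> {x \<in> car X. nrm X x \<le> 1}"
      then have x: "x \<in> car X" "nrm X x \<le> 1" by auto
      have "\<bar>F x\<bar> \<le> C * nrm X x" using C x by auto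
      also have "\<dots> \<le> \<bar>C\<bar> * 1"
        using x nrm_nonneg[OF x(1)] by (intro mult_mono) auto
      finally show "\<bar>F x\<bar> \<le> \<bar>C\<bar>" by simp
    qed
    have "\<bar>F 0\<bar> \<le> nrm (dual X) F"
      unfolding dual_def using mem_zero by (simp, intro cSUP_upper[OF _ bdd]) auto
    then show ?thesis by linarith
  qed
  show "nrm (dual X) (F + G) \<le> nrm (dual X) F + nrm (dual X) G"
    if FG: "F \<in> car (dual X)" "G \<in> car (dual X)" for F G
  proof (rule dual_nrm_le)
    fix x assume x: "x \<in> car X"
    show "\<bar>(F + G) x\<bar> \<le> (nrm (dual X) F + nrm (dual X) G) * nrm X x"
      using dual_le_nrm[OF FG(1) x] dual_le_nrm[OF FG(2) x]
      by (simp add: distrib_right)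
  qed (use nn FG in auto)
  have sc: "nrm (dual X) (c *\<^sub>R F) \<le> \<bar>c\<bar> * nrm (dual X) F" if F: "F \<in> car (dual X)" for c F
  proof (rule dual_nrm_le)
    fix x assume x: "x \<in> car X"
    have "\<bar>c\<bar> * \<bar>F x\<bar> \<le> \<bar>c\<bar> * (nrm (dual X) F * nrm X x)"
      using dual_le_nrm[OF F x] by (intro mult_left_mono) auto
    then show "\<bar>(c *\<^sub>R F) x\<bar> \<le> (\<bar>c\<bar> * nrm (dual X) F) * nrm X x"
      by (simp add: scaleR_fun_def abs_mult)
  qed (use nn F in auto)
  show "nrm (dual X) (c *\<^sub>R F) = \<bar>c\<bar> * nrm (dual X) F" if F: "F \<in> car (dual X)" for c F
  proof (cases "c = 0")
    case True
    then show ?thesis using sc[OF F, of 0] nn[OF subspace_scale[OF subspace_dual F, of 0]] by simp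
  next
    case False
    have "nrm (dual X) ((1/c) *\<^sub>R (c *\<^sub>R F)) \<le> \<bar>1/c\<bar> * nrm (dual X) (c *\<^sub>R F)"
      by (rule sc) (use F subspace_scale[OF subspace_dual] in auto)
    then have "\<bar>c\<bar> * nrm (dual X) F \<le> nrm (dual X) (c *\<^sub>R F)"
      using False by (simp add: field_simps)
    then show ?thesis using sc[OF F, of c] by simp
  qed
qed

end

locale semi_inner =
  fixes V :: "'v::real_vector set" and ip :: "'v \<Rightarrow> 'v \<Rightarrow> real"
  assumes ip_sub: "subspace V"
    and ip_lin: "\<And>y. y \<in> V \<Longrightarrow> lin_on V (\<lambda>x. ip x y)"
    and ip_sym: "\<And>x y. x \<in> V \<Longrightarrow> y \<in> V \<Longrightarrow> ip x y = ip y x"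
    and ip_nonneg: "\<And>x. x \<in> V \<Longrightarrow> 0 \<le> ip x x"
begin

lemmas ip_mem_add = subspace_add[OF ip_sub]
lemmas ip_mem_diff = subspace_diff[OF ip_sub]
lemmas ip_mem_scale = subspace_scale[OF ip_sub]
lemmas ip_mem_zero = subspace_0[OF ip_sub]

lemma ip_add_left: "x \<in> V \<Longrightarrow> y \<in> V \<Longrightarrow> z \<in> V \<Longrightarrow> ip (x + y) z = ip x z + ip y z"
  using lin_on_add[OF ip_lin] by blast

lemma ip_scale_left: "x \<in> V \<Longrightarrow> z \<in> V \<Longrightarrow> ip (c *\<^sub>R x) z = c * ip x z"
  using lin_on_scale[OF ip_lin] by blast

lemma ip_diff_left: "x \<in> V \<Longrightarrow> y \<in> V \<Longrightarrow> z \<in> V \<Longrightarrow> ip (x - y) z = ip x z - ip y z"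
  using lin_on_diff[OF ip_sub ip_lin] by blast

lemma ip_add_right: "x \<in> V \<Longrightarrow> y \<in> V \<Longrightarrow> z \<in> V \<Longrightarrow> ip z (x + y) = ip z x + ip z y"
  by (metis ip_add_left ip_sym ip_mem_add)

lemma ip_scale_right: "x \<in> V \<Longrightarrow> z \<in> V \<Longrightarrow> ip z (c *\<^sub>R x) = c * ip z x"
  by (metis ip_scale_left ip_sym ip_mem_scale)

lemma ip_diff_right: "x \<in> V \<Longrightarrow> y \<in> V \<Longrightarrow> z \<in> V \<Longrightarrow> ip z (x - y) = ip z x - ip z y"
  by (metis ip_diff_left ip_sym ip_mem_diff)

lemmas ip_simps = ip_add_left ip_add_right ip_scale_left ip_scale_right ip_diff_left ip_diff_right
  ip_mem_add ip_mem_diff ip_mem_scale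

lemma ip_lin_right: "x \<in> V \<Longrightarrow> lin_on V (ip x)"
  by (intro lin_onI) (auto simp: ip_simps)

lemma young: "x \<in> V \<Longrightarrow> y \<in> V \<Longrightarrow> 2 * \<bar>ip x y\<bar> \<le> ip x x + ip y y"
  using ip_nonneg[of "x - y"] ip_nonneg[of "x + y"] ip_sym[of y x]
  by (auto simp: ip_simps)

lemma cauchy_schwarz_sq:
  assumes x: "x \<in> V" and y: "y \<in> V"
  shows "(ip x y)\<^sup>2 \<le> ip x x * ip y y"
proof -
  have quad: "0 \<le> ip x x + 2 * t * ip x y + t\<^sup>2 * ip y y" for t
    using ip_nonneg[of "x + t *\<^sub>R y"] x y ip_sym[OF x y]
    by (simp add: ip_simps power2_eq_square algebra_simps)
  show ?thesis
  proof (cases "ip y y = 0")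
    case True
    have "ip x y = 0"
    proof (rule ccontr)
      assume n: "ip x y \<noteq> 0"
      have "2 * (- (ip x x + 1) / (2 * ip x y)) * ip x y = - (ip x x + 1)"
        using n by simp
      then show False
        using quad[of "- (ip x x + 1) / (2 * ip x y)"] True by simp
    qed
    then show ?thesis using True by simp
  next
    case False
    then have p: "ip y y > 0" using ip_nonneg[OF y] by simp
    have "0 \<le> ip x x + 2 * (- ip x y / ip y y) * ip x y + (- ip x y / ip y y)\<^sup>2 * ip y y"
      by (rule quad)
    also have "\<dots> = ip x x - (ip x y)\<^sup>2 / ip y y"
      using p by (simp add: power2_eq_square field_simps)
    finally show ?thesis using p by (simp add: field_simps)
  qed
qed

lemma cauchy_schwarz:
  assumes x: "x \<in> V" and y: "y \<in> V"
  shows "\<bar>ip x y\<bar> \<le> sqrt (ip x x) * sqrt (ip y y)"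
  using real_sqrt_le_mono[OF cauchy_schwarz_sq[OF x y]]
  by (simp add: real_sqrt_mult)

lemma ip_add_le:
  assumes x: "x \<in> V" and y: "y \<in> V"
  shows "ip (x + y) (x + y) \<le> 2 * ip x x + 2 * ip y y"
  using young[OF x y] ip_sym[OF x y] x y by (simp add: ip_simps)

lemma ip_diff_le:
  assumes x: "x \<in> V" and y: "y \<in> V"
  shows "ip (x - y) (x - y) \<le> 2 * ip x x + 2 * ip y y"
  using young[OF x y] ip_sym[OF x y] x y by (simp add: ip_simps)

lemma seminormedI:
  assumes "car X = V" "\<And>x. x \<in> V \<Longrightarrow> nrm X x = sqrt (ip x x)"
  shows "seminormed X"
proof (rule seminormed.intro)
  show "subspace (car X)" using ip_sub assms by simp
  show "0 \<le> nrm X x" if "x \<in> car X" for x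
    using that assms ip_nonneg by auto
  show "nrm X (c *\<^sub>R x) = \<bar>c\<bar> * nrm X x" if "x \<in> car X" for c x
  proof -
    have "ip (c *\<^sub>R x) (c *\<^sub>R x) = c\<^sup>2 * ip x x"
      using that assms(1) by (simp add: ip_simps power2_eq_square)
    then show ?thesis
      using that assms by (simp add: ip_simps real_sqrt_mult)
  qed
  show "nrm X (x + y) \<le> nrm X x + nrm X y" if "x \<in> car X" "y \<in> car X" for x y
  proof -
    have xy: "x \<in> V" "y \<in> V" using that assms by auto
    have "ip (x + y) (x + y) = ip x x + 2 * ip x y + ip y y"
      using xy ip_sym[of x y] by (simp add: ip_simps)
    also have "\<dots> \<le> (sqrt (ip x x) + sqrt (ip y y))\<^sup>2"
      using cauchy_schwarz[OF xy] ip_nonneg[OF xy(1)] ip_nonneg[OF xy(2)]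
      by (simp add: power2_sum)
    finally have "sqrt (ip (x + y) (x + y)) \<le> sqrt (ip x x) + sqrt (ip y y)"
      by (intro real_le_lsqrt) (use ip_nonneg xy in auto)
    then show ?thesis using assms(2) xy ip_mem_add by auto
  qed
qed

text \<open>
  The Riesz representation theorem without completeness: minimising
  \<open>\<langle>v, v\<rangle> - 2 F v\<close> gives a Cauchy sequence (parallelogram law) which represents \<open>F\<close> in the
  limit. In an incomplete subspace such as the test functions this is all that holds; the
  limit itself is then taken in a larger, complete space.
\<close>

lemma approximate_riesz:
  assumes F: "lin_on V F" and bd: "\<And>x. x \<in> V \<Longrightarrow> \<bar>F x\<bar> \<le> C * sqrt (ip x x)"
  obtains v where "\<And>n::nat. v n \<in> V"
    and "\<And>e. e > 0 \<Longrightarrow> \<exists>N. \<forall>m\<ge>N. \<forall>n\<ge>N. ip (v m - v n) (v m - v n) < e"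
    and "\<And>x. x \<in> V \<Longrightarrow> (\<lambda>n. ip (v n) x) \<longlonglongrightarrow> F x"
proof -
  define J where "J x = ip x x - 2 * F x" for x
  have lower: "- C\<^sup>2 \<le> J x" if "x \<in> V" for x
  proof -
    have "0 \<le> (sqrt (ip x x) - C)\<^sup>2" by simp
    also have "\<dots> = ip x x - 2 * (C * sqrt (ip x x)) + C\<^sup>2"
      using ip_nonneg[OF that] by (simp add: power2_diff)
    also have "\<dots> \<le> ip x x - 2 * F x + C\<^sup>2"
      using bd[OF that] by linarith
    finally show ?thesis by (simp add: J_def)
  qed
  define m where "m = (INF x\<in>V. J x)"
  have bdd: "bdd_below (J ` V)" using lower by (intro bdd_belowI2)
  have m_le: "m \<le> J x" if "x \<in> V" for x
    unfolding m_def by (rule cINF_lower[OF bdd that])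
  have "\<exists>x. x \<in> V \<and> J x < m + 1 / real (Suc n)" for n
  proof -
    have "Inf (J ` V) < m + 1 / real (Suc n)"
      by (simp add: m_def)
    then show ?thesis
      using cInf_lessD[of "J ` V" "m + 1 / real (Suc n)"] ip_mem_zero by auto
  qed
  then obtain v where v: "\<And>n. v n \<in> V" "\<And>n. J (v n) < m + 1 / real (Suc n)" by metis
  have par: "ip (x - y) (x - y) = 2 * J x + 2 * J y - 4 * J ((1/2) *\<^sub>R (x + y))"
    if "x \<in> V" "y \<in> V" for x y
    using that ip_sym[OF that] lin_on_add[OF F] lin_on_scale[OF F]
    by (simp add: J_def ip_simps algebra_simps)
  have close: "ip (v i - v j) (v i - v j) \<le> 2 / real (Suc i) + 2 / real (Suc j)" for i j
  proof -
    have "m \<le> J ((1/2) *\<^sub>R (v i + v j))" by (intro m_le ip_mem_scale ip_mem_add v)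
    then show ?thesis using par[OF v(1)[of i] v(1)[of j]] v(2)[of i] v(2)[of j] by linarith
  qed
  show thesis
  proof (rule that[of v])
    show "v n \<in> V" for n by (rule v)
    show "\<exists>N. \<forall>m\<ge>N. \<forall>n\<ge>N. ip (v m - v n) (v m - v n) < e" if "e > 0" for e
    proof -
      have "e / 4 > 0" using that by simp
      then obtain N where N: "1 / real (Suc N) < e / 4"
        using nat_approx_posE[of "e/4"] zero_less_divide_iff zero_less_numeral by metis
      have "ip (v i - v j) (v i - v j) < e" if "i \<ge> N" "j \<ge> N" for i j
      proof -
        have "1 / real (Suc i) \<le> 1 / real (Suc N)" "1 / real (Suc j) \<le> 1 / real (Suc N)"
          using that by (auto simp: field_simps)
        moreover have "2 / real (Suc i) = 2 * (1 / real (Suc i))" "2 / real (Suc j) = 2 * (1 / real (Suc j))"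
          by simp_all
        ultimately show ?thesis using close[of i j] N by linarith
      qed
      then show ?thesis by blast
    qed
    show "(\<lambda>n. ip (v n) x) \<longlonglongrightarrow> F x" if x: "x \<in> V" for x
    proof -
      define q where "q = ip x x + 1"
      have q: "q > 0" using ip_nonneg[OF x] by (simp add: q_def)
      have "(ip (v n) x - F x)\<^sup>2 \<le> q * (1 / real (Suc n))" for n
      proof -
        define d where "d = ip (v n) x - F x"
        define t where "t = - d / q"
        have "m \<le> J (v n + t *\<^sub>R x)" by (intro m_le ip_mem_add ip_mem_scale v x)
        also have "\<dots> = J (v n) + 2 * t * d + t\<^sup>2 * ip x x"
          using v(1)[of n] x ip_sym[OF v(1)[of n] x] lin_on_add[OF F] lin_on_scale[OF F]
          by (simp add: J_def d_def ip_simps power2_eq_square algebra_simps)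
        also have "\<dots> \<le> J (v n) + 2 * t * d + t\<^sup>2 * q"
          by (simp add: q_def mult_left_mono)
        also have "\<dots> = J (v n) - d\<^sup>2 / q"
          using q by (simp add: t_def power2_eq_square field_simps)
        finally have "d\<^sup>2 / q \<le> 1 / real (Suc n)" using v(2)[of n] by linarith
        then show ?thesis using q by (simp add: d_def field_simps)
      qed
      moreover have "(\<lambda>n. q * (1 / real (Suc n))) \<longlonglongrightarrow> q * 0"
        by (intro tendsto_intros LIMSEQ_Suc[OF lim_1_over_n])
      ultimately have "(\<lambda>n. (ip (v n) x - F x)\<^sup>2) \<longlonglongrightarrow> 0"
        by (intro tendsto_sandwich[OF always_eventually always_eventually tendsto_const,
              of 0 "\<lambda>n. (ip (v n) x - F x)\<^sup>2" "\<lambda>n. q * (1 / real (Suc n))"]) (simp_all del: of_nat_Suc)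
      then have "(\<lambda>n. sqrt ((ip (v n) x - F x)\<^sup>2)) \<longlonglongrightarrow> sqrt 0" by (rule tendsto_real_sqrt)
      then have "(\<lambda>n. \<bar>ip (v n) x - F x\<bar>) \<longlonglongrightarrow> 0" by simp
      then have "(\<lambda>n. ip (v n) x - F x) \<longlonglongrightarrow> 0" by (rule tendsto_rabs_zero_cancel)
      then show ?thesis using LIM_zero_iff by blast
    qed
  qed
qed

text \<open>
  Weak convergence to zero of a bounded sequence need only be tested with inner products,
  even where functionals are not known to be inner products. If \<open>\<bar>F (e n)\<bar> \<ge> d\<close> infinitely
  often, the argument of Banach and Saks picks signed terms that are almost orthogonal to the
  sum of those already picked: \<open>F\<close> of the sum grows like \<open>N\<close>, its norm only like \<open>sqrt N\<close>.
\<close>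

lemma weak_null_of_ip_null:
  assumes e: "\<And>n::nat. e n \<in> V"
    and bd: "eventually (\<lambda>n. ip (e n) (e n) \<le> C) sequentially"
    and null: "\<And>h. h \<in> V \<Longrightarrow> (\<lambda>n. ip (e n) h) \<longlonglongrightarrow> 0"
    and F: "lin_on V F" and FK: "\<And>x. x \<in> V \<Longrightarrow> \<bar>F x\<bar> \<le> K * sqrt (ip x x)"
  shows "(\<lambda>n. F (e n)) \<longlonglongrightarrow> 0"
proof (rule ccontr)
  assume "\<not> (\<lambda>n. F (e n)) \<longlonglongrightarrow> 0"
  then obtain d where d: "d > 0" "\<not> (\<forall>\<^sub>F n in sequentially. \<bar>F (e n)\<bar> < d)"
    by (auto simp: tendsto_iff)
  have step: "\<exists>S\<in>V. real N * d \<le> F S \<and> ip S S \<le> real N * (\<bar>C\<bar> + 2)" for N :: nat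
  proof (induction N)
    case 0
    show ?case
      by (intro bexI[of _ 0])
         (auto simp: lin_on_zero[OF ip_sub F] ip_mem_zero lin_on_zero[OF ip_sub ip_lin])
  next
    case (Suc N)
    then obtain S where S: "S \<in> V" "real N * d \<le> F S" "ip S S \<le> real N * (\<bar>C\<bar> + 2)" by blast
    have "\<forall>\<^sub>F n in sequentially. \<bar>ip (e n) S\<bar> < 1"
      using tendstoD[OF null[OF S(1)], of 1] by simp
    note * = this
    have "\<exists>\<^sub>F n in sequentially. \<bar>ip (e n) S\<bar> < 1 \<and> ip (e n) (e n) \<le> C \<and> d \<le> \<bar>F (e n)\<bar>"
    proof -
      have "\<exists>\<^sub>F n in sequentially. d \<le> \<bar>F (e n)\<bar>"
        using d(2) by (simp add: frequently_def not_le)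
      from frequently_eventually_conj[OF this eventually_conj[OF * bd]]
      show ?thesis by (rule frequently_elim1) simp
    qed
    then obtain n where n: "\<bar>ip (e n) S\<bar> < 1" "ip (e n) (e n) \<le> C" "d \<le> \<bar>F (e n)\<bar>"
      using frequently_ex by blast
    define s where "s = sgn (F (e n))"
    have s: "s\<^sup>2 = 1" "s * F (e n) = \<bar>F (e n)\<bar>" "\<bar>s\<bar> = 1"
      using n(3) d(1) by (auto simp: s_def sgn_if)
    have "F (S + s *\<^sub>R e n) = F S + \<bar>F (e n)\<bar>"
      using S e by (simp add: lin_on_add[OF F] lin_on_scale[OF F] ip_mem_scale s)
    moreover have "ip (S + s *\<^sub>R e n) (S + s *\<^sub>R e n) = ip S S + 2 * (s * ip (e n) S) + s\<^sup>2 * ip (e n) (e n)"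
      using S e ip_sym[OF S(1) e[of n]]
      by (simp add: ip_simps power2_eq_square algebra_simps)
    moreover have "s * ip (e n) S \<le> 1"
    proof -
      have "s * ip (e n) S \<le> \<bar>s\<bar> * \<bar>ip (e n) S\<bar>" by (metis abs_ge_self abs_mult)
      then show ?thesis using n(1) s(3) by simp
    qed
    ultimately show ?case
      using S(2,3) n(2,3) S(1) e abs_ge_self[of C] s(1)
      by (intro bexI[of _ "S + s *\<^sub>R e n"] conjI)
         (simp_all add: ip_mem_add ip_mem_scale distrib_right)
  qed
  have "real N * d\<^sup>2 \<le> K\<^sup>2 * (\<bar>C\<bar> + 2)" if "N > 0" for N
  proof -
    obtain S where S: "S \<in> V" "real N * d \<le> F S" "ip S S \<le> real N * (\<bar>C\<bar> + 2)"
      using step by blast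
    have "(real N * d)\<^sup>2 \<le> (K * sqrt (ip S S))\<^sup>2"
      using S(2) FK[OF S(1)] d(1) by (intro power_mono) auto
    also have "\<dots> = K\<^sup>2 * ip S S" using ip_nonneg[OF S(1)] by (simp add: power_mult_distrib)
    also have "\<dots> \<le> K\<^sup>2 * (real N * (\<bar>C\<bar> + 2))" by (intro mult_left_mono S) auto
    finally show ?thesis using that by (simp add: power2_eq_square mult_ac)
  qed
  moreover obtain N :: nat where "real N > K\<^sup>2 * (\<bar>C\<bar> + 2) / d\<^sup>2 + 1"
    using reals_Archimedean2 by blast
  moreover have "K\<^sup>2 * (\<bar>C\<bar> + 2) / d\<^sup>2 \<ge> 0" by simp
  ultimately show False using d(1) by (smt (verit) divide_less_eq of_nat_0_less_iff zero_less_power)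
qed

end

section \<open>Strongly measurable and square-integrable functions of time\<close>

lemma abs_diff_tendsto_iff:
  fixes a :: real
  shows "((\<lambda>n. \<bar>a - x n\<bar>) \<longlongrightarrow> 0) F \<longleftrightarrow> (x \<longlongrightarrow> a) F"
  by (subst tendsto_dist_iff[of x]) (simp add: dist_real_def abs_minus_commute)

definition real_sp :: "real normed_sp"
  where "real_sp = \<lparr>car = UNIV, nrm = abs\<rparr>"

lemma real_sp_simps [simp]: "car real_sp = UNIV" "nrm real_sp = abs"
  by (auto simp: real_sp_def)

lemma seminormed_real_sp: "seminormed real_sp"
  by unfold_locales (auto simp: abs_mult)

definition bdd_bilin ::
  "'v::real_vector normed_sp \<Rightarrow> 'w::real_vector normed_sp \<Rightarrow> ('v \<Rightarrow> 'w \<Rightarrow> real) \<Rightarrow> bool"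
  where "bdd_bilin X Y B \<longleftrightarrow>
    (\<forall>y\<in>car Y. lin_on (car X) (\<lambda>x. B x y)) \<and> (\<forall>x\<in>car X. lin_on (car Y) (B x)) \<and>
    (\<exists>C\<ge>0. \<forall>x\<in>car X. \<forall>y\<in>car Y. \<bar>B x y\<bar> \<le> C * nrm X x * nrm Y y)"

lemma bdd_bilinD:
  assumes "bdd_bilin X Y B"
  shows "y \<in> car Y \<Longrightarrow> lin_on (car X) (\<lambda>x. B x y)" "x \<in> car X \<Longrightarrow> lin_on (car Y) (B x)"
  using assms by (auto simp: bdd_bilin_def)

lemma bdd_bilin_bound:
  assumes "bdd_bilin X Y B"
  obtains C where "C \<ge> 0" "\<And>x y. x \<in> car X \<Longrightarrow> y \<in> car Y \<Longrightarrow> \<bar>B x y\<bar> \<le> C * nrm X x * nrm Y y"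
  using assms by (auto simp: bdd_bilin_def)

lemma bdd_bilin_dual:
  assumes "bdd_bilin X Y B" "seminormed X" "seminormed Y"
  shows "y \<in> car Y \<Longrightarrow> (\<lambda>x. B x y) \<in> car (dual X)" "x \<in> car X \<Longrightarrow> B x \<in> car (dual Y)"
proof -
  obtain C where C: "C \<ge> 0" "\<And>x y. x \<in> car X \<Longrightarrow> y \<in> car Y \<Longrightarrow> \<bar>B x y\<bar> \<le> C * nrm X x * nrm Y y"
    using bdd_bilin_bound[OF assms(1)] by blast
  show "y \<in> car Y \<Longrightarrow> (\<lambda>x. B x y) \<in> car (dual X)"
    using C by (auto simp: dual_iff bdd_bilinD[OF assms(1)] mult_ac intro!: exI[of _ "C * nrm Y y"])
  show "x \<in> car X \<Longrightarrow> B x \<in> car (dual Y)"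
    using C by (auto simp: dual_iff bdd_bilinD[OF assms(1)] mult_ac intro!: exI[of _ "C * nrm X x"])
qed

lemma strongly_measurable_compose2:
  assumes f: "strongly_measurable M X f" and g: "strongly_measurable M Y g"
    and car: "\<And>x y. x \<in> car X \<Longrightarrow> y \<in> car Y \<Longrightarrow> \<Phi> x y \<in> car Z"
    and cont: "\<And>x y x' y'. x \<in> car X \<Longrightarrow> y \<in> car Y \<Longrightarrow> (\<And>n::nat. x' n \<in> car X) \<Longrightarrow> (\<And>n. y' n \<in> car Y) \<Longrightarrow>
      (\<lambda>n. nrm X (x - x' n)) \<longlonglongrightarrow> 0 \<Longrightarrow> (\<lambda>n. nrm Y (y - y' n)) \<longlonglongrightarrow> 0 \<Longrightarrow>
      (\<lambda>n. nrm Z (\<Phi> x y - \<Phi> (x' n) (y' n))) \<longlonglongrightarrow> 0"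
  shows "strongly_measurable M Z (\<lambda>t. \<Phi> (f t) (g t))"
proof -
  obtain s where s: "\<And>n. simple_function M (s n)" "\<And>n. s n ` space M \<subseteq> car X"
    "AE t in M. (\<lambda>n. nrm X (f t - s n t)) \<longlonglongrightarrow> 0"
    using f by (auto simp: strongly_measurable_def)
  obtain r where r: "\<And>n. simple_function M (r n)" "\<And>n. r n ` space M \<subseteq> car Y"
    "AE t in M. (\<lambda>n. nrm Y (g t - r n t)) \<longlonglongrightarrow> 0"
    using g by (auto simp: strongly_measurable_def)
  have fg: "AE t in M. f t \<in> car X" "AE t in M. g t \<in> car Y"
    using f g by (auto simp: strongly_measurable_def)
  have "AE t in M. (\<lambda>n. nrm Z (\<Phi> (f t) (g t) - \<Phi> (s n t) (r n t))) \<longlonglongrightarrow> 0"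
    using fg s(3) r(3) AE_space
  proof eventually_elim
    fix t assume t: "f t \<in> car X" "g t \<in> car Y" "t \<in> space M"
      "(\<lambda>n. nrm X (f t - s n t)) \<longlonglongrightarrow> 0" "(\<lambda>n. nrm Y (g t - r n t)) \<longlonglongrightarrow> 0"
    show "(\<lambda>n. nrm Z (\<Phi> (f t) (g t) - \<Phi> (s n t) (r n t))) \<longlonglongrightarrow> 0"
    proof (rule cont)
      show "s n t \<in> car X" "r n t \<in> car Y" for n using t(3) s(2)[of n] r(2)[of n] by auto
    qed (use t in auto)
  qed
  moreover have "simple_function M (\<lambda>t. \<Phi> (s n t) (r n t))" for n
    by (rule simple_function_compose2[OF s(1) r(1)])
  moreover have "(\<lambda>t. \<Phi> (s n t) (r n t)) ` space M \<subseteq> car Z" for n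
    using s(2)[of n] r(2)[of n] car by blast
  moreover have "AE t in M. \<Phi> (f t) (g t) \<in> car Z"
    using fg by eventually_elim (rule car)
  ultimately show ?thesis
    unfolding strongly_measurable_def
    by (intro conjI exI[of _ "\<lambda>n t. \<Phi> (s n t) (r n t)"] allI) assumption+
qed

lemma strongly_measurable_compose:
  assumes f: "strongly_measurable M X f"
    and car: "\<And>x. x \<in> car X \<Longrightarrow> \<Phi> x \<in> car Z"
    and cont: "\<And>x x'. x \<in> car X \<Longrightarrow> x' \<in> car X \<Longrightarrow> nrm Z (\<Phi> x - \<Phi> x') \<le> C * nrm X (x - x')"
    and nonneg: "\<And>z. z \<in> car Z \<Longrightarrow> 0 \<le> nrm Z z" and Z: "subspace (car Z)"
  shows "strongly_measurable M Z (\<lambda>t. \<Phi> (f t))"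
proof (rule strongly_measurable_compose2[OF f f, where \<Phi> = "\<lambda>x y. \<Phi> x"])
  fix x y x' y'
  assume a: "x \<in> car X" "\<And>n::nat. x' n \<in> car X" "(\<lambda>n. nrm X (x - x' n)) \<longlonglongrightarrow> 0"
  have "(\<lambda>n. C * nrm X (x - x' n)) \<longlonglongrightarrow> C * 0" by (intro tendsto_intros a)
  then show "(\<lambda>n. nrm Z (\<Phi> x - \<Phi> (x' n))) \<longlonglongrightarrow> 0"
    by (intro tendsto_sandwich[OF always_eventually always_eventually tendsto_const,
          of 0 "\<lambda>n. nrm Z (\<Phi> x - \<Phi> (x' n))" "\<lambda>n. C * nrm X (x - x' n)"])
       (use a cont nonneg car subspace_diff[OF Z] in auto)
qed (use car in auto)

lemma borel_measurable_AE_LIMSEQ: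
  fixes g :: "'a::euclidean_space \<Rightarrow> real"
  assumes S: "S \<in> sets lebesgue" and f: "\<And>n. f n \<in> borel_measurable (lebesgue_on S)"
    and lim: "AE t in lebesgue_on S. (\<lambda>n. f n t) \<longlonglongrightarrow> g t"
  shows "g \<in> borel_measurable (lebesgue_on S)"
proof -
  have "(\<lambda>t. lim (\<lambda>n. f n t)) \<in> borel_measurable (lebesgue_on S)"
    using f by (rule borel_measurable_lim_metric)
  then have 1: "(\<lambda>t. if t \<in> S then lim (\<lambda>n. f n t) else 0) \<in> borel_measurable lebesgue"
    using S by (simp add: borel_measurable_if)
  have "AE t in lebesgue. t \<in> S \<longrightarrow> (\<lambda>n. f n t) \<longlonglongrightarrow> g t"
    using lim S by (simp add: AE_restrict_space_iff)
  then have "AE t in lebesgue. (if t \<in> S then lim (\<lambda>n. f n t) else 0) = (if t \<in> S then g t else 0)"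
    by eventually_elim (auto dest: limI)
  then have "(\<lambda>t. if t \<in> S then g t else 0) \<in> borel_measurable lebesgue"
    using 1 by (rule borel_measurable_AE[rotated])
  then show ?thesis using S by (simp add: borel_measurable_if)
qed

lemma strongly_measurable_real_iff:
  fixes f :: "'a::euclidean_space \<Rightarrow> real"
  assumes S: "S \<in> sets lebesgue"
  shows "strongly_measurable (lebesgue_on S) real_sp f \<longleftrightarrow> f \<in> borel_measurable (lebesgue_on S)"
proof
  assume "strongly_measurable (lebesgue_on S) real_sp f"
  then obtain s where s: "\<And>n. simple_function (lebesgue_on S) (s n)"
    "AE t in lebesgue_on S. (\<lambda>n. \<bar>f t - s n t\<bar>) \<longlonglongrightarrow> 0"
    by (auto simp: strongly_measurable_def)
  have "AE t in lebesgue_on S. (\<lambda>n. s n t) \<longlonglongrightarrow> f t"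
    using s(2) by eventually_elim (simp add: abs_diff_tendsto_iff)
  then show "f \<in> borel_measurable (lebesgue_on S)"
    by (rule borel_measurable_AE_LIMSEQ[OF S borel_measurable_simple_function[OF s(1)]])
next
  assume f: "f \<in> borel_measurable (lebesgue_on S)"
  from borel_measurable_implies_sequence_metric[OF f, of 0]
  obtain F where F: "\<And>i. simple_function (lebesgue_on S) (F i)"
    "\<And>x. x \<in> space (lebesgue_on S) \<Longrightarrow> (\<lambda>i. F i x) \<longlonglongrightarrow> f x"
    by blast
  have "(\<lambda>n. \<bar>f t - F n t\<bar>) \<longlonglongrightarrow> 0" if "t \<in> space (lebesgue_on S)" for t
    using F(2)[OF that] by (simp add: abs_diff_tendsto_iff)
  then show "strongly_measurable (lebesgue_on S) real_sp f"
    using F(1) by (auto simp: strongly_measurable_def intro!: exI[of _ F] AE_I2)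
qed

lemma bdd_bilin_tendsto:
  assumes "seminormed X" "seminormed Y" and B: "bdd_bilin X Y B"
    and x: "x \<in> car X" "\<And>n::nat. x' n \<in> car X" "(\<lambda>n. nrm X (x - x' n)) \<longlonglongrightarrow> 0"
    and y: "y \<in> car Y" "\<And>n. y' n \<in> car Y" "(\<lambda>n. nrm Y (y - y' n)) \<longlonglongrightarrow> 0"
  shows "(\<lambda>n. B (x' n) (y' n)) \<longlonglongrightarrow> B x y"
proof -
  interpret X: seminormed X by fact
  interpret Y: seminormed Y by fact
  obtain C where C: "C \<ge> 0" "\<And>x y. x \<in> car X \<Longrightarrow> y \<in> car Y \<Longrightarrow> \<bar>B x y\<bar> \<le> C * nrm X x * nrm Y y"
    using bdd_bilin_bound[OF B] by blast
  have le: "\<bar>B (x' n) (y' n) - B x y\<bar> \<le>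
      C * nrm X (x - x' n) * nrm Y y + C * (nrm X x + nrm X (x - x' n)) * nrm Y (y - y' n)" for n
  proof -
    have "B x y - B (x' n) (y' n) = B (x - x' n) y + B (x' n) (y - y' n)"
      using x y lin_on_diff[OF X.sub bdd_bilinD(1)[OF B]] lin_on_diff[OF Y.sub bdd_bilinD(2)[OF B]]
      by simp
    moreover have "\<bar>B (x - x' n) y\<bar> \<le> C * nrm X (x - x' n) * nrm Y y"
      using C(2) x y X.mem_diff by blast
    moreover have "\<bar>B (x' n) (y - y' n)\<bar> \<le> C * nrm X (x' n) * nrm Y (y - y' n)"
      using C(2) x y Y.mem_diff by blast
    moreover have "nrm X (x' n) \<le> nrm X x + nrm X (x - x' n)"
      using X.nrm_le_diff[OF x(2) x(1)] X.nrm_commute[OF x(1) x(2)] by simp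
    then have "C * nrm X (x' n) * nrm Y (y - y' n) \<le> C * (nrm X x + nrm X (x - x' n)) * nrm Y (y - y' n)"
      using C(1) Y.nrm_nonneg[OF Y.mem_diff[OF y(1) y(2)]] by (intro mult_right_mono mult_left_mono) auto
    ultimately show ?thesis by linarith
  qed
  have "(\<lambda>n. C * nrm X (x - x' n) * nrm Y y + C * (nrm X x + nrm X (x - x' n)) * nrm Y (y - y' n))
    \<longlonglongrightarrow> C * 0 * nrm Y y + C * (nrm X x + 0) * 0"
    by (intro tendsto_intros x y)
  then have "(\<lambda>n. C * nrm X (x - x' n) * nrm Y y + C * (nrm X x + nrm X (x - x' n)) * nrm Y (y - y' n))
    \<longlonglongrightarrow> 0" by simp
  then have "(\<lambda>n. \<bar>B (x' n) (y' n) - B x y\<bar>) \<longlonglongrightarrow> 0"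
    by (rule tendsto_sandwich[OF always_eventually always_eventually tendsto_const, rotated 2])
       (use le in auto)
  then show ?thesis by (simp add: LIM_zero_iff tendsto_rabs_zero_iff)
qed

lemma bdd_bilin_measurable:
  fixes f :: "'a::euclidean_space \<Rightarrow> _"
  assumes "S \<in> sets lebesgue" and X: "seminormed X" and Y: "seminormed Y" and B: "bdd_bilin X Y B"
    and f: "strongly_measurable (lebesgue_on S) X f" and g: "strongly_measurable (lebesgue_on S) Y g"
  shows "(\<lambda>t. B (f t) (g t)) \<in> borel_measurable (lebesgue_on S)"
proof -
  have "strongly_measurable (lebesgue_on S) real_sp (\<lambda>t. B (f t) (g t))"
  proof (rule strongly_measurable_compose2[OF f g, where \<Phi> = B])
    fix x y x' y'
    assume a: "x \<in> car X" "y \<in> car Y" "\<And>n::nat. x' n \<in> car X" "\<And>n. y' n \<in> car Y"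
      "(\<lambda>n. nrm X (x - x' n)) \<longlonglongrightarrow> 0" "(\<lambda>n. nrm Y (y - y' n)) \<longlonglongrightarrow> 0"
    have "(\<lambda>n. B (x' n) (y' n)) \<longlonglongrightarrow> B x y"
      by (rule bdd_bilin_tendsto[OF X Y B]) (use a in auto)
    then show "(\<lambda>n. nrm real_sp (B x y - B (x' n) (y' n))) \<longlonglongrightarrow> 0"
      by (simp add: abs_diff_tendsto_iff)
  qed auto
  then show ?thesis using assms(1) by (simp add: strongly_measurable_real_iff)
qed

context seminormed
begin

lemma strongly_measurable_add:
  assumes f: "strongly_measurable M X f" and g: "strongly_measurable M X g"
  shows "strongly_measurable M X (\<lambda>t. f t + g t)"
proof (rule strongly_measurable_compose2[OF f g])
  fix x y x' y'
  assume a: "x \<in> car X" "y \<in> car X" "\<And>n::nat. x' n \<in> car X" "\<And>n. y' n \<in> car X"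
    "(\<lambda>n. nrm X (x - x' n)) \<longlonglongrightarrow> 0" "(\<lambda>n. nrm X (y - y' n)) \<longlonglongrightarrow> 0"
  have "(\<lambda>n. nrm X (x - x' n) + nrm X (y - y' n)) \<longlonglongrightarrow> 0 + 0" by (intro tendsto_intros a)
  then have lim: "(\<lambda>n. nrm X (x - x' n) + nrm X (y - y' n)) \<longlonglongrightarrow> 0" by simp
  have le: "nrm X (x + y - (x' n + y' n)) \<le> nrm X (x - x' n) + nrm X (y - y' n)" for n
    using nrm_triangle[of "x - x' n" "y - y' n"] a mem_diff by (simp add: algebra_simps)
  show "(\<lambda>n. nrm X (x + y - (x' n + y' n))) \<longlonglongrightarrow> 0"
    by (rule tendsto_sandwich[OF always_eventually always_eventually tendsto_const lim])
       (use le a nrm_nonneg mem_diff mem_add in auto)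
qed (rule mem_add)

lemma strongly_measurable_scale:
  assumes \<theta>: "strongly_measurable M real_sp \<theta>" and g: "strongly_measurable M X g"
  shows "strongly_measurable M X (\<lambda>t. \<theta> t *\<^sub>R g t)"
proof (rule strongly_measurable_compose2[OF \<theta> g])
  fix x y x' y'
  assume a: "y \<in> car X" "\<And>n::nat. y' n \<in> car X"
    "(\<lambda>n. nrm real_sp (x - x' n)) \<longlonglongrightarrow> 0" "(\<lambda>n. nrm X (y - y' n)) \<longlonglongrightarrow> 0"
  have le: "nrm X (x *\<^sub>R y - x' n *\<^sub>R y' n) \<le> \<bar>x - x' n\<bar> * nrm X y + (\<bar>x\<bar> + \<bar>x - x' n\<bar>) * nrm X (y - y' n)" for n
  proof -
    have "nrm X (x *\<^sub>R y - x' n *\<^sub>R y' n) = nrm X ((x - x' n) *\<^sub>R y + x' n *\<^sub>R (y - y' n))"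
      by (simp add: algebra_simps)
    also have "\<dots> \<le> \<bar>x - x' n\<bar> * nrm X y + \<bar>x' n\<bar> * nrm X (y - y' n)"
      using nrm_triangle[of "(x - x' n) *\<^sub>R y" "x' n *\<^sub>R (y - y' n)"] a mem_diff mem_scale
      by (simp add: nrm_scale)
    also have "\<dots> \<le> \<bar>x - x' n\<bar> * nrm X y + (\<bar>x\<bar> + \<bar>x - x' n\<bar>) * nrm X (y - y' n)"
      using a mem_diff nrm_nonneg by (intro add_left_mono mult_right_mono) auto
    finally show ?thesis .
  qed
  have a3: "(\<lambda>n. \<bar>x - x' n\<bar>) \<longlonglongrightarrow> 0" using a(3) by simp
  have "(\<lambda>n. \<bar>x - x' n\<bar> * nrm X y + (\<bar>x\<bar> + \<bar>x - x' n\<bar>) * nrm X (y - y' n)) \<longlonglongrightarrow> 0 * nrm X y + (\<bar>x\<bar> + 0) * 0"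
    by (intro tendsto_add tendsto_mult tendsto_const a3 a(4))
  then have lim: "(\<lambda>n. \<bar>x - x' n\<bar> * nrm X y + (\<bar>x\<bar> + \<bar>x - x' n\<bar>) * nrm X (y - y' n)) \<longlonglongrightarrow> 0" by simp
  show "(\<lambda>n. nrm X (x *\<^sub>R y - x' n *\<^sub>R y' n)) \<longlonglongrightarrow> 0"
    by (rule tendsto_sandwich[OF always_eventually always_eventually tendsto_const lim])
       (use le a nrm_nonneg mem_diff mem_scale in auto)
qed (rule mem_scale)

lemma strongly_measurable_cong_AE:
  assumes f: "strongly_measurable M X f" and eq: "AE t in M. g t \<in> car X \<and> nrm X (f t - g t) = 0"
  shows "strongly_measurable M X g"
proof -
  obtain s where s: "\<And>n. simple_function M (s n)" "\<And>n. s n ` space M \<subseteq> car X"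
    "AE t in M. (\<lambda>n. nrm X (f t - s n t)) \<longlonglongrightarrow> 0"
    using f by (auto simp: strongly_measurable_def)
  have fc: "AE t in M. f t \<in> car X" using f by (auto simp: strongly_measurable_def)
  have "AE t in M. (\<lambda>n. nrm X (g t - s n t)) \<longlonglongrightarrow> 0"
    using fc eq s(3) AE_space
  proof eventually_elim
    fix t assume a: "f t \<in> car X" "g t \<in> car X \<and> nrm X (f t - g t) = 0"
      "(\<lambda>n. nrm X (f t - s n t)) \<longlonglongrightarrow> 0" "t \<in> space M"
    have "nrm X (g t - s n t) = nrm X (f t - s n t)" for n
    proof (rule nrm_cong)
      show "g t - s n t \<in> car X" "f t - s n t \<in> car X"
        using a s(2)[of n] by (auto intro!: mem_diff)
      show "nrm X (g t - s n t - (f t - s n t)) = 0"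
        using a nrm_commute[of "f t" "g t"] by simp
    qed
    then show "(\<lambda>n. nrm X (g t - s n t)) \<longlonglongrightarrow> 0" using a by simp
  qed
  moreover have "AE t in M. g t \<in> car X" using eq by eventually_elim simp
  ultimately show ?thesis
    unfolding strongly_measurable_def by (intro conjI exI[of _ s] allI s)
qed

lemma nrm_measurable:
  fixes f :: "'a::euclidean_space \<Rightarrow> _"
  assumes "S \<in> sets lebesgue" and f: "strongly_measurable (lebesgue_on S) X f"
  shows "(\<lambda>t. nrm X (f t)) \<in> borel_measurable (lebesgue_on S)"
proof -
  have "strongly_measurable (lebesgue_on S) real_sp (\<lambda>t. nrm X (f t))"
    by (rule strongly_measurable_compose[OF f, where \<Phi> = "nrm X" and C = 1])
       (use abs_nrm_diff in auto)
  then show ?thesis using assms(1) by (simp add: strongly_measurable_real_iff)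
qed

end

lemma L2_time_iff:
  "f \<in> car (L2_time T X) \<longleftrightarrow> strongly_measurable (time_measure T) X f \<and>
    integrable (time_measure T) (\<lambda>t. (nrm X (f t))\<^sup>2)"
  by (simp add: L2_time_def)

lemma L2_time_AE: "f \<in> car (L2_time T X) \<Longrightarrow> AE t in time_measure T. f t \<in> car X"
  by (simp add: L2_time_iff strongly_measurable_def)

lemma finite_measure_time: "finite_measure (time_measure T)"
  by (intro finite_measure_lebesgue_on) auto

lemma integrable_const_time: "integrable (time_measure T) (\<lambda>t. c :: real)"
  using finite_measure.integrable_const[OF finite_measure_time] .

context seminormed
begin

lemma L2_timeI_bound:
  assumes f: "strongly_measurable (time_measure T) X f"
    and g: "integrable (time_measure T) g" and le: "AE t in time_measure T. (nrm X (f t))\<^sup>2 \<le> g t"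
  shows "f \<in> car (L2_time T X)"
  unfolding L2_time_iff
proof
  show "integrable (time_measure T) (\<lambda>t. (nrm X (f t))\<^sup>2)"
  proof (rule Bochner_Integration.integrable_bound[OF g])
    have "(\<lambda>t. nrm X (f t)) \<in> borel_measurable (time_measure T)"
      by (rule nrm_measurable[OF _ f]) auto
    then show "(\<lambda>t. (nrm X (f t))\<^sup>2) \<in> borel_measurable (time_measure T)" by measurable
    show "AE t in time_measure T. norm ((nrm X (f t))\<^sup>2) \<le> norm (g t)"
      using le by eventually_elim auto
  qed
qed fact

lemma L2_time_add:
  assumes f: "f \<in> car (L2_time T X)" and g: "g \<in> car (L2_time T X)"
  shows "(\<lambda>t. f t + g t) \<in> car (L2_time T X)"
proof (rule L2_timeI_bound)
  show "strongly_measurable (time_measure T) X (\<lambda>t. f t + g t)"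
    using f g by (intro strongly_measurable_add) (auto simp: L2_time_iff)
  show "integrable (time_measure T) (\<lambda>t. 2 * (nrm X (f t))\<^sup>2 + 2 * (nrm X (g t))\<^sup>2)"
    using f g by (auto simp: L2_time_iff)
  show "AE t in time_measure T. (nrm X (f t + g t))\<^sup>2 \<le> 2 * (nrm X (f t))\<^sup>2 + 2 * (nrm X (g t))\<^sup>2"
    using L2_time_AE[OF f] L2_time_AE[OF g]
  proof eventually_elim
    fix t assume a: "f t \<in> car X" "g t \<in> car X"
    have "(nrm X (f t + g t))\<^sup>2 \<le> (nrm X (f t) + nrm X (g t))\<^sup>2"
      using nrm_triangle[OF a] nrm_nonneg mem_add a by (intro power_mono) auto
    also have "\<dots> \<le> 2 * (nrm X (f t))\<^sup>2 + 2 * (nrm X (g t))\<^sup>2"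
      using sum_squares_bound[of "nrm X (f t)" "nrm X (g t)"] by (simp add: power2_sum)
    finally show "(nrm X (f t + g t))\<^sup>2 \<le> 2 * (nrm X (f t))\<^sup>2 + 2 * (nrm X (g t))\<^sup>2" .
  qed
qed

lemma L2_time_mult:
  assumes f: "f \<in> car (L2_time T X)" and \<theta>: "\<theta> \<in> borel_measurable (time_measure T)"
    and bd: "\<And>t. t \<in> {0<..<T} \<Longrightarrow> \<bar>\<theta> t\<bar> \<le> K"
  shows "(\<lambda>t. \<theta> t *\<^sub>R f t) \<in> car (L2_time T X)"
proof (rule L2_timeI_bound)
  show "strongly_measurable (time_measure T) X (\<lambda>t. \<theta> t *\<^sub>R f t)"
    using f \<theta> by (intro strongly_measurable_scale) (auto simp: L2_time_iff strongly_measurable_real_iff)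
  show "integrable (time_measure T) (\<lambda>t. K\<^sup>2 * (nrm X (f t))\<^sup>2)"
    using f by (auto simp: L2_time_iff)
  show "AE t in time_measure T. (nrm X (\<theta> t *\<^sub>R f t))\<^sup>2 \<le> K\<^sup>2 * (nrm X (f t))\<^sup>2"
    using L2_time_AE[OF f] AE_space
  proof eventually_elim
    fix t assume a: "f t \<in> car X" "t \<in> space (time_measure T)"
    then have "\<bar>\<theta> t\<bar> \<le> K" using bd by simp
    then have "(\<theta> t)\<^sup>2 \<le> K\<^sup>2" using abs_le_square_iff[of "\<theta> t" K] by (simp add: abs_le_iff)
    then show "(nrm X (\<theta> t *\<^sub>R f t))\<^sup>2 \<le> K\<^sup>2 * (nrm X (f t))\<^sup>2"
      using a by (simp add: nrm_scale power_mult_distrib mult_right_mono)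
  qed
qed

lemma L2_time_zero: "(\<lambda>t. 0) \<in> car (L2_time T X)"
  by (auto simp: L2_time_iff strongly_measurable_def mem_zero intro!: exI[of _ "\<lambda>n t. 0"])

lemma subspace_L2_time: "subspace (car (L2_time T X))"
proof (rule subspaceI)
  show "0 \<in> car (L2_time T X)" using L2_time_zero by (simp add: zero_fun_def)
  show "f + g \<in> car (L2_time T X)" if "f \<in> car (L2_time T X)" "g \<in> car (L2_time T X)" for f g
    using L2_time_add[OF that] by (simp add: plus_fun_def)
  show "c *\<^sub>R f \<in> car (L2_time T X)" if "f \<in> car (L2_time T X)" for c f
    using L2_time_mult[OF that, of "\<lambda>_. c" "\<bar>c\<bar>"] by (simp add: scaleR_fun_def)
qed

lemma L2_time_diff:
  assumes "f \<in> car (L2_time T X)" "g \<in> car (L2_time T X)"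
  shows "(\<lambda>t. f t - g t) \<in> car (L2_time T X)"
  using subspace_diff[OF subspace_L2_time assms] by (simp add: fun_diff_def)

lemma L2_time_cong_AE:
  assumes f: "f \<in> car (L2_time T X)"
    and eq: "AE t in time_measure T. g t \<in> car X \<and> nrm X (f t - g t) = 0"
  shows "g \<in> car (L2_time T X)"
proof (rule L2_timeI_bound)
  show "strongly_measurable (time_measure T) X g"
    using f eq by (intro strongly_measurable_cong_AE[of _ f g]) (auto simp: L2_time_iff)
  show "integrable (time_measure T) (\<lambda>t. (nrm X (f t))\<^sup>2)"
    using f by (auto simp: L2_time_iff)
  show "AE t in time_measure T. (nrm X (g t))\<^sup>2 \<le> (nrm X (f t))\<^sup>2"
    using eq L2_time_AE[OF f] 
  proof eventually_elim
    fix t assume a: "g t \<in> car X \<and> nrm X (f t - g t) = 0" "f t \<in> car X"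
    then have "nrm X (f t) = nrm X (g t)" by (intro nrm_cong) auto
    then show "(nrm X (g t))\<^sup>2 \<le> (nrm X (f t))\<^sup>2" by simp
  qed
qed

lemma L2_time_compose:
  assumes f: "f \<in> car (L2_time T X)" and Z: "seminormed Z"
    and car: "\<And>x. x \<in> car X \<Longrightarrow> \<Phi> x \<in> car Z"
    and cont: "\<And>x x'. x \<in> car X \<Longrightarrow> x' \<in> car X \<Longrightarrow> nrm Z (\<Phi> x - \<Phi> x') \<le> C * nrm X (x - x')"
    and bd: "\<And>x. x \<in> car X \<Longrightarrow> nrm Z (\<Phi> x) \<le> C * nrm X x"
  shows "(\<lambda>t. \<Phi> (f t)) \<in> car (L2_time T Z)"
proof -
  interpret Z: seminormed Z by fact
  show ?thesis
  proof (rule Z.L2_timeI_bound)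
    show "strongly_measurable (time_measure T) Z (\<lambda>t. \<Phi> (f t))"
      using f by (intro strongly_measurable_compose[OF _ car cont Z.nrm_nonneg Z.sub]) (auto simp: L2_time_iff)
    show "integrable (time_measure T) (\<lambda>t. C\<^sup>2 * (nrm X (f t))\<^sup>2)"
      using f by (auto simp: L2_time_iff)
    show "AE t in time_measure T. (nrm Z (\<Phi> (f t)))\<^sup>2 \<le> C\<^sup>2 * (nrm X (f t))\<^sup>2"
      using L2_time_AE[OF f]
      by eventually_elim (use bd car Z.nrm_nonneg in \<open>auto simp flip: power_mult_distrib intro!: power_mono\<close>)
  qed
qed

text \<open>
  Cutting the simple approximants off where they exceed twice the function makes dominated
  convergence applicable.
\<close>

lemma L2_time_simple_approx:
  assumes f: "f \<in> car (L2_time T X)" and d: "d > 0"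
  obtains s where "simple_function (time_measure T) s" "s ` space (time_measure T) \<subseteq> car X"
    "s \<in> car (L2_time T X)" "(LINT t|time_measure T. (nrm X (f t - s t))\<^sup>2) < d"
proof -
  let ?M = "time_measure T"
  have sm: "strongly_measurable ?M X f" using f by (simp add: L2_time_iff)
  obtain s where s: "\<And>n. simple_function ?M (s n)" "\<And>n. s n ` space ?M \<subseteq> car X"
    "AE t in ?M. (\<lambda>n. nrm X (f t - s n t)) \<longlonglongrightarrow> 0"
    using sm by (auto simp: strongly_measurable_def)
  have fm: "(\<lambda>t. nrm X (f t)) \<in> borel_measurable ?M" by (rule nrm_measurable[OF _ sm]) auto
  have sn: "(\<lambda>t. nrm X (s n t)) \<in> borel_measurable ?M" for n
    by (rule borel_measurable_simple_function[OF simple_function_compose1[OF s(1)]])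
  define r where "r n t = (if nrm X (s n t) \<le> 2 * nrm X (f t) then s n t else 0)" for n t
  have rs: "simple_function ?M (r n)" for n
    unfolding r_def
  proof (rule simple_function_If)
    show "{x \<in> space ?M. nrm X (s n x) \<le> 2 * nrm X (f x)} \<in> sets ?M"
      using fm sn[of n] by measurable
  qed (use s in auto)
  have rc: "r n ` space ?M \<subseteq> car X" for n
    using s(2)[of n] mem_zero by (auto simp: r_def)
  have rt: "r n t \<in> car X" if "t \<in> space ?M" for n t
    using rc[of n] that by blast
  have rl: "AE t in ?M. (\<lambda>n. nrm X (f t - r n t)) \<longlonglongrightarrow> 0"
    using s(3) L2_time_AE[OF f] AE_space
  proof eventually_elim
    fix t assume a: "(\<lambda>n. nrm X (f t - s n t)) \<longlonglongrightarrow> 0" "f t \<in> car X" "t \<in> space ?M"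
    have st: "s n t \<in> car X" for n using s(2)[of n] a by blast
    have le: "nrm X (f t - r n t) \<le> nrm X (f t - s n t)" for n
    proof (cases "nrm X (s n t) \<le> 2 * nrm X (f t)")
      case False
      then show ?thesis
        using nrm_le_diff[OF st[of n] a(2)] nrm_commute[OF st[of n] a(2)] by (simp add: r_def)
    qed (simp add: r_def)
    show "(\<lambda>n. nrm X (f t - r n t)) \<longlonglongrightarrow> 0"
      by (rule tendsto_sandwich[OF always_eventually always_eventually tendsto_const a(1)])
         (use le nrm_nonneg[OF mem_diff[OF a(2) rt[OF a(3)]]] in auto)
  qed
  have rd: "nrm X (r n t) \<le> 2 * nrm X (f t)" if "f t \<in> car X" for n t
    using nrm_nonneg[OF that] by (auto simp: r_def)
  have f2: "integrable ?M (\<lambda>t. (nrm X (f t))\<^sup>2)" using f by (simp add: L2_time_iff)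
  have rsm: "strongly_measurable ?M X (r n)" for n
    unfolding strongly_measurable_def
  proof (intro conjI exI[of _ "\<lambda>_. r n"] allI)
    show "AE t in ?M. r n t \<in> car X" by (intro AE_I2 rt)
  qed (use rs[of n] rc[of n] in auto)
  have rL: "r n \<in> car (L2_time T X)" for n
  proof (rule L2_timeI_bound)
    show "AE t in ?M. (nrm X (r n t))\<^sup>2 \<le> 4 * (nrm X (f t))\<^sup>2"
      using L2_time_AE[OF f] AE_space
    proof eventually_elim
      fix t assume "f t \<in> car X" "t \<in> space ?M"
      then have "(nrm X (r n t))\<^sup>2 \<le> (2 * nrm X (f t))\<^sup>2"
        using rd rt nrm_nonneg by (intro power_mono) blast+
      then show "(nrm X (r n t))\<^sup>2 \<le> 4 * (nrm X (f t))\<^sup>2" by (simp add: power_mult_distrib)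
    qed
    show "strongly_measurable ?M X (r n)" by (rule rsm)
  qed (use f2 in auto)
  have "(\<lambda>n. LINT t|?M. (nrm X (f t - r n t))\<^sup>2) \<longlonglongrightarrow> (LINT t|?M. 0)"
  proof (rule integral_dominated_convergence[where w = "\<lambda>t. 9 * (nrm X (f t))\<^sup>2"])
    show "(\<lambda>t. (nrm X (f t - r n t))\<^sup>2) \<in> borel_measurable ?M" for n
      using L2_time_diff[OF f rL[of n]] by (auto simp: L2_time_iff)
    show "integrable ?M (\<lambda>t. 9 * (nrm X (f t))\<^sup>2)" using f2 by simp
    show "AE t in ?M. (\<lambda>n. (nrm X (f t - r n t))\<^sup>2) \<longlonglongrightarrow> 0"
      using rl by eventually_elim (use tendsto_power[of _ 0 _ 2] in fastforce)
    show "AE t in ?M. norm ((nrm X (f t - r n t))\<^sup>2) \<le> 9 * (nrm X (f t))\<^sup>2" for n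
      using L2_time_AE[OF f] AE_space
    proof eventually_elim
      fix t assume a: "f t \<in> car X" "t \<in> space ?M"
      have r: "r n t \<in> car X" using rt a by blast
      have "nrm X (f t - r n t) \<le> 3 * nrm X (f t)"
        using nrm_diff_le[OF a(1) r] rd[OF a(1), of n] by simp
      then have "(nrm X (f t - r n t))\<^sup>2 \<le> (3 * nrm X (f t))\<^sup>2"
        using nrm_nonneg mem_diff a r by (intro power_mono) auto
      then show "norm ((nrm X (f t - r n t))\<^sup>2) \<le> 9 * (nrm X (f t))\<^sup>2" by (simp add: power_mult_distrib)
    qed
  qed auto
  then have "\<forall>\<^sub>F n in sequentially. (LINT t|?M. (nrm X (f t - r n t))\<^sup>2) < d"
    using d by (simp add: order_tendstoD)
  then obtain n where "(LINT t|?M. (nrm X (f t - r n t))\<^sup>2) < d"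
    using eventually_happens by fastforce
  then show thesis using that[of "r n"] rs rc rL by blast
qed

end

lemma bdd_bilin_integrable:
  assumes X: "seminormed X" and Y: "seminormed Y" and B: "bdd_bilin X Y B"
    and f: "f \<in> car (L2_time T X)" and g: "g \<in> car (L2_time T Y)"
  shows "integrable (time_measure T) (\<lambda>t. B (f t) (g t))"
proof -
  interpret X: seminormed X by fact
  interpret Y: seminormed Y by fact
  obtain C where C: "C \<ge> 0" "\<And>x y. x \<in> car X \<Longrightarrow> y \<in> car Y \<Longrightarrow> \<bar>B x y\<bar> \<le> C * nrm X x * nrm Y y"
    using bdd_bilin_bound[OF B] by blast
  show ?thesis
  proof (rule Bochner_Integration.integrable_bound)
    show "integrable (time_measure T) (\<lambda>t. C * (nrm X (f t))\<^sup>2 + C * (nrm Y (g t))\<^sup>2)"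
      using f g by (auto simp: L2_time_iff)
    show "(\<lambda>t. B (f t) (g t)) \<in> borel_measurable (time_measure T)"
      using f g by (intro bdd_bilin_measurable[OF _ X Y B]) (auto simp: L2_time_iff)
    show "AE t in time_measure T. norm (B (f t) (g t)) \<le> norm (C * (nrm X (f t))\<^sup>2 + C * (nrm Y (g t))\<^sup>2)"
      using L2_time_AE[OF f] L2_time_AE[OF g]
    proof eventually_elim
      fix t assume a: "f t \<in> car X" "g t \<in> car Y"
      have "nrm X (f t) * nrm Y (g t) \<le> (nrm X (f t))\<^sup>2 + (nrm Y (g t))\<^sup>2"
        using sum_squares_bound[of "nrm X (f t)" "nrm Y (g t)"]
          mult_nonneg_nonneg[OF X.nrm_nonneg[OF a(1)] Y.nrm_nonneg[OF a(2)]] by linarith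
      then have "C * (nrm X (f t) * nrm Y (g t)) \<le> C * ((nrm X (f t))\<^sup>2 + (nrm Y (g t))\<^sup>2)"
        using C(1) by (rule mult_left_mono)
      then show "norm (B (f t) (g t)) \<le> norm (C * (nrm X (f t))\<^sup>2 + C * (nrm Y (g t))\<^sup>2)"
        using C(1) C(2)[OF a] by (simp add: algebra_simps)
    qed
  qed
qed

locale semi_inner_sp = semi_inner "car X" ip for X :: "'v::real_vector normed_sp" and ip +
  assumes nrm_ip: "\<And>x. x \<in> car X \<Longrightarrow> nrm X x = sqrt (ip x x)"
begin

sublocale seminormed X
  by (rule seminormedI) (auto simp: nrm_ip)

lemma nrm_sq: "x \<in> car X \<Longrightarrow> (nrm X x)\<^sup>2 = ip x x"
  using nrm_ip ip_nonneg by simp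

lemma bdd_bilin_ip: "bdd_bilin X X ip"
  unfolding bdd_bilin_def
  using ip_lin ip_lin_right cauchy_schwarz by (intro conjI ballI exI[of _ 1]) (auto simp: nrm_ip)

lemma ip_integrable:
  "f \<in> car (L2_time T X) \<Longrightarrow> g \<in> car (L2_time T X) \<Longrightarrow> integrable (time_measure T) (\<lambda>t. ip (f t) (g t))"
  by (rule bdd_bilin_integrable[OF seminormed_axioms seminormed_axioms bdd_bilin_ip])

lemma LINT_nrm_sq:
  assumes "f \<in> car (L2_time T X)"
  shows "(LINT t|time_measure T. (nrm X (f t))\<^sup>2) = (LINT t|time_measure T. ip (f t) (f t))"
proof (rule Bochner_Integration.integral_cong_AE)
  show "(\<lambda>t. (nrm X (f t))\<^sup>2) \<in> borel_measurable (time_measure T)" using assms by (auto simp: L2_time_iff)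
  show "(\<lambda>t. ip (f t) (f t)) \<in> borel_measurable (time_measure T)"
    using ip_integrable[OF assms assms] by auto
  show "AE t in time_measure T. (nrm X (f t))\<^sup>2 = ip (f t) (f t)"
    using L2_time_AE[OF assms] by eventually_elim (rule nrm_sq)
qed

lemma semi_inner_sp_L2_time:
  "semi_inner_sp (L2_time T X) (\<lambda>f g. LINT t|time_measure T. ip (f t) (g t))"
proof
  let ?M = "time_measure T"
  show "subspace (car (L2_time T X))" by (rule subspace_L2_time)
  show "lin_on (car (L2_time T X)) (\<lambda>f. LINT t|?M. ip (f t) (g t))" if g: "g \<in> car (L2_time T X)" for g
  proof (rule lin_onI)
    fix f h assume f: "f \<in> car (L2_time T X)" and h: "h \<in> car (L2_time T X)"
    have "(LINT t|?M. ip ((f + h) t) (g t)) = (LINT t|?M. ip (f t) (g t) + ip (h t) (g t))"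
    proof (rule Bochner_Integration.integral_cong_AE)
      show "(\<lambda>t. ip ((f + h) t) (g t)) \<in> borel_measurable ?M"
        using ip_integrable[OF subspace_add[OF subspace_L2_time f h] g] by auto
      show "(\<lambda>t. ip (f t) (g t) + ip (h t) (g t)) \<in> borel_measurable ?M"
        using ip_integrable[OF f g] ip_integrable[OF h g] by auto
      show "AE t in ?M. ip ((f + h) t) (g t) = ip (f t) (g t) + ip (h t) (g t)"
        using L2_time_AE[OF f] L2_time_AE[OF g] L2_time_AE[OF h] by eventually_elim (simp add: ip_add_left)
    qed
    then show "(LINT t|?M. ip ((f + h) t) (g t)) = (LINT t|?M. ip (f t) (g t)) + (LINT t|?M. ip (h t) (g t))"
      using ip_integrable[OF f g] ip_integrable[OF h g] by simp
  next
    fix c f assume f: "f \<in> car (L2_time T X)"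
    have "(LINT t|?M. ip ((c *\<^sub>R f) t) (g t)) = (LINT t|?M. c * ip (f t) (g t))"
    proof (rule Bochner_Integration.integral_cong_AE)
      show "(\<lambda>t. ip ((c *\<^sub>R f) t) (g t)) \<in> borel_measurable ?M"
        using ip_integrable[OF subspace_scale[OF subspace_L2_time f] g] by auto
      show "(\<lambda>t. c * ip (f t) (g t)) \<in> borel_measurable ?M"
        using ip_integrable[OF f g] by auto
      show "AE t in ?M. ip ((c *\<^sub>R f) t) (g t) = c * ip (f t) (g t)"
        using L2_time_AE[OF f] L2_time_AE[OF g] by eventually_elim (simp add: ip_scale_left scaleR_fun_def)
    qed
    then show "(LINT t|?M. ip ((c *\<^sub>R f) t) (g t)) = c * (LINT t|?M. ip (f t) (g t))" by simp
  qed
  show "(LINT t|?M. ip (f t) (g t)) = (LINT t|?M. ip (g t) (f t))"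
    if f: "f \<in> car (L2_time T X)" and g: "g \<in> car (L2_time T X)" for f g
  proof (rule Bochner_Integration.integral_cong_AE)
    show "AE t in ?M. ip (f t) (g t) = ip (g t) (f t)"
      using L2_time_AE[OF f] L2_time_AE[OF g] by eventually_elim (rule ip_sym)
  qed (use ip_integrable[OF f g] ip_integrable[OF g f] in auto)
  show "0 \<le> (LINT t|?M. ip (f t) (f t))" if f: "f \<in> car (L2_time T X)" for f
    by (rule integral_nonneg_AE, rule AE_mp[OF L2_time_AE[OF f]]) (simp add: ip_nonneg)
  show "nrm (L2_time T X) f = sqrt (LINT t|?M. ip (f t) (f t))" if f: "f \<in> car (L2_time T X)" for f
    using LINT_nrm_sq[OF f] by (simp add: L2_time_def)
qed

text \<open>
  Simple functions are dense, and the error of approximating by them is uniform along a bounded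
  sequence; \<open>weak_null_of_ip_null\<close> then takes care of functionals.
\<close>

lemma L2_time_weak_null:
  assumes e: "\<And>n::nat. e n \<in> car (L2_time T X)"
    and bd: "\<forall>\<^sub>F n in sequentially. (LINT t|time_measure T. ip (e n t) (e n t)) \<le> C"
    and null: "\<And>x A. x \<in> car X \<Longrightarrow> A \<in> sets (time_measure T) \<Longrightarrow>
      (\<lambda>n. LINT t|time_measure T. indicator A t * ip (e n t) x) \<longlonglongrightarrow> 0"
    and F: "F \<in> car (dual (L2_time T X))"
  shows "(\<lambda>n. F (e n)) \<longlonglongrightarrow> 0"
proof -
  let ?M = "time_measure T"
  interpret L: semi_inner_sp "L2_time T X" "\<lambda>f g. LINT t|?M. ip (f t) (g t)"
    by (rule semi_inner_sp_L2_time)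
  obtain K where K: "\<forall>x\<in>car (L2_time T X). \<bar>F x\<bar> \<le> K * nrm (L2_time T X) x"
    and lin: "lin_on (car (L2_time T X)) F" using F by (auto simp: dual_iff)
  show ?thesis
  proof (rule L.weak_null_of_ip_null[OF e bd _ lin])
    show "\<bar>F x\<bar> \<le> K * sqrt (LINT t|?M. ip (x t) (x t))" if "x \<in> car (L2_time T X)" for x
      using K L.nrm_ip that by auto
    show "(\<lambda>n. LINT t|?M. ip (e n t) (h t)) \<longlonglongrightarrow> 0" if h: "h \<in> car (L2_time T X)" for h
    proof (rule LIMSEQ_I)
      fix r :: real assume r: "r > 0"
      define d where "d = (r / (2 * (sqrt \<bar>C\<bar> + 1)))\<^sup>2"
      have c1: "sqrt \<bar>C\<bar> + 1 > 0" by (smt (verit) abs_ge_zero real_sqrt_ge_zero)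
      have d: "d > 0" using r c1 by (simp add: d_def)
      obtain s where s: "simple_function ?M s" "s ` space ?M \<subseteq> car X" "s \<in> car (L2_time T X)"
        "(LINT t|?M. (nrm X (h t - s t))\<^sup>2) < d"
        using L2_time_simple_approx[OF h d] by blast
      have hs: "(\<lambda>t. h t - s t) \<in> car (L2_time T X)" by (rule L2_time_diff[OF h s(3)])
      have simple: "(LINT t|?M. ip (e n t) (s t)) =
        (\<Sum>x\<in>s ` space ?M. LINT t|?M. indicator (s -` {x} \<inter> space ?M) t * ip (e n t) x)" for n
      proof -
        have int: "integrable ?M (\<lambda>t. indicator (s -` {x} \<inter> space ?M) t * ip (e n t) x)"
          if x: "x \<in> s ` space ?M" for x
        proof -
          have xc: "(\<lambda>t. x) \<in> car (L2_time T X)"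
            using x s(2) integrable_const_time[of T]
            by (auto simp: L2_time_iff strongly_measurable_def intro!: exI[of _ "\<lambda>_ _. x"])
          show ?thesis
            using integrable_mult_indicator[OF simple_functionD(2)[OF s(1), of "{x}"] ip_integrable[OF e xc, of n]]
            by simp
        qed
        have "(LINT t|?M. ip (e n t) (s t)) =
          (LINT t|?M. (\<Sum>x\<in>s ` space ?M. indicator (s -` {x} \<inter> space ?M) t * ip (e n t) x))"
        proof (rule Bochner_Integration.integral_cong)
          fix t assume t: "t \<in> space ?M"
          have "(\<Sum>x\<in>s ` space ?M. indicator (s -` {x} \<inter> space ?M) t * ip (e n t) x) =
            (\<Sum>x\<in>s ` space ?M. if x = s t then ip (e n t) x else 0)"
            using t by (intro sum.cong) (auto simp: indicator_def)
          also have "\<dots> = ip (e n t) (s t)"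
            using t simple_functionD(1)[OF s(1)] by (simp add: sum.delta)
          finally show "ip (e n t) (s t) = (\<Sum>x\<in>s ` space ?M. indicator (s -` {x} \<inter> space ?M) t * ip (e n t) x)" ..
        qed simp
        also have "\<dots> = (\<Sum>x\<in>s ` space ?M. LINT t|?M. indicator (s -` {x} \<inter> space ?M) t * ip (e n t) x)"
          by (rule Bochner_Integration.integral_sum[OF int])
        finally show ?thesis .
      qed
      have "(\<lambda>n. LINT t|?M. ip (e n t) (s t)) \<longlonglongrightarrow> (\<Sum>x\<in>s ` space ?M. 0)"
        unfolding simple
        by (intro tendsto_sum null) (use s simple_functionD[OF s(1)] in auto)
      then have "\<forall>\<^sub>F n in sequentially. \<bar>LINT t|?M. ip (e n t) (s t)\<bar> < r / 2"
        using r tendstoD[of _ 0 sequentially "r/2"] by fastforce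
      then have "\<forall>\<^sub>F n in sequentially. \<bar>LINT t|?M. ip (e n t) (h t)\<bar> < r"
        using bd
      proof eventually_elim
        fix n assume a: "\<bar>LINT t|?M. ip (e n t) (s t)\<bar> < r / 2" "(LINT t|?M. ip (e n t) (e n t)) \<le> C"
        have "h - s \<in> car (L2_time T X)" by (rule L.mem_diff[OF h s(3)])
        then have "\<bar>LINT t|?M. ip (e n t) ((h - s) t)\<bar> \<le>
          sqrt (LINT t|?M. ip (e n t) (e n t)) * sqrt (LINT t|?M. ip ((h - s) t) ((h - s) t))"
          by (rule L.cauchy_schwarz[OF e])
        also have "\<dots> \<le> sqrt \<bar>C\<bar> * (r / (2 * (sqrt \<bar>C\<bar> + 1)))"
        proof (rule mult_mono)
          show "sqrt (LINT t|?M. ip (e n t) (e n t)) \<le> sqrt \<bar>C\<bar>" using a by simp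
          have "(LINT t|?M. ip ((h - s) t) ((h - s) t)) \<le> d"
            using s(4) LINT_nrm_sq[OF hs] by simp
          then have "sqrt (LINT t|?M. ip ((h - s) t) ((h - s) t)) \<le> sqrt d" by simp
          also have "\<dots> = r / (2 * (sqrt \<bar>C\<bar> + 1))" using r c1 by (simp add: d_def)
          finally show "sqrt (LINT t|?M. ip ((h - s) t) ((h - s) t)) \<le> r / (2 * (sqrt \<bar>C\<bar> + 1))" .
        qed (use L.ip_nonneg[OF \<open>h - s \<in> _\<close>] in auto)
        also have "\<dots> = (r / 2) * (sqrt \<bar>C\<bar> / (sqrt \<bar>C\<bar> + 1))" by simp
        also have "\<dots> \<le> (r / 2) * 1" using r c1 by (intro mult_left_mono) (auto simp: divide_le_eq_1)
        finally have "\<bar>LINT t|?M. ip (e n t) ((h - s) t)\<bar> \<le> r / 2" by simp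
        moreover have "(LINT t|?M. ip (e n t) ((h - s) t)) =
          (LINT t|?M. ip (e n t) (h t)) - (LINT t|?M. ip (e n t) (s t))"
          using L.ip_diff_right[OF h s(3) e] .
        ultimately show "\<bar>LINT t|?M. ip (e n t) (h t)\<bar> < r" using a by linarith
      qed
      then show "\<exists>N. \<forall>n\<ge>N. norm ((LINT t|?M. ip (e n t) (h t)) - 0) < r"
        by (simp add: eventually_sequentially)
    qed
  qed
qed

end

section \<open>Smooth functions with compact support\<close>

text \<open>
  The derivatives of \<open>exp (- 1 / s)\<close> are linear combinations of the functions below, which are
  therefore smooth although they vanish on a half-line.
\<close>

definition flat :: "nat \<Rightarrow> real \<Rightarrow> real"
  where "flat n s = (if s > 0 then exp (- 1 / s) / s ^ n else 0)"

lemma flat_tendsto_0: "(flat n \<longlongrightarrow> 0) (at 0)"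
proof -
  have "((\<lambda>x. x ^ n / exp x) \<longlongrightarrow> (0::real)) at_top" by (rule tendsto_power_div_exp_0)
  then have "((\<lambda>s. (inverse s) ^ n / exp (inverse s)) \<longlongrightarrow> (0::real)) (at_right 0)"
    by (rule filterlim_compose[OF _ filterlim_inverse_at_top_right])
  then have r: "(flat n \<longlongrightarrow> 0) (at_right 0)"
  proof (rule Lim_transform_eventually)
    show "\<forall>\<^sub>F s in at_right 0. (inverse s) ^ n / exp (inverse s) = flat n s"
      by (rule eventually_at_right_less[THEN eventually_mono])
         (simp add: flat_def exp_minus divide_simps power_inverse)
  qed
  have "(flat n \<longlongrightarrow> 0) (at_left 0)"
    by (rule tendsto_eventually)
       (auto simp: eventually_at_left_field flat_def intro!: exI[of _ "-1"])
  then show ?thesis using r by (simp add: filterlim_split_at)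
qed

lemma flat_has_derivative: "(flat n has_real_derivative (flat (n + 2) s - n * flat (n + 1) s)) (at s)"
proof (cases "s = 0")
  case True
  have "(flat n (0 + h) - flat n 0) / h = flat (n + 1) h" for h
    by (auto simp: flat_def)
  then have "(flat n has_real_derivative 0) (at 0)"
    unfolding DERIV_def using flat_tendsto_0[of "n + 1"] by simp
  then show ?thesis using True by (simp add: flat_def)
next
  case False
  show ?thesis
  proof (cases "s > 0")
    case pos: True
    have "((\<lambda>s. exp (- 1 / s) / s ^ n) has_real_derivative
        ((exp (- 1 / s) * (1 / s\<^sup>2)) * s ^ n - exp (- 1 / s) * (n * s ^ (n - 1))) / (s ^ n * s ^ n)) (at s)"
      using pos by (auto intro!: derivative_eq_intros simp: power2_eq_square)
    also have "((exp (- 1 / s) * (1 / s\<^sup>2)) * s ^ n - exp (- 1 / s) * (n * s ^ (n - 1))) / (s ^ n * s ^ n)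
      = flat (n + 2) s - n * flat (n + 1) s"
      using pos by (cases n) (auto simp: flat_def field_simps power2_eq_square)
    finally show ?thesis
    proof (rule has_field_derivative_transform_within_open[of _ _ _ "{0<..}"])
      fix x :: real assume "x \<in> {0<..}"
      then show "exp (- 1 / x) / x ^ n = flat n x" by (simp add: flat_def)
    qed (use pos in auto)
  next
    case neg: False
    have "((\<lambda>s. 0) has_real_derivative 0) (at s)" by simp
    then have "(flat n has_real_derivative 0) (at s)"
      by (rule has_field_derivative_transform_within_open[of _ _ _ "{..<0}"])
         (use neg False in \<open>auto simp: flat_def\<close>)
    then show ?thesis using neg by (simp add: flat_def)
  qed
qed

lemma flat_0_bounds: "0 \<le> flat 0 s" "flat 0 s \<le> 1" "flat 0 s \<noteq> 0 \<longleftrightarrow> s > 0"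
  by (auto simp: flat_def)

text \<open>
  The set is closed under partial derivatives, by \<open>flat_has_derivative\<close>. One differentiation thus
  shows smoothness of all orders, without a Leibniz rule for higher derivatives.
\<close>

inductive smooth_expr :: "('a::euclidean_space \<Rightarrow> real) \<Rightarrow> bool" where
  const: "smooth_expr (\<lambda>x. c)"
| flat: "smooth_expr (\<lambda>x. flat n (x \<bullet> v - a))"
| add: "smooth_expr f \<Longrightarrow> smooth_expr g \<Longrightarrow> smooth_expr (\<lambda>x. f x + g x)"
| mult: "smooth_expr f \<Longrightarrow> smooth_expr g \<Longrightarrow> smooth_expr (\<lambda>x. f x * g x)"

lemma smooth_expr_derivative:
  assumes "smooth_expr f"
  shows "\<exists>D. (\<forall>x. (f has_derivative (\<lambda>e. D e x)) (at x)) \<and> (\<forall>e. smooth_expr (D e))"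
  using assms
proof induction
  case (const c)
  show ?case by (rule exI[of _ "\<lambda>e x. 0"]) (auto intro: smooth_expr.const)
next
  case (flat n v a)
  have "((\<lambda>x. flat n (x \<bullet> v - a)) has_derivative
      (\<lambda>e. (e \<bullet> v) * (flat (n + 2) (x \<bullet> v - a) + (- real n) * flat (n + 1) (x \<bullet> v - a)))) (at x)" for x :: 'a
  proof -
    have "((\<lambda>x. x \<bullet> v - a) has_derivative (\<lambda>e. e \<bullet> v)) (at x)"
      by (auto intro!: derivative_eq_intros)
    from has_derivative_compose[OF this has_field_derivative_imp_has_derivative[OF flat_has_derivative]]
    show ?thesis by (simp add: mult_ac)
  qed
  then show ?case
    by (intro exI[of _ "\<lambda>e x. (e \<bullet> v) * (flat (n + 2) (x \<bullet> v - a) + (- real n) * flat (n + 1) (x \<bullet> v - a))"] conjI allI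
        smooth_expr.intros)
next
  case (add f g)
  then obtain D E where D: "\<And>x. (f has_derivative (\<lambda>e. D e x)) (at x)" "\<And>e. smooth_expr (D e)"
    and E: "\<And>x. (g has_derivative (\<lambda>e. E e x)) (at x)" "\<And>e. smooth_expr (E e)" by blast
  show ?case
    by (rule exI[of _ "\<lambda>e x. D e x + E e x"]) (auto intro!: smooth_expr.add D E has_derivative_add)
next
  case (mult f g)
  then obtain D E where D: "\<And>x. (f has_derivative (\<lambda>e. D e x)) (at x)" "\<And>e. smooth_expr (D e)"
    and E: "\<And>x. (g has_derivative (\<lambda>e. E e x)) (at x)" "\<And>e. smooth_expr (E e)" by blast
  show ?case
    by (rule exI[of _ "\<lambda>e x. f x * E e x + D e x * g x"])
       (auto intro!: smooth_expr.add smooth_expr.mult mult.hyps D E has_derivative_mult)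
qed

lemma smooth_expr_C_k: "smooth_expr f \<Longrightarrow> C_k k f"
proof (induction k arbitrary: f)
  case 0
  obtain D where "\<And>x. (f has_derivative (\<lambda>e. D e x)) (at x)"
    using smooth_expr_derivative[OF 0] by blast
  then show ?case
    by (auto simp: continuous_on_eq_continuous_at intro: has_derivative_continuous)
next
  case (Suc k)
  obtain D where D: "\<And>x. (f has_derivative (\<lambda>e. D e x)) (at x)" "\<And>e. smooth_expr (D e)"
    using smooth_expr_derivative[OF Suc.prems] by blast
  have "frechet_derivative f (at x) = (\<lambda>e. D e x)" for x
    using frechet_derivative_at[OF D(1)] by simp
  then show ?case using D Suc.IH by (auto intro: differentiableI)
qed

lemma compact_closure_subset:
  assumes "compact K" "closure S \<subseteq> K"
  shows "compact (closure S)"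
proof -
  have "closure S = K \<inter> closure S" using assms by auto
  then show ?thesis using compact_Int_closed[OF assms(1) closed_closure] by metis
qed

lemma smooth_expr_test_function:
  assumes "smooth_expr f" "compact K" "K \<subseteq> U" "\<And>x. x \<notin> K \<Longrightarrow> f x = 0"
  shows "f \<in> test_functions U"
proof -
  have "closure {x. f x \<noteq> 0} \<subseteq> K"
    using assms by (intro closure_minimal compact_imp_closed) auto
  moreover then have "compact (closure {x. f x \<noteq> 0})"
    using assms(2) by (rule compact_closure_subset[rotated])
  ultimately show ?thesis
    using assms smooth_expr_C_k by (auto simp: test_functions_def)
qed

lemma C_k_continuous: "C_k k f \<Longrightarrow> continuous_on UNIV f"
  by (cases k) (auto simp: continuous_on_eq_continuous_at intro!: differentiable_imp_continuous_within)

lemma C_k_add: "C_k k f \<Longrightarrow> C_k k g \<Longrightarrow> C_k k (\<lambda>x. f x + g x)"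
proof (induction k arbitrary: f g)
  case 0
  then show ?case by (auto intro: continuous_intros)
next
  case (Suc k)
  then have d: "\<And>x. f differentiable (at x)" "\<And>x. g differentiable (at x)" by auto
  have "frechet_derivative (\<lambda>x. f x + g x) (at x) e = frechet_derivative f (at x) e + frechet_derivative g (at x) e" for x e
  proof -
    have "((\<lambda>x. f x + g x) has_derivative (\<lambda>e. frechet_derivative f (at x) e + frechet_derivative g (at x) e)) (at x)"
      using d[of x] by (intro has_derivative_add) (simp_all add: frechet_derivative_works[symmetric])
    from frechet_derivative_at[OF this] show ?thesis by metis
  qed
  then show ?case using Suc d by auto
qed

lemma C_k_scale: "C_k k f \<Longrightarrow> C_k k (\<lambda>x. c * f x)"
proof (induction k arbitrary: f)
  case 0
  then show ?case by (auto intro: continuous_intros)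
next
  case (Suc k)
  then have d: "\<And>x. f differentiable (at x)" by auto
  have "((\<lambda>x. c * f x) has_derivative (\<lambda>e. c * frechet_derivative f (at x) e)) (at x)" for x
    using d[of x] by (intro has_derivative_mult_right) (simp add: frechet_derivative_works[symmetric])
  from frechet_derivative_at[OF this]
  have "frechet_derivative (\<lambda>x. c * f x) (at x) e = c * frechet_derivative f (at x) e" for x e
    by metis
  then show ?case using Suc d by auto
qed

lemma subspace_test_functions: "subspace (test_functions U)"
proof (rule subspaceI)
  show "0 \<in> test_functions U"
    using smooth_expr_test_function[OF smooth_expr.const[of 0], of "{}"] by (simp add: zero_fun_def)
next
  fix f g :: "'a \<Rightarrow> real" assume fg: "f \<in> test_functions U" "g \<in> test_functions U"
  have sub: "closure {x. f x + g x \<noteq> 0} \<subseteq> closure {x. f x \<noteq> 0} \<union> closure {x. g x \<noteq> 0}"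
    unfolding closure_Un[symmetric] by (rule closure_mono) auto
  moreover have "compact (closure {x. f x \<noteq> 0} \<union> closure {x. g x \<noteq> 0})"
    using fg by (intro compact_Un) (auto simp: test_functions_def)
  ultimately have "compact (closure {x. f x + g x \<noteq> 0})"
    by (rule compact_closure_subset[rotated])
  moreover have "closure {x. f x + g x \<noteq> 0} \<subseteq> U"
    using sub fg by (auto simp: test_functions_def)
  ultimately show "f + g \<in> test_functions U"
    using fg by (auto simp: test_functions_def plus_fun_def C_k_add)
next
  fix c and f :: "'a \<Rightarrow> real" assume f: "f \<in> test_functions U"
  have sub: "closure {x. c * f x \<noteq> 0} \<subseteq> closure {x. f x \<noteq> 0}"
    by (rule closure_mono) auto
  moreover have "compact (closure {x. f x \<noteq> 0})"
    using f by (simp add: test_functions_def)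
  then have "compact (closure {x. c * f x \<noteq> 0})"
    using sub by (rule compact_closure_subset)
  ultimately show "c *\<^sub>R f \<in> test_functions U"
    using f by (auto simp: test_functions_def scaleR_fun_def C_k_scale)
qed

lemma test_function_props:
  assumes "\<phi> \<in> test_functions U"
  shows "continuous_on UNIV \<phi>" "\<And>x. \<phi> differentiable (at x)"
    "\<And>e. e \<in> Basis \<Longrightarrow> continuous_on UNIV (\<lambda>x. frechet_derivative \<phi> (at x) e)"
    "compact (closure {x. \<phi> x \<noteq> 0})" "closure {x. \<phi> x \<noteq> 0} \<subseteq> U"
    "\<And>x. x \<notin> closure {x. \<phi> x \<noteq> 0} \<Longrightarrow> \<phi> x = 0"
    "\<And>x e. x \<notin> closure {x. \<phi> x \<noteq> 0} \<Longrightarrow> frechet_derivative \<phi> (at x) e = 0"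
proof -
  have C: "C_k k \<phi>" for k using assms by (auto simp: test_functions_def)
  show "continuous_on UNIV \<phi>" using C[of 0] by simp
  show "\<phi> differentiable (at x)" for x using C[of 1] by simp
  show "continuous_on UNIV (\<lambda>x. frechet_derivative \<phi> (at x) e)" if "e \<in> Basis" for e
    using C[of 1] that by simp
  show "compact (closure {x. \<phi> x \<noteq> 0})" "closure {x. \<phi> x \<noteq> 0} \<subseteq> U"
    using assms by (auto simp: test_functions_def)
  show "\<phi> x = 0" if "x \<notin> closure {x. \<phi> x \<noteq> 0}" for x
    using that closure_subset[of "{x. \<phi> x \<noteq> 0}"] by auto
  show "frechet_derivative \<phi> (at x) e = 0" if "x \<notin> closure {x. \<phi> x \<noteq> 0}" for x e
  proof -
    have "((\<lambda>x. 0) has_derivative (\<lambda>e. 0)) (at x)" by simp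
    then have "(\<phi> has_derivative (\<lambda>e. 0)) (at x)"
    proof (rule has_derivative_transform_within_open[of _ _ _ _ "- closure {x. \<phi> x \<noteq> 0}"])
      show "0 = \<phi> y" if "y \<in> - closure {x. \<phi> x \<noteq> 0}" for y
        using that closure_subset[of "{x. \<phi> x \<noteq> 0}"] by auto
    qed (use that in auto)
    from frechet_derivative_at[OF this] show ?thesis by metis
  qed
qed

lemma bounded_of_compact_support:
  fixes h :: "'a::euclidean_space \<Rightarrow> real"
  assumes "continuous_on UNIV h" "compact K" "\<And>x. x \<notin> K \<Longrightarrow> h x = 0"
  obtains M where "M \<ge> 0" "\<And>x. \<bar>h x\<bar> \<le> M"
proof -
  have "compact (h ` K)"
    using assms by (intro compact_continuous_image) (auto intro: continuous_on_subset)
  then obtain M where M: "M > 0" "\<forall>y\<in>h ` K. norm y \<le> M"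
    using compact_imp_bounded bounded_pos by metis
  have "\<bar>h x\<bar> \<le> M" for x
    using M assms(3)[of x] by (cases "x \<in> K") auto
  then show thesis using that[of M] M(1) by auto
qed

lemma integrable_of_compact_support:
  fixes h :: "'a::euclidean_space \<Rightarrow> real"
  assumes "continuous_on UNIV h" "compact K" "\<And>x. x \<notin> K \<Longrightarrow> h x = 0"
  shows "integrable lborel h"
proof -
  obtain M where M: "M \<ge> 0" "\<And>x. \<bar>h x\<bar> \<le> M"
    using bounded_of_compact_support[OF assms] by blast
  show ?thesis
  proof (rule Bochner_Integration.integrable_bound)
    show "integrable lborel (\<lambda>x. M * indicator K x)"
      using assms(2) emeasure_compact_finite[OF assms(2)]
      by (intro integrable_mult_right integrable_real_indicator) (auto simp: compact_imp_closed)
    show "h \<in> borel_measurable lborel"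
      using assms(1) by (simp add: borel_measurable_continuous_onI)
    show "AE x in lborel. norm (h x) \<le> norm (M * indicator K x)"
      using M assms(3) by (auto simp: indicator_def)
  qed
qed

lemma LINT_compact_support:
  fixes h :: "'a::euclidean_space \<Rightarrow> real"
  assumes "continuous_on UNIV h" "compact K" "\<And>x. x \<notin> K \<Longrightarrow> h x = 0" "K \<subseteq> \<Omega>" "\<Omega> \<in> sets lebesgue"
  shows "(LINT x|lebesgue_on \<Omega>. h x) = (LINT x|lborel. h x)"
proof -
  have "(LINT x|lebesgue_on \<Omega>. h x) = (LINT x|lebesgue. indicator \<Omega> x *\<^sub>R h x)"
    using assms(5) by (intro integral_restrict_space) auto
  also have "(\<lambda>x. indicator \<Omega> x *\<^sub>R h x) = h"
    using assms(3,4) by (auto simp: indicator_def fun_eq_iff)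
  also have "(LINT x|lebesgue. h x) = (LINT x|lborel. h x)"
    using assms(1) by (intro integral_completion) (simp add: borel_measurable_continuous_onI)
  finally show ?thesis .
qed

text \<open>
  The integral of a difference quotient vanishes by translation invariance; dominated
  convergence carries this over to the derivative.
\<close>

lemma LINT_derivative_compact_support:
  fixes \<psi> :: "'a::euclidean_space \<Rightarrow> real"
  assumes d: "\<And>x. (\<psi> has_derivative D x) (at x)" and c: "continuous_on UNIV (\<lambda>x. D x e)"
    and K: "compact K" "\<And>x. x \<notin> K \<Longrightarrow> \<psi> x = 0" "\<And>x. x \<notin> K \<Longrightarrow> D x e = 0"
  shows "(LINT x|lborel. D x e) = 0"
proof -
  have cc: "continuous_on UNIV \<psi>"
    using d by (auto simp: continuous_on_eq_continuous_at intro: has_derivative_continuous)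
  have int: "integrable lborel \<psi>" by (rule integrable_of_compact_support[OF cc K(1,2)])
  obtain M where M: "M \<ge> 0" "\<And>x. \<bar>D x e\<bar> \<le> M"
    using bounded_of_compact_support[OF c K(1,3)] by blast
  obtain R where R: "K \<subseteq> cball 0 R" 
    using bounded_subset_ballD[OF compact_imp_bounded[OF K(1)], of 0] ball_subset_cball by blast
  define h where "h n = 1 / real (Suc n)" for n
  have h: "h n > 0" "h n \<le> 1" for n by (auto simp: h_def)
  have h0: "h \<longlonglongrightarrow> 0" unfolding h_def by (rule LIMSEQ_Suc[OF lim_1_over_n])
  define q where "q n x = (\<psi> (x + h n *\<^sub>R e) - \<psi> x) / h n" for n x
  have line: "((\<lambda>s. \<psi> (x + s *\<^sub>R e)) has_real_derivative D (x + s *\<^sub>R e) e) (at s)" for x s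
  proof -
    have "((\<lambda>s. x + s *\<^sub>R e) has_derivative (\<lambda>s. s *\<^sub>R e)) (at s)"
      by (auto intro!: derivative_eq_intros)
    from has_derivative_compose[OF this d]
    have "((\<lambda>s. \<psi> (x + s *\<^sub>R e)) has_derivative (\<lambda>r. D (x + s *\<^sub>R e) (r *\<^sub>R e))) (at s)" .
    moreover have "(\<lambda>r. D (x + s *\<^sub>R e) (r *\<^sub>R e)) = (*) (D (x + s *\<^sub>R e) e)"
      using linear_scale[OF has_derivative_linear[OF d]] by (auto simp: fun_eq_iff)
    ultimately show ?thesis by (simp add: has_field_derivative_def)
  qed
  have shift: "integrable lborel (\<lambda>x. \<psi> (x + a))" "(LINT x|lborel. \<psi> (x + a)) = (LINT x|lborel. \<psi> x)" for a
  proof -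
    have m: "\<psi> \<in> borel_measurable borel" by (rule borel_measurable_continuous_onI[OF cc])
    have "integrable (distr lborel borel ((+) a)) \<psi>" using int by (simp add: lborel_distr_plus)
    then show "integrable lborel (\<lambda>x. \<psi> (x + a))"
      using m by (simp add: integrable_distr_eq add.commute)
    have "(LINT x|distr lborel borel ((+) a). \<psi> x) = (LINT x|lborel. \<psi> (a + x))"
      using m by (intro integral_distr) auto
    then show "(LINT x|lborel. \<psi> (x + a)) = (LINT x|lborel. \<psi> x)"
      by (simp add: lborel_distr_plus add.commute)
  qed
  have q0: "(LINT x|lborel. q n x) = 0" for n
    using shift int by (simp add: q_def)
  have "(\<lambda>n. LINT x|lborel. q n x) \<longlonglongrightarrow> (LINT x|lborel. D x e)"
  proof (rule integral_dominated_convergence[where w = "\<lambda>x. M * indicator (cball 0 (R + norm e)) x"])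
    show "(\<lambda>x. D x e) \<in> borel_measurable lborel"
      using c by (simp add: borel_measurable_continuous_onI)
    show "q n \<in> borel_measurable lborel" for n
    proof -
      have "continuous_on UNIV (q n)"
        unfolding q_def using h[of n]
        by (intro continuous_intros continuous_on_compose2[OF cc]) auto
      then show ?thesis by (simp add: borel_measurable_continuous_onI)
    qed
    show "integrable lborel (\<lambda>x. M * indicator (cball 0 (R + norm e)) x :: real)"
      using emeasure_compact_finite[OF compact_cball, of 0 "R + norm e"]
      by (intro integrable_mult_right integrable_real_indicator) auto
    show "AE x in lborel. (\<lambda>n. q n x) \<longlonglongrightarrow> D x e"
    proof (rule AE_I2)
      fix x
      have 1: "((\<lambda>s. (\<psi> (x + s *\<^sub>R e) - \<psi> x) / s) \<longlongrightarrow> D x e) (at 0)"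
        using line[of x 0] unfolding DERIV_def by simp
      have 2: "filterlim h (at 0) sequentially"
      proof -
        have "h n \<noteq> 0" for n using h(1)[of n] by simp
        then show ?thesis using h0 by (simp add: filterlim_at)
      qed
      show "(\<lambda>n. q n x) \<longlonglongrightarrow> D x e"
        unfolding q_def by (rule filterlim_compose[OF 1 2])
    qed
    show "AE x in lborel. norm (q n x) \<le> M * indicator (cball 0 (R + norm e)) x" for n
    proof (rule AE_I2)
      fix x
      show "norm (q n x) \<le> M * indicator (cball 0 (R + norm e)) x"
      proof (cases "x \<in> cball 0 (R + norm e)")
        case True
        obtain z where "\<psi> (x + h n *\<^sub>R e) - \<psi> (x + 0 *\<^sub>R e) = (h n - 0) * D (x + z *\<^sub>R e) e"
          using MVT2[of 0 "h n" "\<lambda>s. \<psi> (x + s *\<^sub>R e)" "\<lambda>s. D (x + s *\<^sub>R e) e"] h(1)[of n] line by blast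
        then have "q n x = D (x + z *\<^sub>R e) e" using h(1)[of n] by (simp add: q_def)
        then show ?thesis using M True by simp
      next
        case False
        have "x \<notin> cball 0 R" using False norm_ge_zero[of e] by (simp add: not_le del: norm_ge_zero)
        moreover have "x + h n *\<^sub>R e \<notin> cball 0 R"
        proof
          assume a: "x + h n *\<^sub>R e \<in> cball 0 R"
          have "norm x \<le> norm (x + h n *\<^sub>R e) + norm (h n *\<^sub>R e)"
            using norm_triangle_ineq4[of "x + h n *\<^sub>R e" "h n *\<^sub>R e"] by simp
          also have "\<dots> \<le> R + 1 * norm e"
            using a h[of n] mult_right_mono[of "h n" 1 "norm e"] by (intro add_mono) auto
          finally show False using False by simp
        qed
        ultimately have "\<psi> (x + h n *\<^sub>R e) = 0" "\<psi> x = 0" using K(2) R by blast+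
        then have "q n x = 0" by (simp add: q_def)
        then show ?thesis using False by simp
      qed
    qed
  qed
  then have "(\<lambda>n. 0 :: real) \<longlonglongrightarrow> (LINT x|lborel. D x e)" by (simp add: q0)
  then show ?thesis by (simp add: LIMSEQ_const_iff)
qed

section \<open>The fundamental lemma of the calculus of variations\<close>

text \<open>
  As \<open>n\<close> tends to infinity, this tends to the indicator function of the open box from \<open>a\<close> to \<open>b\<close>.
\<close>

definition box_bump :: "'a::euclidean_space \<Rightarrow> 'a \<Rightarrow> nat \<Rightarrow> 'a \<Rightarrow> real"
  where "box_bump a b n x =
    (\<Prod>i\<in>Basis. flat 0 (x \<bullet> (real n *\<^sub>R i) - real n * (a \<bullet> i)) * flat 0 (x \<bullet> (- real n *\<^sub>R i) - - (real n * (b \<bullet> i))))"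

lemma smooth_expr_prod:
  "finite I \<Longrightarrow> (\<And>i. i \<in> I \<Longrightarrow> smooth_expr (f i)) \<Longrightarrow> smooth_expr (\<lambda>x. \<Prod>i\<in>I. f i x)"
  by (induction I rule: finite_induct) (auto intro: smooth_expr.intros)

lemma smooth_box_bump: "smooth_expr (box_bump a b n)"
  unfolding box_bump_def[abs_def]
  by (intro smooth_expr_prod smooth_expr.mult smooth_expr.flat) auto

lemma box_bump_bounds: "0 \<le> box_bump a b n x" "box_bump a b n x \<le> 1"
  unfolding box_bump_def
  by (auto intro!: prod_nonneg prod_le_1 mult_nonneg_nonneg mult_le_one flat_0_bounds)

lemma box_bump_0:
  assumes "x \<notin> box a b"
  shows "box_bump a b n x = 0"
proof -
  obtain i where i: "i \<in> Basis" "\<not> (a \<bullet> i < x \<bullet> i \<and> x \<bullet> i < b \<bullet> i)"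
    using assms by (auto simp: mem_box)
  then have "real n * (x \<bullet> i) \<le> real n * (a \<bullet> i) \<or> real n * (b \<bullet> i) \<le> real n * (x \<bullet> i)"
    by (auto simp: not_less intro: mult_left_mono)
  then have "flat 0 (x \<bullet> (real n *\<^sub>R i) - real n * (a \<bullet> i)) * flat 0 (x \<bullet> (- real n *\<^sub>R i) - - (real n * (b \<bullet> i))) = 0"
    by (auto simp: flat_def)
  then show ?thesis
    unfolding box_bump_def using i(1) by (intro prod_zero) auto
qed

lemma flat_scaled_tendsto_1:
  assumes "s > 0"
  shows "(\<lambda>n. flat 0 (real n * s)) \<longlonglongrightarrow> 1"
proof (rule Lim_transform_eventually)
  have "(\<lambda>n. exp (- (1 / s) * (1 / real n))) \<longlonglongrightarrow> exp (- (1 / s) * 0)"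
    by (intro tendsto_intros lim_1_over_n)
  then show "(\<lambda>n. exp (- (1 / s) * (1 / real n))) \<longlonglongrightarrow> 1" by simp
  show "\<forall>\<^sub>F n in sequentially. exp (- (1 / s) * (1 / real n)) = flat 0 (real n * s)"
    using eventually_gt_at_top[of 0] by eventually_elim (use assms in \<open>simp add: flat_def field_simps\<close>)
qed

lemma box_bump_tendsto_1:
  assumes "x \<in> box a b"
  shows "(\<lambda>n. box_bump a b n x) \<longlonglongrightarrow> 1"
proof -
  have "(\<lambda>n. box_bump a b n x) \<longlonglongrightarrow> (\<Prod>i\<in>(Basis :: 'a set). 1 * 1)"
    unfolding box_bump_def
  proof (intro tendsto_prod tendsto_mult)
    fix i :: 'a assume i: "i \<in> Basis"
    have "(\<lambda>n. flat 0 (real n * (x \<bullet> i - a \<bullet> i))) \<longlonglongrightarrow> 1" "(\<lambda>n. flat 0 (real n * (b \<bullet> i - x \<bullet> i))) \<longlonglongrightarrow> 1"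
      using assms i by (auto intro!: flat_scaled_tendsto_1 simp: mem_box)
    then show "(\<lambda>n. flat 0 (x \<bullet> (real n *\<^sub>R i) - real n * (a \<bullet> i))) \<longlonglongrightarrow> 1"
      "(\<lambda>n. flat 0 (x \<bullet> (- real n *\<^sub>R i) - - (real n * (b \<bullet> i)))) \<longlonglongrightarrow> 1"
      by (simp_all add: algebra_simps)
  qed
  then show ?thesis by simp
qed

text \<open>
  Cover the open set by boxes. One minus the product of one minus their bumps is a test
  function that exhausts the union.
\<close>

lemma test_functions_approx_open:
  fixes U :: "'a::euclidean_space set"
  assumes "open U"
  obtains \<phi> where "\<And>n::nat. \<phi> n \<in> test_functions U" "\<And>n x. 0 \<le> \<phi> n x \<and> \<phi> n x \<le> 1"
    "AE x in lebesgue. (\<lambda>n. \<phi> n x) \<longlonglongrightarrow> indicator U x"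
proof (cases "U = {}")
  case True
  have "0 \<in> test_functions U" by (rule subspace_0[OF subspace_test_functions])
  then show thesis using True by (intro that[of "\<lambda>_. 0"]) auto
next
  case False
  obtain D where D: "countable D" "D \<subseteq> Pow U" "\<And>X. X \<in> D \<Longrightarrow> \<exists>a b. X = cbox a b" "\<Union>D = U"
    using open_countable_Union_open_cbox[OF assms] by metis
  have "D \<noteq> {}" using D(4) False by auto
  have "\<exists>p. X = cbox (fst p) (snd p)" if "X \<in> D" for X
    using D(3)[OF that] by auto
  then have "\<forall>n. \<exists>p. from_nat_into D n = cbox (fst p) (snd p)"
    using from_nat_into[OF \<open>D \<noteq> {}\<close>] by blast
  then obtain p where p: "\<And>n. from_nat_into D n = cbox (fst (p n)) (snd (p n))" by metis
  define a b where "a n = fst (p n)" and "b n = snd (p n)" for n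
  have U: "U = (\<Union>n. cbox (a n) (b n))"
    unfolding a_def b_def p[symmetric]
    using D(4) range_from_nat_into[OF \<open>D \<noteq> {}\<close> D(1)] by simp
  define \<beta> where "\<beta> k n x = box_bump (a k) (b k) n x" for k n x
  define \<phi> where "\<phi> n x = 1 + (- 1) * (\<Prod>k<n. 1 + (- 1) * \<beta> k n x)" for n x
  have fac: "0 \<le> 1 + (- 1) * \<beta> k n x" "1 + (- 1) * \<beta> k n x \<le> 1" for k n x
    using box_bump_bounds[of "a k" "b k" n x] by (auto simp: \<beta>_def)
  have bounds: "0 \<le> \<phi> n x \<and> \<phi> n x \<le> 1" for n x
  proof -
    have "0 \<le> (\<Prod>k<n. 1 + (- 1) * \<beta> k n x)" by (intro prod_nonneg ballI fac)
    moreover have "(\<Prod>k<n. 1 + (- 1) * \<beta> k n x) \<le> 1" by (intro prod_le_1 conjI fac)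
    ultimately show ?thesis unfolding \<phi>_def by linarith
  qed
  have outside: "\<phi> n x = 0" if "x \<notin> (\<Union>k<n. cbox (a k) (b k))" for n x
  proof -
    have "\<beta> k n x = 0" if "k < n" for k
      unfolding \<beta>_def using \<open>x \<notin> _\<close> that box_subset_cbox[of "a k" "b k"] by (intro box_bump_0) blast
    then show ?thesis by (simp add: \<phi>_def)
  qed
  show thesis
  proof (rule that[of \<phi>])
    show "\<phi> n \<in> test_functions U" for n
    proof (rule smooth_expr_test_function[of _ "\<Union>k<n. cbox (a k) (b k)"])
      show "smooth_expr (\<phi> n)"
        unfolding \<phi>_def[abs_def] \<beta>_def
        by (intro smooth_expr.add smooth_expr.mult smooth_expr.const smooth_expr_prod smooth_box_bump) auto
      show "compact (\<Union>k<n. cbox (a k) (b k))" by (intro compact_UN) auto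
      show "(\<Union>k<n. cbox (a k) (b k)) \<subseteq> U" using U by auto
    qed (rule outside)
    show "0 \<le> \<phi> n x \<and> \<phi> n x \<le> 1" for n x by (rule bounds)
    have "negligible (\<Union>k. cbox (a k) (b k) - box (a k) (b k))"
      by (intro negligible_countable_Union) (auto simp: negligible_frontier_interval)
    then have "(\<Union>k. cbox (a k) (b k) - box (a k) (b k)) \<in> null_sets lebesgue"
      by (simp add: negligible_iff_null_sets)
    then show "AE x in lebesgue. (\<lambda>n. \<phi> n x) \<longlonglongrightarrow> indicator U x"
    proof (rule AE_I')
      show "{x \<in> space lebesgue. \<not> (\<lambda>n. \<phi> n x) \<longlonglongrightarrow> indicator U x}
        \<subseteq> (\<Union>k. cbox (a k) (b k) - box (a k) (b k))"
      proof (rule subsetI, rule ccontr)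
        fix x assume x: "x \<in> {x \<in> space lebesgue. \<not> (\<lambda>n. \<phi> n x) \<longlonglongrightarrow> indicator U x}"
          "x \<notin> (\<Union>k. cbox (a k) (b k) - box (a k) (b k))"
        have "(\<lambda>n. \<phi> n x) \<longlonglongrightarrow> indicator U x"
        proof (cases "x \<in> U")
          case False
          then have "\<phi> n x = 0" for n using U by (intro outside) auto
          then show ?thesis using False by simp
        next
          case True
          then obtain k where k: "x \<in> box (a k) (b k)" using x(2) U by blast
          have ge: "\<beta> k n x \<le> \<phi> n x" if "n > k" for n
          proof -
            have "(\<Prod>k<n. 1 + (- 1) * \<beta> k n x) =
                (1 + (- 1) * \<beta> k n x) * (\<Prod>j\<in>{..<n} - {k}. 1 + (- 1) * \<beta> j n x)"
              using that by (intro prod.remove) auto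
            also have "\<dots> \<le> (1 + (- 1) * \<beta> k n x) * 1"
              by (intro mult_left_mono prod_le_1 conjI fac)
            finally show ?thesis by (simp add: \<phi>_def)
          qed
          have "(\<lambda>n. \<phi> n x) \<longlonglongrightarrow> 1"
          proof (rule tendsto_sandwich[OF _ _ _ tendsto_const])
            show "(\<lambda>n. \<beta> k n x) \<longlonglongrightarrow> 1" unfolding \<beta>_def by (rule box_bump_tendsto_1[OF k])
            show "\<forall>\<^sub>F n in sequentially. \<beta> k n x \<le> \<phi> n x"
              using eventually_gt_at_top[of k] by eventually_elim (rule ge)
          qed (use bounds in auto)
          then show ?thesis using True by simp
        qed
        then show False using x(1) by simp
      qed
    qed
  qed
qed

lemma borel_measurable_test_function:
  assumes "\<phi> \<in> test_functions U"
  shows "\<phi> \<in> borel_measurable lebesgue" "\<phi> \<in> borel_measurable (lebesgue_on S)"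
proof -
  have "\<phi> \<in> borel_measurable lborel"
    using test_function_props(1)[OF assms] by (simp add: borel_measurable_continuous_onI)
  then show "\<phi> \<in> borel_measurable lebesgue" by (rule measurable_completion)
  then show "\<phi> \<in> borel_measurable (lebesgue_on S)" by (rule measurable_restrict_space1)
qed

lemma AE_lebesgue_on_mono:
  assumes "S \<in> sets lebesgue" "AE x in lebesgue. P x"
  shows "AE x in lebesgue_on S. P x"
  using assms by (simp add: AE_restrict_space_iff) (metis (mono_tags, lifting) AE_mp AE_I2)

text \<open>
  The integral of \<open>g\<close> vanishes over open sets, which test functions approximate, hence over their
  decreasing intersections, hence over measurable sets, in particular where \<open>g\<close> has a given sign.
\<close>

lemma fundamental_lemma:
  fixes g :: "'a::euclidean_space \<Rightarrow> real"
  assumes \<Omega>: "open \<Omega>" and g: "integrable (lebesgue_on \<Omega>) g"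
    and orth: "\<And>\<phi>. \<phi> \<in> test_functions \<Omega> \<Longrightarrow> (LINT x|lebesgue_on \<Omega>. g x * \<phi> x) = 0"
  shows "AE x in lebesgue_on \<Omega>. g x = 0"
proof -
  let ?M = "lebesgue_on \<Omega>"
  have S: "\<Omega> \<in> sets lebesgue" using \<Omega> by auto
  have gm: "g \<in> borel_measurable ?M" using g by auto
  have open_0: "(LINT x|?M. g x * indicator U x) = 0" if U: "open U" for U
  proof -
    obtain \<phi> where \<phi>: "\<And>n::nat. \<phi> n \<in> test_functions (U \<inter> \<Omega>)" "\<And>n x. 0 \<le> \<phi> n x \<and> \<phi> n x \<le> 1"
      "AE x in lebesgue. (\<lambda>n. \<phi> n x) \<longlonglongrightarrow> indicator (U \<inter> \<Omega>) x"
      using test_functions_approx_open[OF open_Int[OF U \<Omega>]] by blast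
    have "\<phi> n \<in> test_functions \<Omega>" for n
      using \<phi>(1)[of n] by (auto simp: test_functions_def)
    then have z: "(LINT x|?M. g x * \<phi> n x) = 0" for n by (rule orth)
    have "(\<lambda>n. LINT x|?M. g x * \<phi> n x) \<longlonglongrightarrow> (LINT x|?M. g x * indicator U x)"
    proof (rule integral_dominated_convergence[where w = "\<lambda>x. \<bar>g x\<bar>"])
      show "(\<lambda>x. g x * indicator U x) \<in> borel_measurable ?M"
        using U by (intro borel_measurable_times[OF gm] measurable_restrict_space1[OF borel_measurable_indicator]) auto
      show "(\<lambda>x. g x * \<phi> n x) \<in> borel_measurable ?M" for n
        using gm borel_measurable_test_function[OF \<phi>(1)] by (intro borel_measurable_times)
      show "AE x in ?M. (\<lambda>n. g x * \<phi> n x) \<longlonglongrightarrow> g x * indicator U x"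
        using AE_lebesgue_on_mono[OF S \<phi>(3)] AE_space
        by eventually_elim (intro tendsto_mult tendsto_const, auto simp: indicator_def)
      show "AE x in ?M. norm (g x * \<phi> n x) \<le> \<bar>g x\<bar>" for n
        using \<phi>(2) by (intro AE_I2) (simp add: abs_mult mult_left_le)
    qed (use g in auto)
    then show ?thesis by (simp add: z LIMSEQ_const_iff)
  qed
  have set_0: "(LINT x|?M. g x * indicator A x) = 0" if A: "A \<in> sets lebesgue" for A
  proof -
    obtain C N where C: "gdelta C" "N \<in> null_sets lebesgue" "A \<union> N = C"
      using lebesgue_set_almost_gdelta[OF A] by metis
    then obtain G where G: "\<And>n::nat. open (G n)" "C = (\<Inter>n. G n)" by (metis gdelta.cases)
    define O' where "O' n = (\<Inter>k\<le>n. G k)" for n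
    have O': "open (O' n)" "A \<subseteq> O' n" for n using G C(3) by (auto simp: O'_def)
    have dec: "decseq O'" by (force simp: O'_def decseq_def)
    have "(\<Inter>n. O' n) = C" using G(2) by (force simp: O'_def)
    then have sub: "(\<Inter>n. O' n) - A \<subseteq> N" using C(3) by blast
    have ae: "AE x in lebesgue. x \<notin> (\<Inter>n. O' n) - A"
      by (rule eventually_mono[OF AE_not_in[OF C(2)]]) (use sub in blast)
    have "(\<lambda>n. LINT x|?M. g x * indicator (O' n) x) \<longlonglongrightarrow> (LINT x|?M. g x * indicator A x)"
    proof (rule integral_dominated_convergence[where w = "\<lambda>x. \<bar>g x\<bar>"])
      show "(\<lambda>x. g x * indicator A x) \<in> borel_measurable ?M"
        by (intro borel_measurable_times[OF gm] measurable_restrict_space1[OF borel_measurable_indicator[OF A]])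
      show "(\<lambda>x. g x * indicator (O' n) x) \<in> borel_measurable ?M" for n
        using O'(1)[of n] by (intro borel_measurable_times[OF gm] measurable_restrict_space1[OF borel_measurable_indicator]) auto
      show "AE x in ?M. (\<lambda>n. g x * indicator (O' n) x) \<longlonglongrightarrow> g x * indicator A x"
        using AE_lebesgue_on_mono[OF S ae]
      proof eventually_elim
        fix x assume x: "x \<notin> (\<Inter>n. O' n) - A"
        have "(\<lambda>n. indicator (O' n) x :: real) \<longlonglongrightarrow> indicator (\<Inter>n. O' n) x"
          by (rule LIMSEQ_indicator_decseq[OF dec])
        also have "indicator (\<Inter>n. O' n) x = (indicator A x :: real)"
          using x O'(2) by (auto simp: indicator_def)
        finally show "(\<lambda>n. g x * indicator (O' n) x) \<longlonglongrightarrow> g x * indicator A x"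
          by (intro tendsto_mult tendsto_const)
      qed
      show "AE x in ?M. norm (g x * indicator (O' n) x) \<le> \<bar>g x\<bar>" for n
        by (intro AE_I2) (simp add: abs_mult indicator_def)
    qed (use g in auto)
    then show ?thesis by (simp add: open_0 O' LIMSEQ_const_iff)
  qed
  have sign: "AE x in ?M. s * g x \<le> 0" for s
  proof -
    define A where "A = {x \<in> space ?M. 0 \<le> s * g x}"
    have A: "A \<in> sets ?M" unfolding A_def using gm by measurable
    then have A': "A \<in> sets lebesgue" using S by (simp add: sets_restrict_space_iff)
    have int: "integrable ?M (\<lambda>x. s * (g x * indicator A x))"
      using integrable_mult_indicator[OF A g] by (simp add: mult.commute)
    have "AE x in ?M. 0 \<le> s * (g x * indicator A x)"
      by (intro AE_I2) (auto simp: A_def indicator_def)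
    then have "AE x in ?M. s * (g x * indicator A x) = 0"
      using integral_nonneg_eq_0_iff_AE[OF int] set_0[OF A'] by simp
    then show ?thesis
      using AE_space by eventually_elim (auto simp: A_def indicator_def split: if_splits)
  qed
  show ?thesis using sign[of 1] sign[of "-1"] by eventually_elim simp
qed

section \<open>The space \<open>L\<^sup>2(\<Omega>)\<close>\<close>

lemma integral_le_of_AE_LIMSEQ:
  fixes h :: "nat \<Rightarrow> 'a \<Rightarrow> real"
  assumes h: "\<And>i. integrable M (h i)" "\<And>i. AE x in M. 0 \<le> h i x" "\<And>i. integral\<^sup>L M (h i) \<le> C"
    and lim: "AE x in M. (\<lambda>i. h i x) \<longlonglongrightarrow> g x" and g: "g \<in> borel_measurable M"
  shows "integrable M g" "integral\<^sup>L M g \<le> C"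
proof -
  have nn: "AE x in M. \<forall>i. 0 \<le> h i x" using h(2) by (simp add: AE_all_countable)
  have g0: "AE x in M. 0 \<le> g x"
    using nn lim by eventually_elim (auto intro: LIMSEQ_le_const)
  have C: "0 \<le> C" using h(3)[of 0] integral_nonneg_AE[OF h(2)[of 0]] by linarith
  have "(\<integral>\<^sup>+x. ennreal (g x) \<partial>M) = (\<integral>\<^sup>+x. liminf (\<lambda>i. ennreal (h i x)) \<partial>M)"
  proof (rule nn_integral_cong_AE, use lim in eventually_elim)
    fix x assume "(\<lambda>i. h i x) \<longlonglongrightarrow> g x"
    then have "(\<lambda>i. ennreal (h i x)) \<longlonglongrightarrow> ennreal (g x)" by (rule tendsto_ennrealI)
    then show "ennreal (g x) = liminf (\<lambda>i. ennreal (h i x))"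
      by (rule lim_imp_Liminf[OF sequentially_bot, symmetric])
  qed
  also have "\<dots> \<le> liminf (\<lambda>i. \<integral>\<^sup>+x. ennreal (h i x) \<partial>M)"
    using h(1) by (intro nn_integral_liminf) auto
  also have "\<dots> \<le> liminf (\<lambda>i. ennreal C)"
  proof (rule Liminf_mono, rule always_eventually, rule allI)
    fix i
    have "(\<integral>\<^sup>+x. ennreal (h i x) \<partial>M) = ennreal (integral\<^sup>L M (h i))"
      by (rule nn_integral_eq_integral[OF h(1,2)])
    then show "(\<integral>\<^sup>+x. ennreal (h i x) \<partial>M) \<le> ennreal C" using h(3) by (simp add: ennreal_leI)
  qed
  also have "\<dots> = ennreal C" by (simp add: Liminf_const)
  finally have le: "(\<integral>\<^sup>+x. ennreal (g x) \<partial>M) \<le> ennreal C" .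
  show i: "integrable M g"
    by (rule integrableI_nonneg[OF g g0]) (use le in \<open>simp add: le_less_trans\<close>)
  show "integral\<^sup>L M g \<le> C"
    using le nn_integral_eq_integral[OF i g0] C by simp
qed

lemma L2_iff:
  "f \<in> car (L2 \<Omega>) \<longleftrightarrow> f \<in> borel_measurable (lebesgue_on \<Omega>) \<and> integrable (lebesgue_on \<Omega>) (\<lambda>x. (norm (f x))\<^sup>2)"
  by (simp add: L2_def)

lemma L2_I:
  assumes "f \<in> borel_measurable (lebesgue_on \<Omega>)" "integrable (lebesgue_on \<Omega>) g"
    "AE x in lebesgue_on \<Omega>. (norm (f x))\<^sup>2 \<le> g x"
  shows "f \<in> car (L2 \<Omega>)"
  unfolding L2_iff
proof
  show "integrable (lebesgue_on \<Omega>) (\<lambda>x. (norm (f x))\<^sup>2)"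
    by (rule Bochner_Integration.integrable_bound[OF assms(2)]) (use assms in \<open>auto elim: eventually_mono\<close>)
qed fact

lemma L2_inner_integrable:
  assumes f: "f \<in> car (L2 \<Omega>)" and g: "g \<in> car (L2 \<Omega>)"
  shows "integrable (lebesgue_on \<Omega>) (\<lambda>x. f x \<bullet> g x)"
proof (rule Bochner_Integration.integrable_bound)
  show "integrable (lebesgue_on \<Omega>) (\<lambda>x. (norm (f x))\<^sup>2 + (norm (g x))\<^sup>2)"
    using f g by (auto simp: L2_iff)
  show "(\<lambda>x. f x \<bullet> g x) \<in> borel_measurable (lebesgue_on \<Omega>)"
    using f g by (auto simp: L2_iff)
  show "AE x in lebesgue_on \<Omega>. norm (f x \<bullet> g x) \<le> norm ((norm (f x))\<^sup>2 + (norm (g x))\<^sup>2)"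
  proof (rule AE_I2)
    fix x
    have "norm (f x \<bullet> g x) \<le> norm (f x) * norm (g x)"
      using Cauchy_Schwarz_ineq2[of "f x" "g x"] by simp
    also have "\<dots> \<le> (norm (f x))\<^sup>2 + (norm (g x))\<^sup>2"
      using sum_squares_bound[of "norm (f x)" "norm (g x)"]
        mult_nonneg_nonneg[OF norm_ge_zero[of "f x"] norm_ge_zero[of "g x"]] by linarith
    finally show "norm (f x \<bullet> g x) \<le> norm ((norm (f x))\<^sup>2 + (norm (g x))\<^sup>2)" by simp
  qed
qed

lemma L2_inner_cong_AE:
  assumes "f \<in> car (L2 \<Omega>)" "g \<in> car (L2 \<Omega>)" "f' \<in> car (L2 \<Omega>)" "g' \<in> car (L2 \<Omega>)"
    "AE x in lebesgue_on \<Omega>. f x = f' x" "AE x in lebesgue_on \<Omega>. g x = g' x"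
  shows "L2_inner \<Omega> f g = L2_inner \<Omega> f' g'"
  unfolding L2_inner_def
proof (rule Bochner_Integration.integral_cong_AE)
  show "AE x in lebesgue_on \<Omega>. f x \<bullet> g x = f' x \<bullet> g' x"
    using assms(5,6) by eventually_elim simp
qed (use L2_inner_integrable assms in blast)+

lemma semi_inner_sp_L2: "semi_inner_sp (L2 \<Omega> :: ('a::euclidean_space \<Rightarrow> 'b::euclidean_space) normed_sp) (L2_inner \<Omega>)"
proof
  show "subspace (car (L2 \<Omega> :: ('a \<Rightarrow> 'b) normed_sp))"
  proof (rule subspaceI)
    show "(0 :: 'a \<Rightarrow> 'b) \<in> car (L2 \<Omega>)" by (simp add: L2_iff zero_fun_def)
  next
    fix f g :: "'a \<Rightarrow> 'b" assume fg: "f \<in> car (L2 \<Omega>)" "g \<in> car (L2 \<Omega>)"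
    show "f + g \<in> car (L2 \<Omega>)"
    proof (rule L2_I)
      show "f + g \<in> borel_measurable (lebesgue_on \<Omega>)" using fg by (auto simp: L2_iff plus_fun_def)
      show "integrable (lebesgue_on \<Omega>) (\<lambda>x. 2 * (norm (f x))\<^sup>2 + 2 * (norm (g x))\<^sup>2)"
        using fg by (auto simp: L2_iff)
      show "AE x in lebesgue_on \<Omega>. (norm ((f + g) x))\<^sup>2 \<le> 2 * (norm (f x))\<^sup>2 + 2 * (norm (g x))\<^sup>2"
      proof (rule AE_I2)
        fix x
        have "(norm (f x + g x))\<^sup>2 \<le> (norm (f x) + norm (g x))\<^sup>2"
          by (intro power_mono norm_triangle_ineq) auto
        then show "(norm ((f + g) x))\<^sup>2 \<le> 2 * (norm (f x))\<^sup>2 + 2 * (norm (g x))\<^sup>2"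
          using sum_squares_bound[of "norm (f x)" "norm (g x)"] by (simp add: power2_sum)
      qed
    qed
  next
    fix c and f :: "'a \<Rightarrow> 'b" assume f: "f \<in> car (L2 \<Omega>)"
    then show "c *\<^sub>R f \<in> car (L2 \<Omega>)" by (auto simp: L2_iff scaleR_fun_def power_mult_distrib)
  qed
next
  fix g :: "'a \<Rightarrow> 'b" assume g: "g \<in> car (L2 \<Omega>)"
  show "lin_on (car (L2 \<Omega>)) (\<lambda>f. L2_inner \<Omega> f g)"
    by (rule lin_onI)
       (simp_all add: L2_inner_def inner_add_left scaleR_fun_def L2_inner_integrable[OF _ g])
next
  fix f g :: "'a \<Rightarrow> 'b"
  show "L2_inner \<Omega> f g = L2_inner \<Omega> g f" by (simp add: L2_inner_def inner_commute)
next
  fix f :: "'a \<Rightarrow> 'b"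
  show "0 \<le> L2_inner \<Omega> f f" by (simp add: L2_inner_def)
next
  fix f :: "'a \<Rightarrow> 'b"
  show "nrm (L2 \<Omega>) f = sqrt (L2_inner \<Omega> f f)" by (simp add: L2_def)
qed

interpretation L2: semi_inner_sp "L2 \<Omega> :: ('a::euclidean_space \<Rightarrow> 'b::euclidean_space) normed_sp" "L2_inner \<Omega>" for \<Omega>
  by (rule semi_inner_sp_L2)

lemma L2_inner_self: "L2_inner \<Omega> f f = (LINT x|lebesgue_on \<Omega>. (norm (f x))\<^sup>2)"
  by (simp add: L2_inner_def power2_norm_eq_inner)

lemma L2_integrable_norm:
  fixes f :: "'a::euclidean_space \<Rightarrow> 'b::euclidean_space"
  assumes \<Omega>: "\<Omega> \<in> lmeasurable" and f: "f \<in> car (L2 \<Omega>)"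
  shows "integrable (lebesgue_on \<Omega>) (\<lambda>x. norm (f x))"
    and "(LINT x|lebesgue_on \<Omega>. norm (f x)) \<le> sqrt (measure lebesgue \<Omega>) * sqrt (L2_inner \<Omega> f f)"
proof -
  interpret finite_measure "lebesgue_on \<Omega>" by (rule finite_measure_lebesgue_on[OF \<Omega>])
  have 1: "(\<lambda>x. 1 :: real) \<in> car (L2 \<Omega>)" by (simp add: L2_iff)
  have n: "(\<lambda>x. norm (f x)) \<in> car (L2 \<Omega>)" using f by (auto simp: L2_iff)
  show "integrable (lebesgue_on \<Omega>) (\<lambda>x. norm (f x))"
    using L2_inner_integrable[OF 1 n] by simp
  have "measure (lebesgue_on \<Omega>) (space (lebesgue_on \<Omega>)) = measure lebesgue \<Omega>"
    using \<Omega> by (simp add: measure_restrict_space fmeasurable_def)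
  then have 11: "L2_inner \<Omega> (\<lambda>x. 1 :: real) (\<lambda>x. 1) = measure lebesgue \<Omega>"
    by (simp add: L2_inner_def)
  have nn: "L2_inner \<Omega> (\<lambda>x. norm (f x)) (\<lambda>x. norm (f x)) = L2_inner \<Omega> f f"
    by (simp add: L2_inner_self)
  show "(LINT x|lebesgue_on \<Omega>. norm (f x)) \<le> sqrt (measure lebesgue \<Omega>) * sqrt (L2_inner \<Omega> f f)"
    using L2.cauchy_schwarz[OF 1 n] unfolding 11 nn by (simp add: L2_inner_def)
qed

text \<open>Riesz--Fischer: a subsequence converges almost everywhere, and Fatou's lemma does the rest.\<close>

lemma L2_complete:
  fixes f :: "nat \<Rightarrow> 'a::euclidean_space \<Rightarrow> 'b::euclidean_space"
  assumes \<Omega>: "\<Omega> \<in> lmeasurable" and f: "\<And>n. f n \<in> car (L2 \<Omega>)"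
    and cauchy: "\<And>e. e > 0 \<Longrightarrow> \<exists>N. \<forall>m\<ge>N. \<forall>n\<ge>N. L2_inner \<Omega> (f m - f n) (f m - f n) < e"
  obtains g where "g \<in> car (L2 \<Omega>)" "(\<lambda>n. L2_inner \<Omega> (f n - g) (f n - g)) \<longlonglongrightarrow> 0"
proof -
  let ?M = "lebesgue_on \<Omega>"
  have fm: "f n \<in> borel_measurable ?M" for n using f by (simp add: L2_iff)
  have d: "f m - f n \<in> car (L2 \<Omega>)" for m n by (rule L2.mem_diff[OF f f])
  interpret finite_measure ?M by (rule finite_measure_lebesgue_on[OF \<Omega>])
  have int: "integrable ?M (f n)" for n
    using L2_integrable_norm(1)[OF \<Omega> f] fm by (simp add: integrable_norm_iff)
  have L1: "\<exists>N. \<forall>i\<ge>N. \<forall>j\<ge>N. (LINT x|?M. norm (f i x - f j x)) < e" if e: "e > 0" for e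
  proof -
    define K where "K = sqrt (measure lebesgue \<Omega>) + 1"
    have K: "K > 0" unfolding K_def by (smt (verit) measure_nonneg real_sqrt_ge_zero)
    obtain N where N: "\<And>m n. m \<ge> N \<Longrightarrow> n \<ge> N \<Longrightarrow> L2_inner \<Omega> (f m - f n) (f m - f n) < (e / K)\<^sup>2"
      using cauchy[of "(e / K)\<^sup>2"] e K by auto
    have "(LINT x|?M. norm (f i x - f j x)) < e" if "i \<ge> N" "j \<ge> N" for i j
    proof -
      have "(LINT x|?M. norm (f i x - f j x)) \<le> sqrt (measure lebesgue \<Omega>) * sqrt (L2_inner \<Omega> (f i - f j) (f i - f j))"
        using L2_integrable_norm(2)[OF \<Omega> d[of i j]] by simp
      also have "\<dots> \<le> sqrt (measure lebesgue \<Omega>) * (e / K)"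
        using N[OF that] e K by (intro mult_left_mono real_le_lsqrt) auto
      also have "\<dots> < K * (e / K)" using e K by (intro mult_strict_right_mono) (auto simp: K_def)
      finally show ?thesis using K by simp
    qed
    then show ?thesis by blast
  qed
  obtain r where r: "strict_mono r" "AE x in ?M. Cauchy (\<lambda>i. f (r i) x)"
    using cauchy_L1_AE_cauchy_subseq[OF int L1] by blast
  define g where "g x = lim (\<lambda>i. f (r i) x)" for x
  have gm: "g \<in> borel_measurable ?M" unfolding g_def[abs_def] by (rule borel_measurable_lim_metric[OF fm])
  have conv: "AE x in ?M. (\<lambda>i. f (r i) x) \<longlonglongrightarrow> g x"
    using r(2) by eventually_elim (simp add: g_def Cauchy_convergent_iff convergent_LIMSEQ_iff)
  have fatou: "integrable ?M (\<lambda>x. (norm (f n x - g x))\<^sup>2)"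
      "(LINT x|?M. (norm (f n x - g x))\<^sup>2) \<le> e"
    if N: "\<And>m. m \<ge> N \<Longrightarrow> L2_inner \<Omega> (f n - f m) (f n - f m) < e" for n N e
  proof -
    have a: "integrable ?M (\<lambda>x. (norm (f n x - f (r (i + N)) x))\<^sup>2)" for i
      using d[of n "r (i + N)"] by (simp add: L2_iff)
    have b: "(LINT x|?M. (norm (f n x - f (r (i + N)) x))\<^sup>2) \<le> e" for i
      using N[of "r (i + N)"] seq_suble[OF r(1), of "i + N"] by (simp add: L2_inner_self)
    have c: "AE x in ?M. (\<lambda>i. (norm (f n x - f (r (i + N)) x))\<^sup>2) \<longlonglongrightarrow> (norm (f n x - g x))\<^sup>2"
      using conv
    proof eventually_elim
      fix x assume "(\<lambda>i. f (r i) x) \<longlonglongrightarrow> g x"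
      then have "(\<lambda>i. f (r (i + N)) x) \<longlonglongrightarrow> g x" by (rule LIMSEQ_ignore_initial_segment)
      then show "(\<lambda>i. (norm (f n x - f (r (i + N)) x))\<^sup>2) \<longlonglongrightarrow> (norm (f n x - g x))\<^sup>2"
        by (intro tendsto_intros)
    qed
    have m: "(\<lambda>x. (norm (f n x - g x))\<^sup>2) \<in> borel_measurable ?M" using fm gm by measurable
    show "integrable ?M (\<lambda>x. (norm (f n x - g x))\<^sup>2)"
      by (rule integral_le_of_AE_LIMSEQ(1)[OF a _ b c m]) auto
    show "(LINT x|?M. (norm (f n x - g x))\<^sup>2) \<le> e"
      by (rule integral_le_of_AE_LIMSEQ(2)[OF a _ b c m]) auto
  qed
  have diff: "f n - g \<in> car (L2 \<Omega>)"
    if N: "\<And>m. m \<ge> N \<Longrightarrow> L2_inner \<Omega> (f n - f m) (f n - f m) < 1" for n N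
    using fatou(1)[OF N] fm gm by (auto simp: L2_iff fun_diff_def)
  obtain N where N: "\<And>m n. m \<ge> N \<Longrightarrow> n \<ge> N \<Longrightarrow> L2_inner \<Omega> (f m - f n) (f m - f n) < 1"
    using cauchy[of 1] by auto
  have "f N - (f N - g) \<in> car (L2 \<Omega>)" by (intro L2.mem_diff f diff[of N N] N) auto
  then have g: "g \<in> car (L2 \<Omega>)" by simp
  have "(\<lambda>n. L2_inner \<Omega> (f n - g) (f n - g)) \<longlonglongrightarrow> 0"
  proof (rule LIMSEQ_I)
    fix e :: real assume e: "e > 0"
    obtain N where N: "\<And>m n. m \<ge> N \<Longrightarrow> n \<ge> N \<Longrightarrow> L2_inner \<Omega> (f m - f n) (f m - f n) < e / 2"
      using cauchy[of "e / 2"] e by auto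
    have "norm (L2_inner \<Omega> (f n - g) (f n - g) - 0) < e" if "n \<ge> N" for n
      using fatou(2)[where N = N, OF N[OF that]] L2.ip_nonneg[OF L2.mem_diff[OF f g]] e by (simp add: L2_inner_self)
    then show "\<exists>N. \<forall>n\<ge>N. norm (L2_inner \<Omega> (f n - g) (f n - g) - 0) < e" by blast
  qed
  then show thesis using that g by blast
qed

lemma L2_of_compact_support:
  fixes h :: "'a::euclidean_space \<Rightarrow> real"
  assumes h: "continuous_on UNIV h" and K: "compact K" "\<And>x. x \<notin> K \<Longrightarrow> h x = 0"
    and S: "\<Omega> \<in> sets lebesgue"
  shows "h \<in> car (L2 \<Omega>)"
proof -
  have c: "continuous_on UNIV (\<lambda>x. (norm (h x))\<^sup>2)" by (intro continuous_intros h)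
  have "integrable lborel (\<lambda>x. (norm (h x))\<^sup>2)"
    by (rule integrable_of_compact_support[OF c K(1)]) (use K in auto)
  moreover have "(\<lambda>x. (norm (h x))\<^sup>2) \<in> borel_measurable lborel"
    using borel_measurable_continuous_onI[OF c] by simp
  ultimately have "integrable lebesgue (\<lambda>x. (norm (h x))\<^sup>2)"
    using integrable_completion[of "\<lambda>x. (norm (h x))\<^sup>2" lborel] by blast
  then have "integrable lebesgue (\<lambda>x. indicator \<Omega> x *\<^sub>R (norm (h x))\<^sup>2)"
    by (rule integrable_mult_indicator[OF S])
  then have "integrable (lebesgue_on \<Omega>) (\<lambda>x. (norm (h x))\<^sup>2)"
    using S by (subst integrable_restrict_space) auto
  moreover have "h \<in> borel_measurable (lebesgue_on \<Omega>)"
    using borel_measurable_continuous_onI[OF h]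
    by (intro measurable_restrict_space1 measurable_completion) simp
  ultimately show ?thesis by (simp add: L2_iff)
qed

lemma test_function_L2:
  assumes "\<phi> \<in> test_functions U" "\<Omega> \<in> sets lebesgue"
  shows "\<phi> \<in> car (L2 \<Omega>)"
  using test_function_props[OF assms(1)] by (intro L2_of_compact_support[OF _ _ _ assms(2)])

lemma test_function_derivative_L2:
  assumes "\<phi> \<in> test_functions U" "\<Omega> \<in> sets lebesgue" "e \<in> Basis"
  shows "(\<lambda>x. frechet_derivative \<phi> (at x) e) \<in> car (L2 \<Omega>)"
  using test_function_props[OF assms(1)] assms(3) by (intro L2_of_compact_support[OF _ _ _ assms(2)])

lemma L2_eq_0_of_orthogonal:
  fixes f :: "'a::euclidean_space \<Rightarrow> real"
  assumes \<Omega>: "open \<Omega>" "\<Omega> \<in> lmeasurable" and f: "f \<in> car (L2 \<Omega>)"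
    and orth: "\<And>\<phi>. \<phi> \<in> test_functions \<Omega> \<Longrightarrow> L2_inner \<Omega> f \<phi> = 0"
  shows "AE x in lebesgue_on \<Omega>. f x = 0"
proof (rule fundamental_lemma[OF \<Omega>(1)])
  have "f \<in> borel_measurable (lebesgue_on \<Omega>)" using f by (simp add: L2_iff)
  then show "integrable (lebesgue_on \<Omega>) f"
    using L2_integrable_norm(1)[OF \<Omega>(2) f] by (simp only: integrable_norm_iff)
qed (use orth in \<open>simp add: L2_inner_def\<close>)

lemma L2_limit_inner:
  fixes f :: "nat \<Rightarrow> 'a::euclidean_space \<Rightarrow> 'b::euclidean_space"
  assumes "\<And>n. f n \<in> car (L2 \<Omega>)" "g \<in> car (L2 \<Omega>)" "h \<in> car (L2 \<Omega>)"
    "(\<lambda>n. L2_inner \<Omega> (f n - g) (f n - g)) \<longlonglongrightarrow> 0"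
  shows "(\<lambda>n. L2_inner \<Omega> (f n) h) \<longlonglongrightarrow> L2_inner \<Omega> g h"
proof -
  have "(\<lambda>n. sqrt (L2_inner \<Omega> (f n - g) (f n - g)) * sqrt (L2_inner \<Omega> h h)) \<longlonglongrightarrow> sqrt 0 * sqrt (L2_inner \<Omega> h h)"
    by (intro tendsto_intros assms)
  then have lim: "(\<lambda>n. sqrt (L2_inner \<Omega> (f n - g) (f n - g)) * sqrt (L2_inner \<Omega> h h)) \<longlonglongrightarrow> 0" by simp
  have le: "\<bar>L2_inner \<Omega> (f n) h - L2_inner \<Omega> g h\<bar> \<le> sqrt (L2_inner \<Omega> (f n - g) (f n - g)) * sqrt (L2_inner \<Omega> h h)" for n
    using L2.cauchy_schwarz[OF L2.mem_diff[OF assms(1)[of n] assms(2)] assms(3)] L2.ip_diff_left[OF assms(1)[of n] assms(2,3)]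
    by simp
  have "(\<lambda>n. \<bar>L2_inner \<Omega> (f n) h - L2_inner \<Omega> g h\<bar>) \<longlonglongrightarrow> 0"
    by (rule tendsto_sandwich[OF always_eventually always_eventually tendsto_const lim]) (use le in auto)
  then show ?thesis using LIM_zero_iff tendsto_rabs_zero_iff by blast
qed

text \<open>
  Represent the inner product with \<open>f\<close> approximately by test functions. Their limit has the same
  inner products with test functions as \<open>f\<close>, hence equals \<open>f\<close> by the fundamental lemma.
\<close>

lemma test_functions_dense_L2:
  fixes f :: "'a::euclidean_space \<Rightarrow> real"
  assumes \<Omega>: "open \<Omega>" "\<Omega> \<in> lmeasurable" and f: "f \<in> car (L2 \<Omega>)" and d: "d > 0"
  obtains \<phi> where "\<phi> \<in> test_functions \<Omega>" "L2_inner \<Omega> (f - \<phi>) (f - \<phi>) < d"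
proof -
  have S: "\<Omega> \<in> sets lebesgue" using \<Omega> by auto
  have tf: "\<phi> \<in> car (L2 \<Omega>)" if "\<phi> \<in> test_functions \<Omega>" for \<phi> :: "'a \<Rightarrow> real"
    by (rule test_function_L2[OF that S])
  interpret V: semi_inner "test_functions \<Omega>" "L2_inner \<Omega>"
  proof
    show "subspace (test_functions \<Omega>)" by (rule subspace_test_functions)
    show "lin_on (test_functions \<Omega>) (\<lambda>x. L2_inner \<Omega> x y)" if "y \<in> test_functions \<Omega>" for y
      using L2.ip_lin[OF tf[OF that]] tf by (auto simp: lin_on_def)
  qed (use L2.ip_sym L2.ip_nonneg tf in blast)+
  have lin: "lin_on (test_functions \<Omega>) (L2_inner \<Omega> f)"
    using L2.ip_lin_right[OF f] tf by (auto simp: lin_on_def)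
  have bd: "\<bar>L2_inner \<Omega> f \<phi>\<bar> \<le> sqrt (L2_inner \<Omega> f f) * sqrt (L2_inner \<Omega> \<phi> \<phi>)"
    if "\<phi> \<in> test_functions \<Omega>" for \<phi>
    by (rule L2.cauchy_schwarz[OF f tf[OF that]])
  obtain v where v: "\<And>n::nat. v n \<in> test_functions \<Omega>"
    "\<And>e. e > 0 \<Longrightarrow> \<exists>N. \<forall>m\<ge>N. \<forall>n\<ge>N. L2_inner \<Omega> (v m - v n) (v m - v n) < e"
    "\<And>\<phi>. \<phi> \<in> test_functions \<Omega> \<Longrightarrow> (\<lambda>n. L2_inner \<Omega> (v n) \<phi>) \<longlonglongrightarrow> L2_inner \<Omega> f \<phi>"
    using V.approximate_riesz[OF lin bd] by blast
  obtain g where g: "g \<in> car (L2 \<Omega>)" "(\<lambda>n. L2_inner \<Omega> (v n - g) (v n - g)) \<longlonglongrightarrow> 0"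
    using L2_complete[OF \<Omega>(2) tf[OF v(1)] v(2)] by blast
  have fg: "f - g \<in> car (L2 \<Omega>)" by (rule L2.mem_diff[OF f g(1)])
  have "AE x in lebesgue_on \<Omega>. (f - g) x = 0"
  proof (rule L2_eq_0_of_orthogonal[OF \<Omega> fg])
    fix \<phi> assume \<phi>: "\<phi> \<in> test_functions \<Omega>"
    have "L2_inner \<Omega> g \<phi> = L2_inner \<Omega> f \<phi>"
      by (rule LIMSEQ_unique[OF L2_limit_inner[OF tf[OF v(1)] g(1) tf[OF \<phi>] g(2)] v(3)[OF \<phi>]])
    then show "L2_inner \<Omega> (f - g) \<phi> = 0" using L2.ip_diff_left[OF f g(1) tf[OF \<phi>]] by simp
  qed
  then have ae: "AE x in lebesgue_on \<Omega>. (v n - g) x = - ((f - v n) x)" for n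
    by eventually_elim simp
  obtain n where n: "L2_inner \<Omega> (v n - g) (v n - g) < d"
    using order_tendstoD(2)[OF g(2) d] eventually_happens'[OF sequentially_bot] by blast
  have neg: "L2_inner \<Omega> (- h) (- h) = L2_inner \<Omega> h h" for h :: "'a \<Rightarrow> real"
    by (simp add: L2_inner_def)
  have "L2_inner \<Omega> (v n - g) (v n - g) = L2_inner \<Omega> (- (f - v n)) (- (f - v n))"
    by (rule L2_inner_cong_AE)
       (use ae[of n] L2.mem_diff[OF tf[OF v(1)] g(1)] L2.mem_neg[OF L2.mem_diff[OF f tf[OF v(1)]]] in auto)
  then have "L2_inner \<Omega> (f - v n) (f - v n) < d"
    unfolding neg
    using n by simp
  then show thesis using that v(1) by blast
qed

section \<open>Weak gradients and \<open>H\<^sup>1\<^sub>0(\<Omega>)\<close>\<close>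

lemma L2_component:
  fixes g :: "'a::euclidean_space \<Rightarrow> 'b::euclidean_space"
  assumes g: "g \<in> car (L2 \<Omega>)" and e: "e \<in> Basis"
  shows "(\<lambda>x. g x \<bullet> e) \<in> car (L2 \<Omega>)" "L2_inner \<Omega> (\<lambda>x. g x \<bullet> e) (\<lambda>x. g x \<bullet> e) \<le> L2_inner \<Omega> g g"
proof -
  have le: "(norm (g x \<bullet> e))\<^sup>2 \<le> (norm (g x))\<^sup>2" for x
    using Basis_le_norm[OF e, of "g x"] by (intro power_mono) auto
  show c: "(\<lambda>x. g x \<bullet> e) \<in> car (L2 \<Omega>)"
    by (rule L2_I[where g = "\<lambda>x. (norm (g x))\<^sup>2"]) (use g le in \<open>auto simp: L2_iff\<close>)
  show "L2_inner \<Omega> (\<lambda>x. g x \<bullet> e) (\<lambda>x. g x \<bullet> e) \<le> L2_inner \<Omega> g g"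
    unfolding L2_inner_self by (intro integral_mono) (use g c le in \<open>auto simp: L2_iff\<close>)
qed

lemma L2_scaleR_vector:
  fixes \<phi> :: "'a::euclidean_space \<Rightarrow> real" and e :: "'b::euclidean_space"
  assumes "\<phi> \<in> car (L2 \<Omega>)"
  shows "(\<lambda>x. \<phi> x *\<^sub>R e) \<in> car (L2 \<Omega>)"
  by (rule L2_I[where g = "\<lambda>x. (norm e)\<^sup>2 * (norm (\<phi> x))\<^sup>2"])
     (use assms in \<open>auto simp: L2_iff power_mult_distrib\<close>)

lemma L2_inner_components:
  fixes f g :: "'a::euclidean_space \<Rightarrow> 'b::euclidean_space"
  assumes "f \<in> car (L2 \<Omega>)" "g \<in> car (L2 \<Omega>)"
  shows "L2_inner \<Omega> f g = (\<Sum>e\<in>Basis. L2_inner \<Omega> (\<lambda>x. f x \<bullet> e) (\<lambda>x. g x \<bullet> e))"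
proof -
  have "L2_inner \<Omega> f g = (LINT x|lebesgue_on \<Omega>. (\<Sum>e\<in>Basis. (f x \<bullet> e) * (g x \<bullet> e)))"
    unfolding L2_inner_def by (simp add: euclidean_inner[of "f _" "g _"])
  also have "\<dots> = (\<Sum>e\<in>Basis. LINT x|lebesgue_on \<Omega>. (f x \<bullet> e) * (g x \<bullet> e))"
    using L2_inner_integrable[OF L2_component(1)[OF assms(1)] L2_component(1)[OF assms(2)]]
    by (intro Bochner_Integration.integral_sum) auto
  finally show ?thesis by (simp add: L2_inner_def)
qed

lemma has_weak_grad_iff:
  "has_weak_grad \<Omega> f g \<longleftrightarrow> (\<forall>\<phi>\<in>test_functions \<Omega>. \<forall>e\<in>Basis.
    L2_inner \<Omega> f (\<lambda>x. frechet_derivative \<phi> (at x) e) = - L2_inner \<Omega> g (\<lambda>x. \<phi> x *\<^sub>R e))"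
  by (simp add: has_weak_grad_def L2_inner_def mult.commute)

lemma car_H1: "car (H1 \<Omega>) = {f \<in> car (L2 \<Omega>). \<exists>g\<in>car (L2 \<Omega>). has_weak_grad \<Omega> f g}"
  by (simp add: H1_def)

lemma grad_props:
  assumes "f \<in> car (H1 \<Omega>)"
  shows "f \<in> car (L2 \<Omega>)" "grad \<Omega> f \<in> car (L2 \<Omega>)" "has_weak_grad \<Omega> f (grad \<Omega> f)"
proof -
  have "\<exists>g. g \<in> car (L2 \<Omega>) \<and> has_weak_grad \<Omega> f g" using assms by (auto simp: car_H1)
  from someI_ex[OF this] show "grad \<Omega> f \<in> car (L2 \<Omega>)" "has_weak_grad \<Omega> f (grad \<Omega> f)"
    by (auto simp: grad_def)
  show "f \<in> car (L2 \<Omega>)" using assms by (auto simp: car_H1)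
qed

definition h1_inner :: "'a::euclidean_space set \<Rightarrow> real \<Rightarrow> ('a \<Rightarrow> real) \<Rightarrow> ('a \<Rightarrow> real) \<Rightarrow> real"
  where "h1_inner \<Omega> \<epsilon> f g = L2_inner \<Omega> f g + \<epsilon> * dirichlet_form \<Omega> f g"

locale bounded_open_set =
  fixes \<Omega> :: "'a::euclidean_space set"
  assumes op: "open \<Omega>" and lm: "\<Omega> \<in> lmeasurable"
begin

lemma S: "\<Omega> \<in> sets lebesgue"
  using lm by auto

lemmas tf_L2 = test_function_L2[OF _ S]
lemmas tfd_L2 = test_function_derivative_L2[OF _ S]

lemma weak_grad_unique:
  assumes g: "g \<in> car (L2 \<Omega>)" "has_weak_grad \<Omega> f g" and h: "h \<in> car (L2 \<Omega>)" "has_weak_grad \<Omega> f h"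
  shows "AE x in lebesgue_on \<Omega>. g x = h x"
proof -
  have "AE x in lebesgue_on \<Omega>. (g x - h x) \<bullet> e = 0" if e: "e \<in> Basis" for e
  proof (rule L2_eq_0_of_orthogonal[OF op lm])
    have gh: "(\<lambda>x. g x - h x) \<in> car (L2 \<Omega>)"
      using L2.mem_diff[OF g(1) h(1)] by (simp add: fun_diff_def)
    show "(\<lambda>x. (g x - h x) \<bullet> e) \<in> car (L2 \<Omega>)"
      by (rule L2_component(1)[OF gh e])
    fix \<phi> assume \<phi>: "\<phi> \<in> test_functions \<Omega>"
    have "L2_inner \<Omega> (\<lambda>x. (g x - h x) \<bullet> e) \<phi> = L2_inner \<Omega> (g - h) (\<lambda>x. \<phi> x *\<^sub>R e)"
      by (simp add: L2_inner_def mult.commute)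
    also have "\<dots> = 0"
      using g(2) h(2) \<phi> e
      by (subst L2.ip_diff_left[OF g(1) h(1) L2_scaleR_vector[OF tf_L2[OF \<phi>]]])
         (simp add: has_weak_grad_iff)
    finally show "L2_inner \<Omega> (\<lambda>x. (g x - h x) \<bullet> e) \<phi> = 0" .
  qed
  then have "AE x in lebesgue_on \<Omega>. \<forall>e\<in>Basis. (g x - h x) \<bullet> e = 0"
    by (simp add: AE_finite_all)
  then show ?thesis
    by eventually_elim (rule euclidean_eqI, simp add: inner_diff_left)
qed

lemma grad_AE:
  assumes "f \<in> car (L2 \<Omega>)" "g \<in> car (L2 \<Omega>)" "has_weak_grad \<Omega> f g"
  shows "f \<in> car (H1 \<Omega>)" "AE x in lebesgue_on \<Omega>. grad \<Omega> f x = g x"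
proof -
  show f: "f \<in> car (H1 \<Omega>)" using assms by (auto simp: car_H1)
  show "AE x in lebesgue_on \<Omega>. grad \<Omega> f x = g x"
    by (rule weak_grad_unique[OF grad_props(2,3)[OF f] assms(2,3)])
qed

lemma grad_add:
  assumes f: "f \<in> car (H1 \<Omega>)" and g: "g \<in> car (H1 \<Omega>)"
  shows "f + g \<in> car (H1 \<Omega>)" "AE x in lebesgue_on \<Omega>. grad \<Omega> (f + g) x = (grad \<Omega> f + grad \<Omega> g) x"
proof -
  note F = grad_props[OF f] and G = grad_props[OF g]
  have w: "has_weak_grad \<Omega> (f + g) (grad \<Omega> f + grad \<Omega> g)"
    unfolding has_weak_grad_iff
  proof (intro ballI)
    fix \<phi> e assume \<phi>: "\<phi> \<in> test_functions \<Omega>" and e: "e \<in> (Basis :: 'a set)"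
    show "L2_inner \<Omega> (f + g) (\<lambda>x. frechet_derivative \<phi> (at x) e) =
        - L2_inner \<Omega> (grad \<Omega> f + grad \<Omega> g) (\<lambda>x. \<phi> x *\<^sub>R e)"
      using F(3) G(3) \<phi> e
      by (subst L2.ip_add_left[OF F(1) G(1) tfd_L2[OF \<phi> e]],
          subst L2.ip_add_left[OF F(2) G(2) L2_scaleR_vector[OF tf_L2[OF \<phi>]]])
         (simp add: has_weak_grad_iff)
  qed
  show "f + g \<in> car (H1 \<Omega>)" "AE x in lebesgue_on \<Omega>. grad \<Omega> (f + g) x = (grad \<Omega> f + grad \<Omega> g) x"
    by (rule grad_AE[OF L2.mem_add[OF F(1) G(1)] L2.mem_add[OF F(2) G(2)] w])+
qed

lemma grad_scale:
  assumes f: "f \<in> car (H1 \<Omega>)"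
  shows "c *\<^sub>R f \<in> car (H1 \<Omega>)" "AE x in lebesgue_on \<Omega>. grad \<Omega> (c *\<^sub>R f) x = (c *\<^sub>R grad \<Omega> f) x"
proof -
  note F = grad_props[OF f]
  have w: "has_weak_grad \<Omega> (c *\<^sub>R f) (c *\<^sub>R grad \<Omega> f)"
    unfolding has_weak_grad_iff
  proof (intro ballI)
    fix \<phi> e assume \<phi>: "\<phi> \<in> test_functions \<Omega>" and e: "e \<in> (Basis :: 'a set)"
    show "L2_inner \<Omega> (c *\<^sub>R f) (\<lambda>x. frechet_derivative \<phi> (at x) e) =
        - L2_inner \<Omega> (c *\<^sub>R grad \<Omega> f) (\<lambda>x. \<phi> x *\<^sub>R e)"
      using F(3) \<phi> e
      by (subst L2.ip_scale_left[OF F(1) tfd_L2[OF \<phi> e]],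
          subst L2.ip_scale_left[OF F(2) L2_scaleR_vector[OF tf_L2[OF \<phi>]]])
         (simp add: has_weak_grad_iff)
  qed
  show "c *\<^sub>R f \<in> car (H1 \<Omega>)" "AE x in lebesgue_on \<Omega>. grad \<Omega> (c *\<^sub>R f) x = (c *\<^sub>R grad \<Omega> f) x"
    by (rule grad_AE[OF L2.mem_scale[OF F(1)] L2.mem_scale[OF F(2)] w])+
qed

lemma subspace_H1: "subspace (car (H1 \<Omega>))"
proof (rule subspaceI)
  have "has_weak_grad \<Omega> 0 0" by (simp add: has_weak_grad_def)
  then show "0 \<in> car (H1 \<Omega>)" by (rule grad_AE(1)[OF L2.mem_zero L2.mem_zero])
qed (use grad_add(1) grad_scale(1) in blast)+

lemma dirichlet_add_left:
  assumes "f \<in> car (H1 \<Omega>)" "g \<in> car (H1 \<Omega>)" "h \<in> car (H1 \<Omega>)"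
  shows "dirichlet_form \<Omega> (f + g) h = dirichlet_form \<Omega> f h + dirichlet_form \<Omega> g h"
proof -
  note F = grad_props(2)[OF assms(1)] and G = grad_props(2)[OF assms(2)] and H = grad_props(2)[OF assms(3)]
  show ?thesis
    unfolding dirichlet_form_def L2.ip_add_left[OF F G H, symmetric]
    by (rule L2_inner_cong_AE[OF grad_props(2)[OF grad_add(1)[OF assms(1,2)]] H L2.mem_add[OF F G] H
          grad_add(2)[OF assms(1,2)]]) simp
qed

lemma dirichlet_scale_left:
  assumes "f \<in> car (H1 \<Omega>)" "h \<in> car (H1 \<Omega>)"
  shows "dirichlet_form \<Omega> (c *\<^sub>R f) h = c * dirichlet_form \<Omega> f h"
proof -
  note F = grad_props(2)[OF assms(1)] and H = grad_props(2)[OF assms(2)]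
  show ?thesis
    unfolding dirichlet_form_def L2.ip_scale_left[OF F H, symmetric]
    by (rule L2_inner_cong_AE[OF grad_props(2)[OF grad_scale(1)[OF assms(1)]] H L2.mem_scale[OF F] H
          grad_scale(2)[OF assms(1)]]) simp
qed

lemma dirichlet_sym: "dirichlet_form \<Omega> f g = dirichlet_form \<Omega> g f"
  by (simp add: dirichlet_form_def L2_inner_def inner_commute)

lemma dirichlet_nonneg: "0 \<le> dirichlet_form \<Omega> f f"
  by (simp add: dirichlet_form_def L2_inner_def)

lemma semi_inner_dirichlet_H1: "semi_inner (car (H1 \<Omega>)) (dirichlet_form \<Omega>)"
proof
  show "lin_on (car (H1 \<Omega>)) (\<lambda>f. dirichlet_form \<Omega> f g)" if "g \<in> car (H1 \<Omega>)" for g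
    using that by (intro lin_onI) (simp_all add: dirichlet_add_left dirichlet_scale_left)
qed (rule subspace_H1 dirichlet_sym dirichlet_nonneg)+

lemma semi_inner_H1:
  assumes "0 \<le> \<epsilon>"
  shows "semi_inner (car (H1 \<Omega>)) (h1_inner \<Omega> \<epsilon>)"
proof
  show "subspace (car (H1 \<Omega>))" by (rule subspace_H1)
  show "lin_on (car (H1 \<Omega>)) (\<lambda>f. h1_inner \<Omega> \<epsilon> f g)" if "g \<in> car (H1 \<Omega>)" for g
    using that by (intro lin_onI)
      (simp_all add: h1_inner_def dirichlet_add_left dirichlet_scale_left L2.ip_add_left L2.ip_scale_left
        grad_props(1) algebra_simps)
  show "h1_inner \<Omega> \<epsilon> f g = h1_inner \<Omega> \<epsilon> g f" for f g
    using dirichlet_sym by (simp add: h1_inner_def L2_inner_def mult.commute)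
  show "0 \<le> h1_inner \<Omega> \<epsilon> f f" for f
    using assms dirichlet_nonneg by (simp add: h1_inner_def L2_inner_def)
qed

lemma nrm_H1: "nrm (H1 \<Omega>) f = sqrt (h1_inner \<Omega> 1 f f)"
  by (simp add: H1_def h1_inner_def dirichlet_form_def L2_def L2_inner_def)

sublocale H1: semi_inner_sp "H1 \<Omega>" "h1_inner \<Omega> 1"
  by (intro semi_inner_sp.intro semi_inner_H1 semi_inner_sp_axioms.intro) (auto simp: nrm_H1)

lemma car_H10: "car (H10 \<Omega>) = {f \<in> car (H1 \<Omega>). \<exists>\<phi>. (\<forall>n. \<phi> n \<in> test_functions \<Omega>) \<and> converges_in (H1 \<Omega>) \<phi> f}"
  and nrm_H10: "nrm (H10 \<Omega>) = nrm (H1 \<Omega>)"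
  by (simp_all add: H10_def)

lemma H10_I:
  assumes "\<And>n. \<phi> n \<in> test_functions \<Omega>" "converges_in (H1 \<Omega>) \<phi> f"
  shows "f \<in> car (H10 \<Omega>)"
  using assms by (auto simp: car_H10 converges_in_def intro!: exI[of _ \<phi>])

lemma subspace_H10: "subspace (car (H10 \<Omega>))"
proof (rule subspaceI)
  have "converges_in (H1 \<Omega>) (\<lambda>n. 0) 0" by (simp add: converges_in_def H1.mem_zero)
  then show "0 \<in> car (H10 \<Omega>)"
    by (rule H10_I[rotated]) (rule subspace_0[OF subspace_test_functions])
next
  fix f g assume "f \<in> car (H10 \<Omega>)" "g \<in> car (H10 \<Omega>)"
  then obtain \<phi> \<psi> where f: "f \<in> car (H1 \<Omega>)" "\<And>n. \<phi> n \<in> test_functions \<Omega>" "converges_in (H1 \<Omega>) \<phi> f"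
    and g: "g \<in> car (H1 \<Omega>)" "\<And>n. \<psi> n \<in> test_functions \<Omega>" "converges_in (H1 \<Omega>) \<psi> g"
    by (auto simp: car_H10)
  have p: "\<phi> n \<in> car (H1 \<Omega>)" "\<psi> n \<in> car (H1 \<Omega>)" for n using f g by (auto simp: converges_in_def)
  have "(\<lambda>n. nrm (H1 \<Omega>) (\<phi> n - f) + nrm (H1 \<Omega>) (\<psi> n - g)) \<longlonglongrightarrow> 0 + 0"
    using f g by (intro tendsto_add) (auto simp: converges_in_def)
  then have lim: "(\<lambda>n. nrm (H1 \<Omega>) (\<phi> n - f) + nrm (H1 \<Omega>) (\<psi> n - g)) \<longlonglongrightarrow> 0" by simp
  have le: "nrm (H1 \<Omega>) (\<phi> n + \<psi> n - (f + g)) \<le> nrm (H1 \<Omega>) (\<phi> n - f) + nrm (H1 \<Omega>) (\<psi> n - g)" for n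
    using H1.nrm_triangle[OF H1.mem_diff[OF p(1)[of n] f(1)] H1.mem_diff[OF p(2)[of n] g(1)]]
    by (simp add: algebra_simps)
  have "(\<lambda>n. nrm (H1 \<Omega>) (\<phi> n + \<psi> n - (f + g))) \<longlonglongrightarrow> 0"
    by (rule tendsto_sandwich[OF always_eventually always_eventually tendsto_const lim])
       (use le H1.nrm_nonneg[OF H1.mem_diff[OF H1.mem_add[OF p] H1.mem_add[OF f(1) g(1)]]] in blast)+
  then have "converges_in (H1 \<Omega>) (\<lambda>n. \<phi> n + \<psi> n) (f + g)"
    using p f(1) g(1) H1.mem_add by (auto simp: converges_in_def)
  then show "f + g \<in> car (H10 \<Omega>)"
    by (rule H10_I[rotated]) (rule subspace_add[OF subspace_test_functions f(2) g(2)])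
next
  fix c f assume "f \<in> car (H10 \<Omega>)"
  then obtain \<phi> where f: "f \<in> car (H1 \<Omega>)" "\<And>n. \<phi> n \<in> test_functions \<Omega>" "converges_in (H1 \<Omega>) \<phi> f"
    by (auto simp: car_H10)
  have p: "\<phi> n \<in> car (H1 \<Omega>)" for n using f by (auto simp: converges_in_def)
  have "(\<lambda>n. \<bar>c\<bar> * nrm (H1 \<Omega>) (\<phi> n - f)) \<longlonglongrightarrow> \<bar>c\<bar> * 0"
    using f by (intro tendsto_intros) (auto simp: converges_in_def)
  moreover have "nrm (H1 \<Omega>) (c *\<^sub>R \<phi> n - c *\<^sub>R f) = \<bar>c\<bar> * nrm (H1 \<Omega>) (\<phi> n - f)" for n
    using H1.nrm_scale[OF H1.mem_diff[OF p[of n] f(1)], of c] by (simp only: scaleR_diff_right)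
  ultimately have "converges_in (H1 \<Omega>) (\<lambda>n. c *\<^sub>R \<phi> n) (c *\<^sub>R f)"
    using p f(1) H1.mem_scale by (auto simp: converges_in_def)
  then show "c *\<^sub>R f \<in> car (H10 \<Omega>)"
    by (rule H10_I[rotated]) (rule subspace_scale[OF subspace_test_functions f(2)])
qed

lemma H10_H1: "f \<in> car (H10 \<Omega>) \<Longrightarrow> f \<in> car (H1 \<Omega>)"
  by (simp add: car_H10)

lemma H10_L2: "f \<in> car (H10 \<Omega>) \<Longrightarrow> f \<in> car (L2 \<Omega>)"
  by (simp add: H10_H1 grad_props(1))

lemma semi_inner_subset:
  assumes "semi_inner V ip" "subspace W" "W \<subseteq> V"
  shows "semi_inner W ip"
proof -
  interpret semi_inner V ip by fact
  show ?thesis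
    using assms(2,3) ip_lin by unfold_locales (auto simp: lin_on_def ip_sym ip_nonneg subset_iff)
qed

lemma semi_inner_H10: "0 \<le> \<epsilon> \<Longrightarrow> semi_inner (car (H10 \<Omega>)) (h1_inner \<Omega> \<epsilon>)"
  by (rule semi_inner_subset[OF semi_inner_H1 subspace_H10]) (auto simp: H10_H1)

sublocale H10: semi_inner_sp "H10 \<Omega>" "h1_inner \<Omega> 1"
  by (intro semi_inner_sp.intro semi_inner_H10 semi_inner_sp_axioms.intro) (auto simp: nrm_H10 nrm_H1)

sublocale dir: semi_inner "car (H10 \<Omega>)" "dirichlet_form \<Omega>"
  by (rule semi_inner_subset[OF semi_inner_dirichlet_H1 subspace_H10]) (auto simp: H10_H1)

lemma nrm_L2_le_H10: "f \<in> car (H10 \<Omega>) \<Longrightarrow> nrm (L2 \<Omega>) f \<le> nrm (H10 \<Omega>) f"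
  by (simp add: nrm_H10 nrm_H1 L2_def h1_inner_def dirichlet_nonneg)

lemma test_function_H1:
  assumes \<phi>: "\<phi> \<in> test_functions \<Omega>"
  shows "\<phi> \<in> car (H1 \<Omega>)"
proof (rule grad_AE(1)[OF tf_L2[OF \<phi>]])
  note p = test_function_props[OF \<phi>]
  define g where "g = (\<lambda>x. \<Sum>e\<in>Basis. frechet_derivative \<phi> (at x) e *\<^sub>R e)"
  show "g \<in> car (L2 \<Omega>)"
  proof -
    have "(\<Sum>e\<in>Basis. (\<lambda>x. frechet_derivative \<phi> (at x) e *\<^sub>R e)) \<in> car (L2 \<Omega>)"
      by (intro L2.mem_sum L2_scaleR_vector tfd_L2[OF \<phi>])
    moreover have "(\<Sum>e\<in>Basis. (\<lambda>x. frechet_derivative \<phi> (at x) e *\<^sub>R e)) = g"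
    proof
      fix x
      have "finite I \<Longrightarrow> (\<Sum>e\<in>I. (\<lambda>x. frechet_derivative \<phi> (at x) e *\<^sub>R e)) x =
          (\<Sum>e\<in>I. frechet_derivative \<phi> (at x) e *\<^sub>R e)" for I :: "'a set"
        by (induction I rule: finite_induct) auto
      then show "(\<Sum>e\<in>Basis. (\<lambda>x. frechet_derivative \<phi> (at x) e *\<^sub>R e)) x = g x"
        by (simp add: g_def)
    qed
    ultimately show ?thesis by simp
  qed
  show "has_weak_grad \<Omega> \<phi> g"
    unfolding has_weak_grad_def
  proof (intro ballI)
    fix \<psi> e assume \<psi>: "\<psi> \<in> test_functions \<Omega>" and e: "e \<in> (Basis :: 'a set)"
    note q = test_function_props[OF \<psi>]
    let ?K = "closure {x. \<phi> x \<noteq> 0}"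
    define D where "D x e = \<phi> x * frechet_derivative \<psi> (at x) e + frechet_derivative \<phi> (at x) e * \<psi> x" for x e
    have ge: "g x \<bullet> e = frechet_derivative \<phi> (at x) e" for x
      using e by (simp add: g_def)
    have c: "continuous_on UNIV (\<lambda>x. D x e)"
      unfolding D_def by (intro continuous_on_add continuous_on_mult p(1) q(1) p(3)[OF e] q(3)[OF e])
    have D0: "D x e = 0" if "x \<notin> ?K" for x
      using p(6,7)[OF that] by (simp add: D_def)
    have "(LINT x|lborel. D x e) = 0"
    proof (rule LINT_derivative_compact_support[where \<psi> = "\<lambda>x. \<phi> x * \<psi> x" and D = D and e = e, OF _ c p(4)])
      show "((\<lambda>x. \<phi> x * \<psi> x) has_derivative D x) (at x)" for x
        unfolding D_def[abs_def]
        by (rule has_derivative_mult[OF frechet_derivative_works[THEN iffD1, OF p(2)]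
              frechet_derivative_works[THEN iffD1, OF q(2)]])
    next
      show "\<phi> x * \<psi> x = 0" if "x \<notin> ?K" for x using p(6)[OF that] by simp
      show "D x e = 0" if "x \<notin> ?K" for x by (rule D0[OF that])
    qed
    moreover have "(LINT x|lebesgue_on \<Omega>. D x e) = (LINT x|lborel. D x e)"
      by (rule LINT_compact_support[OF c p(4) D0 p(5) S])
    moreover have "(LINT x|lebesgue_on \<Omega>. D x e) =
      (LINT x|lebesgue_on \<Omega>. \<phi> x * frechet_derivative \<psi> (at x) e) + (LINT x|lebesgue_on \<Omega>. (g x \<bullet> e) * \<psi> x)"
      unfolding D_def ge
      using L2_inner_integrable[OF tf_L2[OF \<phi>] tfd_L2[OF \<psi> e]] L2_inner_integrable[OF tfd_L2[OF \<phi> e] tf_L2[OF \<psi>]]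
      by (intro Bochner_Integration.integral_add) simp_all
    ultimately show "(LINT x|lebesgue_on \<Omega>. \<phi> x * frechet_derivative \<psi> (at x) e) =
        - (LINT x|lebesgue_on \<Omega>. (g x \<bullet> e) * \<psi> x)" by linarith
  qed
qed

lemma test_function_H10:
  assumes \<phi>: "\<phi> \<in> test_functions \<Omega>"
  shows "\<phi> \<in> car (H10 \<Omega>)"
proof -
  have "converges_in (H1 \<Omega>) (\<lambda>_. \<phi>) \<phi>"
    using test_function_H1[OF \<phi>] by (simp add: converges_in_def H1.nrm_zero)
  then show ?thesis by (rule H10_I[rotated]) (rule \<phi>)
qed

text \<open>
  For fixed \<open>h\<close>, the form \<open>a[\<sqdot>, h]\<close> is continuous for the \<open>L\<^sup>2\<close> norm up to an arbitrarily small
  multiple of the energy: replace the components of \<open>\<nabla>h\<close> by test functions and integrate by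
  parts. Hence \<open>L\<^sup>2\<close> convergence with bounded energy implies weak convergence of gradients.
\<close>

lemma dirichlet_L2_bound:
  assumes h: "h \<in> car (H10 \<Omega>)" and d: "\<delta> > 0"
  obtains C where "C \<ge> 0" "\<And>w. w \<in> car (H10 \<Omega>) \<Longrightarrow>
    \<bar>dirichlet_form \<Omega> w h\<bar> \<le> \<delta> * sqrt (dirichlet_form \<Omega> w w) + C * sqrt (L2_inner \<Omega> w w)"
proof -
  let ?N = "real DIM('a)"
  have G: "grad \<Omega> h \<in> car (L2 \<Omega>)" by (rule grad_props(2)[OF H10_H1[OF h]])
  have "\<exists>\<phi>. \<phi> \<in> test_functions \<Omega> \<and>
      L2_inner \<Omega> ((\<lambda>x. grad \<Omega> h x \<bullet> e) - \<phi>) ((\<lambda>x. grad \<Omega> h x \<bullet> e) - \<phi>) < (\<delta> / ?N)\<^sup>2" if "e \<in> Basis" for e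
    using test_functions_dense_L2[OF op lm L2_component(1)[OF G that], of "(\<delta> / ?N)\<^sup>2"] d by auto
  then obtain \<phi> where \<phi>: "\<And>e. e \<in> Basis \<Longrightarrow> \<phi> e \<in> test_functions \<Omega>"
    "\<And>e. e \<in> Basis \<Longrightarrow> L2_inner \<Omega> ((\<lambda>x. grad \<Omega> h x \<bullet> e) - \<phi> e) ((\<lambda>x. grad \<Omega> h x \<bullet> e) - \<phi> e) < (\<delta> / ?N)\<^sup>2"
    by metis
  define D where "D e = (\<lambda>x. frechet_derivative (\<phi> e) (at x) e)" for e
  have D: "D e \<in> car (L2 \<Omega>)" if "e \<in> Basis" for e unfolding D_def by (rule tfd_L2[OF \<phi>(1)[OF that] that])
  define C where "C = (\<Sum>e\<in>Basis. sqrt (L2_inner \<Omega> (D e) (D e)))"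
  show thesis
  proof (rule that[of C])
    show "C \<ge> 0" unfolding C_def by (intro sum_nonneg) (simp add: L2.ip_nonneg D)
    fix w assume w: "w \<in> car (H10 \<Omega>)"
    note W = grad_props[OF H10_H1[OF w]]
    have "\<bar>L2_inner \<Omega> (\<lambda>x. grad \<Omega> w x \<bullet> e) (\<lambda>x. grad \<Omega> h x \<bullet> e)\<bar> \<le>
        sqrt (dirichlet_form \<Omega> w w) * (\<delta> / ?N) + sqrt (L2_inner \<Omega> w w) * sqrt (L2_inner \<Omega> (D e) (D e))"
      if e: "e \<in> Basis" for e
    proof -
      let ?w = "\<lambda>x. grad \<Omega> w x \<bullet> e" and ?h = "\<lambda>x. grad \<Omega> h x \<bullet> e"
      have t: "\<phi> e \<in> car (L2 \<Omega>)" by (rule tf_L2[OF \<phi>(1)[OF e]])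
      have wc: "?w \<in> car (L2 \<Omega>)" and hc: "?h \<in> car (L2 \<Omega>)"
        by (rule L2_component(1)[OF W(2) e], rule L2_component(1)[OF G e])
      have "\<bar>L2_inner \<Omega> ?w (?h - \<phi> e)\<bar> \<le> sqrt (L2_inner \<Omega> ?w ?w) * sqrt (L2_inner \<Omega> (?h - \<phi> e) (?h - \<phi> e))"
        by (rule L2.cauchy_schwarz[OF wc L2.mem_diff[OF hc t]])
      also have "\<dots> \<le> sqrt (dirichlet_form \<Omega> w w) * (\<delta> / ?N)"
        using L2_component(2)[OF W(2) e] \<phi>(2)[OF e] d L2.ip_nonneg[OF L2.mem_diff[OF hc t]]
          dirichlet_nonneg
        by (intro mult_mono real_le_lsqrt) (auto simp: dirichlet_form_def)
      finally have 1: "\<bar>L2_inner \<Omega> ?w (?h - \<phi> e)\<bar> \<le> sqrt (dirichlet_form \<Omega> w w) * (\<delta> / ?N)" .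
      have "L2_inner \<Omega> ?w (\<phi> e) = L2_inner \<Omega> (grad \<Omega> w) (\<lambda>x. \<phi> e x *\<^sub>R e)"
        by (simp add: L2_inner_def mult.commute)
      also have "\<dots> = - L2_inner \<Omega> w (D e)"
        using W(3) \<phi>(1)[OF e] e by (simp add: has_weak_grad_iff D_def)
      finally have 2: "\<bar>L2_inner \<Omega> ?w (\<phi> e)\<bar> \<le> sqrt (L2_inner \<Omega> w w) * sqrt (L2_inner \<Omega> (D e) (D e))"
        using L2.cauchy_schwarz[OF W(1) D[OF e]] by simp
      have "L2_inner \<Omega> ?w ?h = L2_inner \<Omega> ?w (?h - \<phi> e) + L2_inner \<Omega> ?w (\<phi> e)"
        using L2.ip_diff_right[OF hc t wc] by simp
      then show ?thesis using 1 2 by linarith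
    qed
    then have "\<bar>dirichlet_form \<Omega> w h\<bar> \<le> (\<Sum>e\<in>(Basis :: 'a set).
        sqrt (dirichlet_form \<Omega> w w) * (\<delta> / ?N) + sqrt (L2_inner \<Omega> w w) * sqrt (L2_inner \<Omega> (D e) (D e)))"
      unfolding dirichlet_form_def[of _ w h] L2_inner_components[OF W(2) G]
      by (intro order_trans[OF sum_abs] sum_mono)
    also have "\<dots> = \<delta> * sqrt (dirichlet_form \<Omega> w w) + C * sqrt (L2_inner \<Omega> w w)"
      by (simp add: sum.distrib C_def sum_distrib_left mult.commute)
    finally show "\<bar>dirichlet_form \<Omega> w h\<bar> \<le> \<delta> * sqrt (dirichlet_form \<Omega> w w) + C * sqrt (L2_inner \<Omega> w w)" .
  qed
qed

text \<open>
  A limit in \<open>L\<^sup>2\<close> exists for the functions and for their gradients, and the definition of the weak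
  gradient is stable under \<open>L\<^sup>2\<close> convergence.
\<close>

lemma H10_of_cauchy:
  assumes v: "\<And>n::nat. v n \<in> test_functions \<Omega>" and e: "\<epsilon> > 0"
    and cauchy: "\<And>d. d > 0 \<Longrightarrow> \<exists>N. \<forall>m\<ge>N. \<forall>n\<ge>N. h1_inner \<Omega> \<epsilon> (v m - v n) (v m - v n) < d"
  obtains w where "w \<in> car (H10 \<Omega>)" "(\<lambda>n. h1_inner \<Omega> \<epsilon> (v n - w) (v n - w)) \<longlonglongrightarrow> 0"
proof -
  have vH: "v n \<in> car (H1 \<Omega>)" for n by (rule test_function_H1[OF v])
  note V = grad_props[OF vH]
  have dG: "AE x in lebesgue_on \<Omega>. grad \<Omega> (f - g) x = (grad \<Omega> f - grad \<Omega> g) x"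
    if "f \<in> car (H1 \<Omega>)" "g \<in> car (H1 \<Omega>)" for f g
    using grad_add(2)[OF that(1) grad_scale(1)[OF that(2), of "-1"]] grad_scale(2)[OF that(2), of "-1"]
    by eventually_elim simp
  have dd: "dirichlet_form \<Omega> (v m - v n) (v m - v n) = L2_inner \<Omega> (grad \<Omega> (v m) - grad \<Omega> (v n)) (grad \<Omega> (v m) - grad \<Omega> (v n))" for m n
    unfolding dirichlet_form_def
    by (rule L2_inner_cong_AE[OF grad_props(2) grad_props(2) L2.mem_diff L2.mem_diff dG dG])
       (use H1.mem_diff vH V in auto)
  have c1: "\<exists>N. \<forall>m\<ge>N. \<forall>n\<ge>N. L2_inner \<Omega> (v m - v n) (v m - v n) < d" if "d > 0" for d
  proof -
    have "L2_inner \<Omega> (v m - v n) (v m - v n) \<le> h1_inner \<Omega> \<epsilon> (v m - v n) (v m - v n)" for m n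
      using e dirichlet_nonneg by (simp add: h1_inner_def)
    then show ?thesis using cauchy[OF that] by (meson le_less_trans)
  qed
  have c2: "\<exists>N. \<forall>m\<ge>N. \<forall>n\<ge>N. L2_inner \<Omega> (grad \<Omega> (v m) - grad \<Omega> (v n)) (grad \<Omega> (v m) - grad \<Omega> (v n)) < d"
    if "d > 0" for d
  proof -
    have le: "\<epsilon> * L2_inner \<Omega> (grad \<Omega> (v m) - grad \<Omega> (v n)) (grad \<Omega> (v m) - grad \<Omega> (v n)) \<le> h1_inner \<Omega> \<epsilon> (v m - v n) (v m - v n)" for m n
      by (simp add: h1_inner_def dd L2_inner_self)
    have "\<epsilon> * d > 0" using e that by simp
    from cauchy[OF this] obtain N
      where N: "\<And>m n. m \<ge> N \<Longrightarrow> n \<ge> N \<Longrightarrow> h1_inner \<Omega> \<epsilon> (v m - v n) (v m - v n) < \<epsilon> * d"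
      by blast
    have "L2_inner \<Omega> (grad \<Omega> (v m) - grad \<Omega> (v n)) (grad \<Omega> (v m) - grad \<Omega> (v n)) < d"
      if "m \<ge> N" "n \<ge> N" for m n
      using le_less_trans[OF le N[OF that]] e by simp
    then show ?thesis by blast
  qed
  obtain w where w: "w \<in> car (L2 \<Omega>)" "(\<lambda>n. L2_inner \<Omega> (v n - w) (v n - w)) \<longlonglongrightarrow> 0"
    using L2_complete[OF lm V(1) c1] by blast
  obtain g where g: "g \<in> car (L2 \<Omega>)" "(\<lambda>n. L2_inner \<Omega> (grad \<Omega> (v n) - g) (grad \<Omega> (v n) - g)) \<longlonglongrightarrow> 0"
    using L2_complete[OF lm V(2) c2] by blast
  have wg: "has_weak_grad \<Omega> w g"
    unfolding has_weak_grad_iff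
  proof (intro ballI)
    fix \<phi> b assume \<phi>: "\<phi> \<in> test_functions \<Omega>" and b: "b \<in> (Basis :: 'a set)"
    have 1: "(\<lambda>n. L2_inner \<Omega> (v n) (\<lambda>x. frechet_derivative \<phi> (at x) b)) \<longlonglongrightarrow> L2_inner \<Omega> w (\<lambda>x. frechet_derivative \<phi> (at x) b)"
      by (rule L2_limit_inner[OF V(1) w(1) tfd_L2[OF \<phi> b] w(2)])
    have "(\<lambda>n. - L2_inner \<Omega> (grad \<Omega> (v n)) (\<lambda>x. \<phi> x *\<^sub>R b)) \<longlonglongrightarrow> - L2_inner \<Omega> g (\<lambda>x. \<phi> x *\<^sub>R b)"
      by (intro tendsto_minus L2_limit_inner[OF V(2) g(1) L2_scaleR_vector[OF tf_L2[OF \<phi>]] g(2)])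
    moreover have "- L2_inner \<Omega> (grad \<Omega> (v n)) (\<lambda>x. \<phi> x *\<^sub>R b) = L2_inner \<Omega> (v n) (\<lambda>x. frechet_derivative \<phi> (at x) b)" for n
      using V(3)[of n] \<phi> b by (simp add: has_weak_grad_iff)
    ultimately show "L2_inner \<Omega> w (\<lambda>x. frechet_derivative \<phi> (at x) b) = - L2_inner \<Omega> g (\<lambda>x. \<phi> x *\<^sub>R b)"
      using LIMSEQ_unique[OF 1] by simp
  qed
  have wH: "w \<in> car (H1 \<Omega>)" and gw: "AE x in lebesgue_on \<Omega>. grad \<Omega> w x = g x"
    by (rule grad_AE[OF w(1) g(1) wg])+
  have dw: "dirichlet_form \<Omega> (v n - w) (v n - w) = L2_inner \<Omega> (grad \<Omega> (v n) - g) (grad \<Omega> (v n) - g)" for n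
  proof -
    have "AE x in lebesgue_on \<Omega>. grad \<Omega> (v n - w) x = (grad \<Omega> (v n) - g) x"
      using dG[OF vH wH] gw by eventually_elim simp
    then show ?thesis
      unfolding dirichlet_form_def
      by (intro L2_inner_cong_AE grad_props(2)[OF H1.mem_diff[OF vH wH]] L2.mem_diff[OF V(2) g(1)])
  qed
  have lim: "(\<lambda>n. h1_inner \<Omega> c (v n - w) (v n - w)) \<longlonglongrightarrow> 0" for c
  proof -
    have "(\<lambda>n. h1_inner \<Omega> c (v n - w) (v n - w)) \<longlonglongrightarrow> 0 + c * 0"
      unfolding h1_inner_def dw by (intro tendsto_intros w g)
    then show ?thesis by simp
  qed
  have "(\<lambda>n. nrm (H1 \<Omega>) (v n - w)) \<longlonglongrightarrow> 0"
    using tendsto_real_sqrt[OF lim[of 1]] by (simp add: nrm_H1)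
  then have "converges_in (H1 \<Omega>) v w" using vH wH by (simp add: converges_in_def)
  then have "w \<in> car (H10 \<Omega>)" by (rule H10_I[rotated]) (rule v)
  then show thesis using that lim by blast
qed

end

section \<open>The resolvent of the Dirichlet Laplacian\<close>

context bounded_open_set
begin

lemma H10_limit_inner:
  assumes c: "0 \<le> c" and f: "\<And>n. f n \<in> car (H10 \<Omega>)" and g: "g \<in> car (H10 \<Omega>)" and h: "h \<in> car (H10 \<Omega>)"
    and lim: "(\<lambda>n. h1_inner \<Omega> c (f n - g) (f n - g)) \<longlonglongrightarrow> 0"
  shows "(\<lambda>n. h1_inner \<Omega> c (f n) h) \<longlonglongrightarrow> h1_inner \<Omega> c g h"
proof -
  interpret C: semi_inner "car (H10 \<Omega>)" "h1_inner \<Omega> c" by (rule semi_inner_H10[OF c])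
  have "(\<lambda>n. sqrt (h1_inner \<Omega> c (f n - g) (f n - g)) * sqrt (h1_inner \<Omega> c h h)) \<longlonglongrightarrow> sqrt 0 * sqrt (h1_inner \<Omega> c h h)"
    by (intro tendsto_intros lim)
  then have lim': "(\<lambda>n. sqrt (h1_inner \<Omega> c (f n - g) (f n - g)) * sqrt (h1_inner \<Omega> c h h)) \<longlonglongrightarrow> 0" by simp
  have le: "\<bar>h1_inner \<Omega> c (f n) h - h1_inner \<Omega> c g h\<bar> \<le> sqrt (h1_inner \<Omega> c (f n - g) (f n - g)) * sqrt (h1_inner \<Omega> c h h)" for n
    using C.cauchy_schwarz[OF C.ip_mem_diff[OF f[of n] g] h] C.ip_diff_left[OF f[of n] g h] by simp
  have "(\<lambda>n. \<bar>h1_inner \<Omega> c (f n) h - h1_inner \<Omega> c g h\<bar>) \<longlonglongrightarrow> 0"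
    by (rule tendsto_sandwich[OF always_eventually always_eventually tendsto_const lim']) (use le in auto)
  then show ?thesis using LIM_zero_iff tendsto_rabs_zero_iff by blast
qed

lemma h1_inner_ge:
  assumes "0 < \<epsilon>" "\<epsilon> \<le> 1"
  shows "\<epsilon> * h1_inner \<Omega> 1 f f \<le> h1_inner \<Omega> \<epsilon> f f"
proof -
  have "\<epsilon> * L2_inner \<Omega> f f \<le> 1 * L2_inner \<Omega> f f"
    using assms by (intro mult_right_mono) (auto simp: L2_inner_def)
  then show ?thesis by (simp add: h1_inner_def distrib_left)
qed

lemma Hm1_iff: "F \<in> car (Hm1 \<Omega>) \<longleftrightarrow> lin_on (car (H10 \<Omega>)) F \<and> (\<exists>C. \<forall>x\<in>car (H10 \<Omega>). \<bar>F x\<bar> \<le> C * nrm (H10 \<Omega>) x)"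
  by (simp add: Hm1_def dual_iff)

text \<open>
  The minimising sequence is taken among test functions, so that its limit is in
  \<open>H\<^sup>1\<^sub>0(\<Omega>)\<close> by definition of that space.
\<close>

lemma elliptic_solution:
  assumes \<epsilon>: "0 < \<epsilon>" "\<epsilon> \<le> 1" and F: "F \<in> car (Hm1 \<Omega>)"
  obtains w where "w \<in> car (H10 \<Omega>)" "\<And>v. v \<in> car (H10 \<Omega>) \<Longrightarrow> h1_inner \<Omega> \<epsilon> w v = F v"
proof -
  obtain K where lin: "lin_on (car (H10 \<Omega>)) F" and K: "\<And>x. x \<in> car (H10 \<Omega>) \<Longrightarrow> \<bar>F x\<bar> \<le> K * nrm (H10 \<Omega>) x"
    using F by (auto simp: Hm1_iff)
  interpret C: semi_inner "car (H10 \<Omega>)" "h1_inner \<Omega> \<epsilon>" by (rule semi_inner_H10) (use \<epsilon> in simp)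
  have sub: "test_functions \<Omega> \<subseteq> car (H10 \<Omega>)" using test_function_H10 by blast
  interpret V: semi_inner "test_functions \<Omega>" "h1_inner \<Omega> \<epsilon>"
    by (rule semi_inner_subset[OF C.semi_inner_axioms subspace_test_functions sub])
  have linV: "lin_on (test_functions \<Omega>) F" using lin sub unfolding lin_on_def by blast
  have bd: "\<bar>F x\<bar> \<le> (\<bar>K\<bar> / sqrt \<epsilon>) * sqrt (h1_inner \<Omega> \<epsilon> x x)" if "x \<in> test_functions \<Omega>" for x
  proof -
    have x: "x \<in> car (H10 \<Omega>)" using sub that by auto
    have "\<bar>F x\<bar> \<le> \<bar>K\<bar> * nrm (H10 \<Omega>) x"
      by (rule order_trans[OF K[OF x] mult_right_mono[OF abs_ge_self H10.nrm_nonneg[OF x]]])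
    also have "nrm (H10 \<Omega>) x = sqrt (h1_inner \<Omega> 1 x x)" by (rule H10.nrm_ip[OF x])
    also have "\<dots> \<le> sqrt (h1_inner \<Omega> \<epsilon> x x / \<epsilon>)"
      using h1_inner_ge[OF \<epsilon>, of x] \<epsilon> by (simp add: pos_le_divide_eq mult.commute)
    finally show ?thesis by (simp add: real_sqrt_divide mult_left_mono)
  qed
  obtain v where v: "\<And>n::nat. v n \<in> test_functions \<Omega>"
    "\<And>e. e > 0 \<Longrightarrow> \<exists>N. \<forall>m\<ge>N. \<forall>n\<ge>N. h1_inner \<Omega> \<epsilon> (v m - v n) (v m - v n) < e"
    "\<And>\<phi>. \<phi> \<in> test_functions \<Omega> \<Longrightarrow> (\<lambda>n. h1_inner \<Omega> \<epsilon> (v n) \<phi>) \<longlonglongrightarrow> F \<phi>"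
    using V.approximate_riesz[OF linV bd] by blast
  obtain w where w: "w \<in> car (H10 \<Omega>)" "(\<lambda>n. h1_inner \<Omega> \<epsilon> (v n - w) (v n - w)) \<longlonglongrightarrow> 0"
    using H10_of_cauchy[OF v(1) \<epsilon>(1) v(2)] by blast
  have vH: "v n \<in> car (H10 \<Omega>)" for n using v sub by auto
  have test: "h1_inner \<Omega> \<epsilon> w \<phi> = F \<phi>" if "\<phi> \<in> test_functions \<Omega>" for \<phi>
    using LIMSEQ_unique[OF H10_limit_inner[OF _ vH w(1) _ w(2)] v(3)[OF that]] sub that \<epsilon> by auto
  show thesis
  proof (rule that[OF w(1)])
    fix x assume x: "x \<in> car (H10 \<Omega>)"
    obtain \<phi> where \<phi>: "\<And>n. \<phi> n \<in> test_functions \<Omega>" "converges_in (H1 \<Omega>) \<phi> x"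
      using x by (auto simp: car_H10)
    have \<phi>H: "\<phi> n \<in> car (H10 \<Omega>)" for n using \<phi> sub by auto
    have lim: "(\<lambda>n. nrm (H10 \<Omega>) (\<phi> n - x)) \<longlonglongrightarrow> 0"
      using \<phi>(2) by (simp add: converges_in_def nrm_H10)
    define G where "G = (\<lambda>y. h1_inner \<Omega> \<epsilon> w y - F y)"
    have bdG: "\<bar>G y\<bar> \<le> (sqrt (h1_inner \<Omega> \<epsilon> w w) + \<bar>K\<bar>) * nrm (H10 \<Omega>) y" if y: "y \<in> car (H10 \<Omega>)" for y
    proof -
      have "h1_inner \<Omega> \<epsilon> y y \<le> h1_inner \<Omega> 1 y y"
        using \<epsilon> dirichlet_nonneg[of y] mult_right_mono[of \<epsilon> 1 "dirichlet_form \<Omega> y y"] by (simp add: h1_inner_def)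
      then have "sqrt (h1_inner \<Omega> \<epsilon> y y) \<le> nrm (H10 \<Omega>) y" using H10.nrm_ip[OF y] by simp
      then have "sqrt (h1_inner \<Omega> \<epsilon> w w) * sqrt (h1_inner \<Omega> \<epsilon> y y) \<le> sqrt (h1_inner \<Omega> \<epsilon> w w) * nrm (H10 \<Omega>) y"
        by (rule mult_left_mono) (simp add: C.ip_nonneg w)
      moreover have "\<bar>F y\<bar> \<le> \<bar>K\<bar> * nrm (H10 \<Omega>) y"
        by (rule order_trans[OF K[OF y] mult_right_mono[OF abs_ge_self H10.nrm_nonneg[OF y]]])
      ultimately show ?thesis
        using C.cauchy_schwarz[OF w(1) y] by (simp add: G_def distrib_right)
    qed
    have linG: "lin_on (car (H10 \<Omega>)) G"
      using C.ip_lin_right[OF w(1)] lin by (auto simp: lin_on_def G_def algebra_simps)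
    have "\<bar>G x\<bar> \<le> (sqrt (h1_inner \<Omega> \<epsilon> w w) + \<bar>K\<bar>) * nrm (H10 \<Omega>) (\<phi> n - x)" for n
    proof -
      have "G (\<phi> n - x) = - G x"
        using lin_on_diff[OF subspace_H10 linG \<phi>H[of n] x] test[OF \<phi>(1)] by (simp add: G_def)
      then show ?thesis using bdG[OF H10.mem_diff[OF \<phi>H[of n] x]] by simp
    qed
    moreover have "(\<lambda>n. (sqrt (h1_inner \<Omega> \<epsilon> w w) + \<bar>K\<bar>) * nrm (H10 \<Omega>) (\<phi> n - x)) \<longlonglongrightarrow> (sqrt (h1_inner \<Omega> \<epsilon> w w) + \<bar>K\<bar>) * 0"
      by (intro tendsto_intros lim)
    ultimately have "\<bar>G x\<bar> \<le> (sqrt (h1_inner \<Omega> \<epsilon> w w) + \<bar>K\<bar>) * 0"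
      by (intro LIMSEQ_le_const) auto
    then show "h1_inner \<Omega> \<epsilon> w x = F x" by (simp add: G_def)
  qed
qed

lemma seminormed_Hm1: "seminormed (Hm1 \<Omega>)"
  unfolding Hm1_def by (rule H10.seminormed_dual)

sublocale Hm1: seminormed "Hm1 \<Omega>"
  by (rule seminormed_Hm1)

lemma Hm1_le: "F \<in> car (Hm1 \<Omega>) \<Longrightarrow> v \<in> car (H10 \<Omega>) \<Longrightarrow> \<bar>F v\<bar> \<le> nrm (Hm1 \<Omega>) F * nrm (H10 \<Omega>) v"
  unfolding Hm1_def by (rule H10.dual_le_nrm)

lemma L2_Hm1_bound:
  assumes f: "f \<in> car (L2 \<Omega>)" and v: "v \<in> car (H10 \<Omega>)"
  shows "\<bar>L2_inner \<Omega> f v\<bar> \<le> nrm (L2 \<Omega>) f * nrm (H10 \<Omega>) v"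
proof -
  have "\<bar>L2_inner \<Omega> f v\<bar> \<le> nrm (L2 \<Omega>) f * nrm (L2 \<Omega>) v"
    using L2.cauchy_schwarz[OF f H10_L2[OF v]] by (simp add: L2.nrm_ip f H10_L2[OF v])
  also have "\<dots> \<le> nrm (L2 \<Omega>) f * nrm (H10 \<Omega>) v"
    by (intro mult_left_mono nrm_L2_le_H10 v L2.nrm_nonneg f)
  finally show ?thesis .
qed

lemma L2_Hm1: "f \<in> car (L2 \<Omega>) \<Longrightarrow> L2_inner \<Omega> f \<in> car (Hm1 \<Omega>)"
  using L2.ip_lin_right[of f \<Omega>] H10_L2 L2_Hm1_bound by (auto simp: Hm1_iff lin_on_def)

lemma nrm_Hm1_diff_le:
  assumes f: "f \<in> car (L2 \<Omega>)" and g: "g \<in> car (L2 \<Omega>)"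
  shows "nrm (Hm1 \<Omega>) (L2_inner \<Omega> f - L2_inner \<Omega> g) \<le> nrm (L2 \<Omega>) (f - g)"
  unfolding Hm1_def
proof (rule H10.dual_nrm_le)
  show "0 \<le> nrm (L2 \<Omega>) (f - g)" by (intro L2.nrm_nonneg L2.mem_diff f g)
  show "\<bar>(L2_inner \<Omega> f - L2_inner \<Omega> g) x\<bar> \<le> nrm (L2 \<Omega>) (f - g) * nrm (H10 \<Omega>) x" if x: "x \<in> car (H10 \<Omega>)" for x
    using L2_Hm1_bound[OF L2.mem_diff[OF f g] x] L2.ip_diff_left[OF f g H10_L2[OF x]] by simp
qed

lemma bdd_bilin_eval: "bdd_bilin (Hm1 \<Omega>) (H10 \<Omega>) (\<lambda>F v. F v)"
  unfolding bdd_bilin_def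
proof (intro conjI ballI exI[of _ 1])
  show "lin_on (car (Hm1 \<Omega>)) (\<lambda>F. F v)" for v
    by (auto simp: lin_on_def scaleR_fun_def)
  show "lin_on (car (H10 \<Omega>)) F" if "F \<in> car (Hm1 \<Omega>)" for F using that by (simp add: Hm1_iff)
qed (use Hm1_le in auto)

lemma bdd_bilin_L2_H10: "bdd_bilin (L2 \<Omega>) (H10 \<Omega>) (L2_inner \<Omega>)"
  unfolding bdd_bilin_def
proof (intro conjI ballI exI[of _ 1])
  show "lin_on (car (L2 \<Omega>)) (\<lambda>f. L2_inner \<Omega> f v)" if "v \<in> car (H10 \<Omega>)" for v
    by (rule L2.ip_lin[OF H10_L2[OF that]])
  show "lin_on (car (H10 \<Omega>)) (L2_inner \<Omega> f)" if "f \<in> car (L2 \<Omega>)" for f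
    using L2.ip_lin_right[OF that] H10_L2 by (auto simp: lin_on_def)
qed (use L2_Hm1_bound in auto)

lemma bdd_bilin_dirichlet: "bdd_bilin (H10 \<Omega>) (H10 \<Omega>) (dirichlet_form \<Omega>)"
  unfolding bdd_bilin_def
proof (intro conjI ballI exI[of _ 1])
  show "lin_on (car (H10 \<Omega>)) (\<lambda>f. dirichlet_form \<Omega> f v)" if "v \<in> car (H10 \<Omega>)" for v
    by (rule dir.ip_lin[OF that])
  show "lin_on (car (H10 \<Omega>)) (dirichlet_form \<Omega> f)" if "f \<in> car (H10 \<Omega>)" for f
    by (rule dir.ip_lin_right[OF that])
  show "\<bar>dirichlet_form \<Omega> f g\<bar> \<le> 1 * nrm (H10 \<Omega>) f * nrm (H10 \<Omega>) g"
    if f: "f \<in> car (H10 \<Omega>)" and g: "g \<in> car (H10 \<Omega>)" for f g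
  proof -
    have le: "sqrt (dirichlet_form \<Omega> f f) \<le> nrm (H10 \<Omega>) f" if "f \<in> car (H10 \<Omega>)" for f
      using H10.nrm_ip[OF that] L2.ip_nonneg[OF H10_L2[OF that]] by (simp add: h1_inner_def)
    have "\<bar>dirichlet_form \<Omega> f g\<bar> \<le> sqrt (dirichlet_form \<Omega> f f) * sqrt (dirichlet_form \<Omega> g g)"
      by (rule dir.cauchy_schwarz[OF f g])
    also have "\<dots> \<le> nrm (H10 \<Omega>) f * nrm (H10 \<Omega>) g"
      by (intro mult_mono le f g H10.nrm_nonneg) (simp add: dirichlet_nonneg)
    finally show ?thesis by simp
  qed
qed auto

end

text \<open>
  The weak solution \<open>w\<close> of \<open>w - \<epsilon>\<Delta>w = F\<close> with zero boundary values. The choice only fixes a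
  representative of an element of \<open>H\<^sup>1\<^sub>0\<close>.
\<close>

definition resolvent :: "'a::euclidean_space set \<Rightarrow> real \<Rightarrow> (('a \<Rightarrow> real) \<Rightarrow> real) \<Rightarrow> 'a \<Rightarrow> real"
  where "resolvent \<Omega> \<epsilon> F = (SOME w. w \<in> car (H10 \<Omega>) \<and> (\<forall>v\<in>car (H10 \<Omega>). h1_inner \<Omega> \<epsilon> w v = F v))"

text \<open>
  The resolvent smooths in space: it maps \<open>H\<^sup>-\<^sup>1\<close> to \<open>H\<^sup>1\<^sub>0\<close>, so the image of a time derivative
  is an admissible test function. It is symmetric and commutes with the Laplacian, hence the
  energy identities survive with the forms below in place of the \<open>L\<^sup>2\<close> inner product and of the
  Dirichlet form.
\<close>

locale resolvent_setting = bounded_open_set +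
  fixes \<epsilon> :: real
  assumes eps: "0 < \<epsilon>" "\<epsilon> \<le> 1"
begin

abbreviation R :: "(('a \<Rightarrow> real) \<Rightarrow> real) \<Rightarrow> 'a \<Rightarrow> real"
  where "R \<equiv> resolvent \<Omega> \<epsilon>"

definition J :: "('a \<Rightarrow> real) \<Rightarrow> 'a \<Rightarrow> real"
  where "J f = R (L2_inner \<Omega> f)"

definition smooth_inner :: "('a \<Rightarrow> real) \<Rightarrow> ('a \<Rightarrow> real) \<Rightarrow> real"
  where "smooth_inner f g = L2_inner \<Omega> f (J g)"

text \<open>
  The form of the Yosida approximation \<open>(I - J) / \<epsilon>\<close> of \<open>- \<Delta>\<close>.
\<close>

definition yosida_form :: "('a \<Rightarrow> real) \<Rightarrow> ('a \<Rightarrow> real) \<Rightarrow> real"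
  where "yosida_form f g = (L2_inner \<Omega> f g - smooth_inner f g) / \<epsilon>"

sublocale he: semi_inner "car (H10 \<Omega>)" "h1_inner \<Omega> \<epsilon>"
  by (rule semi_inner_H10) (use eps in simp)

lemma resolvent_props:
  assumes "F \<in> car (Hm1 \<Omega>)"
  shows "R F \<in> car (H10 \<Omega>)" "v \<in> car (H10 \<Omega>) \<Longrightarrow> h1_inner \<Omega> \<epsilon> (R F) v = F v"
proof -
  have "\<exists>w. w \<in> car (H10 \<Omega>) \<and> (\<forall>v\<in>car (H10 \<Omega>). h1_inner \<Omega> \<epsilon> w v = F v)"
    by (rule elliptic_solution[OF eps assms]) blast
  then have "R F \<in> car (H10 \<Omega>) \<and> (\<forall>v\<in>car (H10 \<Omega>). h1_inner \<Omega> \<epsilon> (R F) v = F v)"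
    unfolding resolvent_def by (rule someI_ex)
  then show "R F \<in> car (H10 \<Omega>)" "v \<in> car (H10 \<Omega>) \<Longrightarrow> h1_inner \<Omega> \<epsilon> (R F) v = F v"
    by blast+
qed

lemma nrm_H10_le:
  assumes w: "w \<in> car (H10 \<Omega>)" and le: "h1_inner \<Omega> \<epsilon> w w \<le> K * nrm (H10 \<Omega>) w"
    and K: "0 \<le> K"
  shows "nrm (H10 \<Omega>) w \<le> K / \<epsilon>"
proof (cases "nrm (H10 \<Omega>) w = 0")
  case True
  then show ?thesis using K eps by simp
next
  case False
  then have pos: "nrm (H10 \<Omega>) w > 0" using H10.nrm_nonneg[OF w] by simp
  have "\<epsilon> * (nrm (H10 \<Omega>) w)\<^sup>2 \<le> K * nrm (H10 \<Omega>) w"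
    using h1_inner_ge[OF eps, of w] le H10.nrm_sq[OF w] by simp
  then have "(\<epsilon> * nrm (H10 \<Omega>) w) * nrm (H10 \<Omega>) w \<le> K * nrm (H10 \<Omega>) w"
    by (simp add: power2_eq_square mult.assoc)
  then have "\<epsilon> * nrm (H10 \<Omega>) w \<le> K" using pos by (rule mult_right_le_imp_le)
  then show ?thesis using eps by (simp add: field_simps)
qed

lemma nrm_R_le:
  assumes F: "F \<in> car (Hm1 \<Omega>)"
  shows "nrm (H10 \<Omega>) (R F) \<le> nrm (Hm1 \<Omega>) F / \<epsilon>"
  using resolvent_props[OF F] Hm1_le[OF F resolvent_props(1)[OF F]]
  by (intro nrm_H10_le Hm1.nrm_nonneg F) auto

lemma R_sym:
  assumes "F \<in> car (Hm1 \<Omega>)" "G \<in> car (Hm1 \<Omega>)"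
  shows "F (R G) = G (R F)"
  using resolvent_props[OF assms(1)] resolvent_props[OF assms(2)] he.ip_sym by metis

sublocale Hm1_form: semi_inner "car (Hm1 \<Omega>)" "\<lambda>F G. F (R G)"
proof
  show "subspace (car (Hm1 \<Omega>))" by (rule Hm1.sub)
  show "lin_on (car (Hm1 \<Omega>)) (\<lambda>F. F (R G))" for G
    by (auto simp: lin_on_def scaleR_fun_def)
  show "F (R G) = G (R F)" if "F \<in> car (Hm1 \<Omega>)" "G \<in> car (Hm1 \<Omega>)" for F G
    by (rule R_sym[OF that])
  show "0 \<le> F (R F)" if "F \<in> car (Hm1 \<Omega>)" for F
    using resolvent_props[OF that] he.ip_nonneg by metis
qed

lemma bdd_bilin_Hm1: "bdd_bilin (Hm1 \<Omega>) (Hm1 \<Omega>) (\<lambda>F G. F (R G))"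
  unfolding bdd_bilin_def
proof (intro conjI ballI exI[of _ "1 / \<epsilon>"])
  show "lin_on (car (Hm1 \<Omega>)) (\<lambda>F. F (R G))" if "G \<in> car (Hm1 \<Omega>)" for G by (rule Hm1_form.ip_lin[OF that])
  show "lin_on (car (Hm1 \<Omega>)) (\<lambda>G. F (R G))" if "F \<in> car (Hm1 \<Omega>)" for F by (rule Hm1_form.ip_lin_right[OF that])
  show "\<bar>F (R G)\<bar> \<le> 1 / \<epsilon> * nrm (Hm1 \<Omega>) F * nrm (Hm1 \<Omega>) G" if F: "F \<in> car (Hm1 \<Omega>)" and G: "G \<in> car (Hm1 \<Omega>)" for F G
    using Hm1_le[OF F resolvent_props(1)[OF G]] mult_left_mono[OF nrm_R_le[OF G] Hm1.nrm_nonneg[OF F]]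
    by (simp add: field_simps)
qed (use eps in auto)

lemma J_props:
  assumes "f \<in> car (L2 \<Omega>)"
  shows "J f \<in> car (H10 \<Omega>)" "v \<in> car (H10 \<Omega>) \<Longrightarrow> h1_inner \<Omega> \<epsilon> (J f) v = L2_inner \<Omega> f v"
  unfolding J_def using resolvent_props[OF L2_Hm1[OF assms]] by auto

lemma J_L2: "f \<in> car (L2 \<Omega>) \<Longrightarrow> J f \<in> car (L2 \<Omega>)"
  by (rule H10_L2[OF J_props(1)])

lemma smooth_inner_le: "f \<in> car (L2 \<Omega>) \<Longrightarrow> smooth_inner f f \<le> L2_inner \<Omega> f f"
proof -
  assume f: "f \<in> car (L2 \<Omega>)"
  have "L2_inner \<Omega> (J f) (J f) \<le> h1_inner \<Omega> \<epsilon> (J f) (J f)"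
    using eps dirichlet_nonneg by (simp add: h1_inner_def)
  also have "\<dots> = L2_inner \<Omega> f (J f)" by (rule J_props(2)[OF f J_props(1)[OF f]])
  finally show ?thesis
    using L2.young[OF f J_L2[OF f]] by (simp add: smooth_inner_def)
qed

sublocale sm: semi_inner "car (L2 \<Omega>)" smooth_inner
proof
  show "subspace (car (L2 \<Omega>))" by (rule L2.sub)
  show "lin_on (car (L2 \<Omega>)) (\<lambda>f. smooth_inner f g)" if "g \<in> car (L2 \<Omega>)" for g
    unfolding smooth_inner_def by (rule L2.ip_lin[OF J_L2[OF that]])
  show "smooth_inner f g = smooth_inner g f" if "f \<in> car (L2 \<Omega>)" "g \<in> car (L2 \<Omega>)" for f g
    unfolding smooth_inner_def J_def by (rule R_sym[OF L2_Hm1[OF that(1)] L2_Hm1[OF that(2)]])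
  show "0 \<le> smooth_inner f f" if "f \<in> car (L2 \<Omega>)" for f
    unfolding smooth_inner_def J_def by (rule Hm1_form.ip_nonneg[OF L2_Hm1[OF that]])
qed

lemma abs_smooth_inner_le:
  assumes f: "f \<in> car (L2 \<Omega>)" and g: "g \<in> car (L2 \<Omega>)"
  shows "\<bar>smooth_inner f g\<bar> \<le> nrm (L2 \<Omega>) f * nrm (L2 \<Omega>) g"
proof -
  have "\<bar>smooth_inner f g\<bar> \<le> sqrt (smooth_inner f f) * sqrt (smooth_inner g g)"
    by (rule sm.cauchy_schwarz[OF f g])
  also have "\<dots> \<le> sqrt (L2_inner \<Omega> f f) * sqrt (L2_inner \<Omega> g g)"
    by (intro mult_mono) (auto intro: smooth_inner_le f g sm.ip_nonneg L2.ip_nonneg)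
  finally show ?thesis by (simp add: L2.nrm_ip f g)
qed

lemma bdd_bilin_smooth: "bdd_bilin (L2 \<Omega>) (L2 \<Omega>) smooth_inner"
  unfolding bdd_bilin_def
  using sm.ip_lin sm.ip_lin_right abs_smooth_inner_le
  by (intro conjI ballI exI[of _ 1]) auto

lemma bdd_bilin_Hm1_L2: "bdd_bilin (Hm1 \<Omega>) (L2 \<Omega>) (\<lambda>F g. F (J g))"
  unfolding bdd_bilin_def
proof (intro conjI ballI exI[of _ "1 / \<epsilon>"])
  have eq: "F (J g) = L2_inner \<Omega> g (R F)" if "F \<in> car (Hm1 \<Omega>)" "g \<in> car (L2 \<Omega>)" for F g
    unfolding J_def by (rule R_sym[OF that(1) L2_Hm1[OF that(2)]])
  show "lin_on (car (Hm1 \<Omega>)) (\<lambda>F. F (J g))" for g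
    by (auto simp: lin_on_def scaleR_fun_def)
  show "lin_on (car (L2 \<Omega>)) (\<lambda>g. F (J g))" if F: "F \<in> car (Hm1 \<Omega>)" for F
    by (rule lin_onI)
       (simp_all add: eq[OF F] L2.mem_add L2.mem_scale L2.ip_add_left L2.ip_scale_left
         H10_L2[OF resolvent_props(1)[OF F]])
  show "\<bar>F (J g)\<bar> \<le> 1 / \<epsilon> * nrm (Hm1 \<Omega>) F * nrm (L2 \<Omega>) g" if F: "F \<in> car (Hm1 \<Omega>)" and g: "g \<in> car (L2 \<Omega>)" for F g
    using L2_Hm1_bound[OF g resolvent_props(1)[OF F]] mult_left_mono[OF nrm_R_le[OF F] L2.nrm_nonneg[OF g]]
    by (simp add: eq[OF F g] field_simps)
qed (use eps in auto)

lemma J_lipschitz: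
  assumes f: "f \<in> car (L2 \<Omega>)" and g: "g \<in> car (L2 \<Omega>)"
  shows "nrm (H10 \<Omega>) (J f - J g) \<le> (1 / \<epsilon>) * nrm (L2 \<Omega>) (f - g)"
proof -
  have w: "J f - J g \<in> car (H10 \<Omega>)" by (intro H10.mem_diff J_props f g)
  have "h1_inner \<Omega> \<epsilon> (J f - J g) (J f - J g) = L2_inner \<Omega> (f - g) (J f - J g)"
    using he.ip_diff_left[OF J_props(1)[OF f] J_props(1)[OF g] w] J_props(2)[OF f w] J_props(2)[OF g w]
      L2.ip_diff_left[OF f g H10_L2[OF w]] by simp
  then have "h1_inner \<Omega> \<epsilon> (J f - J g) (J f - J g) \<le> nrm (L2 \<Omega>) (f - g) * nrm (H10 \<Omega>) (J f - J g)"
    using L2_Hm1_bound[OF L2.mem_diff[OF f g] w] by simp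
  from nrm_H10_le[OF w this L2.nrm_nonneg[OF L2.mem_diff[OF f g]]] show ?thesis by simp
qed

lemma J_bound:
  assumes f: "f \<in> car (L2 \<Omega>)"
  shows "nrm (H10 \<Omega>) (J f) \<le> (1 / \<epsilon>) * nrm (L2 \<Omega>) f"
proof -
  note w = J_props(1)[OF f]
  have "h1_inner \<Omega> \<epsilon> (J f) (J f) \<le> nrm (L2 \<Omega>) f * nrm (H10 \<Omega>) (J f)"
    using J_props(2)[OF f w] L2_Hm1_bound[OF f w] by simp
  from nrm_H10_le[OF w this L2.nrm_nonneg[OF f]] show ?thesis by simp
qed

lemma J_L2_time:
  assumes "h \<in> car (L2_time T (L2 \<Omega>))"
  shows "(\<lambda>t. J (h t)) \<in> car (L2_time T (H10 \<Omega>))"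
  by (rule L2.L2_time_compose[OF assms H10.seminormed_axioms, where C = "1 / \<epsilon>"])
     (use J_props(1) J_lipschitz J_bound in blast)+

lemma dirichlet_J:
  assumes z: "z \<in> car (H10 \<Omega>)" and g: "g \<in> car (L2 \<Omega>)"
  shows "dirichlet_form \<Omega> z (J g) = yosida_form z g"
proof -
  have "h1_inner \<Omega> \<epsilon> (J g) z = L2_inner \<Omega> g z" by (rule J_props(2)[OF g z])
  then show ?thesis
    using eps dirichlet_sym[of z "J g"] L2.ip_sym[OF H10_L2[OF z] g] L2.ip_sym[OF H10_L2[OF z] J_L2[OF g]]
    by (simp add: h1_inner_def yosida_form_def smooth_inner_def field_simps)
qed

sublocale yo: semi_inner "car (L2 \<Omega>)" yosida_form
proof
  show "subspace (car (L2 \<Omega>))" by (rule L2.sub)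
  show "lin_on (car (L2 \<Omega>)) (\<lambda>f. yosida_form f g)" if "g \<in> car (L2 \<Omega>)" for g
    using L2.ip_lin[OF that] sm.ip_lin[OF that]
    by (auto simp: lin_on_def yosida_form_def diff_divide_distrib add_divide_distrib right_diff_distrib)
  show "yosida_form f g = yosida_form g f" if "f \<in> car (L2 \<Omega>)" "g \<in> car (L2 \<Omega>)" for f g
    using that by (simp add: yosida_form_def L2.ip_sym[OF that] sm.ip_sym[OF that])
  show "0 \<le> yosida_form f f" if "f \<in> car (L2 \<Omega>)" for f
    using smooth_inner_le[OF that] eps by (simp add: yosida_form_def)
qed

lemma bdd_bilin_yosida: "bdd_bilin (L2 \<Omega>) (L2 \<Omega>) yosida_form"
  unfolding bdd_bilin_def
proof (intro conjI ballI exI[of _ "2 / \<epsilon>"])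
  show "lin_on (car (L2 \<Omega>)) (\<lambda>f. yosida_form f g)" if "g \<in> car (L2 \<Omega>)" for g by (rule yo.ip_lin[OF that])
  show "lin_on (car (L2 \<Omega>)) (yosida_form f)" if "f \<in> car (L2 \<Omega>)" for f by (rule yo.ip_lin_right[OF that])
  show "\<bar>yosida_form f g\<bar> \<le> 2 / \<epsilon> * nrm (L2 \<Omega>) f * nrm (L2 \<Omega>) g" if f: "f \<in> car (L2 \<Omega>)" and g: "g \<in> car (L2 \<Omega>)" for f g
  proof -
    have "\<bar>L2_inner \<Omega> f g\<bar> \<le> nrm (L2 \<Omega>) f * nrm (L2 \<Omega>) g"
      using L2.cauchy_schwarz[OF f g] by (simp add: L2.nrm_ip f g)
    then have "\<bar>L2_inner \<Omega> f g - smooth_inner f g\<bar> \<le> 2 * (nrm (L2 \<Omega>) f * nrm (L2 \<Omega>) g)"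
      using abs_smooth_inner_le[OF f g] by linarith
    then show ?thesis using eps by (simp add: yosida_form_def field_simps)
  qed
qed (use eps in auto)

text \<open>
  Test the equation of \<open>J z\<close> with \<open>z - J z\<close>.
\<close>

lemma energy_J:
  assumes z: "z \<in> car (H10 \<Omega>)"
  shows "yosida_form z z \<le> dirichlet_form \<Omega> z z"
    and "dirichlet_form \<Omega> (J z) (J z) \<le> dirichlet_form \<Omega> z z"
    and "L2_inner \<Omega> (z - J z) (z - J z) \<le> \<epsilon> * dirichlet_form \<Omega> z z"
proof -
  note zL = H10_L2[OF z] and j = J_props(1)[OF H10_L2[OF z]] and jL = J_L2[OF H10_L2[OF z]]
  have d: "z - J z \<in> car (H10 \<Omega>)" by (rule H10.mem_diff[OF z j])
  have "h1_inner \<Omega> \<epsilon> (J z) (z - J z) = L2_inner \<Omega> z (z - J z)" by (rule J_props(2)[OF zL d])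
  then have key: "\<epsilon> * dirichlet_form \<Omega> (J z) (z - J z) = L2_inner \<Omega> (z - J z) (z - J z)"
    using L2.ip_diff_left[OF zL jL H10_L2[OF d]] by (simp add: h1_inner_def)
  have "0 \<le> \<epsilon> * dirichlet_form \<Omega> (J z) (z - J z)" using key L2.ip_nonneg[OF H10_L2[OF d]] by simp
  then have "0 \<le> dirichlet_form \<Omega> (J z) (z - J z)" using eps by (simp add: zero_le_mult_iff)
  then have le: "dirichlet_form \<Omega> (J z) (J z) \<le> dirichlet_form \<Omega> z (J z)"
    using dir.ip_diff_right[OF z j j] dirichlet_sym[of z "J z"] by simp
  have y: "2 * \<bar>dirichlet_form \<Omega> z (J z)\<bar> \<le> dirichlet_form \<Omega> z z + dirichlet_form \<Omega> (J z) (J z)"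
    by (rule dir.young[OF z j])
  show "dirichlet_form \<Omega> (J z) (J z) \<le> dirichlet_form \<Omega> z z" using le y by linarith
  have le2: "dirichlet_form \<Omega> z (J z) \<le> dirichlet_form \<Omega> z z" using le y by linarith
  then show "yosida_form z z \<le> dirichlet_form \<Omega> z z" using dirichlet_J[OF z zL] by simp
  have "dirichlet_form \<Omega> (J z) (z - J z) \<le> dirichlet_form \<Omega> z z"
    using dir.ip_diff_right[OF z j j] dirichlet_sym[of z "J z"] dirichlet_nonneg[of "J z"] le2 by simp
  then show "L2_inner \<Omega> (z - J z) (z - J z) \<le> \<epsilon> * dirichlet_form \<Omega> z z"
    unfolding key[symmetric] using eps by (intro mult_left_mono) auto
qed

end

context bounded_open_set
begin

text \<open>
  The difference to the limit is \<open>\<epsilon>\<close> times the Yosida form. This is at most the squared \<open>L\<^sup>2\<close> norm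
  and, for test functions, at most \<open>\<epsilon>\<close> times the Dirichlet energy; test functions are dense.
\<close>

lemma smooth_inner_tendsto:
  assumes f: "f \<in> car (L2 \<Omega>)"
  shows "(\<lambda>n. resolvent_setting.smooth_inner \<Omega> (1 / real (Suc n)) f f) \<longlonglongrightarrow> L2_inner \<Omega> f f"
proof (rule LIMSEQ_I)
  fix d :: real assume d: "d > 0"
  obtain \<phi> where \<phi>: "\<phi> \<in> test_functions \<Omega>" "L2_inner \<Omega> (f - \<phi>) (f - \<phi>) < d / 4"
    using test_functions_dense_L2[OF op lm f, of "d / 4"] d by auto
  have p: "\<phi> \<in> car (H10 \<Omega>)" "\<phi> \<in> car (L2 \<Omega>)" using test_function_H10[OF \<phi>(1)] H10_L2 by auto
  have fp: "f - \<phi> \<in> car (L2 \<Omega>)" by (rule L2.mem_diff[OF f p(2)])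
  have "(\<lambda>n. 2 * (1 / real (Suc n)) * dirichlet_form \<Omega> \<phi> \<phi>) \<longlonglongrightarrow> 2 * 0 * dirichlet_form \<Omega> \<phi> \<phi>"
    by (intro tendsto_intros LIMSEQ_Suc[OF lim_1_over_n])
  then have "\<forall>\<^sub>F n in sequentially. 2 * (1 / real (Suc n)) * dirichlet_form \<Omega> \<phi> \<phi> < d / 2"
    using d by (intro order_tendstoD) auto
  then obtain N where N: "\<And>n. n \<ge> N \<Longrightarrow> 2 * (1 / real (Suc n)) * dirichlet_form \<Omega> \<phi> \<phi> < d / 2"
    by (auto simp: eventually_sequentially)
  have "norm (resolvent_setting.smooth_inner \<Omega> (1 / real (Suc n)) f f - L2_inner \<Omega> f f) < d" if "n \<ge> N" for n
  proof -
    define e where "e = 1 / real (Suc n)"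
    interpret r: resolvent_setting \<Omega> e by unfold_locales (auto simp: e_def)
    have a: "r.yosida_form f f \<le> 2 * r.yosida_form (f - \<phi>) (f - \<phi>) + 2 * r.yosida_form \<phi> \<phi>"
      using r.yo.ip_add_le[OF fp p(2)] by simp
    have "e * r.yosida_form f f \<le> e * (2 * r.yosida_form (f - \<phi>) (f - \<phi>) + 2 * dirichlet_form \<Omega> \<phi> \<phi>)"
      using a r.energy_J(1)[OF p(1)] r.eps by (intro mult_left_mono) auto
    also have "\<dots> = 2 * (e * r.yosida_form (f - \<phi>) (f - \<phi>)) + 2 * e * dirichlet_form \<Omega> \<phi> \<phi>"
      by (simp add: algebra_simps)
    also have "e * r.yosida_form (f - \<phi>) (f - \<phi>) \<le> L2_inner \<Omega> (f - \<phi>) (f - \<phi>)"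
      using r.sm.ip_nonneg[OF fp] r.eps by (simp add: r.yosida_form_def)
    finally have "e * r.yosida_form f f < d" using \<phi>(2) N[OF that] by (simp add: e_def)
    moreover have "e * r.yosida_form f f = L2_inner \<Omega> f f - r.smooth_inner f f"
      using r.eps by (simp add: r.yosida_form_def)
    ultimately have "L2_inner \<Omega> f f - r.smooth_inner f f < d" by simp
    then show ?thesis using r.smooth_inner_le[OF f] by (simp add: e_def)
  qed
  then show "\<exists>N. \<forall>n\<ge>N. norm (resolvent_setting.smooth_inner \<Omega> (1 / real (Suc n)) f f - L2_inner \<Omega> f f) < d"
    by blast
qed

text \<open>
  The difference to the limit is the Dirichlet form of \<open>z - J z\<close> and \<open>z\<close>. The first has bounded
  energy and tends to 0 in \<open>L\<^sup>2\<close>, so \<open>dirichlet_L2_bound\<close> applies.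
\<close>

lemma yosida_form_tendsto:
  assumes z: "z \<in> car (H10 \<Omega>)"
  shows "(\<lambda>n. resolvent_setting.yosida_form \<Omega> (1 / real (Suc n)) z z) \<longlonglongrightarrow> dirichlet_form \<Omega> z z"
proof (rule LIMSEQ_I)
  fix d :: real assume d: "d > 0"
  define E where "E = dirichlet_form \<Omega> z z"
  have E: "0 \<le> E" by (simp add: E_def dirichlet_nonneg)
  define k where "k = 2 * sqrt E + 1"
  define \<delta> where "\<delta> = d / (2 * k)"
  have q: "k > 0" using real_sqrt_ge_zero[OF E] unfolding k_def by linarith
  have \<delta>: "\<delta> > 0" using d q by (simp add: \<delta>_def)
  obtain C where C: "C \<ge> 0" "\<And>w. w \<in> car (H10 \<Omega>) \<Longrightarrow>
    \<bar>dirichlet_form \<Omega> w z\<bar> \<le> \<delta> * sqrt (dirichlet_form \<Omega> w w) + C * sqrt (L2_inner \<Omega> w w)"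
    using dirichlet_L2_bound[OF z \<delta>] by blast
  have "(\<lambda>n. C * sqrt ((1 / real (Suc n)) * E)) \<longlonglongrightarrow> C * sqrt (0 * E)"
    by (intro tendsto_intros LIMSEQ_Suc[OF lim_1_over_n])
  then have "\<forall>\<^sub>F n in sequentially. C * sqrt ((1 / real (Suc n)) * E) < d / 2"
    using d by (intro order_tendstoD) auto
  then obtain N where N: "\<And>n. n \<ge> N \<Longrightarrow> C * sqrt ((1 / real (Suc n)) * E) < d / 2"
    by (auto simp: eventually_sequentially)
  have "norm (resolvent_setting.yosida_form \<Omega> (1 / real (Suc n)) z z - dirichlet_form \<Omega> z z) < d" if "n \<ge> N" for n
  proof -
    define e where "e = 1 / real (Suc n)"
    interpret r: resolvent_setting \<Omega> e by unfold_locales (auto simp: e_def)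
    note zL = H10_L2[OF z] and j = r.J_props(1)[OF H10_L2[OF z]]
    have w: "z - r.J z \<in> car (H10 \<Omega>)" by (rule H10.mem_diff[OF z j])
    have "dirichlet_form \<Omega> (z - r.J z) z = dirichlet_form \<Omega> z z - r.yosida_form z z"
      using dir.ip_diff_left[OF z j z] dirichlet_sym[of z "r.J z"] r.dirichlet_J[OF z zL] by simp
    moreover have "dirichlet_form \<Omega> (z - r.J z) (z - r.J z) \<le> 4 * E"
      using dir.ip_diff_le[OF z j] r.energy_J(2)[OF z] by (simp add: E_def)
    then have "\<delta> * sqrt (dirichlet_form \<Omega> (z - r.J z) (z - r.J z)) \<le> \<delta> * (2 * sqrt E)"
      using \<delta> real_sqrt_le_mono[of _ "4 * E"] by (intro mult_left_mono) (auto simp: real_sqrt_mult)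
    moreover have "\<delta> * (2 * sqrt E) \<le> \<delta> * k" using \<delta> by (intro mult_left_mono) (auto simp: k_def)
    moreover have "\<delta> * k = d / 2" using q by (simp add: \<delta>_def)
    moreover have "C * sqrt (L2_inner \<Omega> (z - r.J z) (z - r.J z)) \<le> C * sqrt (e * E)"
      using r.energy_J(3)[OF z] C(1) by (intro mult_left_mono real_sqrt_le_mono) (auto simp: E_def)
    ultimately have "\<bar>dirichlet_form \<Omega> z z - r.yosida_form z z\<bar> < d"
      using C(2)[OF w] N[OF that] unfolding e_def by linarith
    then show ?thesis by (simp add: e_def abs_minus_commute)
  qed
  then show "\<exists>N. \<forall>n\<ge>N. norm (resolvent_setting.yosida_form \<Omega> (1 / real (Suc n)) z z - dirichlet_form \<Omega> z z) < d"
    by blast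
qed

end

section \<open>Weak time derivatives and the product rule\<close>

lemma has_bochner_integral_in_dual:
  assumes X: "seminormed X" and f: "has_bochner_integral_in (time_measure T) X f I" and F: "F \<in> car (dual X)"
  shows "(LINT t|time_measure T. F (f t)) = F I"
proof -
  let ?M = "time_measure T"
  interpret X: seminormed X by fact
  obtain C where C: "\<And>x. x \<in> car X \<Longrightarrow> \<bar>F x\<bar> \<le> C * nrm X x" and lin: "lin_on (car X) F"
    using F by (auto simp: dual_iff)
  have F0: "F 0 = 0" by (rule lin_on_zero[OF X.sub lin])
  obtain s where sm: "strongly_measurable ?M X f" and I: "I \<in> car X"
    and s: "\<And>n. Bochner_Integration.simple_bochner_integrable ?M (s n)" "\<And>n. s n ` space ?M \<subseteq> car X"
      "(\<lambda>n. \<integral>\<^sup>+t. ennreal (nrm X (f t - s n t)) \<partial>?M) \<longlonglongrightarrow> 0"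
      "(\<lambda>n. nrm X (Bochner_Integration.simple_bochner_integral ?M (s n) - I)) \<longlonglongrightarrow> 0"
    using f by (auto simp: has_bochner_integral_in_def)
  have sf: "simple_function ?M (s n)" for n
    using s(1)[of n] by (auto elim: Bochner_Integration.simple_bochner_integrable.cases)
  have fc: "AE t in ?M. f t \<in> car X" using sm by (simp add: strongly_measurable_def)
  have Fsb: "Bochner_Integration.simple_bochner_integrable ?M (\<lambda>t. F (s n t))" for n
    using simple_bochner_integrable_compose2[of "\<lambda>x y. F x", OF F0 s(1)[of n] s(1)[of n]] .
  have simple: "Bochner_Integration.simple_bochner_integral ?M (\<lambda>t. F (s n t)) =
      F (Bochner_Integration.simple_bochner_integral ?M (s n))" for n
  proof -
    have "Bochner_Integration.simple_bochner_integral ?M (\<lambda>t. F (s n t)) =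
        (\<Sum>y\<in>s n ` space ?M. measure ?M {x\<in>space ?M. s n x = y} *\<^sub>R F y)"
      by (rule simple_bochner_integral_partition[OF Fsb sf[of n]]) auto
    also have "\<dots> = (\<Sum>y\<in>s n ` space ?M. F (measure ?M {x\<in>space ?M. s n x = y} *\<^sub>R y))"
      using s(2)[of n] by (intro sum.cong refl) (auto simp: lin_on_scale[OF lin] subset_iff)
    also have "\<dots> = F (Bochner_Integration.simple_bochner_integral ?M (s n))"
      unfolding simple_bochner_integral_def
      using simple_functionD(1)[OF sf[of n]] s(2)[of n] X.mem_scale
      by (intro lin_on_sum[OF X.sub lin, symmetric]) auto
    finally show ?thesis .
  qed
  have car: "Bochner_Integration.simple_bochner_integral ?M (s n) \<in> car X" for n
    unfolding simple_bochner_integral_def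
    by (intro X.mem_sum X.mem_scale) (use s(2)[of n] in blast)
  have meas: "(\<lambda>t. F (f t)) \<in> borel_measurable ?M"
  proof -
    have "bdd_bilin X real_sp (\<lambda>x y. F x * y)"
      unfolding bdd_bilin_def
    proof (intro conjI ballI exI[of _ "\<bar>C\<bar>"])
      show "\<bar>F x * y\<bar> \<le> \<bar>C\<bar> * nrm X x * nrm real_sp y" if "x \<in> car X" for x y
      proof -
        have "\<bar>F x\<bar> \<le> \<bar>C\<bar> * nrm X x"
          by (rule order_trans[OF C[OF that] mult_right_mono[OF abs_ge_self X.nrm_nonneg[OF that]]])
        then show ?thesis by (simp add: abs_mult mult_right_mono)
      qed
    qed (use lin in \<open>auto simp: lin_on_def algebra_simps\<close>)
    from bdd_bilin_measurable[OF _ X seminormed_real_sp this sm, of "\<lambda>_. 1"]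
    show ?thesis by (simp add: strongly_measurable_real_iff)
  qed
  have "has_bochner_integral ?M (\<lambda>t. F (f t)) (F I)"
  proof (rule has_bochner_integral.intros[OF meas Fsb])
    have "(\<lambda>n. ennreal \<bar>C\<bar> * (\<integral>\<^sup>+t. ennreal (nrm X (f t - s n t)) \<partial>?M)) \<longlonglongrightarrow> ennreal \<bar>C\<bar> * 0"
      by (intro ennreal_tendsto_cmult s) simp
    then have lim: "(\<lambda>n. ennreal \<bar>C\<bar> * (\<integral>\<^sup>+t. ennreal (nrm X (f t - s n t)) \<partial>?M)) \<longlonglongrightarrow> 0" by simp
    have le: "(\<integral>\<^sup>+t. ennreal (norm (F (f t) - F (s n t))) \<partial>?M) \<le> ennreal \<bar>C\<bar> * (\<integral>\<^sup>+t. ennreal (nrm X (f t - s n t)) \<partial>?M)" for n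
    proof -
      have diff: "strongly_measurable ?M X (\<lambda>t. f t + (- 1) *\<^sub>R s n t)"
      proof (intro X.strongly_measurable_add sm)
        have "(\<lambda>t. (- 1) *\<^sub>R s n t) ` space ?M \<subseteq> car X" using s(2)[of n] X.mem_scale by blast
        moreover have "simple_function ?M (\<lambda>t. (- 1) *\<^sub>R s n t)"
          by (rule simple_function_compose1[OF sf])
        ultimately show "strongly_measurable ?M X (\<lambda>t. (- 1) *\<^sub>R s n t)"
          unfolding strongly_measurable_def
          by (intro conjI exI[of _ "\<lambda>_ t. (- 1) *\<^sub>R s n t"]) (auto intro!: AE_I2)
      qed
      have dm: "(\<lambda>t. nrm X (f t - s n t)) \<in> borel_measurable ?M"
        using X.nrm_measurable[OF _ diff] by simp
      have "(\<integral>\<^sup>+t. ennreal (norm (F (f t) - F (s n t))) \<partial>?M) \<le> (\<integral>\<^sup>+t. ennreal \<bar>C\<bar> * ennreal (nrm X (f t - s n t)) \<partial>?M)"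
      proof (rule nn_integral_mono_AE, use fc AE_space in eventually_elim)
        fix t assume t: "f t \<in> car X" "t \<in> space ?M"
        have st: "s n t \<in> car X" using s(2)[of n] t(2) by blast
        note d = X.mem_diff[OF t(1) st]
        have "\<bar>F (f t) - F (s n t)\<bar> \<le> C * nrm X (f t - s n t)"
          using C[OF d] lin_on_diff[OF X.sub lin t(1) st] by simp
        also have "\<dots> \<le> \<bar>C\<bar> * nrm X (f t - s n t)"
          by (intro mult_right_mono X.nrm_nonneg d) auto
        finally show "ennreal (norm (F (f t) - F (s n t))) \<le> ennreal \<bar>C\<bar> * ennreal (nrm X (f t - s n t))"
          using X.nrm_nonneg[OF d] by (simp add: ennreal_mult[symmetric] ennreal_leI)
      qed
      also have "\<dots> = ennreal \<bar>C\<bar> * (\<integral>\<^sup>+t. ennreal (nrm X (f t - s n t)) \<partial>?M)"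
        using dm by (intro nn_integral_cmult) auto
      finally show ?thesis .
    qed
    show "(\<lambda>n. \<integral>\<^sup>+t. ennreal (norm (F (f t) - F (s n t))) \<partial>?M) \<longlonglongrightarrow> 0"
      by (rule tendsto_sandwich[OF always_eventually always_eventually tendsto_const lim]) (use le in auto)
    show "(\<lambda>n. Bochner_Integration.simple_bochner_integral ?M (\<lambda>t. F (s n t))) \<longlonglongrightarrow> F I"
      unfolding simple
    proof -
      have "(\<lambda>n. C * nrm X (Bochner_Integration.simple_bochner_integral ?M (s n) - I)) \<longlonglongrightarrow> C * 0"
        by (intro tendsto_intros s)
      then have lim: "(\<lambda>n. C * nrm X (Bochner_Integration.simple_bochner_integral ?M (s n) - I)) \<longlonglongrightarrow> 0" by simp
      have "\<bar>F (Bochner_Integration.simple_bochner_integral ?M (s n)) - F I\<bar> \<le> C * nrm X (Bochner_Integration.simple_bochner_integral ?M (s n) - I)" for n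
        using C[OF X.mem_diff[OF car[of n] I]] lin_on_diff[OF X.sub lin car[of n] I] by simp
      then have "(\<lambda>n. \<bar>F (Bochner_Integration.simple_bochner_integral ?M (s n)) - F I\<bar>) \<longlonglongrightarrow> 0"
        by (intro tendsto_sandwich[OF always_eventually always_eventually tendsto_const lim]) auto
      then show "(\<lambda>n. F (Bochner_Integration.simple_bochner_integral ?M (s n))) \<longlonglongrightarrow> F I"
        using LIM_zero_iff tendsto_rabs_zero_iff by blast
    qed
  qed
  then show ?thesis by (rule has_bochner_integral_integral_eq)
qed

lemma deriv_eq_frechet_derivative:
  assumes \<phi>: "\<phi> \<in> test_functions U"
  shows "deriv \<phi> = (\<lambda>x. frechet_derivative \<phi> (at x) 1)"
proof
  fix x
  obtain D where D: "(\<phi> has_field_derivative D) (at x)"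
    using test_function_props(2)[OF \<phi>, of x] by (auto simp: real_differentiable_def)
  have "(*) D = frechet_derivative \<phi> (at x)"
    by (rule frechet_derivative_at) (use D in \<open>simp add: has_field_derivative_def\<close>)
  then show "deriv \<phi> x = frechet_derivative \<phi> (at x) 1"
    using DERIV_imp_deriv[OF D] by (metis mult.right_neutral)
qed

lemma borel_measurable_deriv_test:
  assumes \<phi>: "\<phi> \<in> test_functions U"
  shows "deriv \<phi> \<in> borel_measurable (lebesgue_on S)"
proof -
  have "continuous_on UNIV (deriv \<phi>)"
    unfolding deriv_eq_frechet_derivative[OF \<phi>] using test_function_props(3)[OF \<phi>, of 1] by simp
  then show ?thesis
    using borel_measurable_continuous_onI by (intro measurable_restrict_space1 measurable_completion) auto
qed

lemma weak_time_deriv_dual: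
  assumes X: "seminormed X" and d: "has_weak_time_deriv T X v w" and F: "F \<in> car (dual X)"
    and v: "AE t in time_measure T. v t \<in> car X" and w: "AE t in time_measure T. w t \<in> car X"
    and \<phi>: "\<phi> \<in> test_functions {0<..<T}"
    and vm: "(\<lambda>t. F (v t)) \<in> borel_measurable (time_measure T)" and wm: "(\<lambda>t. F (w t)) \<in> borel_measurable (time_measure T)"
  shows "(LINT t|time_measure T. deriv \<phi> t * F (v t)) = - (LINT t|time_measure T. \<phi> t * F (w t))"
proof -
  let ?M = "time_measure T"
  interpret X: seminormed X by fact
  have lin: "lin_on (car X) F" using F by (simp add: dual_iff)
  obtain I where I: "has_bochner_integral_in ?M X (\<lambda>t. deriv \<phi> t *\<^sub>R v t) I"
    "has_bochner_integral_in ?M X (\<lambda>t. \<phi> t *\<^sub>R w t) (- I)"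
    using d \<phi> by (auto simp: has_weak_time_deriv_def)
  have Ic: "I \<in> car X" using I(1) by (simp add: has_bochner_integral_in_def)
  note dm = borel_measurable_deriv_test[OF \<phi>]
  have pm: "\<phi> \<in> borel_measurable ?M" by (rule borel_measurable_test_function(2)[OF \<phi>])
  have "(LINT t|?M. deriv \<phi> t * F (v t)) = (LINT t|?M. F (deriv \<phi> t *\<^sub>R v t))"
  proof (rule Bochner_Integration.integral_cong_AE)
    show e: "AE t in ?M. deriv \<phi> t * F (v t) = F (deriv \<phi> t *\<^sub>R v t)"
      using v by eventually_elim (simp add: lin_on_scale[OF lin])
    show m: "(\<lambda>t. deriv \<phi> t * F (v t)) \<in> borel_measurable ?M" using dm vm by measurable
    show "(\<lambda>t. F (deriv \<phi> t *\<^sub>R v t)) \<in> borel_measurable ?M"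
      by (rule borel_measurable_AE_LIMSEQ[of _ "\<lambda>_ t. deriv \<phi> t * F (v t)"]) (use m e in auto)
  qed
  also have "\<dots> = F I" by (rule has_bochner_integral_in_dual[OF X I(1) F])
  also have "\<dots> = - F (- I)" by (simp add: lin_on_minus[OF lin Ic])
  also have "F (- I) = (LINT t|?M. F (\<phi> t *\<^sub>R w t))" by (rule has_bochner_integral_in_dual[OF X I(2) F, symmetric])
  also have "\<dots> = (LINT t|?M. \<phi> t * F (w t))"
  proof (rule Bochner_Integration.integral_cong_AE)
    show e: "AE t in ?M. F (\<phi> t *\<^sub>R w t) = \<phi> t * F (w t)"
      using w by eventually_elim (simp add: lin_on_scale[OF lin])
    show m: "(\<lambda>t. \<phi> t * F (w t)) \<in> borel_measurable ?M" using pm wm by measurable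
    show "(\<lambda>t. F (\<phi> t *\<^sub>R w t)) \<in> borel_measurable ?M"
      by (rule borel_measurable_AE_LIMSEQ[of _ "\<lambda>_ t. \<phi> t * F (w t)"]) (use m e in auto)
  qed
  finally show ?thesis .
qed

text \<open>
  A step from 0 to 1 inside \<open>[a, b]\<close> together with its derivative. Only the derivative is built from
  the elementary smooth functions; the step itself is an integral.
\<close>

definition is_smooth_step :: "real \<Rightarrow> real \<Rightarrow> (real \<Rightarrow> real) \<Rightarrow> (real \<Rightarrow> real) \<Rightarrow> bool"
  where "is_smooth_step a b \<beta> P \<longleftrightarrow> smooth_expr \<beta> \<and> (\<forall>x. 0 \<le> \<beta> x) \<and> (\<forall>x. x \<notin> {a..b} \<longrightarrow> \<beta> x = 0) \<and>
    (\<forall>x. (P has_real_derivative \<beta> x) (at x)) \<and> (\<forall>x\<le>a. P x = 0) \<and> (\<forall>x\<ge>b. P x = 1) \<and>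
    (\<forall>x. 0 \<le> P x \<and> P x \<le> 1)"

lemma is_smooth_stepD:
  assumes "is_smooth_step a b \<beta> P"
  shows "smooth_expr \<beta>" "\<And>x. 0 \<le> \<beta> x" "\<And>x. x \<notin> {a..b} \<Longrightarrow> \<beta> x = 0"
    "\<And>x. (P has_real_derivative \<beta> x) (at x)" "\<And>x. x \<le> a \<Longrightarrow> P x = 0" "\<And>x. b \<le> x \<Longrightarrow> P x = 1"
    "\<And>x. 0 \<le> P x \<and> P x \<le> 1"
  using assms by (auto simp: is_smooth_step_def)

lemma smooth_step_exists:
  fixes a b :: real
  assumes ab: "a < b"
  shows "\<exists>\<beta> P. is_smooth_step a b \<beta> P"
proof -
  define \<gamma> where "\<gamma> x = flat 0 (x \<bullet> 1 - a) * flat 0 (x \<bullet> (- 1) - - b)" for x :: real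
  have sm: "smooth_expr \<gamma>" unfolding \<gamma>_def[abs_def] by (intro smooth_expr.intros)
  have c: "continuous_on UNIV \<gamma>" by (rule C_k_continuous[OF smooth_expr_C_k[OF sm, of 0]])
  have nn: "0 \<le> \<gamma> x" for x by (simp add: \<gamma>_def flat_0_bounds)
  have out: "\<gamma> x = 0" if "x \<notin> {a<..<b}" for x using that by (auto simp: \<gamma>_def flat_def)
  define Q where "Q x = integral {a - 1..x} \<gamma>" for x
  have Q0: "Q x = 0" if "x \<le> a - 1" for x
    using that by (cases "x = a - 1") (auto simp: Q_def)
  have dQ: "(Q has_real_derivative \<gamma> x) (at x)" for x
  proof (cases "x > a - 1")
    case True
    have "(Q has_real_derivative \<gamma> x) (at x within {a - 1..x + 1})"
      unfolding Q_def[abs_def]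
      by (rule integral_has_real_derivative) (use True in \<open>auto intro: continuous_on_subset[OF c]\<close>)
    then show ?thesis using True by (simp add: at_within_Icc_at)
  next
    case False
    show ?thesis
    proof (cases "x < a - 1")
      case True
      show ?thesis
        by (rule has_field_derivative_transform_within_open[of "\<lambda>_. 0" _ _ "{..<a - 1}"])
           (use True out Q0 in auto)
    next
      case F: False
      then have x: "x = a - 1" using False by simp
      have z: "Q y = 0" if "y < a" for y
      proof (cases "y \<le> a - 1")
        case f: False
        have "Q y = integral {a - 1..y} (\<lambda>_. 0)"
          unfolding Q_def using that out by (intro Henstock_Kurzweil_Integration.integral_cong) auto
        then show ?thesis by simp
      qed (rule Q0)
      show ?thesis
        by (rule has_field_derivative_transform_within_open[of "\<lambda>_. 0" _ _ "{..<a}"])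
           (use x out z in auto)
    qed
  qed
  have mono: "Q x \<le> Q y" if "x \<le> y" for x y
    using DERIV_nonneg_imp_nondecreasing[OF that, of Q] dQ nn by blast
  have const: "Q x = Q y" if "x \<le> y" "\<And>z. x \<le> z \<Longrightarrow> z \<le> y \<Longrightarrow> \<gamma> z = 0" for x y
  proof -
    have "Q x \<ge> Q y"
      using DERIV_nonpos_imp_nonincreasing[OF that(1), of Q] dQ that(2) by force
    then show ?thesis using mono[OF that(1)] by simp
  qed
  have Qa: "Q x = 0" if "x \<le> a" for x
  proof (cases "x \<le> a - 1")
    case False
    have "Q (a - 1) = Q x" using False that by (intro const out) auto
    then show ?thesis using Q0[of "a - 1"] by simp
  qed (rule Q0)
  have Qb: "Q x = Q b" if "b \<le> x" for x
    using const[OF that] out by auto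
  define m where "m = (a + b) / 2"
  have m: "a < m" "m < b" using ab by (auto simp: m_def)
  have "\<gamma> m > 0" using m by (simp add: \<gamma>_def flat_def)
  from DERIV_pos_inc_right[OF dQ this] obtain d where d: "d > 0" "\<And>h. h > 0 \<Longrightarrow> h < d \<Longrightarrow> Q m < Q (m + h)" by blast
  have "Q m < Q (m + min (d/2) (b - m))" using d(1) m by (intro d(2)) auto
  also have "\<dots> \<le> Q b" by (rule mono) auto
  finally have Z: "Q b > 0" using mono[OF less_imp_le[OF m(1)]] Qa[of a] by simp
  show ?thesis
    unfolding is_smooth_step_def
  proof (rule exI[of _ "\<lambda>x. (1 / Q b) * \<gamma> x"], rule exI[of _ "\<lambda>x. (1 / Q b) * Q x"], intro conjI allI impI)
    show "smooth_expr (\<lambda>x. (1 / Q b) * \<gamma> x)" by (intro smooth_expr.mult smooth_expr.const sm)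
    show "((\<lambda>x. (1 / Q b) * Q x) has_real_derivative (1 / Q b) * \<gamma> x) (at x)" for x
      by (rule DERIV_cmult[OF dQ])
    show "0 \<le> (1 / Q b) * Q x" "(1 / Q b) * Q x \<le> 1" for x
    proof -
      have "0 \<le> Q x" using mono[of "min a x" x] Qa[of "min a x"] by simp
      moreover have "Q x \<le> Q b" using mono[of x "max b x"] Qb[of "max b x"] by simp
      ultimately show "0 \<le> (1 / Q b) * Q x" "(1 / Q b) * Q x \<le> 1" using Z by simp_all
    qed
    show "0 \<le> (1 / Q b) * \<gamma> x" for x using Z nn[of x] by simp
    show "(1 / Q b) * \<gamma> x = 0" if "x \<notin> {a..b}" for x using out[of x] that by fastforce
    show "(1 / Q b) * Q x = 0" if "x \<le> a" for x using Qa[OF that] by simp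
    show "(1 / Q b) * Q x = 1" if "b \<le> x" for x using Qb[OF that] Z by simp
  qed
qed

lemma AE_time_neq: "AE r in time_measure T. r \<noteq> t"
  by (rule AE_lebesgue_on_mono[OF _ AE_completion[OF AE_lborel_singleton]]) auto

lemma LINT_derivative_time:
  assumes d: "\<And>x. (P has_real_derivative \<beta> x) (at x)" and c: "continuous_on UNIV \<beta>" and T: "0 \<le> T"
  shows "(LINT t|time_measure T. \<beta> t) = P T - P 0" "integrable (time_measure T) \<beta>"
proof -
  have "(\<beta> has_integral P T - P 0) {0..T}"
    using d by (intro fundamental_theorem_of_calculus T)
      (auto simp: has_real_derivative_iff_has_vector_derivative[symmetric] intro: has_field_derivative_at_within)
  then have hi: "(\<beta> has_integral P T - P 0) {0<..<T}"
    using has_integral_open_interval[of \<beta> "P T - P 0" 0 T] by simp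
  have "set_integrable lebesgue {0..T} \<beta>"
    using c by (intro absolutely_integrable_continuous_real) (auto intro: continuous_on_subset)
  then have "set_integrable lebesgue {0<..<T} \<beta>"
    by (rule set_integrable_subset) auto
  then show i: "integrable (time_measure T) \<beta>" by (simp add: integrable_restrict_space set_integrable_def)
  show "(LINT t|time_measure T. \<beta> t) = P T - P 0"
    using lebesgue_integral_eq_integral[OF i] hi by (simp add: integral_unique)
qed

text \<open>
  Test with smooth approximations of the indicator of \<open>(s, t)\<close>, whose derivatives approximate
  point evaluations at \<open>s\<close> and \<open>t\<close>.
\<close>

lemma weak_derivative_integral:
  fixes H G :: "real \<Rightarrow> real"
  assumes H: "continuous_on {0..T} H" and G: "integrable (time_measure T) G"
    and weak: "\<And>\<phi>. \<phi> \<in> test_functions {0<..<T} \<Longrightarrow>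
      (LINT t|time_measure T. deriv \<phi> t * H t) = - (LINT t|time_measure T. \<phi> t * G t)"
    and st: "0 \<le> s" "s \<le> t" "t \<le> T"
  shows "H t - H s = (LINT r|time_measure T. indicator {s<..t} r * G r)"
proof (cases "s = t")
  case True
  then show ?thesis by simp
next
  case False
  then have lt: "s < t" using st by simp
  let ?M = "time_measure T"
  define h where "h n = (t - s) / (4 + real n)" for n
  have h: "0 < h n" "4 * h n \<le> t - s" for n
  proof -
    show "0 < h n" using lt by (simp add: h_def)
    have "h n \<le> (t - s) / 4" unfolding h_def using lt by (intro divide_left_mono) auto
    then show "4 * h n \<le> t - s" by simp
  qed
  have "(\<lambda>n. (t - s) * inverse (4 + real n)) \<longlonglongrightarrow> (t - s) * 0"
    by (intro tendsto_intros tendsto_inverse_0_at_top filterlim_tendsto_add_at_top[OF tendsto_const filterlim_real_sequentially])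
  then have h0: "h \<longlonglongrightarrow> 0" by (simp add: h_def[abs_def] divide_inverse)
  have "\<exists>\<beta> P. is_smooth_step (s + h n) (s + 2 * h n) \<beta> P" "\<exists>\<beta> P. is_smooth_step (t - 2 * h n) (t - h n) \<beta> P" for n
    using h(1)[of n] by (intro smooth_step_exists, simp)+
  then obtain \<beta> P \<beta>' P' where st1: "\<And>n. is_smooth_step (s + h n) (s + 2 * h n) (\<beta> n) (P n)"
    and st2: "\<And>n. is_smooth_step (t - 2 * h n) (t - h n) (\<beta>' n) (P' n)"
    by metis
  note b = is_smooth_stepD[OF st1] and b' = is_smooth_stepD[OF st2]
  have P: "x \<le> s + h n \<Longrightarrow> P n x = 0" "s + 2 * h n \<le> x \<Longrightarrow> P n x = 1" "0 \<le> P n x \<and> P n x \<le> 1" for n x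
    using b(5-7) by blast+
  have P': "x \<le> t - 2 * h n \<Longrightarrow> P' n x = 0" "t - h n \<le> x \<Longrightarrow> P' n x = 1" "0 \<le> P' n x \<and> P' n x \<le> 1" for n x
    using b'(5-7) by blast+
  define \<phi> where "\<phi> n x = P n x - P' n x" for n x
  have d\<phi>: "(\<phi> n has_real_derivative \<beta> n x - \<beta>' n x) (at x)" for n x
    unfolding \<phi>_def[abs_def] by (rule DERIV_diff[OF b(4) b'(4)])
  have deriv\<phi>: "deriv (\<phi> n) x = \<beta> n x - \<beta>' n x" for n x by (rule DERIV_imp_deriv[OF d\<phi>])
  have \<phi>0: "\<phi> n x = 0" if "x \<notin> {s + h n..t - h n}" for n x
  proof (cases "x < s + h n")
    case True
    then show ?thesis using P(1)[of x n] P'(1)[of x n] h[of n] by (simp add: \<phi>_def)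
  next
    case False
    then have "t - h n < x" using that by auto
    then show ?thesis using P(2)[of n x] P'(2)[of n x] h[of n] by (simp add: \<phi>_def)
  qed
  have test: "\<phi> n \<in> test_functions {0<..<T}" for n
  proof -
    have fd: "frechet_derivative (\<phi> n) (at x) 1 = \<beta> n x + (- 1) * \<beta>' n x" for x
    proof -
      have "frechet_derivative (\<phi> n) (at x) = (*) (\<beta> n x - \<beta>' n x)"
        by (rule frechet_derivative_at[OF d\<phi>[unfolded has_field_derivative_def], symmetric])
      then show ?thesis by simp
    qed
    have "C_k k (\<phi> n)" for k
    proof (cases k)
      case 0
      show ?thesis unfolding 0 C_k.simps continuous_on_eq_continuous_at[OF open_UNIV] using DERIV_isCont[OF d\<phi>] by blast
    next
      case (Suc j)
      have "\<phi> n differentiable (at x)" for x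
        using d\<phi>[of n x] by (auto simp: differentiable_def has_field_derivative_def)
      moreover have "C_k j (\<lambda>x. frechet_derivative (\<phi> n) (at x) 1)"
        unfolding fd by (intro smooth_expr_C_k smooth_expr.intros b b')
      ultimately show ?thesis unfolding Suc by simp
    qed
    moreover have cl: "closure {x. \<phi> n x \<noteq> 0} \<subseteq> {s + h n..t - h n}"
    proof (rule closure_minimal)
      show "{x. \<phi> n x \<noteq> 0} \<subseteq> {s + h n..t - h n}" using \<phi>0 by blast
    qed simp
    moreover have "compact (closure {x. \<phi> n x \<noteq> 0})"
      by (rule compact_closure_subset[OF compact_Icc cl])
    moreover have "{s + h n..t - h n} \<subseteq> {0<..<T}" using h[of n] st by auto
    ultimately show ?thesis unfolding test_functions_def by blast
  qed
  have cb: "continuous_on UNIV (\<beta> n)" "continuous_on UNIV (\<beta>' n)" for n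
    using C_k_continuous[OF smooth_expr_C_k] b(1) b'(1) by blast+
  have T0: "0 \<le> T" using st by simp
  \<comment> \<open>a nonnegative weight of mass one near a point nearly evaluates a continuous function\<close>
  have avg: "(\<lambda>n. LINT r|?M. \<gamma> n r * H r) \<longlonglongrightarrow> H p" "\<And>n. integrable ?M (\<lambda>r. \<gamma> n r * H r)"
    if p: "p \<in> {0..T}" and nn: "\<And>n x. 0 \<le> \<gamma> n x" and supp: "\<And>n x. x \<notin> {p - 2 * h n..p + 2 * h n} \<Longrightarrow> \<gamma> n x = 0"
      and int: "\<And>n. integrable ?M (\<gamma> n)" and one: "\<And>n. (LINT r|?M. \<gamma> n r) = 1" for p and \<gamma> :: "nat \<Rightarrow> real \<Rightarrow> real"
  proof -
    obtain B where B: "\<And>r. r \<in> {0..T} \<Longrightarrow> \<bar>H r\<bar> \<le> B"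
      using compact_imp_bounded[OF compact_continuous_image[OF H compact_Icc]]
      unfolding bounded_iff real_norm_def by blast
    have Hm: "H \<in> borel_measurable ?M"
      by (rule continuous_imp_measurable_on_sets_lebesgue[OF continuous_on_subset[OF H]]) auto
    show i: "integrable ?M (\<lambda>r. \<gamma> n r * H r)" for n
    proof (rule Bochner_Integration.integrable_bound[OF integrable_mult_left[OF int[of n], of B]])
      show "AE r in ?M. norm (\<gamma> n r * H r) \<le> norm (\<gamma> n r * B)"
        using B nn by (intro AE_I2) (auto simp: abs_mult intro!: mult_left_mono order_trans[OF B])
    qed (use int Hm in auto)
    show "(\<lambda>n. LINT r|?M. \<gamma> n r * H r) \<longlonglongrightarrow> H p"
    proof (rule LIMSEQ_I)
      fix e :: real assume e: "e > 0"
      obtain d where d: "d > 0" "\<And>r. r \<in> {0..T} \<Longrightarrow> dist r p < d \<Longrightarrow> dist (H r) (H p) < e / 2"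
        using H p e unfolding continuous_on_iff by (metis half_gt_zero)
      obtain N where N: "\<And>n. n \<ge> N \<Longrightarrow> \<bar>h n\<bar> < d / 2"
        using LIMSEQ_D[OF h0, of "d / 2"] d by auto
      have "norm ((LINT r|?M. \<gamma> n r * H r) - H p) < e" if "n \<ge> N" for n
      proof -
        have "(LINT r|?M. \<gamma> n r * H r) - H p = (LINT r|?M. \<gamma> n r * H r) - (LINT r|?M. \<gamma> n r * H p)"
          using one[of n] by simp
        also have "\<dots> = (LINT r|?M. \<gamma> n r * H r - \<gamma> n r * H p)"
          using i int by (intro Bochner_Integration.integral_diff[symmetric]) auto
        finally have eq: "(LINT r|?M. \<gamma> n r * H r) - H p = (LINT r|?M. \<gamma> n r * H r - \<gamma> n r * H p)" .
        have "norm (LINT r|?M. \<gamma> n r * H r - \<gamma> n r * H p) \<le> (LINT r|?M. \<gamma> n r * (e / 2))"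
        proof (rule order_trans[OF integral_norm_bound integral_mono])
          show "norm (\<gamma> n r * H r - \<gamma> n r * H p) \<le> \<gamma> n r * (e / 2)" if r: "r \<in> space ?M" for r
          proof (cases "r \<in> {p - 2 * h n..p + 2 * h n}")
            case True
            then have "dist r p \<le> 2 * h n" by (auto simp: dist_real_def)
            then have "dist r p < d" using N[OF \<open>n \<ge> N\<close>] by simp
            then have "\<bar>H r - H p\<bar> < e / 2" using d(2)[of r] r by (simp add: dist_real_def)
            then have "\<gamma> n r * \<bar>H r - H p\<bar> \<le> \<gamma> n r * (e / 2)" using nn by (intro mult_left_mono) auto
            then show ?thesis using nn[of n r] by (simp add: right_diff_distrib[symmetric] abs_mult)
          next
            case False
            then show ?thesis using supp by simp
          qed
        qed (use i int in auto)
        also have "\<dots> = e / 2" using one[of n] by simp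
        finally show ?thesis using e unfolding eq by simp
      qed
      then show "\<exists>N. \<forall>n\<ge>N. norm ((LINT r|?M. \<gamma> n r * H r) - H p) < e" by blast
    qed
  qed
  have one: "(LINT r|?M. \<beta> n r) = 1" "(LINT r|?M. \<beta>' n r) = 1" for n
  proof -
    show "(LINT r|?M. \<beta> n r) = 1"
      unfolding LINT_derivative_time(1)[OF b(4) cb(1) T0] using h[of n] st by (simp add: b)
    show "(LINT r|?M. \<beta>' n r) = 1"
      unfolding LINT_derivative_time(1)[OF b'(4) cb(2) T0] using h[of n] st by (simp add: b')
  qed
  have int: "integrable ?M (\<beta> n)" "integrable ?M (\<beta>' n)" for n
    by (rule LINT_derivative_time(2)[OF b(4) cb(1) T0], rule LINT_derivative_time(2)[OF b'(4) cb(2) T0])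
  have supp: "\<beta> n x = 0" if "x \<notin> {s - 2 * h n..s + 2 * h n}" for n x
    by (rule b(3)) (use that h(1)[of n] in auto)
  have supp': "\<beta>' n x = 0" if "x \<notin> {t - 2 * h n..t + 2 * h n}" for n x
    by (rule b'(3)) (use that h(1)[of n] in auto)
  have sp: "s \<in> {0..T}" "t \<in> {0..T}" using st by auto
  note avs = avg[OF sp(1) b(2) supp int(1) one(1)] and avt = avg[OF sp(2) b'(2) supp' int(2) one(2)]
  have "(LINT r|?M. deriv (\<phi> n) r * H r) = (LINT r|?M. \<beta> n r * H r) - (LINT r|?M. \<beta>' n r * H r)" for n
    unfolding deriv\<phi> left_diff_distrib by (rule Bochner_Integration.integral_diff[OF avs(2) avt(2)])
  then have L1: "(\<lambda>n. - (LINT r|?M. \<phi> n r * G r)) \<longlonglongrightarrow> H s - H t"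
    using tendsto_diff[OF avs(1) avt(1)] weak[OF test] by simp
  have L2: "(\<lambda>n. LINT r|?M. \<phi> n r * G r) \<longlonglongrightarrow> (LINT r|?M. indicator {s<..t} r * G r)"
  proof (rule integral_dominated_convergence[where w = "\<lambda>r. \<bar>G r\<bar>"])
    have Gm: "G \<in> borel_measurable ?M" using G by auto
    show "(\<lambda>r. \<phi> n r * G r) \<in> borel_measurable ?M" for n
      by (intro borel_measurable_times Gm borel_measurable_test_function(2)[OF test])
    show "(\<lambda>r. indicator {s<..t} r * G r) \<in> borel_measurable ?M"
      by (intro borel_measurable_times Gm measurable_restrict_space1 borel_measurable_indicator) auto
    show "AE r in ?M. (\<lambda>n. \<phi> n r * G r) \<longlonglongrightarrow> indicator {s<..t} r * G r"
      using AE_time_neq[of t T]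
    proof eventually_elim
      fix r assume r: "r \<noteq> t"
      show "(\<lambda>n. \<phi> n r * G r) \<longlonglongrightarrow> indicator {s<..t} r * G r"
      proof (intro tendsto_mult tendsto_const, cases "r \<in> {s<..<t}")
        case True
        then have "\<forall>\<^sub>F n in sequentially. h n < min (r - s) (t - r) / 2"
          by (intro order_tendstoD(2)[OF h0]) auto
        then have "\<forall>\<^sub>F n in sequentially. 1 = \<phi> n r"
        proof eventually_elim
          fix n assume "h n < min (r - s) (t - r) / 2"
          then show "1 = \<phi> n r" using P(2)[of n r] P'(1)[of r n] by (simp add: \<phi>_def)
        qed
        then show "(\<lambda>n. \<phi> n r) \<longlonglongrightarrow> indicator {s<..t} r"
          using True by (intro Lim_transform_eventually[OF tendsto_const]) auto
      next
        case False
        have "\<phi> n r = 0" for n by (rule \<phi>0) (use False h(1)[of n] in auto)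
        moreover have "r \<notin> {s<..t}" using False r by auto
        ultimately show "(\<lambda>n. \<phi> n r) \<longlonglongrightarrow> indicator {s<..t} r" by simp
      qed
    qed
    show "AE r in ?M. norm (\<phi> n r * G r) \<le> \<bar>G r\<bar>" for n
    proof (rule AE_I2)
      fix r
      have "\<bar>\<phi> n r\<bar> \<le> 1" using P(3)[of n r] P'(3)[of n r] by (auto simp: \<phi>_def)
      then show "norm (\<phi> n r * G r) \<le> \<bar>G r\<bar>" by (simp add: abs_mult mult_left_le_one_le)
    qed
  qed (use G in auto)
  show ?thesis
    using LIMSEQ_unique[OF L1 tendsto_minus[OF L2]] by simp
qed

text \<open>
  The function \<open>c\<close> is the continuous representative of a function with weak derivative \<open>w\<close>. The
  fundamental theorem of calculus is required after applying functionals, so that only scalar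
  integrals occur.
\<close>

definition time_regular :: "real \<Rightarrow> 'v::real_vector normed_sp \<Rightarrow> (real \<Rightarrow> 'v) \<Rightarrow> (real \<Rightarrow> 'v) \<Rightarrow> bool"
  where "time_regular T X c w \<longleftrightarrow>
    c \<in> car (L2_time T X) \<and> w \<in> car (L2_time T X) \<and> (\<forall>t\<in>{0..T}. c t \<in> car X) \<and>
    (\<forall>t\<in>{0..T}. ((\<lambda>s. nrm X (c s - c t)) \<longlongrightarrow> 0) (at t within {0..T})) \<and>
    (\<forall>F\<in>car (dual X). \<forall>s t. 0 \<le> s \<longrightarrow> s \<le> t \<longrightarrow> t \<le> T \<longrightarrow>
      F (c t) - F (c s) = (LINT r|time_measure T. indicator {s<..t} r * F (w r)))"

lemma time_regularD:
  assumes "time_regular T X c w"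
  shows "c \<in> car (L2_time T X)" "w \<in> car (L2_time T X)" "\<And>t. t \<in> {0..T} \<Longrightarrow> c t \<in> car X"
    "\<And>t. t \<in> {0..T} \<Longrightarrow> ((\<lambda>s. nrm X (c s - c t)) \<longlongrightarrow> 0) (at t within {0..T})"
    "\<And>F s t. F \<in> car (dual X) \<Longrightarrow> 0 \<le> s \<Longrightarrow> s \<le> t \<Longrightarrow> t \<le> T \<Longrightarrow>
      F (c t) - F (c s) = (LINT r|time_measure T. indicator {s<..t} r * F (w r))"
  using assms by (auto simp: time_regular_def)

lemma integrable_indicator_time:
  fixes g :: "real \<Rightarrow> real"
  assumes "integrable (time_measure T) g"
  shows "integrable (time_measure T) (\<lambda>r. indicator {s<..t} r * g r)"
proof (rule Bochner_Integration.integrable_bound[OF assms])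
  have "g \<in> borel_measurable (time_measure T)" using assms by auto
  then show "(\<lambda>r. indicator {s<..t} r * g r) \<in> borel_measurable (time_measure T)"
    by (intro borel_measurable_times[OF measurable_restrict_space1[OF borel_measurable_indicator]]) auto
qed (auto simp: indicator_def intro!: AE_I2)

lemma LINT_indicator_split:
  fixes g :: "real \<Rightarrow> real"
  assumes g: "integrable (time_measure T) g" and "s \<le> m" "m \<le> t"
  shows "(LINT r|time_measure T. indicator {s<..t} r * g r) =
    (LINT r|time_measure T. indicator {s<..m} r * g r) + (LINT r|time_measure T. indicator {m<..t} r * g r)"
proof -
  have "indicator {s<..t} r * g r = indicator {s<..m} r * g r + indicator {m<..t} r * g r" for r
    using assms(2,3) by (auto simp: indicator_def)
  then show ?thesis
    by (simp add: Bochner_Integration.integral_add integrable_indicator_time[OF g])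
qed

lemma LINT_indicator_time_full:
  "(LINT r|time_measure T. indicator {0<..T} r * g r) = (LINT r|time_measure T. g r :: real)"
  by (intro Bochner_Integration.integral_cong) auto

text \<open>
  Divide the interval into pieces shorter than \<open>\<delta>\<close> and sum: the increment over \<open>[s, t]\<close> is at most
  \<open>\<eta>\<close> times the integral of \<open>g\<close>, for every \<open>\<eta>\<close>.
\<close>

lemma const_of_small_increments:
  fixes K g :: "real \<Rightarrow> real"
  assumes g: "integrable (time_measure T) g" "AE r in time_measure T. 0 \<le> g r"
    and small: "\<And>\<eta>. \<eta> > 0 \<Longrightarrow> \<exists>\<delta>>0. \<forall>s t. 0 \<le> s \<longrightarrow> s \<le> t \<longrightarrow> t \<le> T \<longrightarrow> t - s < \<delta> \<longrightarrow>
      \<bar>K t - K s\<bar> \<le> \<eta> * (LINT r|time_measure T. indicator {s<..t} r * g r)"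
    and st: "0 \<le> s" "s \<le> t" "t \<le> T"
  shows "K t = K s"
proof -
  define A where "A s t = (LINT r|time_measure T. indicator {s<..t} r * g r)" for s t
  have A0: "0 \<le> A s t" for s t
    unfolding A_def by (rule integral_nonneg_AE) (use g(2) in eventually_elim, simp)
  have split: "A s t = A s m + A m t" if "s \<le> m" "m \<le> t" for s m t
    unfolding A_def by (rule LINT_indicator_split[OF g(1) that])
  have le: "\<bar>K t - K s\<bar> \<le> \<eta> * A s t" if \<eta>: "\<eta> > 0" for \<eta>
  proof -
    obtain \<delta> where \<delta>: "\<delta> > 0" "\<And>s t. 0 \<le> s \<Longrightarrow> s \<le> t \<Longrightarrow> t \<le> T \<Longrightarrow> t - s < \<delta> \<Longrightarrow> \<bar>K t - K s\<bar> \<le> \<eta> * A s t"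
      using small[OF \<eta>] unfolding A_def by blast
    have "\<bar>K t - K s\<bar> \<le> \<eta> * A s t" if "0 \<le> s" "s \<le> t" "t - s \<le> real n * (\<delta> / 2)" for n s
      using that
    proof (induction n arbitrary: s)
      case 0
      then have "s = t" by simp
      then show ?case using A0 \<eta> by simp
    next
      case (Suc n)
      define m where "m = min t (s + \<delta> / 2)"
      have m: "s \<le> m" "m \<le> t" "m - s < \<delta>" using Suc.prems \<delta>(1) by (auto simp: m_def)
      have "t - m \<le> real n * (\<delta> / 2)"
      proof (cases "t \<le> s + \<delta> / 2")
        case True
        then show ?thesis using \<delta>(1) by (simp add: m_def)
      next
        case False
        then show ?thesis using Suc.prems(3) by (simp add: m_def distrib_right)
      qed
      then have "\<bar>K t - K m\<bar> \<le> \<eta> * A m t" using Suc.prems m by (intro Suc.IH) auto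
      moreover have "\<bar>K m - K s\<bar> \<le> \<eta> * A s m" using m Suc.prems st by (intro \<delta>(2)) auto
      ultimately show ?case using split[OF m(1,2)] by (simp add: distrib_left)
    qed
    moreover obtain n :: nat where "(t - s) / (\<delta> / 2) \<le> real n" using real_arch_simple by blast
    then have "t - s \<le> real n * (\<delta> / 2)" using \<delta>(1) by (simp add: field_simps)
    ultimately show ?thesis using st by blast
  qed
  have "\<bar>K t - K s\<bar> \<le> 0"
  proof (rule field_le_epsilon)
    fix e :: real assume e: "e > 0"
    have "\<bar>K t - K s\<bar> \<le> (e / (A s t + 1)) * A s t" using e A0[of s t] by (intro le) auto
    also have "\<dots> \<le> e" using e A0[of s t] by (simp add: field_simps)
    finally show "\<bar>K t - K s\<bar> \<le> 0 + e" by simp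
  qed
  then show ?thesis by simp
qed

context seminormed
begin

lemma L2_time_integrable_nrm:
  assumes "w \<in> car (L2_time T X)"
  shows "integrable (time_measure T) (\<lambda>r. nrm X (w r))"
proof (rule Bochner_Integration.integrable_bound)
  show "integrable (time_measure T) (\<lambda>r. 1 + (nrm X (w r))\<^sup>2)"
    using assms integrable_const_time[of T 1] by (auto simp: L2_time_iff)
  show "(\<lambda>r. nrm X (w r)) \<in> borel_measurable (time_measure T)"
    using assms by (intro nrm_measurable) (auto simp: L2_time_iff)
  show "AE r in time_measure T. norm (nrm X (w r)) \<le> norm (1 + (nrm X (w r))\<^sup>2)"
    using L2_time_AE[OF assms]
  proof eventually_elim
    fix r assume "w r \<in> car X"
    have "0 \<le> (nrm X (w r) - 1)\<^sup>2" by simp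
    then have "2 * nrm X (w r) \<le> 1 + (nrm X (w r))\<^sup>2" by (simp add: power2_diff)
    then show "norm (nrm X (w r)) \<le> norm (1 + (nrm X (w r))\<^sup>2)"
      using nrm_nonneg[OF \<open>w r \<in> car X\<close>] by simp
  qed
qed

lemma time_regular_uniformly_continuous:
  assumes c: "time_regular T X c w" and \<eta>: "\<eta> > 0"
  shows "\<exists>\<delta>>0. \<forall>s\<in>{0..T}. \<forall>t\<in>{0..T}. \<bar>s - t\<bar> < \<delta> \<longrightarrow> nrm X (c s - c t) < \<eta>"
proof -
  have "\<exists>d>0. \<forall>s\<in>{0..T}. dist s a < d \<longrightarrow> nrm X (c s - c a) < \<eta> / 2" if a: "a \<in> {0..T}" for a
  proof -
    obtain d where d: "d > 0" "\<And>s. s \<in> {0..T} \<Longrightarrow> s \<noteq> a \<Longrightarrow> dist s a < d \<Longrightarrow> \<bar>nrm X (c s - c a)\<bar> < \<eta> / 2"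
      using tendstoD[OF time_regularD(4)[OF c a], of "\<eta> / 2"] \<eta>
      unfolding eventually_at dist_real_def by auto
    have "nrm X (c s - c a) < \<eta> / 2" if "s \<in> {0..T}" "dist s a < d" for s
    proof (cases "s = a")
      case True
      then show ?thesis using \<eta> by simp
    next
      case False
      then show ?thesis using d(2)[OF that(1) False that(2)] by linarith
    qed
    then show ?thesis using d(1) by blast
  qed
  then obtain d where d: "\<And>a. a \<in> {0..T} \<Longrightarrow> d a > 0"
    "\<And>a s. a \<in> {0..T} \<Longrightarrow> s \<in> {0..T} \<Longrightarrow> dist s a < d a \<Longrightarrow> nrm X (c s - c a) < \<eta> / 2" by metis
  obtain e where e: "e > 0" "\<And>x. x \<in> {0..T} \<Longrightarrow> \<exists>G\<in>(\<lambda>a. ball a (d a)) ` {0..T}. ball x e \<subseteq> G"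
  proof (rule Heine_Borel_lemma[OF compact_Icc, of 0 T "(\<lambda>a. ball a (d a)) ` {0..T}"])
    show "{0..T} \<subseteq> \<Union> ((\<lambda>a. ball a (d a)) ` {0..T})" using d(1) by (auto intro!: UN_I centre_in_ball[THEN iffD2])
  qed auto
  have "nrm X (c s - c t) < \<eta>" if st: "s \<in> {0..T}" "t \<in> {0..T}" "\<bar>s - t\<bar> < e" for s t
  proof -
    obtain a where a: "a \<in> {0..T}" "ball s e \<subseteq> ball a (d a)" using e(2)[OF st(1)] by blast
    have "s \<in> ball a (d a)" "t \<in> ball a (d a)"
      using a(2) e(1) st(3) by (auto simp: subset_iff dist_real_def)
    then have "nrm X (c s - c a) < \<eta> / 2" "nrm X (c t - c a) < \<eta> / 2"
      using d(2)[OF a(1)] st by (auto simp: dist_commute)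
    moreover have "nrm X (c s - c t) \<le> nrm X (c s - c a) + nrm X (c a - c t)"
      using time_regularD(3)[OF c] st a by (intro nrm_diff_triangle) auto
    moreover have "nrm X (c a - c t) = nrm X (c t - c a)"
      using time_regularD(3)[OF c] st a by (intro nrm_commute) auto
    ultimately show ?thesis by linarith
  qed
  then show ?thesis using e(1) by blast
qed

lemma bdd_bilin_scale_dual:
  assumes F: "F \<in> car (dual X)"
  shows "bdd_bilin real_sp X (\<lambda>a x. a * F x)"
proof -
  have lin: "lin_on (car X) F" using F by (simp add: dual_iff)
  obtain C where C: "\<And>x. x \<in> car X \<Longrightarrow> \<bar>F x\<bar> \<le> C * nrm X x"
    using F by (auto simp: dual_iff)
  show ?thesis
    unfolding bdd_bilin_def
  proof (intro conjI ballI exI[of _ "\<bar>C\<bar>"])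
    show "\<bar>a * F x\<bar> \<le> \<bar>C\<bar> * nrm real_sp a * nrm X x" if x: "x \<in> car X" for a x
    proof -
      have "\<bar>a\<bar> * \<bar>F x\<bar> \<le> \<bar>a\<bar> * (\<bar>C\<bar> * nrm X x)"
        by (intro mult_left_mono order_trans[OF C[OF x] mult_right_mono[OF abs_ge_self nrm_nonneg[OF x]]]) auto
      then show ?thesis by (simp add: abs_mult mult_ac)
    qed
  qed (use lin in \<open>auto simp: lin_on_def algebra_simps\<close>)
qed

lemma dual_L2_time:
  assumes F: "F \<in> car (dual X)" and w: "w \<in> car (L2_time T X)"
  shows "integrable (time_measure T) (\<lambda>r. F (w r))"
proof -
  have "bdd_bilin real_sp X (\<lambda>a x. a * F x)" by (rule bdd_bilin_scale_dual[OF F])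
  moreover have "(\<lambda>_. 1) \<in> car (L2_time T real_sp)"
    using integrable_const_time[of T 1] by (simp add: L2_time_iff strongly_measurable_real_iff)
  ultimately show ?thesis
    using bdd_bilin_integrable[OF seminormed_real_sp seminormed_axioms _ _ w, of "\<lambda>a x. a * F x" "\<lambda>_. 1"] by simp
qed

text \<open>
  The continuous representative is the one that the initial condition provides; composing it with
  a functional reduces the claim to \<open>weak_derivative_integral\<close>.
\<close>

lemma time_regular_of_weak_deriv:
  assumes d: "has_weak_time_deriv T X v w" and v: "v \<in> car (L2_time T X)" and w: "w \<in> car (L2_time T X)"
    and init: "has_initial_value T X v v0"
  obtains c where "time_regular T X c w" "AE t in time_measure T. nrm X (v t - c t) = 0" "nrm X (c 0 - v0) = 0"
proof -
  obtain c where c: "\<And>t. t \<in> {0..T} \<Longrightarrow> c t \<in> car X"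
    "\<And>t. t \<in> {0..T} \<Longrightarrow> ((\<lambda>s. nrm X (c s - c t)) \<longlongrightarrow> 0) (at t within {0..T})"
    "AE t in time_measure T. nrm X (v t - c t) = 0" "nrm X (c 0 - v0) = 0"
    using init unfolding has_initial_value_def by blast
  have cc: "AE t in time_measure T. c t \<in> car X" by (rule AE_I2) (use c(1) in auto)
  have cL: "c \<in> car (L2_time T X)"
    by (rule L2_time_cong_AE[OF v]) (use cc c(3) in eventually_elim, simp)
  have "F (c t) - F (c s) = (LINT r|time_measure T. indicator {s<..t} r * F (w r))"
    if F: "F \<in> car (dual X)" and st: "0 \<le> s" "s \<le> t" "t \<le> T" for F s t
  proof (rule weak_derivative_integral[OF _ dual_L2_time[OF F w] _ st])
    obtain C where C: "\<forall>x\<in>car X. \<bar>F x\<bar> \<le> C * nrm X x" and lin: "lin_on (car X) F"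
      using F by (auto simp: dual_iff)
    show "continuous_on {0..T} (\<lambda>t. F (c t))"
      unfolding continuous_on_def
    proof
      fix a assume a: "a \<in> {0..T}"
      have "((\<lambda>s. C * nrm X (c s - c a)) \<longlongrightarrow> C * 0) (at a within {0..T})" by (intro tendsto_intros c(2) a)
      then have lim: "((\<lambda>s. C * nrm X (c s - c a)) \<longlongrightarrow> 0) (at a within {0..T})" by simp
      have "\<bar>F (c s) - F (c a)\<bar> \<le> C * nrm X (c s - c a)" if "s \<in> {0..T}" for s
        using C mem_diff[OF c(1)[OF that] c(1)[OF a]] lin_on_diff[OF sub lin c(1)[OF that] c(1)[OF a]] by auto
      then have "\<forall>\<^sub>F s in at a within {0..T}. \<bar>F (c s) - F (c a)\<bar> \<le> C * nrm X (c s - c a)"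
        by (auto simp: eventually_at intro!: exI[of _ 1])
      then have "((\<lambda>s. \<bar>F (c s) - F (c a)\<bar>) \<longlongrightarrow> 0) (at a within {0..T})"
        by (intro tendsto_sandwich[OF always_eventually _ tendsto_const lim]) auto
      then show "((\<lambda>s. F (c s)) \<longlongrightarrow> F (c a)) (at a within {0..T})"
        using LIM_zero_iff tendsto_rabs_zero_iff by blast
    qed
    fix \<phi> assume \<phi>: "\<phi> \<in> test_functions {0<..<T}"
    have vm: "(\<lambda>t. F (v t)) \<in> borel_measurable (time_measure T)" and wm: "(\<lambda>t. F (w t)) \<in> borel_measurable (time_measure T)"
      and cm: "(\<lambda>t. F (c t)) \<in> borel_measurable (time_measure T)"
      using dual_L2_time[OF F v] dual_L2_time[OF F w] dual_L2_time[OF F cL] by auto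
    have eq: "AE t in time_measure T. F (c t) = F (v t)"
      using c(3) cc L2_time_AE[OF v] by eventually_elim (rule dual_cong[OF F, symmetric])
    have "(LINT t|time_measure T. deriv \<phi> t * F (c t)) = (LINT t|time_measure T. deriv \<phi> t * F (v t))"
    proof (rule Bochner_Integration.integral_cong_AE)
      show "AE t in time_measure T. deriv \<phi> t * F (c t) = deriv \<phi> t * F (v t)"
        using eq by eventually_elim simp
    qed (use borel_measurable_deriv_test[OF \<phi>] vm cm in \<open>auto intro: borel_measurable_times\<close>)
    also have "\<dots> = - (LINT t|time_measure T. \<phi> t * F (w t))"
      by (rule weak_time_deriv_dual[OF seminormed_axioms d F L2_time_AE[OF v] L2_time_AE[OF w] \<phi> vm wm])
    finally show "(LINT t|time_measure T. deriv \<phi> t * F (c t)) = - (LINT t|time_measure T. \<phi> t * F (w t))" .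
  qed
  then have "time_regular T X c w" using c cL w by (auto simp: time_regular_def)
  then show thesis using that c by blast
qed

end

text \<open>
  Replacing \<open>c\<close> and \<open>d\<close> by their values at the end points of a short interval costs little by
  uniform continuity, and with these values fixed the claim is the integral formula for
  functionals.
\<close>

lemma product_rule:
  assumes X: "seminormed X" and Y: "seminormed Y" and B: "bdd_bilin X Y B"
    and c: "time_regular T X c w" and d: "time_regular T Y d z"
    and st: "0 \<le> s" "s \<le> t" "t \<le> T"
  shows "B (c t) (d t) - B (c s) (d s) =
    (LINT r|time_measure T. indicator {s<..t} r * (B (w r) (d r) + B (c r) (z r)))"
proof -
  let ?M = "time_measure T"
  interpret X: seminormed X by fact
  interpret Y: seminormed Y by fact
  obtain C where C: "C \<ge> 0" "\<And>x y. x \<in> car X \<Longrightarrow> y \<in> car Y \<Longrightarrow> \<bar>B x y\<bar> \<le> C * nrm X x * nrm Y y"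
    using bdd_bilin_bound[OF B] by blast
  note cD = time_regularD[OF c] and dD = time_regularD[OF d]
  note dX = bdd_bilin_dual(1)[OF B X Y] and dY = bdd_bilin_dual(2)[OF B X Y]
  have int1: "integrable ?M (\<lambda>r. B (w r) (d r))" by (rule bdd_bilin_integrable[OF X Y B cD(2) dD(1)])
  have int2: "integrable ?M (\<lambda>r. B (c r) (z r))" by (rule bdd_bilin_integrable[OF X Y B cD(1) dD(2)])
  have int: "integrable ?M (\<lambda>r. B (w r) (d r) + B (c r) (z r))" using int1 int2 by simp
  define I where "I s t = (LINT r|?M. indicator {s<..t} r * (B (w r) (d r) + B (c r) (z r)))" for s t
  define K where "K t = B (c t) (d t) - I 0 t" for t
  define g where "g r = C * (nrm X (w r) + nrm Y (z r))" for r
  have "K t = K s"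
  proof (rule const_of_small_increments[of T g, OF _ _ _ st])
    show "integrable ?M g"
      unfolding g_def using X.L2_time_integrable_nrm[OF cD(2)] Y.L2_time_integrable_nrm[OF dD(2)] by simp
    show "AE r in ?M. 0 \<le> g r"
      using L2_time_AE[OF cD(2)] L2_time_AE[OF dD(2)]
      by eventually_elim (simp add: g_def C X.nrm_nonneg Y.nrm_nonneg)
    note gi = \<open>integrable ?M g\<close>
    fix \<eta> :: real assume \<eta>: "\<eta> > 0"
    obtain \<delta>1 where 1: "\<delta>1 > 0" "\<And>s t. s \<in> {0..T} \<Longrightarrow> t \<in> {0..T} \<Longrightarrow> \<bar>s - t\<bar> < \<delta>1 \<Longrightarrow> nrm X (c s - c t) < \<eta>"
      using X.time_regular_uniformly_continuous[OF c \<eta>] by blast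
    obtain \<delta>2 where 2: "\<delta>2 > 0" "\<And>s t. s \<in> {0..T} \<Longrightarrow> t \<in> {0..T} \<Longrightarrow> \<bar>s - t\<bar> < \<delta>2 \<Longrightarrow> nrm Y (d s - d t) < \<eta>"
      using Y.time_regular_uniformly_continuous[OF d \<eta>] by blast
    have "\<bar>K t - K s\<bar> \<le> \<eta> * (LINT r|?M. indicator {s<..t} r * g r)"
      if st: "0 \<le> s" "s \<le> t" "t \<le> T" "t - s < min \<delta>1 \<delta>2" for s t
    proof -
      have sT: "s \<in> {0..T}" "t \<in> {0..T}" using st by auto
      note cs = cD(3)[OF sT(1)] and dt = dD(3)[OF sT(2)]
      have i1: "integrable ?M (\<lambda>r. B (w r) (d t))" by (rule X.dual_L2_time[OF dX[OF dt] cD(2)])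
      have i2: "integrable ?M (\<lambda>r. B (c s) (z r))" by (rule Y.dual_L2_time[OF dY[OF cs] dD(2)])
      have "B (c t) (d t) - B (c s) (d s) = (B (c t) (d t) - B (c s) (d t)) + (B (c s) (d t) - B (c s) (d s))" by simp
      also have "B (c t) (d t) - B (c s) (d t) = (LINT r|?M. indicator {s<..t} r * B (w r) (d t))"
        by (rule cD(5)[OF dX[OF dt] st(1-3)])
      also have "B (c s) (d t) - B (c s) (d s) = (LINT r|?M. indicator {s<..t} r * B (c s) (z r))"
        by (rule dD(5)[OF dY[OF cs] st(1-3)])
      finally have a: "B (c t) (d t) - B (c s) (d s) = (LINT r|?M. indicator {s<..t} r * B (w r) (d t)) + (LINT r|?M. indicator {s<..t} r * B (c s) (z r))" .
      have "I 0 t = I 0 s + I s t"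
        unfolding I_def by (rule LINT_indicator_split[OF int st(1,2)])
      then have "K t - K s = (LINT r|?M. indicator {s<..t} r * B (w r) (d t)) + (LINT r|?M. indicator {s<..t} r * B (c s) (z r)) - I s t"
        using a by (simp add: K_def)
      also have "\<dots> = (LINT r|?M. indicator {s<..t} r * B (w r) (d t) + indicator {s<..t} r * B (c s) (z r)
          - indicator {s<..t} r * (B (w r) (d r) + B (c r) (z r)))"
        unfolding I_def using integrable_indicator_time[OF i1] integrable_indicator_time[OF i2] integrable_indicator_time[OF int]
        by simp
      finally have eq: "K t - K s = \<dots>" .
      have "\<bar>K t - K s\<bar> \<le> (LINT r|?M. norm (indicator {s<..t} r * B (w r) (d t) + indicator {s<..t} r * B (c s) (z r)
          - indicator {s<..t} r * (B (w r) (d r) + B (c r) (z r))))"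
        unfolding eq using integral_norm_bound[of ?M "\<lambda>r. indicator {s<..t} r * B (w r) (d t) + indicator {s<..t} r * B (c s) (z r)
          - indicator {s<..t} r * (B (w r) (d r) + B (c r) (z r))"] by simp
      also have "\<dots> \<le> (LINT r|?M. \<eta> * (indicator {s<..t} r * g r))"
      proof (rule integral_mono_AE)
        show "AE r in ?M. norm (indicator {s<..t} r * B (w r) (d t) + indicator {s<..t} r * B (c s) (z r)
          - indicator {s<..t} r * (B (w r) (d r) + B (c r) (z r))) \<le> \<eta> * (indicator {s<..t} r * g r)"
          using L2_time_AE[OF cD(2)] L2_time_AE[OF dD(2)] AE_space
        proof eventually_elim
          fix r assume r: "w r \<in> car X" "z r \<in> car Y" "r \<in> space ?M"
          show "norm (indicator {s<..t} r * B (w r) (d t) + indicator {s<..t} r * B (c s) (z r)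
            - indicator {s<..t} r * (B (w r) (d r) + B (c r) (z r))) \<le> \<eta> * (indicator {s<..t} r * g r)"
          proof (cases "r \<in> {s<..t}")
            case False
            then show ?thesis by simp
          next
            case True
            have rT: "r \<in> {0..T}" using r(3) by auto
            note cr = cD(3)[OF rT] and dr = dD(3)[OF rT]
            have "B (w r) (d t) - B (w r) (d r) = B (w r) (d t - d r)"
              using lin_on_diff[OF Y.sub bdd_bilinD(2)[OF B r(1)] dt dr] by simp
            moreover have "\<bar>B (w r) (d t - d r)\<bar> \<le> C * nrm X (w r) * nrm Y (d t - d r)"
              by (rule C(2)[OF r(1) Y.mem_diff[OF dt dr]])
            moreover have "C * nrm X (w r) * nrm Y (d t - d r) \<le> C * nrm X (w r) * \<eta>"
              using 2(2)[OF sT(2) rT] True st C(1) X.nrm_nonneg[OF r(1)] by (intro mult_left_mono) auto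
            moreover have "B (c s) (z r) - B (c r) (z r) = B (c s - c r) (z r)"
              using lin_on_diff[OF X.sub bdd_bilinD(1)[OF B r(2)] cs cr] by simp
            moreover have "\<bar>B (c s - c r) (z r)\<bar> \<le> C * nrm X (c s - c r) * nrm Y (z r)"
              by (rule C(2)[OF X.mem_diff[OF cs cr] r(2)])
            moreover have "C * nrm X (c s - c r) * nrm Y (z r) \<le> C * \<eta> * nrm Y (z r)"
              using 1(2)[OF sT(1) rT] True st C(1) Y.nrm_nonneg[OF r(2)] by (intro mult_right_mono mult_left_mono) auto
            ultimately have "\<bar>B (w r) (d t) + B (c s) (z r) - (B (w r) (d r) + B (c r) (z r))\<bar> \<le> C * nrm X (w r) * \<eta> + C * \<eta> * nrm Y (z r)"
              by linarith
            also have "\<dots> = \<eta> * g r" by (simp add: g_def algebra_simps)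
            finally show ?thesis using True by simp
          qed
        qed
      qed (intro integrable_norm Bochner_Integration.integrable_diff Bochner_Integration.integrable_add
            integrable_mult_right integrable_indicator_time i1 i2 int gi)+
      also have "\<dots> = \<eta> * (LINT r|?M. indicator {s<..t} r * g r)" by simp
      finally show ?thesis .
    qed
    then show "\<exists>\<delta>>0. \<forall>s t. 0 \<le> s \<longrightarrow> s \<le> t \<longrightarrow> t \<le> T \<longrightarrow> t - s < \<delta> \<longrightarrow>
        \<bar>K t - K s\<bar> \<le> \<eta> * (LINT r|?M. indicator {s<..t} r * g r)"
      using 1(1) 2(1) by (intro exI[of _ "min \<delta>1 \<delta>2"]) auto
  qed
  moreover have "I 0 t = I 0 s + I s t"
    unfolding I_def by (rule LINT_indicator_split[OF int st(1,2)])
  ultimately show ?thesis by (simp add: K_def I_def)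
qed

context seminormed
begin

lemma time_regular_diff:
  assumes c: "time_regular T X c w" and d: "time_regular T X d z"
  shows "time_regular T X (\<lambda>t. c t - d t) (\<lambda>t. w t - z t)"
proof -
  note cD = time_regularD[OF c] and dD = time_regularD[OF d]
  have "((\<lambda>s. nrm X (c s - d s - (c t - d t))) \<longlongrightarrow> 0) (at t within {0..T})" if t: "t \<in> {0..T}" for t
  proof -
    have "((\<lambda>s. nrm X (c s - c t) + nrm X (d s - d t)) \<longlongrightarrow> 0 + 0) (at t within {0..T})"
      by (intro tendsto_add cD(4) dD(4) t)
    then have lim: "((\<lambda>s. nrm X (c s - c t) + nrm X (d s - d t)) \<longlongrightarrow> 0) (at t within {0..T})" by simp
    have le: "0 \<le> nrm X (c s - d s - (c t - d t)) \<and>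
        nrm X (c s - d s - (c t - d t)) \<le> nrm X (c s - c t) + nrm X (d s - d t)" if s: "s \<in> {0..T}" for s
    proof -
      have m: "c s - c t \<in> car X" "d s - d t \<in> car X" using cD(3) dD(3) s t mem_diff by auto
      have eq: "c s - d s - (c t - d t) = (c s - c t) - (d s - d t)" by simp
      show ?thesis unfolding eq using nrm_diff_le[OF m] nrm_nonneg[OF mem_diff[OF m]] by blast
    qed
    have ev: "\<forall>\<^sub>F s in at t within {0..T}. s \<in> {0..T}" by (auto simp: eventually_at intro!: exI[of _ 1])
    show ?thesis
      by (rule tendsto_sandwich[OF _ _ tendsto_const lim]; rule eventually_mono[OF ev]) (use le in blast)+
  qed
  moreover have "F (c t - d t) - F (c s - d s) = (LINT r|time_measure T. indicator {s<..t} r * F (w r - z r))"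
    if F: "F \<in> car (dual X)" and st: "0 \<le> s" "s \<le> t" "t \<le> T" for F s t
  proof -
    have lin: "lin_on (car X) F" using F by (simp add: dual_iff)
    note iw = integrable_indicator_time[OF dual_L2_time[OF F cD(2)]] and iz = integrable_indicator_time[OF dual_L2_time[OF F dD(2)]]
    have "F (c t - d t) - F (c s - d s) = (F (c t) - F (c s)) - (F (d t) - F (d s))"
      using st by (simp add: lin_on_diff[OF sub lin cD(3) dD(3)])
    also have "\<dots> = (LINT r|time_measure T. indicator {s<..t} r * F (w r)) - (LINT r|time_measure T. indicator {s<..t} r * F (z r))"
      by (simp only: cD(5)[OF F st] dD(5)[OF F st])
    also have "\<dots> = (LINT r|time_measure T. indicator {s<..t} r * F (w r) - indicator {s<..t} r * F (z r))"
      by (rule Bochner_Integration.integral_diff[OF iw iz, symmetric])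
    also have "\<dots> = (LINT r|time_measure T. indicator {s<..t} r * F (w r - z r))"
    proof (rule Bochner_Integration.integral_cong_AE)
      show "AE r in time_measure T. indicator {s<..t} r * F (w r) - indicator {s<..t} r * F (z r) = indicator {s<..t} r * F (w r - z r)"
        using L2_time_AE[OF cD(2)] L2_time_AE[OF dD(2)]
        by eventually_elim (simp add: lin_on_diff[OF sub lin] right_diff_distrib)
      show "(\<lambda>r. indicator {s<..t} r * F (w r) - indicator {s<..t} r * F (z r)) \<in> borel_measurable (time_measure T)"
        using iw iz by (intro borel_measurable_diff) auto
      show "(\<lambda>r. indicator {s<..t} r * F (w r - z r)) \<in> borel_measurable (time_measure T)"
        using integrable_indicator_time[OF dual_L2_time[OF F L2_time_diff[OF cD(2) dD(2)]]] by auto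
    qed
    finally show ?thesis .
  qed
  ultimately show ?thesis
    using L2_time_diff[OF cD(1) dD(1)] L2_time_diff[OF cD(2) dD(2)] cD(3) dD(3) mem_diff
    by (simp add: time_regular_def)
qed

end

text \<open>
  Integration by parts for an absolutely continuous \<open>q\<close>: the difference of the two sides, as a
  function of the end point, satisfies \<open>const_of_small_increments\<close>.
\<close>

lemma LINT_weight_by_parts:
  fixes q g :: "real \<Rightarrow> real"
  assumes T: "0 \<le> T" and g: "integrable (time_measure T) g" and q: "integrable (time_measure T) q"
    and cont: "continuous_on {0..T} q"
    and ftc: "\<And>s t. 0 \<le> s \<Longrightarrow> s \<le> t \<Longrightarrow> t \<le> T \<Longrightarrow> q t - q s = (LINT r|time_measure T. indicator {s<..t} r * g r)"
  shows "(LINT r|time_measure T. (k - r) * g r) = (k - T) * q T - k * q 0 + (LINT r|time_measure T. q r)"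
proof -
  let ?M = "time_measure T"
  have gw: "integrable ?M (\<lambda>r. (k - r) * g r)"
  proof (rule Bochner_Integration.integrable_bound[OF integrable_mult_right[OF g, of "\<bar>k\<bar> + T"]])
    have "(\<lambda>r. k - r) \<in> borel_measurable ?M"
      by (intro measurable_restrict_space1 measurable_completion) simp
    then show "(\<lambda>r. (k - r) * g r) \<in> borel_measurable ?M" using g by auto
    show "AE r in ?M. norm ((k - r) * g r) \<le> norm ((\<bar>k\<bar> + T) * g r)"
      by (intro AE_I2) (auto simp: abs_mult intro!: mult_right_mono)
  qed
  define I where "I f s t = (LINT r|?M. indicator {s<..t} r * f r)" for f :: "real \<Rightarrow> real" and s t
  define K where "K t = (k - t) * q t - I (\<lambda>r. (k - r) * g r) 0 t + I q 0 t" for t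
  have "K T = K 0"
  proof (rule const_of_small_increments[where T = T and g = "\<lambda>r. 1 + \<bar>g r\<bar>" and K = K and s = 0 and t = T])
    show "integrable ?M (\<lambda>r. 1 + \<bar>g r\<bar>)" using g integrable_const_time[of T 1] by simp
    note gi = this
    fix \<eta> :: real assume \<eta>: "\<eta> > 0"
    have "uniformly_continuous_on {0..T} q" using compact_uniformly_continuous[OF cont compact_Icc] .
    then obtain d where d: "d > 0" "\<And>r s. r \<in> {0..T} \<Longrightarrow> s \<in> {0..T} \<Longrightarrow> dist r s < d \<Longrightarrow> dist (q r) (q s) < \<eta>"
      using \<eta> unfolding uniformly_continuous_on_def by metis
    have "\<bar>K t - K s\<bar> \<le> \<eta> * I (\<lambda>r. 1 + \<bar>g r\<bar>) s t" if st: "0 \<le> s" "s \<le> t" "t \<le> T" "t - s < min d \<eta>" for s t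
    proof -
      have one: "I (\<lambda>_. 1) s t = t - s"
      proof -
        have "I (\<lambda>_. 1) s t = measure ?M ({s<..t} \<inter> {0<..<T})"
          unfolding I_def by (simp add: integral_indicator Int_commute)
        also have "\<dots> = measure lebesgue ({s<..t} \<inter> {0<..<T})"
          by (rule measure_restrict_space) auto
        also have "\<dots> = measure lebesgue {s<..t}"
        proof (rule measure_eq_AE)
          show "AE x in lebesgue. (x \<in> {s<..t} \<inter> {0<..<T}) = (x \<in> {s<..t})"
            using AE_completion[OF AE_lborel_singleton[of T]] by eventually_elim (use st in auto)
        qed auto
        finally show ?thesis using st by simp
      qed
      note i1 = integrable_indicator_time[OF gw, of s t] and i2 = integrable_indicator_time[OF q, of s t]
        and i3 = integrable_indicator_time[OF g, of s t] and i4 = integrable_indicator_time[OF integrable_const_time[of T 1], of s t]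
      have "I (\<lambda>r. (k - r) * g r) 0 t = I (\<lambda>r. (k - r) * g r) 0 s + I (\<lambda>r. (k - r) * g r) s t"
        "I q 0 t = I q 0 s + I q s t"
        unfolding I_def by (rule LINT_indicator_split[OF gw st(1,2)], rule LINT_indicator_split[OF q st(1,2)])
      then have "K t - K s = (k - t) * (q t - q s) - (t - s) * q s - I (\<lambda>r. (k - r) * g r) s t + I q s t"
        by (simp add: K_def algebra_simps)
      also have "q t - q s = I g s t" unfolding I_def by (rule ftc[OF st(1-3)])
      also have "(t - s) * q s = q s * I (\<lambda>_. 1) s t" by (simp add: one)
      also have "(k - t) * I g s t - q s * I (\<lambda>_. 1) s t - I (\<lambda>r. (k - r) * g r) s t + I q s t =
          (LINT r|?M. (k - t) * (indicator {s<..t} r * g r) - q s * (indicator {s<..t} r * 1)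
            - indicator {s<..t} r * ((k - r) * g r) + indicator {s<..t} r * q r)"
        unfolding I_def using i1 i2 i3 i4 by simp
      finally have eq: "K t - K s = \<dots>" .
      have "\<bar>K t - K s\<bar> \<le> (LINT r|?M. norm ((k - t) * (indicator {s<..t} r * g r) - q s * (indicator {s<..t} r * 1)
            - indicator {s<..t} r * ((k - r) * g r) + indicator {s<..t} r * q r))"
        unfolding eq real_norm_def[symmetric] by (rule integral_norm_bound)
      also have "\<dots> \<le> (LINT r|?M. \<eta> * (indicator {s<..t} r * (1 + \<bar>g r\<bar>)))"
      proof (rule integral_mono_AE)
        show "AE r in ?M. norm ((k - t) * (indicator {s<..t} r * g r) - q s * (indicator {s<..t} r * 1)
            - indicator {s<..t} r * ((k - r) * g r) + indicator {s<..t} r * q r) \<le> \<eta> * (indicator {s<..t} r * (1 + \<bar>g r\<bar>))"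
        proof (rule AE_I2)
          fix r assume r: "r \<in> space ?M"
          show "norm ((k - t) * (indicator {s<..t} r * g r) - q s * (indicator {s<..t} r * 1)
            - indicator {s<..t} r * ((k - r) * g r) + indicator {s<..t} r * q r) \<le> \<eta> * (indicator {s<..t} r * (1 + \<bar>g r\<bar>))"
          proof (cases "r \<in> {s<..t}")
            case False
            then show ?thesis by simp
          next
            case True
            have "\<bar>q r - q s\<bar> \<le> \<eta>" using d(2)[of r s] True st r by (auto simp: dist_real_def)
            moreover have "\<bar>(r - t) * g r\<bar> \<le> \<eta> * \<bar>g r\<bar>"
              unfolding abs_mult using True st by (intro mult_right_mono) auto
            moreover have "(k - t) * g r - q s - (k - r) * g r + q r = (r - t) * g r + (q r - q s)"
              by (simp add: algebra_simps)
            ultimately have "\<bar>(k - t) * g r - q s - (k - r) * g r + q r\<bar> \<le> \<eta> * \<bar>g r\<bar> + \<eta>" by linarith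
            then show ?thesis using True by (simp add: distrib_left)
          qed
        qed
      qed (use i1 i2 i3 i4 integrable_indicator_time[OF gi] in auto)
      also have "\<dots> = \<eta> * I (\<lambda>r. 1 + \<bar>g r\<bar>) s t" by (simp add: I_def)
      finally show ?thesis .
    qed
    then show "\<exists>\<delta>>0. \<forall>s t. 0 \<le> s \<longrightarrow> s \<le> t \<longrightarrow> t \<le> T \<longrightarrow> t - s < \<delta> \<longrightarrow>
        \<bar>K t - K s\<bar> \<le> \<eta> * (LINT r|?M. indicator {s<..t} r * (1 + \<bar>g r\<bar>))"
      using d(1) \<eta> by (intro exI[of _ "min d \<eta>"]) (auto simp: I_def)
  qed (use T in auto)
  then show ?thesis by (simp add: K_def I_def LINT_indicator_time_full)
qed

text \<open>
  The solutions are only determined up to null sets of times, whence the representatives \<open>v\<close> and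
  \<open>e\<close> of the continuous functions \<open>c\<close> and \<open>d\<close>.
\<close>

lemma weighted_product_rule:
  assumes X: "seminormed X" and Y: "seminormed Y" and B: "bdd_bilin X Y B" and T: "0 \<le> T"
    and c: "time_regular T X c w" and d: "time_regular T Y d z"
    and v: "v \<in> car (L2_time T X)" "AE t in time_measure T. nrm X (v t - c t) = 0"
    and e: "e \<in> car (L2_time T Y)" "AE t in time_measure T. nrm Y (e t - d t) = 0"
  shows "(LINT t|time_measure T. (k - t) * (B (w t) (e t) + B (v t) (z t))) =
    (k - T) * B (c T) (d T) - k * B (c 0) (d 0) + (LINT t|time_measure T. B (v t) (e t))"
proof -
  let ?M = "time_measure T"
  interpret X: seminormed X by fact
  interpret Y: seminormed Y by fact
  note cD = time_regularD[OF c] and dD = time_regularD[OF d]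
  note bi = bdd_bilin_integrable[OF X Y B]
  define g where "g t = B (w t) (d t) + B (c t) (z t)" for t
  define q where "q t = B (c t) (d t)" for t
  have gi: "integrable ?M g" unfolding g_def using bi[OF cD(2) dD(1)] bi[OF cD(1) dD(2)] by simp
  have qi: "integrable ?M q" unfolding q_def by (rule bi[OF cD(1) dD(1)])
  have cont: "continuous_on {0..T} q"
    unfolding continuous_on_def
  proof
    fix a assume a: "a \<in> {0..T}"
    show "(q \<longlongrightarrow> q a) (at a within {0..T})"
    proof (subst tendsto_at_iff_sequentially, intro allI impI)
      fix x assume x: "\<forall>n. x n \<in> {0..T} - {a}" "x \<longlonglongrightarrow> a"
      then have f: "filterlim x (at a within {0..T}) sequentially"
        by (auto simp: filterlim_at)
      show "(q \<circ> x) \<longlonglongrightarrow> q a"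
        unfolding q_def comp_def
      proof (rule bdd_bilin_tendsto[OF X Y B])
        show "c a \<in> car X" "d a \<in> car Y" "\<And>n. c (x n) \<in> car X" "\<And>n. d (x n) \<in> car Y"
          using a x cD(3) dD(3) by auto
        then show "(\<lambda>n. nrm X (c a - c (x n))) \<longlonglongrightarrow> 0" "(\<lambda>n. nrm Y (d a - d (x n))) \<longlonglongrightarrow> 0"
          using filterlim_compose[OF cD(4)[OF a] f] filterlim_compose[OF dD(4)[OF a] f]
          by (simp_all add: X.nrm_commute[of "c a"] Y.nrm_commute[of "d a"])
      qed
    qed
  qed
  have main: "(LINT t|?M. (k - t) * g t) = (k - T) * q T - k * q 0 + (LINT t|?M. q t)"
    by (rule LINT_weight_by_parts[OF T gi qi cont])
       (unfold q_def g_def, rule product_rule[OF X Y B c d])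
  have wm: "(\<lambda>t. k - t) \<in> borel_measurable ?M"
    by (intro measurable_restrict_space1 measurable_completion) simp
  have B_cong: "B x y = B x' y'" if "x \<in> car X" "x' \<in> car X" "y \<in> car Y" "y' \<in> car Y" "nrm X (x - x') = 0" "nrm Y (y - y') = 0" for x x' y y'
    using X.dual_cong[OF bdd_bilin_dual(1)[OF B X Y that(3)] that(1,2,5)]
      Y.dual_cong[OF bdd_bilin_dual(2)[OF B X Y that(2)] that(3,4,6)] by simp
  have cc: "AE t in ?M. c t \<in> car X" "AE t in ?M. d t \<in> car Y"
    by (rule L2_time_AE[OF cD(1)], rule L2_time_AE[OF dD(1)])
  have "(LINT t|?M. (k - t) * g t) = (LINT t|?M. (k - t) * (B (w t) (e t) + B (v t) (z t)))"
  proof (rule Bochner_Integration.integral_cong_AE)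
    show "AE t in ?M. (k - t) * g t = (k - t) * (B (w t) (e t) + B (v t) (z t))"
      using cc v(2) e(2) L2_time_AE[OF v(1)] L2_time_AE[OF e(1)] L2_time_AE[OF cD(2)] L2_time_AE[OF dD(2)]
    proof eventually_elim
      fix t assume a: "c t \<in> car X" "d t \<in> car Y" "nrm X (v t - c t) = 0" "nrm Y (e t - d t) = 0"
        "v t \<in> car X" "e t \<in> car Y" "w t \<in> car X" "z t \<in> car Y"
      have "B (w t) (e t) = B (w t) (d t)" "B (v t) (z t) = B (c t) (z t)"
        using a X.nrm_zero Y.nrm_zero by (auto intro!: B_cong)
      then show "(k - t) * g t = (k - t) * (B (w t) (e t) + B (v t) (z t))" by (simp add: g_def)
    qed
    show "(\<lambda>t. (k - t) * g t) \<in> borel_measurable ?M" using wm gi by auto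
    show "(\<lambda>t. (k - t) * (B (w t) (e t) + B (v t) (z t))) \<in> borel_measurable ?M"
      using wm bi[OF cD(2) e(1)] bi[OF v(1) dD(2)] by auto
  qed
  moreover have "(LINT t|?M. q t) = (LINT t|?M. B (v t) (e t))"
  proof (rule Bochner_Integration.integral_cong_AE)
    show "AE t in ?M. q t = B (v t) (e t)"
      using cc v(2) e(2) L2_time_AE[OF v(1)] L2_time_AE[OF e(1)]
      unfolding q_def by eventually_elim (rule B_cong[symmetric])
  qed (use qi bi[OF v(1) e(1)] in auto)
  ultimately show ?thesis using main by (simp add: q_def)
qed

section \<open>Energy and error estimates\<close>

context bounded_open_set
begin

lemma H10_time_L2: "f \<in> car (L2_time T (H10 \<Omega>)) \<Longrightarrow> f \<in> car (L2_time T (L2 \<Omega>))"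
  by (rule H10.L2_time_compose[of f T "L2 \<Omega>" "\<lambda>x. x" 1])
     (auto simp: L2.seminormed_axioms H10_L2 intro!: nrm_L2_le_H10 H10.mem_diff)

lemma L2_time_Hm1:
  assumes "f \<in> car (L2_time T (L2 \<Omega>))"
  shows "(\<lambda>t. L2_inner \<Omega> (f t)) \<in> car (L2_time T (Hm1 \<Omega>))"
proof (rule L2.L2_time_compose[OF assms seminormed_Hm1, where C = 1])
  show "L2_inner \<Omega> x \<in> car (Hm1 \<Omega>)" if "x \<in> car (L2 \<Omega>)" for x by (rule L2_Hm1[OF that])
  show "nrm (Hm1 \<Omega>) (L2_inner \<Omega> x - L2_inner \<Omega> y) \<le> 1 * nrm (L2 \<Omega>) (x - y)"
    if "x \<in> car (L2 \<Omega>)" "y \<in> car (L2 \<Omega>)" for x y using nrm_Hm1_diff_le[OF that] by simp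
  show "nrm (Hm1 \<Omega>) (L2_inner \<Omega> x) \<le> 1 * nrm (L2 \<Omega>) x" if x: "x \<in> car (L2 \<Omega>)" for x
    unfolding Hm1_def using L2_Hm1_bound[OF x] L2.nrm_nonneg[OF x] by (intro H10.dual_nrm_le) auto
qed

lemma W_space_props:
  assumes "y \<in> W_space \<Omega> T"
  shows "y \<in> car (L2_time T (H10 \<Omega>))" "y \<in> car (L2_time T (L2 \<Omega>))"
    "time_d1 \<Omega> T y \<in> car (L2_time T (L2 \<Omega>))" "has_weak_time_deriv T (L2 \<Omega>) y (time_d1 \<Omega> T y)"
proof -
  show y: "y \<in> car (L2_time T (H10 \<Omega>))" using assms by (simp add: W_space_def)
  then show "y \<in> car (L2_time T (L2 \<Omega>))" by (rule H10_time_L2)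
  have "\<exists>w. w \<in> car (L2_time T (L2 \<Omega>)) \<and> has_weak_time_deriv T (L2 \<Omega>) y w"
    using assms by (auto simp: W_space_def weakly_time_differentiable_def)
  from someI_ex[OF this]
  show "time_d1 \<Omega> T y \<in> car (L2_time T (L2 \<Omega>))" "has_weak_time_deriv T (L2 \<Omega>) y (time_d1 \<Omega> T y)"
    by (simp_all add: time_d1_def time_deriv_def)
qed

lemma Y_space_props:
  assumes "y \<in> Y_space \<Omega> T"
  shows "y \<in> W_space \<Omega> T" "time_d1_Hm1 \<Omega> T y \<in> car (L2_time T (Hm1 \<Omega>))"
    "time_d2 \<Omega> T y \<in> car (L2_time T (Hm1 \<Omega>))" "has_weak_time_deriv T (Hm1 \<Omega>) (time_d1_Hm1 \<Omega> T y) (time_d2 \<Omega> T y)"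
proof -
  show y: "y \<in> W_space \<Omega> T" using assms by (simp add: Y_space_def)
  show "time_d1_Hm1 \<Omega> T y \<in> car (L2_time T (Hm1 \<Omega>))"
    unfolding time_d1_Hm1_def by (rule L2_time_Hm1[OF W_space_props(3)[OF y]])
  have "\<exists>w. w \<in> car (L2_time T (Hm1 \<Omega>)) \<and> has_weak_time_deriv T (Hm1 \<Omega>) (time_d1_Hm1 \<Omega> T y) w"
    using assms by (auto simp: Y_space_def weakly_time_differentiable_def)
  from someI_ex[OF this]
  show "time_d2 \<Omega> T y \<in> car (L2_time T (Hm1 \<Omega>))" "has_weak_time_deriv T (Hm1 \<Omega>) (time_d1_Hm1 \<Omega> T y) (time_d2 \<Omega> T y)"
    by (simp_all add: time_d2_def time_deriv_def)
qed

end

lemma time_weight_measurable: "(\<lambda>t. k - t) \<in> borel_measurable (time_measure T)"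
  by (intro measurable_restrict_space1 measurable_completion) simp

lemma time_weight_integrable:
  fixes f :: "real \<Rightarrow> real"
  assumes "integrable (time_measure T) f"
  shows "integrable (time_measure T) (\<lambda>t. (k - t) * f t)"
proof (rule Bochner_Integration.integrable_bound[OF integrable_mult_right[OF assms, of "\<bar>k\<bar> + \<bar>T\<bar>"]])
  show "(\<lambda>t. (k - t) * f t) \<in> borel_measurable (time_measure T)"
    using assms time_weight_measurable by auto
  show "AE t in time_measure T. norm ((k - t) * f t) \<le> norm ((\<bar>k\<bar> + \<bar>T\<bar>) * f t)"
    by (intro AE_I2) (auto simp: abs_mult intro!: mult_right_mono)
qed

lemma LINT_weighted_eq_AE:
  fixes f :: "real \<Rightarrow> real"
  assumes "AE t in time_measure T. F t = f t" "integrable (time_measure T) F"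
  shows "integrable (time_measure T) f" "(LINT t|time_measure T. F t) = (LINT t|time_measure T. f t)"
proof -
  have m: "f \<in> borel_measurable (time_measure T)"
    by (rule borel_measurable_AE_LIMSEQ[of _ "\<lambda>_. F"]) (use assms in auto)
  show "integrable (time_measure T) f"
    using integrable_cong_AE[OF _ m assms(1)] assms(2) by auto
  show "(LINT t|time_measure T. F t) = (LINT t|time_measure T. f t)"
    by (rule Bochner_Integration.integral_cong_AE[OF _ m assms(1)]) (use assms in auto)
qed

lemma weighted_square_rule:
  assumes X: "seminormed X" and B: "bdd_bilin X X B" and T: "0 \<le> T"
    and sym: "\<And>x y. x \<in> car X \<Longrightarrow> y \<in> car X \<Longrightarrow> B x y = B y x"
    and c: "time_regular T X c w"
    and v: "v \<in> car (L2_time T X)" "AE t in time_measure T. nrm X (v t - c t) = 0"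
  shows "2 * (LINT t|time_measure T. (k - t) * B (w t) (v t)) =
    (k - T) * B (c T) (c T) - k * B (c 0) (c 0) + (LINT t|time_measure T. B (v t) (v t))"
proof -
  note w = time_regularD(2)[OF c]
  have "(LINT t|time_measure T. (k - t) * (B (w t) (v t) + B (v t) (w t))) = (LINT t|time_measure T. 2 * ((k - t) * B (w t) (v t)))"
  proof (rule LINT_weighted_eq_AE(2))
    show "AE t in time_measure T. (k - t) * (B (w t) (v t) + B (v t) (w t)) = 2 * ((k - t) * B (w t) (v t))"
      using L2_time_AE[OF w] L2_time_AE[OF v(1)] by eventually_elim (simp add: sym)
    show "integrable (time_measure T) (\<lambda>t. (k - t) * (B (w t) (v t) + B (v t) (w t)))"
      using bdd_bilin_integrable[OF X X B w v(1)] bdd_bilin_integrable[OF X X B v(1) w]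
      by (intro time_weight_integrable) simp
  qed
  then show ?thesis
    using weighted_product_rule[OF X X B T c c v v, of k] by simp
qed

context resolvent_setting
begin

lemma Hm1_weight:
  assumes "F \<in> car (Hm1 \<Omega>)" "g \<in> car (L2 \<Omega>)"
  shows "F (J (k *\<^sub>R g)) = k * F (J g)"
  by (rule lin_on_scale[OF bdd_bilinD(2)[OF bdd_bilin_Hm1_L2 assms(1)] assms(2)])

text \<open>
  The test function is \<open>(k - t) J h\<close>. For \<open>k \<ge> T\<close> the weight is nonnegative, and its derivative
  is \<open>-1\<close>, so that the product rule produces integrals over time of the squares to be bounded.
\<close>

lemma cattaneo_tested:
  assumes sol: "cattaneo_weak_solution \<Omega> T \<tau> u y0 y1 y" and u: "u \<in> car (L2_time T (L2 \<Omega>))"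
    and h: "h \<in> car (L2_time T (L2 \<Omega>))"
  shows "\<tau> * (LINT t|time_measure T. (k - t) * time_d2 \<Omega> T y t (J (h t)))
      + (LINT t|time_measure T. (k - t) * smooth_inner (time_d1 \<Omega> T y t) (h t))
      + (LINT t|time_measure T. (k - t) * yosida_form (y t) (h t))
    = (LINT t|time_measure T. (k - t) * smooth_inner (u t) (h t))"
proof -
  let ?M = "time_measure T"
  have Y: "y \<in> Y_space \<Omega> T" using sol by (simp add: cattaneo_weak_solution_def)
  note W = W_space_props[OF Y_space_props(1)[OF Y]] and Z = Y_space_props[OF Y]
  have i2: "integrable ?M (\<lambda>t. time_d2 \<Omega> T y t (J (h t)))"
    by (rule bdd_bilin_integrable[OF seminormed_Hm1 L2.seminormed_axioms bdd_bilin_Hm1_L2 Z(3) h])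
  have i1: "integrable ?M (\<lambda>t. smooth_inner (time_d1 \<Omega> T y t) (h t))"
    by (rule bdd_bilin_integrable[OF L2.seminormed_axioms L2.seminormed_axioms bdd_bilin_smooth W(3) h])
  have i0: "integrable ?M (\<lambda>t. yosida_form (y t) (h t))"
    by (rule bdd_bilin_integrable[OF L2.seminormed_axioms L2.seminormed_axioms bdd_bilin_yosida W(2) h])
  have wh: "(\<lambda>t. (k - t) *\<^sub>R h t) \<in> car (L2_time T (L2 \<Omega>))"
    by (rule L2.L2_time_mult[OF h time_weight_measurable, of _ "\<bar>k\<bar> + \<bar>T\<bar>"]) auto
  define v where "v t = J ((k - t) *\<^sub>R h t)" for t
  have v: "v \<in> car (L2_time T (H10 \<Omega>))" unfolding v_def by (rule J_L2_time[OF wh])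
  note iv = bdd_bilin_integrable[OF seminormed_Hm1 H10.seminormed_axioms bdd_bilin_eval Z(3) v]
    bdd_bilin_integrable[OF L2.seminormed_axioms H10.seminormed_axioms bdd_bilin_L2_H10 W(3) v]
    bdd_bilin_integrable[OF H10.seminormed_axioms H10.seminormed_axioms bdd_bilin_dirichlet W(1) v]
  have "(LINT t|?M. \<tau> * time_d2 \<Omega> T y t (v t) + L2_inner \<Omega> (time_d1 \<Omega> T y t) (v t) + dirichlet_form \<Omega> (y t) (v t))
      = (LINT t|?M. \<tau> * ((k - t) * time_d2 \<Omega> T y t (J (h t))) + (k - t) * smooth_inner (time_d1 \<Omega> T y t) (h t)
        + (k - t) * yosida_form (y t) (h t))"
  proof (rule LINT_weighted_eq_AE(2))
    show "AE t in ?M. \<tau> * time_d2 \<Omega> T y t (v t) + L2_inner \<Omega> (time_d1 \<Omega> T y t) (v t) + dirichlet_form \<Omega> (y t) (v t)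
      = \<tau> * ((k - t) * time_d2 \<Omega> T y t (J (h t))) + (k - t) * smooth_inner (time_d1 \<Omega> T y t) (h t)
        + (k - t) * yosida_form (y t) (h t)"
      using L2_time_AE[OF Z(3)] L2_time_AE[OF W(3)] L2_time_AE[OF W(1)] L2_time_AE[OF h]
    proof eventually_elim
      fix t assume a: "time_d2 \<Omega> T y t \<in> car (Hm1 \<Omega>)" "time_d1 \<Omega> T y t \<in> car (L2 \<Omega>)" "y t \<in> car (H10 \<Omega>)" "h t \<in> car (L2 \<Omega>)"
      have "L2_inner \<Omega> (time_d1 \<Omega> T y t) (v t) = (k - t) * smooth_inner (time_d1 \<Omega> T y t) (h t)"
        unfolding v_def smooth_inner_def by (rule Hm1_weight[OF L2_Hm1[OF a(2)] a(4)])
      moreover have "dirichlet_form \<Omega> (y t) (v t) = (k - t) * yosida_form (y t) (h t)"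
        unfolding v_def dirichlet_J[OF a(3) L2.mem_scale[OF a(4)]]
        by (rule yo.ip_scale_right[OF a(4) H10_L2[OF a(3)]])
      moreover have "time_d2 \<Omega> T y t (v t) = (k - t) * time_d2 \<Omega> T y t (J (h t))"
        unfolding v_def by (rule Hm1_weight[OF a(1,4)])
      ultimately show "\<tau> * time_d2 \<Omega> T y t (v t) + L2_inner \<Omega> (time_d1 \<Omega> T y t) (v t) + dirichlet_form \<Omega> (y t) (v t)
        = \<tau> * ((k - t) * time_d2 \<Omega> T y t (J (h t))) + (k - t) * smooth_inner (time_d1 \<Omega> T y t) (h t)
          + (k - t) * yosida_form (y t) (h t)" by simp
    qed
  qed (use iv in simp)
  also have "\<dots> = \<tau> * (LINT t|?M. (k - t) * time_d2 \<Omega> T y t (J (h t)))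
      + (LINT t|?M. (k - t) * smooth_inner (time_d1 \<Omega> T y t) (h t)) + (LINT t|?M. (k - t) * yosida_form (y t) (h t))"
    using time_weight_integrable[OF i2] time_weight_integrable[OF i1] time_weight_integrable[OF i0] by simp
  finally have L: "(LINT t|?M. \<tau> * time_d2 \<Omega> T y t (v t) + L2_inner \<Omega> (time_d1 \<Omega> T y t) (v t) + dirichlet_form \<Omega> (y t) (v t)) = \<dots>" .
  have "(LINT t|?M. L2_inner \<Omega> (u t) (v t)) = (LINT t|?M. (k - t) * smooth_inner (u t) (h t))"
  proof (rule LINT_weighted_eq_AE(2))
    show "AE t in ?M. L2_inner \<Omega> (u t) (v t) = (k - t) * smooth_inner (u t) (h t)"
      using L2_time_AE[OF u] L2_time_AE[OF h]
      unfolding v_def smooth_inner_def by eventually_elim (rule Hm1_weight[OF L2_Hm1])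
    show "integrable ?M (\<lambda>t. L2_inner \<Omega> (u t) (v t))"
      by (rule bdd_bilin_integrable[OF L2.seminormed_axioms H10.seminormed_axioms bdd_bilin_L2_H10 u v])
  qed
  then show ?thesis
    using L sol v by (auto simp: cattaneo_weak_solution_def)
qed

lemma heat_tested:
  assumes sol: "heat_weak_solution \<Omega> T u y0 y" and u: "u \<in> car (L2_time T (L2 \<Omega>))"
    and h: "h \<in> car (L2_time T (L2 \<Omega>))"
  shows "(LINT t|time_measure T. (k - t) * smooth_inner (time_d1 \<Omega> T y t) (h t))
      + (LINT t|time_measure T. (k - t) * yosida_form (y t) (h t))
    = (LINT t|time_measure T. (k - t) * smooth_inner (u t) (h t))"
proof -
  let ?M = "time_measure T"
  have Y: "y \<in> W_space \<Omega> T" using sol by (simp add: heat_weak_solution_def)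
  note W = W_space_props[OF Y]
  have i1: "integrable ?M (\<lambda>t. smooth_inner (time_d1 \<Omega> T y t) (h t))"
    by (rule bdd_bilin_integrable[OF L2.seminormed_axioms L2.seminormed_axioms bdd_bilin_smooth W(3) h])
  have i0: "integrable ?M (\<lambda>t. yosida_form (y t) (h t))"
    by (rule bdd_bilin_integrable[OF L2.seminormed_axioms L2.seminormed_axioms bdd_bilin_yosida W(2) h])
  have wh: "(\<lambda>t. (k - t) *\<^sub>R h t) \<in> car (L2_time T (L2 \<Omega>))"
    by (rule L2.L2_time_mult[OF h time_weight_measurable, of _ "\<bar>k\<bar> + \<bar>T\<bar>"]) auto
  define v where "v t = J ((k - t) *\<^sub>R h t)" for t
  have v: "v \<in> car (L2_time T (H10 \<Omega>))" unfolding v_def by (rule J_L2_time[OF wh])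
  note iv = bdd_bilin_integrable[OF L2.seminormed_axioms H10.seminormed_axioms bdd_bilin_L2_H10 W(3) v]
    bdd_bilin_integrable[OF H10.seminormed_axioms H10.seminormed_axioms bdd_bilin_dirichlet W(1) v]
  have "(LINT t|?M. L2_inner \<Omega> (time_d1 \<Omega> T y t) (v t) + dirichlet_form \<Omega> (y t) (v t))
      = (LINT t|?M. (k - t) * smooth_inner (time_d1 \<Omega> T y t) (h t) + (k - t) * yosida_form (y t) (h t))"
  proof (rule LINT_weighted_eq_AE(2))
    show "AE t in ?M. L2_inner \<Omega> (time_d1 \<Omega> T y t) (v t) + dirichlet_form \<Omega> (y t) (v t)
      = (k - t) * smooth_inner (time_d1 \<Omega> T y t) (h t) + (k - t) * yosida_form (y t) (h t)"
      using L2_time_AE[OF W(3)] L2_time_AE[OF W(1)] L2_time_AE[OF h]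
    proof eventually_elim
      fix t assume a: "time_d1 \<Omega> T y t \<in> car (L2 \<Omega>)" "y t \<in> car (H10 \<Omega>)" "h t \<in> car (L2 \<Omega>)"
      have "L2_inner \<Omega> (time_d1 \<Omega> T y t) (v t) = (k - t) * smooth_inner (time_d1 \<Omega> T y t) (h t)"
        unfolding v_def smooth_inner_def by (rule Hm1_weight[OF L2_Hm1[OF a(1)] a(3)])
      moreover have "dirichlet_form \<Omega> (y t) (v t) = (k - t) * yosida_form (y t) (h t)"
        unfolding v_def dirichlet_J[OF a(2) L2.mem_scale[OF a(3)]]
        by (rule yo.ip_scale_right[OF a(3) H10_L2[OF a(2)]])
      ultimately show "L2_inner \<Omega> (time_d1 \<Omega> T y t) (v t) + dirichlet_form \<Omega> (y t) (v t)
        = (k - t) * smooth_inner (time_d1 \<Omega> T y t) (h t) + (k - t) * yosida_form (y t) (h t)" by simp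
    qed
  qed (use iv in simp)
  also have "\<dots> = (LINT t|?M. (k - t) * smooth_inner (time_d1 \<Omega> T y t) (h t)) + (LINT t|?M. (k - t) * yosida_form (y t) (h t))"
    using time_weight_integrable[OF i1] time_weight_integrable[OF i0] by simp
  finally have L: "(LINT t|?M. L2_inner \<Omega> (time_d1 \<Omega> T y t) (v t) + dirichlet_form \<Omega> (y t) (v t)) = \<dots>" .
  have "(LINT t|?M. L2_inner \<Omega> (u t) (v t)) = (LINT t|?M. (k - t) * smooth_inner (u t) (h t))"
  proof (rule LINT_weighted_eq_AE(2))
    show "AE t in ?M. L2_inner \<Omega> (u t) (v t) = (k - t) * smooth_inner (u t) (h t)"
      using L2_time_AE[OF u] L2_time_AE[OF h]
      unfolding v_def smooth_inner_def by eventually_elim (rule Hm1_weight[OF L2_Hm1])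
    show "integrable ?M (\<lambda>t. L2_inner \<Omega> (u t) (v t))"
      by (rule bdd_bilin_integrable[OF L2.seminormed_axioms H10.seminormed_axioms bdd_bilin_L2_H10 u v])
  qed
  then show ?thesis
    using L sol v by (auto simp: heat_weak_solution_def)
qed

end

context bounded_open_set
begin

lemma solution_representative:
  assumes "y \<in> W_space \<Omega> T" "has_initial_value T (L2 \<Omega>) y y0"
  obtains c where "time_regular T (L2 \<Omega>) c (time_d1 \<Omega> T y)" "AE t in time_measure T. nrm (L2 \<Omega>) (y t - c t) = 0"
    "nrm (L2 \<Omega>) (c 0 - y0) = 0"
  using L2.time_regular_of_weak_deriv[OF W_space_props(4,2,3)[OF assms(1)] assms(2)] by blast

end

context resolvent_setting
begin

abbreviation smooth_sq :: "real \<Rightarrow> (real \<Rightarrow> 'a \<Rightarrow> real) \<Rightarrow> real"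
  where "smooth_sq T f \<equiv> LINT t|time_measure T. smooth_inner (f t) (f t)"

lemmas sm_int = bdd_bilin_integrable[OF L2.seminormed_axioms L2.seminormed_axioms bdd_bilin_smooth]
lemmas yo_int = bdd_bilin_integrable[OF L2.seminormed_axioms L2.seminormed_axioms bdd_bilin_yosida]

lemma smooth_sq_le:
  assumes "f \<in> car (L2_time T (L2 \<Omega>))"
  shows "smooth_sq T f \<le> (LINT t|time_measure T. L2_inner \<Omega> (f t) (f t))"
proof (rule integral_mono_AE[OF sm_int[OF assms assms] L2.ip_integrable[OF assms assms]])
  show "AE t in time_measure T. smooth_inner (f t) (f t) \<le> L2_inner \<Omega> (f t) (f t)"
    using L2_time_AE[OF assms] by eventually_elim (rule smooth_inner_le)
qed

lemma weighted_smooth_young: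
  assumes f: "f \<in> car (L2_time T (L2 \<Omega>))" and g: "g \<in> car (L2_time T (L2 \<Omega>))" and k: "T \<le> k"
  shows "2 * \<bar>LINT t|time_measure T. (k - t) * smooth_inner (f t) (g t)\<bar> \<le>
    (LINT t|time_measure T. (k - t) * smooth_inner (f t) (f t)) + (LINT t|time_measure T. (k - t) * smooth_inner (g t) (g t))"
proof -
  let ?M = "time_measure T"
  note i = time_weight_integrable[OF sm_int[OF f g], of k] time_weight_integrable[OF sm_int[OF f f], of k]
    time_weight_integrable[OF sm_int[OF g g], of k]
  have "2 * \<bar>LINT t|?M. (k - t) * smooth_inner (f t) (g t)\<bar> \<le> 2 * (LINT t|?M. norm ((k - t) * smooth_inner (f t) (g t)))"
    using integral_norm_bound[of ?M "\<lambda>t. (k - t) * smooth_inner (f t) (g t)"] by simp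
  also have "\<dots> = (LINT t|?M. 2 * norm ((k - t) * smooth_inner (f t) (g t)))" by simp
  also have "\<dots> \<le> (LINT t|?M. (k - t) * smooth_inner (f t) (f t) + (k - t) * smooth_inner (g t) (g t))"
  proof (rule integral_mono_AE)
    show "AE t in ?M. 2 * norm ((k - t) * smooth_inner (f t) (g t)) \<le> (k - t) * smooth_inner (f t) (f t) + (k - t) * smooth_inner (g t) (g t)"
      using L2_time_AE[OF f] L2_time_AE[OF g] AE_space
    proof eventually_elim
      fix t assume a: "f t \<in> car (L2 \<Omega>)" "g t \<in> car (L2 \<Omega>)" "t \<in> space ?M"
      have "0 \<le> k - t" using a(3) k by simp
      from mult_left_mono[OF sm.young[OF a(1,2)] this]
      show "2 * norm ((k - t) * smooth_inner (f t) (g t)) \<le> (k - t) * smooth_inner (f t) (f t) + (k - t) * smooth_inner (g t) (g t)"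
        using \<open>0 \<le> k - t\<close> by (simp add: abs_mult distrib_left mult_ac)
    qed
  qed (use i in simp_all)
  also have "\<dots> = (LINT t|?M. (k - t) * smooth_inner (f t) (f t)) + (LINT t|?M. (k - t) * smooth_inner (g t) (g t))"
    by (rule Bochner_Integration.integral_add[OF i(2,3)])
  finally show ?thesis .
qed

lemma weighted_smooth_sq_bounds:
  assumes f: "f \<in> car (L2_time T (L2 \<Omega>))"
  shows "(LINT t|time_measure T. (k - t) * smooth_inner (f t) (f t)) \<le> k * smooth_sq T f"
    "(k - T) * smooth_sq T f \<le> (LINT t|time_measure T. (k - t) * smooth_inner (f t) (f t))"
proof -
  let ?M = "time_measure T"
  note i = sm_int[OF f f] and iw = time_weight_integrable[OF sm_int[OF f f], of k]
  have "(LINT t|?M. (k - t) * smooth_inner (f t) (f t)) \<le> (LINT t|?M. k * smooth_inner (f t) (f t))"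
  proof (rule integral_mono_AE[OF iw])
    show "AE t in ?M. (k - t) * smooth_inner (f t) (f t) \<le> k * smooth_inner (f t) (f t)"
      using L2_time_AE[OF f] AE_space
      by eventually_elim (intro mult_right_mono sm.ip_nonneg, auto)
  qed (use i in simp)
  then show "(LINT t|?M. (k - t) * smooth_inner (f t) (f t)) \<le> k * smooth_sq T f" by simp
  have "(LINT t|?M. (k - T) * smooth_inner (f t) (f t)) \<le> (LINT t|?M. (k - t) * smooth_inner (f t) (f t))"
  proof (rule integral_mono_AE[OF _ iw])
    show "AE t in ?M. (k - T) * smooth_inner (f t) (f t) \<le> (k - t) * smooth_inner (f t) (f t)"
      using L2_time_AE[OF f] AE_space
      by eventually_elim (intro mult_right_mono sm.ip_nonneg, auto)
  qed (use i in simp)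
  then show "(k - T) * smooth_sq T f \<le> (LINT t|?M. (k - t) * smooth_inner (f t) (f t))" by simp
qed

text \<open>
  Test with \<open>(T + 1 - t) J y'\<close>. The terms at time \<open>T\<close> are nonnegative and those at time 0 are
  the data; the derivative of the weight contributes the integral of the potential energy.
\<close>

lemma smoothed_energy_estimate:
  assumes T: "T > 0" and \<tau>: "\<tau> > 0"
    and u: "u \<in> car (L2_time T (L2 \<Omega>))" and y0: "y0 \<in> car (H10 \<Omega>)" and y1: "y1 \<in> car (L2 \<Omega>)"
    and sol: "cattaneo_weak_solution \<Omega> T \<tau> u y0 y1 y"
  shows "smooth_sq T (time_d1 \<Omega> T y) + (LINT t|time_measure T. yosida_form (y t) (y t))
    \<le> (T + 1) * (\<tau> * L2_inner \<Omega> y1 y1 + dirichlet_form \<Omega> y0 y0 + (LINT t|time_measure T. L2_inner \<Omega> (u t) (u t)))"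
proof -
  let ?M = "time_measure T"
  define p where "p = time_d1 \<Omega> T y"
  have Y: "y \<in> Y_space \<Omega> T" and i0: "has_initial_value T (L2 \<Omega>) y y0"
    and i1: "has_initial_value T (Hm1 \<Omega>) (time_d1_Hm1 \<Omega> T y) (L2_inner \<Omega> y1)"
    using sol by (simp_all add: cattaneo_weak_solution_def)
  note Z = Y_space_props[OF Y] and W = W_space_props[OF Y_space_props(1)[OF Y]]
  have p: "p \<in> car (L2_time T (L2 \<Omega>))" using W(3) by (simp add: p_def)
  have y0L: "y0 \<in> car (L2 \<Omega>)" by (rule H10_L2[OF y0])
  obtain c where c: "time_regular T (L2 \<Omega>) c p" "AE t in ?M. nrm (L2 \<Omega>) (y t - c t) = 0" "nrm (L2 \<Omega>) (c 0 - y0) = 0"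
    using solution_representative[OF Z(1) i0] unfolding p_def by blast
  obtain d where d: "time_regular T (Hm1 \<Omega>) d (time_d2 \<Omega> T y)"
    "AE t in ?M. nrm (Hm1 \<Omega>) (time_d1_Hm1 \<Omega> T y t - d t) = 0" "nrm (Hm1 \<Omega>) (d 0 - L2_inner \<Omega> y1) = 0"
    using Hm1.time_regular_of_weak_deriv[OF Z(4,2,3) i1] by blast
  have mem: "c 0 \<in> car (L2 \<Omega>)" "c T \<in> car (L2 \<Omega>)" "d 0 \<in> car (Hm1 \<Omega>)" "d T \<in> car (Hm1 \<Omega>)"
    using time_regularD(3)[OF c(1)] time_regularD(3)[OF d(1)] T by auto
  have T0: "0 \<le> T" using T by simp
  \<comment> \<open>the inertial term is the derivative of the smoothed kinetic energy, a form on \<open>H\<^sup>-\<^sup>1\<close>\<close>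
  have "2 * (LINT t|?M. (T + 1 - t) * time_d2 \<Omega> T y t (R (time_d1_Hm1 \<Omega> T y t))) =
      (T + 1 - T) * d T (R (d T)) - (T + 1) * d 0 (R (d 0)) + (LINT t|?M. time_d1_Hm1 \<Omega> T y t (R (time_d1_Hm1 \<Omega> T y t)))"
  proof (rule weighted_square_rule[where X = "Hm1 \<Omega>" and B = "\<lambda>F G. F (R G)" and c = d and v = "time_d1_Hm1 \<Omega> T y" and w = "time_d2 \<Omega> T y"])
    show "seminormed (Hm1 \<Omega>)" by (rule seminormed_Hm1)
    show "bdd_bilin (Hm1 \<Omega>) (Hm1 \<Omega>) (\<lambda>F G. F (R G))" by (rule bdd_bilin_Hm1)
    show "F (R G) = G (R F)" if "F \<in> car (Hm1 \<Omega>)" "G \<in> car (Hm1 \<Omega>)" for F G by (rule R_sym[OF that])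
  qed (use T0 d Z in auto)
  moreover have "0 \<le> d T (R (d T))" by (rule Hm1_form.ip_nonneg[OF mem(4)])
  moreover have "0 \<le> (LINT t|?M. time_d1_Hm1 \<Omega> T y t (R (time_d1_Hm1 \<Omega> T y t)))"
    by (rule integral_nonneg_AE) (use L2_time_AE[OF Z(2)] in eventually_elim, rule Hm1_form.ip_nonneg)
  moreover have "d 0 (R (d 0)) \<le> L2_inner \<Omega> y1 y1"
  proof -
    have y1H: "L2_inner \<Omega> y1 \<in> car (Hm1 \<Omega>)" by (rule L2_Hm1[OF y1])
    have "d 0 (R (d 0)) = L2_inner \<Omega> y1 (R (d 0))"
      by (rule Hm1.dual_cong[OF bdd_bilin_dual(1)[OF bdd_bilin_Hm1 seminormed_Hm1 seminormed_Hm1 mem(3)] mem(3) y1H d(3)])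
    also have "\<dots> = d 0 (R (L2_inner \<Omega> y1))" by (rule R_sym[OF y1H mem(3)])
    also have "\<dots> = L2_inner \<Omega> y1 (R (L2_inner \<Omega> y1))"
      by (rule Hm1.dual_cong[OF bdd_bilin_dual(1)[OF bdd_bilin_Hm1 seminormed_Hm1 seminormed_Hm1 y1H] mem(3) y1H d(3)])
    also have "\<dots> \<le> L2_inner \<Omega> y1 y1" using smooth_inner_le[OF y1] by (simp add: smooth_inner_def J_def)
    finally show ?thesis .
  qed
  then have "(T + 1) * d 0 (R (d 0)) \<le> (T + 1) * L2_inner \<Omega> y1 y1" using T by (intro mult_left_mono) auto
  ultimately have A: "- ((T + 1) * L2_inner \<Omega> y1 y1) \<le> 2 * (LINT t|?M. (T + 1 - t) * time_d2 \<Omega> T y t (J (p t)))"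
    by (simp add: J_def time_d1_Hm1_def p_def)
  \<comment> \<open>the term with the Laplacian is the derivative of the Yosida energy\<close>
  have "2 * (LINT t|?M. (T + 1 - t) * yosida_form (p t) (y t)) =
      (T + 1 - T) * yosida_form (c T) (c T) - (T + 1) * yosida_form (c 0) (c 0) + (LINT t|?M. yosida_form (y t) (y t))"
    by (rule weighted_square_rule[OF L2.seminormed_axioms bdd_bilin_yosida T0 yo.ip_sym c(1) W(2) c(2)])
  moreover have "0 \<le> yosida_form (c T) (c T)" by (rule yo.ip_nonneg[OF mem(2)])
  moreover have "yosida_form (c 0) (c 0) \<le> dirichlet_form \<Omega> y0 y0"
  proof -
    note dl = bdd_bilin_dual(1)[OF bdd_bilin_yosida L2.seminormed_axioms L2.seminormed_axioms]
    have "yosida_form (c 0) (c 0) = yosida_form y0 (c 0)"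
      by (rule L2.dual_cong[OF dl[OF mem(1)] mem(1) y0L c(3)])
    also have "\<dots> = yosida_form (c 0) y0" by (rule yo.ip_sym[OF y0L mem(1)])
    also have "\<dots> = yosida_form y0 y0" by (rule L2.dual_cong[OF dl[OF y0L] mem(1) y0L c(3)])
    finally show ?thesis using energy_J(1)[OF y0] by simp
  qed
  then have "(T + 1) * yosida_form (c 0) (c 0) \<le> (T + 1) * dirichlet_form \<Omega> y0 y0" using T by (intro mult_left_mono) auto
  moreover have "(LINT t|?M. (T + 1 - t) * yosida_form (p t) (y t)) = (LINT t|?M. (T + 1 - t) * yosida_form (y t) (p t))"
  proof (rule LINT_weighted_eq_AE(2)[OF _ time_weight_integrable[OF yo_int[OF p W(2)]]])
    show "AE t in ?M. (T + 1 - t) * yosida_form (p t) (y t) = (T + 1 - t) * yosida_form (y t) (p t)"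
      using L2_time_AE[OF p] L2_time_AE[OF W(2)] by eventually_elim (simp add: yo.ip_sym)
  qed
  ultimately have B: "(LINT t|?M. yosida_form (y t) (y t)) - (T + 1) * dirichlet_form \<Omega> y0 y0
      \<le> 2 * (LINT t|?M. (T + 1 - t) * yosida_form (y t) (p t))" by simp
  \<comment> \<open>half of the damping absorbs the forcing\<close>
  have E: "2 * (\<tau> * (LINT t|?M. (T + 1 - t) * time_d2 \<Omega> T y t (J (p t))))
      + 2 * (LINT t|?M. (T + 1 - t) * smooth_inner (p t) (p t)) + 2 * (LINT t|?M. (T + 1 - t) * yosida_form (y t) (p t))
    = 2 * (LINT t|?M. (T + 1 - t) * smooth_inner (u t) (p t))"
    using cattaneo_tested[OF sol u p, of "T + 1"] unfolding p_def by linarith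
  have F: "2 * (LINT t|?M. (T + 1 - t) * smooth_inner (u t) (p t)) \<le>
      (LINT t|?M. (T + 1 - t) * smooth_inner (u t) (u t)) + (LINT t|?M. (T + 1 - t) * smooth_inner (p t) (p t))"
    using weighted_smooth_young[OF u p, of "T + 1"] by linarith
  have G: "(LINT t|?M. (T + 1 - t) * smooth_inner (u t) (u t)) \<le> (T + 1) * (LINT t|?M. L2_inner \<Omega> (u t) (u t))"
  proof -
    have "(T + 1) * smooth_sq T u \<le> (T + 1) * (LINT t|?M. L2_inner \<Omega> (u t) (u t))"
      using T smooth_sq_le[OF u] by (intro mult_left_mono) auto
    then show ?thesis using weighted_smooth_sq_bounds(1)[OF u, of "T + 1"] by linarith
  qed
  have H: "smooth_sq T p \<le> (LINT t|?M. (T + 1 - t) * smooth_inner (p t) (p t))"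
    using weighted_smooth_sq_bounds(2)[OF p, of "T + 1"] by simp
  have A': "\<tau> * - ((T + 1) * L2_inner \<Omega> y1 y1) \<le> \<tau> * (2 * (LINT t|?M. (T + 1 - t) * time_d2 \<Omega> T y t (J (p t))))"
    using A \<tau> by (intro mult_left_mono) auto
  have "(T + 1) * (\<tau> * L2_inner \<Omega> y1 y1 + dirichlet_form \<Omega> y0 y0 + (LINT t|?M. L2_inner \<Omega> (u t) (u t))) =
      \<tau> * ((T + 1) * L2_inner \<Omega> y1 y1) + (T + 1) * dirichlet_form \<Omega> y0 y0 + (T + 1) * (LINT t|?M. L2_inner \<Omega> (u t) (u t))"
    by (simp add: algebra_simps)
  moreover have "\<tau> * (2 * (LINT t|?M. (T + 1 - t) * time_d2 \<Omega> T y t (J (p t)))) = 2 * (\<tau> * (LINT t|?M. (T + 1 - t) * time_d2 \<Omega> T y t (J (p t))))"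
    by simp
  ultimately show ?thesis
    using A' B E F G H unfolding p_def[symmetric] by linarith
qed

text \<open>
  Test the difference of the two equations with \<open>(T - t) J e\<close>, where \<open>e\<close> is the error. After
  integration by parts in time, the inertial term only involves first derivatives and carries
  the factor \<open>\<tau>\<close>.
\<close>

lemma smoothed_error_estimate:
  assumes T: "T > 0" and \<tau>: "0 < \<tau>" "\<tau> \<le> 1/2"
    and u: "u \<in> car (L2_time T (L2 \<Omega>))" and y0: "y0 \<in> car (L2 \<Omega>)"
    and sol: "cattaneo_weak_solution \<Omega> T \<tau> u y0 y1 z" and heat: "heat_weak_solution \<Omega> T u y0 y"
  shows "smooth_sq T (\<lambda>t. z t - y t) \<le> 2 * \<tau> * ((T + 1) * (LINT t|time_measure T. L2_inner \<Omega> (time_d1 \<Omega> T z t) (time_d1 \<Omega> T z t))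
    + T * (LINT t|time_measure T. L2_inner \<Omega> (time_d1 \<Omega> T z t - time_d1 \<Omega> T y t) (time_d1 \<Omega> T z t - time_d1 \<Omega> T y t)))"
proof -
  let ?M = "time_measure T"
  define p where "p = time_d1 \<Omega> T z"
  define e where "e = (\<lambda>t. z t - y t)"
  define q where "q = (\<lambda>t. time_d1 \<Omega> T z t - time_d1 \<Omega> T y t)"
  have T0: "0 \<le> T" using T by simp
  have Yz: "z \<in> Y_space \<Omega> T" and iz: "has_initial_value T (L2 \<Omega>) z y0"
    and iz1: "has_initial_value T (Hm1 \<Omega>) (time_d1_Hm1 \<Omega> T z) (L2_inner \<Omega> y1)"
    using sol by (simp_all add: cattaneo_weak_solution_def)
  have Wy: "y \<in> W_space \<Omega> T" and iy: "has_initial_value T (L2 \<Omega>) y y0"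
    using heat by (simp_all add: heat_weak_solution_def)
  note Z = Y_space_props[OF Yz] and zW = W_space_props[OF Y_space_props(1)[OF Yz]] and yW = W_space_props[OF Wy]
  have p: "p \<in> car (L2_time T (L2 \<Omega>))" using zW(3) by (simp add: p_def)
  have e: "e \<in> car (L2_time T (L2 \<Omega>))" unfolding e_def by (rule L2.L2_time_diff[OF zW(2) yW(2)])
  have q: "q \<in> car (L2_time T (L2 \<Omega>))" unfolding q_def by (rule L2.L2_time_diff[OF zW(3) yW(3)])
  obtain c where c: "time_regular T (L2 \<Omega>) c (time_d1 \<Omega> T z)" "AE t in ?M. nrm (L2 \<Omega>) (z t - c t) = 0" "nrm (L2 \<Omega>) (c 0 - y0) = 0"
    using solution_representative[OF Z(1) iz] by blast
  obtain b where b: "time_regular T (L2 \<Omega>) b (time_d1 \<Omega> T y)" "AE t in ?M. nrm (L2 \<Omega>) (y t - b t) = 0" "nrm (L2 \<Omega>) (b 0 - y0) = 0"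
    using solution_representative[OF Wy iy] by blast
  obtain d where d: "time_regular T (Hm1 \<Omega>) d (time_d2 \<Omega> T z)"
    "AE t in ?M. nrm (Hm1 \<Omega>) (time_d1_Hm1 \<Omega> T z t - d t) = 0" "nrm (Hm1 \<Omega>) (d 0 - L2_inner \<Omega> y1) = 0"
    using Hm1.time_regular_of_weak_deriv[OF Z(4,2,3) iz1] by blast
  define f where "f = (\<lambda>t. c t - b t)"
  have f: "time_regular T (L2 \<Omega>) f q" unfolding f_def q_def by (rule L2.time_regular_diff[OF c(1) b(1)])
  have ef: "AE t in ?M. nrm (L2 \<Omega>) (e t - f t) = 0"
    using c(2) b(2) L2_time_AE[OF zW(2)] L2_time_AE[OF yW(2)] L2_time_AE[OF time_regularD(1)[OF c(1)]] L2_time_AE[OF time_regularD(1)[OF b(1)]]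
  proof eventually_elim
    fix t assume a: "nrm (L2 \<Omega>) (z t - c t) = 0" "nrm (L2 \<Omega>) (y t - b t) = 0"
      "z t \<in> car (L2 \<Omega>)" "y t \<in> car (L2 \<Omega>)" "c t \<in> car (L2 \<Omega>)" "b t \<in> car (L2 \<Omega>)"
    have m: "z t - c t \<in> car (L2 \<Omega>)" "y t - b t \<in> car (L2 \<Omega>)" by (rule L2.mem_diff[OF a(3,5)], rule L2.mem_diff[OF a(4,6)])
    have eq: "e t - f t = (z t - c t) - (y t - b t)" by (simp add: e_def f_def)
    show "nrm (L2 \<Omega>) (e t - f t) = 0"
      unfolding eq using L2.nrm_diff_le[OF m] L2.nrm_nonneg[OF L2.mem_diff[OF m]] a(1,2) by linarith
  qed
  have mem: "c 0 \<in> car (L2 \<Omega>)" "b 0 \<in> car (L2 \<Omega>)" "f 0 \<in> car (L2 \<Omega>)" "d 0 \<in> car (Hm1 \<Omega>)"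
    using time_regularD(3)[OF c(1)] time_regularD(3)[OF b(1)] time_regularD(3)[OF f] time_regularD(3)[OF d(1)] T by auto
  have f0: "nrm (L2 \<Omega>) (f 0 - 0) = 0"
  proof -
    have "nrm (L2 \<Omega>) (c 0 - b 0) \<le> nrm (L2 \<Omega>) (c 0 - y0) + nrm (L2 \<Omega>) (y0 - b 0)"
      by (rule L2.nrm_diff_triangle[OF mem(1) y0 mem(2)])
    then show ?thesis
      using c(3) b(3) L2.nrm_commute[OF y0 mem(2)] L2.nrm_nonneg[OF mem(3)] by (simp add: f_def)
  qed
  \<comment> \<open>both solutions start at \<open>y0\<close>; at time \<open>T\<close> the weight vanishes, so no boundary terms remain\<close>
  have Bz: "d 0 (J (f 0)) = 0" "smooth_inner (f 0) (f 0) = 0"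
  proof -
    have 1: "(\<lambda>g. d 0 (J g)) \<in> car (dual (L2 \<Omega>))"
      by (rule bdd_bilin_dual(2)[OF bdd_bilin_Hm1_L2 seminormed_Hm1 L2.seminormed_axioms mem(4)])
    have "d 0 (J (f 0)) = d 0 (J 0)" by (rule L2.dual_cong[OF 1 mem(3) L2.mem_zero f0])
    also have "\<dots> = 0" by (rule lin_on_zero[OF L2.sub bdd_bilinD(2)[OF bdd_bilin_Hm1_L2 mem(4)]])
    finally show "d 0 (J (f 0)) = 0" .
    have "smooth_inner (f 0) (f 0) \<le> L2_inner \<Omega> (f 0) (f 0)" by (rule smooth_inner_le[OF mem(3)])
    also have "\<dots> = 0" using f0 L2.nrm_sq[OF mem(3)] by simp
    finally show "smooth_inner (f 0) (f 0) = 0" using sm.ip_nonneg[OF mem(3)] by simp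
  qed
  have i2: "integrable ?M (\<lambda>t. time_d2 \<Omega> T z t (J (e t)))"
    by (rule bdd_bilin_integrable[OF seminormed_Hm1 L2.seminormed_axioms bdd_bilin_Hm1_L2 Z(3) e])
  have pq: "time_d1_Hm1 \<Omega> T z t (J g) = smooth_inner (p t) g" for t g
    by (simp add: time_d1_Hm1_def smooth_inner_def p_def)
  have "(LINT t|?M. (T - t) * (time_d2 \<Omega> T z t (J (e t)) + time_d1_Hm1 \<Omega> T z t (J (q t)))) =
      (T - T) * d T (J (f T)) - T * d 0 (J (f 0)) + (LINT t|?M. time_d1_Hm1 \<Omega> T z t (J (e t)))"
    by (rule weighted_product_rule[OF seminormed_Hm1 L2.seminormed_axioms bdd_bilin_Hm1_L2 T0 d(1) f Z(2) d(2) e ef])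
  then have "(LINT t|?M. (T - t) * time_d2 \<Omega> T z t (J (e t)) + (T - t) * smooth_inner (p t) (q t)) = (LINT t|?M. smooth_inner (p t) (e t))"
    by (simp add: Bz pq distrib_left)
  then have A: "(LINT t|?M. (T - t) * time_d2 \<Omega> T z t (J (e t))) + (LINT t|?M. (T - t) * smooth_inner (p t) (q t))
      = (LINT t|?M. smooth_inner (p t) (e t))"
    using time_weight_integrable[OF i2, of T] time_weight_integrable[OF sm_int[OF p q], of T] by simp
  have B: "2 * (LINT t|?M. (T - t) * smooth_inner (q t) (e t)) = smooth_sq T e"
    using weighted_square_rule[OF L2.seminormed_axioms bdd_bilin_smooth T0 sm.ip_sym f e ef, of T] by (simp add: Bz)
  have D1: "(LINT t|?M. (T - t) * smooth_inner (q t) (e t)) =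
      (LINT t|?M. (T - t) * smooth_inner (p t) (e t)) - (LINT t|?M. (T - t) * smooth_inner (time_d1 \<Omega> T y t) (e t))"
  proof -
    note i = time_weight_integrable[OF sm_int[OF p e], of T] time_weight_integrable[OF sm_int[OF yW(3) e], of T]
    have "(LINT t|?M. (T - t) * smooth_inner (p t) (e t) - (T - t) * smooth_inner (time_d1 \<Omega> T y t) (e t)) = (LINT t|?M. (T - t) * smooth_inner (q t) (e t))"
    proof (rule LINT_weighted_eq_AE(2))
      show "AE t in ?M. (T - t) * smooth_inner (p t) (e t) - (T - t) * smooth_inner (time_d1 \<Omega> T y t) (e t) = (T - t) * smooth_inner (q t) (e t)"
        using L2_time_AE[OF p] L2_time_AE[OF yW(3)] L2_time_AE[OF e]
        by eventually_elim (simp add: q_def p_def sm.ip_diff_left right_diff_distrib)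
    qed (use i in simp)
    then show ?thesis using i by simp
  qed
  have D2: "0 \<le> (LINT t|?M. (T - t) * yosida_form (z t) (e t)) - (LINT t|?M. (T - t) * yosida_form (y t) (e t))"
  proof -
    note i = time_weight_integrable[OF yo_int[OF zW(2) e], of T] time_weight_integrable[OF yo_int[OF yW(2) e], of T]
    have "0 \<le> (LINT t|?M. (T - t) * yosida_form (z t) (e t) - (T - t) * yosida_form (y t) (e t))"
    proof (rule integral_nonneg_AE)
      show "AE t in ?M. 0 \<le> (T - t) * yosida_form (z t) (e t) - (T - t) * yosida_form (y t) (e t)"
        using L2_time_AE[OF zW(2)] L2_time_AE[OF yW(2)] L2_time_AE[OF e] AE_space
      proof eventually_elim
        fix t assume a: "z t \<in> car (L2 \<Omega>)" "y t \<in> car (L2 \<Omega>)" "e t \<in> car (L2 \<Omega>)" "t \<in> space ?M"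
        have "yosida_form (z t) (e t) - yosida_form (y t) (e t) = yosida_form (e t) (e t)"
          using yo.ip_diff_left[OF a(1-3)] by (simp add: e_def)
        then show "0 \<le> (T - t) * yosida_form (z t) (e t) - (T - t) * yosida_form (y t) (e t)"
          using yo.ip_nonneg[OF a(3)] a(4) by (simp add: right_diff_distrib[symmetric])
      qed
    qed
    then show ?thesis using i by simp
  qed
  have Ez: "\<tau> * (LINT t|?M. (T - t) * time_d2 \<Omega> T z t (J (e t)))
      + (LINT t|?M. (T - t) * smooth_inner (p t) (e t)) + (LINT t|?M. (T - t) * yosida_form (z t) (e t))
    = (LINT t|?M. (T - t) * smooth_inner (u t) (e t))"
    using cattaneo_tested[OF sol u e, of T] unfolding p_def .
  have Ey: "(LINT t|?M. (T - t) * smooth_inner (time_d1 \<Omega> T y t) (e t)) + (LINT t|?M. (T - t) * yosida_form (y t) (e t))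
    = (LINT t|?M. (T - t) * smooth_inner (u t) (e t))"
    by (rule heat_tested[OF heat u e])
  have main: "smooth_sq T e \<le> 2 * (\<tau> * - (LINT t|?M. (T - t) * time_d2 \<Omega> T z t (J (e t))))"
    using Ez Ey D1 D2 B by (simp add: algebra_simps)
  \<comment> \<open>Young's inequality; \<open>\<tau> \<le> 1/2\<close> allows the error on the right to be absorbed\<close>
  define P where "P = (LINT t|?M. L2_inner \<Omega> (p t) (p t))"
  define Q where "Q = (LINT t|?M. L2_inner \<Omega> (q t) (q t))"
  have Y1: "2 * \<bar>LINT t|?M. smooth_inner (p t) (e t)\<bar> \<le> smooth_sq T p + smooth_sq T e"
  proof -
    have "2 * \<bar>LINT t|?M. smooth_inner (p t) (e t)\<bar> \<le> (LINT t|?M. 2 * norm (smooth_inner (p t) (e t)))"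
      using integral_norm_bound[of ?M "\<lambda>t. smooth_inner (p t) (e t)"] by simp
    also have "\<dots> \<le> (LINT t|?M. smooth_inner (p t) (p t) + smooth_inner (e t) (e t))"
    proof (rule integral_mono_AE)
      show "AE t in ?M. 2 * norm (smooth_inner (p t) (e t)) \<le> smooth_inner (p t) (p t) + smooth_inner (e t) (e t)"
        using L2_time_AE[OF p] L2_time_AE[OF e] unfolding real_norm_def by eventually_elim (rule sm.young)
    qed (use sm_int[OF p e] sm_int[OF p p] sm_int[OF e e] in simp_all)
    finally show ?thesis using sm_int[OF p p] sm_int[OF e e] by simp
  qed
  have Y2: "2 * \<bar>LINT t|?M. (T - t) * smooth_inner (p t) (q t)\<bar> \<le> T * P + T * Q"
  proof -
    have "T * smooth_sq T p \<le> T * P" "T * smooth_sq T q \<le> T * Q"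
      unfolding P_def Q_def by (intro mult_left_mono smooth_sq_le p q T0)+
    then show ?thesis
      using weighted_smooth_young[OF p q, of T] weighted_smooth_sq_bounds(1)[OF p, of T] weighted_smooth_sq_bounds(1)[OF q, of T]
      by linarith
  qed
  have "smooth_sq T p \<le> P" unfolding P_def by (rule smooth_sq_le[OF p])
  then have "- (2 * (LINT t|?M. (T - t) * time_d2 \<Omega> T z t (J (e t)))) \<le> P + smooth_sq T e + T * P + T * Q"
    using A Y1 Y2 by linarith
  then have "\<tau> * - (2 * (LINT t|?M. (T - t) * time_d2 \<Omega> T z t (J (e t)))) \<le> \<tau> * (P + smooth_sq T e + T * P + T * Q)"
    using \<tau> by (intro mult_left_mono) auto
  then have "smooth_sq T e \<le> \<tau> * (P + T * P + T * Q) + \<tau> * smooth_sq T e"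
    using main by (simp add: algebra_simps)
  moreover have "\<tau> * smooth_sq T e \<le> (1/2) * smooth_sq T e"
    using \<tau> by (intro mult_right_mono integral_nonneg_AE AE_mp[OF L2_time_AE[OF e] AE_I2]) (auto intro: sm.ip_nonneg)
  ultimately have "smooth_sq T e \<le> 2 * (\<tau> * (P + T * P + T * Q))" by linarith
  also have "\<dots> = 2 * \<tau> * ((T + 1) * P + T * Q)" by (simp add: algebra_simps)
  finally show ?thesis by (simp add: P_def Q_def e_def p_def q_def)
qed

end

context bounded_open_set
begin

text \<open>
  Fatou's lemma removes the smoothing from \<open>smoothed_energy_estimate\<close>, whose right-hand side does
  not depend on \<open>\<epsilon>\<close>.
\<close>

lemma energy_estimate:
  assumes T: "T > 0" and \<tau>: "\<tau> > 0"
    and u: "u \<in> car (L2_time T (L2 \<Omega>))" and y0: "y0 \<in> car (H10 \<Omega>)" and y1: "y1 \<in> car (L2 \<Omega>)"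
    and sol: "cattaneo_weak_solution \<Omega> T \<tau> u y0 y1 y"
  defines "E \<equiv> (T + 1) * (\<tau> * L2_inner \<Omega> y1 y1 + dirichlet_form \<Omega> y0 y0 + (LINT t|time_measure T. L2_inner \<Omega> (u t) (u t)))"
  shows "(LINT t|time_measure T. L2_inner \<Omega> (time_d1 \<Omega> T y t) (time_d1 \<Omega> T y t)) \<le> E"
    and "(LINT t|time_measure T. dirichlet_form \<Omega> (y t) (y t)) \<le> E"
proof -
  let ?M = "time_measure T"
  define r where "r n = 1 / real (Suc n)" for n
  have rs: "resolvent_setting \<Omega> (r n)" for n by unfold_locales (auto simp: r_def)
  have Y: "y \<in> Y_space \<Omega> T" using sol by (simp add: cattaneo_weak_solution_def)
  note W = W_space_props[OF Y_space_props(1)[OF Y]]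
  let ?s = "\<lambda>n t. resolvent_setting.smooth_inner \<Omega> (r n) (time_d1 \<Omega> T y t) (time_d1 \<Omega> T y t)"
  let ?y = "\<lambda>n t. resolvent_setting.yosida_form \<Omega> (r n) (y t) (y t)"
  have props: "integrable ?M (?s n)" "AE t in ?M. 0 \<le> ?s n t" "integral\<^sup>L ?M (?s n) \<le> E"
    "integrable ?M (?y n)" "AE t in ?M. 0 \<le> ?y n t" "integral\<^sup>L ?M (?y n) \<le> E" for n
  proof -
    interpret r: resolvent_setting \<Omega> "r n" by (rule rs)
    show "integrable ?M (?s n)" by (rule r.sm_int[OF W(3) W(3)])
    show s2: "AE t in ?M. 0 \<le> ?s n t" using L2_time_AE[OF W(3)] by eventually_elim (rule r.sm.ip_nonneg)
    show "integrable ?M (?y n)" by (rule r.yo_int[OF W(2) W(2)])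
    show y2: "AE t in ?M. 0 \<le> ?y n t" using L2_time_AE[OF W(2)] by eventually_elim (rule r.yo.ip_nonneg)
    show "integral\<^sup>L ?M (?s n) \<le> E" "integral\<^sup>L ?M (?y n) \<le> E"
      using r.smoothed_energy_estimate[OF T \<tau> u y0 y1 sol] integral_nonneg_AE[OF s2] integral_nonneg_AE[OF y2]
      unfolding E_def by linarith+
  qed
  show "(LINT t|?M. L2_inner \<Omega> (time_d1 \<Omega> T y t) (time_d1 \<Omega> T y t)) \<le> E"
  proof (rule integral_le_of_AE_LIMSEQ(2)[OF props(1-3)])
    show "AE t in ?M. (\<lambda>n. ?s n t) \<longlonglongrightarrow> L2_inner \<Omega> (time_d1 \<Omega> T y t) (time_d1 \<Omega> T y t)"
      using L2_time_AE[OF W(3)] unfolding r_def by eventually_elim (rule smooth_inner_tendsto)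
  qed (use L2.ip_integrable[OF W(3) W(3)] in auto)
  show "(LINT t|?M. dirichlet_form \<Omega> (y t) (y t)) \<le> E"
  proof (rule integral_le_of_AE_LIMSEQ(2)[OF props(4-6)])
    show "AE t in ?M. (\<lambda>n. ?y n t) \<longlonglongrightarrow> dirichlet_form \<Omega> (y t) (y t)"
      using L2_time_AE[OF W(1)] unfolding r_def by eventually_elim (rule yosida_form_tendsto)
  qed (use bdd_bilin_integrable[OF H10.seminormed_axioms H10.seminormed_axioms bdd_bilin_dirichlet W(1) W(1)] in auto)
qed

lemma error_estimate:
  assumes T: "T > 0" and \<tau>: "0 < \<tau>" "\<tau> \<le> 1/2"
    and u: "u \<in> car (L2_time T (L2 \<Omega>))" and y0: "y0 \<in> car (L2 \<Omega>)"
    and sol: "cattaneo_weak_solution \<Omega> T \<tau> u y0 y1 z" and heat: "heat_weak_solution \<Omega> T u y0 y"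
  shows "(LINT t|time_measure T. L2_inner \<Omega> (z t - y t) (z t - y t)) \<le>
    2 * \<tau> * ((T + 1) * (LINT t|time_measure T. L2_inner \<Omega> (time_d1 \<Omega> T z t) (time_d1 \<Omega> T z t))
    + T * (LINT t|time_measure T. L2_inner \<Omega> (time_d1 \<Omega> T z t - time_d1 \<Omega> T y t) (time_d1 \<Omega> T z t - time_d1 \<Omega> T y t)))"
    (is "_ \<le> ?E")
proof -
  let ?M = "time_measure T"
  define r where "r n = 1 / real (Suc n)" for n
  have rs: "resolvent_setting \<Omega> (r n)" for n by unfold_locales (auto simp: r_def)
  have zy: "z \<in> Y_space \<Omega> T" "y \<in> W_space \<Omega> T"
    using sol heat by (simp_all add: cattaneo_weak_solution_def heat_weak_solution_def)
  have e: "(\<lambda>t. z t - y t) \<in> car (L2_time T (L2 \<Omega>))"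
    by (rule L2.L2_time_diff[OF W_space_props(2)[OF Y_space_props(1)[OF zy(1)]] W_space_props(2)[OF zy(2)]])
  let ?s = "\<lambda>n t. resolvent_setting.smooth_inner \<Omega> (r n) (z t - y t) (z t - y t)"
  have props: "integrable ?M (?s n)" "AE t in ?M. 0 \<le> ?s n t" "integral\<^sup>L ?M (?s n) \<le> ?E" for n
  proof -
    interpret r: resolvent_setting \<Omega> "r n" by (rule rs)
    show "integrable ?M (?s n)" by (rule r.sm_int[OF e e])
    show "AE t in ?M. 0 \<le> ?s n t" using L2_time_AE[OF e] by eventually_elim (rule r.sm.ip_nonneg)
    show "integral\<^sup>L ?M (?s n) \<le> ?E" by (rule r.smoothed_error_estimate[OF T \<tau> u y0 sol heat])
  qed
  show ?thesis
  proof (rule integral_le_of_AE_LIMSEQ(2)[OF props])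
    show "AE t in ?M. (\<lambda>n. ?s n t) \<longlonglongrightarrow> L2_inner \<Omega> (z t - y t) (z t - y t)"
      using L2_time_AE[OF e] unfolding r_def by eventually_elim (rule smooth_inner_tendsto)
  qed (use L2.ip_integrable[OF e e] in auto)
qed

end

section \<open>Convergence\<close>

lemma converges_weaklyI:
  assumes X: "seminormed X" and x: "\<And>n. x n \<in> car X" "l \<in> car X"
    and null: "\<And>F. F \<in> car (dual X) \<Longrightarrow> (\<lambda>n. F (x n - l)) \<longlonglongrightarrow> 0"
  shows "converges_weakly_in X x l"
  unfolding converges_weakly_in_def
proof (intro conjI allI ballI x)
  interpret seminormed X by fact
  fix F assume F: "F \<in> car (dual X)"
  then have lin: "lin_on (car X) F" by (simp add: dual_iff)
  have "(\<lambda>n. F (x n) - F l) \<longlonglongrightarrow> 0"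
    using null[OF F] lin_on_diff[OF sub lin x(1) x(2)] by simp
  then show "(\<lambda>n. F (x n)) \<longlonglongrightarrow> F l" by (rule LIM_zero_cancel)
qed

lemma (in seminormed) LINT_nrm_le:
  assumes e: "e \<in> car (L2_time T X)" and T: "0 \<le> T"
  shows "(LINT t|time_measure T. nrm X (e t)) \<le> sqrt T * sqrt (LINT t|time_measure T. (nrm X (e t))\<^sup>2)"
proof -
  have lm: "{0<..<T} \<in> lmeasurable" by simp
  have m: "(\<lambda>t. nrm X (e t)) \<in> borel_measurable (time_measure T)"
    using e by (intro nrm_measurable) (auto simp: L2_time_iff)
  have c: "(\<lambda>t. nrm X (e t)) \<in> car (L2 {0<..<T})" using e m by (simp add: L2_iff L2_time_iff)
  have "(LINT t|time_measure T. nrm X (e t)) \<le> (LINT t|time_measure T. norm (nrm X (e t)))"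
    by (rule integral_mono_AE[OF L2_time_integrable_nrm[OF e] integrable_norm[OF L2_time_integrable_nrm[OF e]]]) auto
  also have "\<dots> \<le> sqrt (measure lebesgue {0<..<T}) * sqrt (L2_inner {0<..<T} (\<lambda>t. nrm X (e t)) (\<lambda>t. nrm X (e t)))"
    by (rule L2_integrable_norm(2)[OF lm c])
  finally show ?thesis using T by (simp add: L2_inner_self)
qed

context bounded_open_set
begin

text \<open>
  Against a fixed element of \<open>H\<^sup>1\<^sub>0\<close>, \<open>dirichlet_L2_bound\<close> trades all but a small part of the energy
  for the \<open>L\<^sup>2\<close> norm, which tends to 0.
\<close>

lemma weak_null_L2H10:
  assumes T: "T > 0" and e: "\<And>n::nat. e n \<in> car (L2_time T (H10 \<Omega>))"
    and bd: "\<forall>\<^sub>F n in sequentially. (LINT t|time_measure T. dirichlet_form \<Omega> (e n t) (e n t)) \<le> C"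
    and null: "(\<lambda>n. LINT t|time_measure T. L2_inner \<Omega> (e n t) (e n t)) \<longlonglongrightarrow> 0"
    and F: "F \<in> car (dual (L2_time T (H10 \<Omega>)))"
  shows "(\<lambda>n. F (e n)) \<longlonglongrightarrow> 0"
proof (rule H10.L2_time_weak_null[OF e _ _ F])
  let ?M = "time_measure T"
  have eL: "e n \<in> car (L2_time T (L2 \<Omega>))" for n by (rule H10_time_L2[OF e])
  have iL: "integrable ?M (\<lambda>t. L2_inner \<Omega> (e n t) (e n t))" for n by (rule L2.ip_integrable[OF eL eL])
  have iD: "integrable ?M (\<lambda>t. dirichlet_form \<Omega> (e n t) (e n t))" for n
    by (rule bdd_bilin_integrable[OF H10.seminormed_axioms H10.seminormed_axioms bdd_bilin_dirichlet e e])
  have "\<forall>\<^sub>F n in sequentially. (LINT t|?M. L2_inner \<Omega> (e n t) (e n t)) < 1"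
    by (rule order_tendstoD(2)[OF null]) simp
  with bd show "\<forall>\<^sub>F n in sequentially. (LINT t|?M. h1_inner \<Omega> 1 (e n t) (e n t)) \<le> C + 1"
    by eventually_elim (simp add: h1_inner_def iL iD)
  fix x A assume x: "x \<in> car (H10 \<Omega>)" and A: "A \<in> sets ?M"
  define a where "a n = (LINT t|?M. nrm (L2 \<Omega>) (e n t))" for n
  have a0: "a \<longlonglongrightarrow> 0"
  proof -
    have "(\<lambda>n. sqrt T * sqrt (LINT t|?M. L2_inner \<Omega> (e n t) (e n t))) \<longlonglongrightarrow> sqrt T * sqrt 0"
      by (intro tendsto_intros null)
    then have lim: "(\<lambda>n. sqrt T * sqrt (LINT t|?M. L2_inner \<Omega> (e n t) (e n t))) \<longlonglongrightarrow> 0" by simp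
    have "0 \<le> a n" for n
      unfolding a_def
      by (intro integral_nonneg_AE AE_mp[OF L2_time_AE[OF eL[of n]] AE_I2]) (auto intro: L2.nrm_nonneg)
    moreover have "a n \<le> sqrt T * sqrt (LINT t|?M. L2_inner \<Omega> (e n t) (e n t))" for n
      using L2.LINT_nrm_le[OF eL[of n]] T unfolding a_def L2.LINT_nrm_sq[OF eL] by simp
    ultimately show ?thesis
      by (intro tendsto_sandwich[OF always_eventually always_eventually tendsto_const lim]) auto
  qed
  show "(\<lambda>n. LINT t|?M. indicator A t * h1_inner \<Omega> 1 (e n t) x) \<longlonglongrightarrow> 0"
  proof (rule LIMSEQ_I)
    fix r :: real assume r: "r > 0"
    define \<delta> where "\<delta> = r / (2 * (T + \<bar>C\<bar> + 1))"
    have \<delta>: "\<delta> > 0" using r T by (simp add: \<delta>_def)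
    obtain K where K: "K \<ge> 0" "\<And>w. w \<in> car (H10 \<Omega>) \<Longrightarrow>
      \<bar>dirichlet_form \<Omega> w x\<bar> \<le> \<delta> * sqrt (dirichlet_form \<Omega> w w) + K * sqrt (L2_inner \<Omega> w w)"
      using dirichlet_L2_bound[OF x \<delta>] by blast
    define N where "N = nrm (L2 \<Omega>) x + K"
    have pt: "\<bar>h1_inner \<Omega> 1 w x\<bar> \<le> \<delta> * (1 + dirichlet_form \<Omega> w w) + N * nrm (L2 \<Omega>) w" if w: "w \<in> car (H10 \<Omega>)" for w
    proof -
      have "\<bar>L2_inner \<Omega> w x\<bar> \<le> nrm (L2 \<Omega>) w * nrm (L2 \<Omega>) x"
        using L2.cauchy_schwarz[OF H10_L2[OF w] H10_L2[OF x]] by (simp add: L2.nrm_ip H10_L2[OF w] H10_L2[OF x])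
      moreover have "sqrt (dirichlet_form \<Omega> w w) \<le> 1 + dirichlet_form \<Omega> w w"
      proof (rule real_le_lsqrt)
        show "dirichlet_form \<Omega> w w \<le> (1 + dirichlet_form \<Omega> w w)\<^sup>2"
          using dirichlet_nonneg[of w] by (simp add: power2_sum)
      qed (use dirichlet_nonneg[of w] in auto)
      then have "\<delta> * sqrt (dirichlet_form \<Omega> w w) \<le> \<delta> * (1 + dirichlet_form \<Omega> w w)" using \<delta> by (intro mult_left_mono) auto
      moreover have "sqrt (L2_inner \<Omega> w w) = nrm (L2 \<Omega>) w" by (simp add: L2.nrm_ip H10_L2[OF w])
      ultimately show ?thesis using K(2)[OF w] by (simp add: h1_inner_def N_def algebra_simps)
    qed
    have "(\<lambda>n. N * a n) \<longlonglongrightarrow> N * 0" by (intro tendsto_intros a0)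
    then have "\<forall>\<^sub>F n in sequentially. N * a n < r / 2" using r by (intro order_tendstoD) auto
    then have "\<forall>\<^sub>F n in sequentially. norm ((LINT t|?M. indicator A t * h1_inner \<Omega> 1 (e n t) x) - 0) < r"
      using bd
    proof eventually_elim
      fix n assume n: "N * a n < r / 2" "(LINT t|?M. dirichlet_form \<Omega> (e n t) (e n t)) \<le> C"
      have xc: "(\<lambda>_. x) \<in> car (L2_time T (H10 \<Omega>))"
        using x integrable_const_time[of T]
        by (auto simp: L2_time_iff strongly_measurable_def intro!: exI[of _ "\<lambda>_ _. x"])
      have i1: "integrable ?M (\<lambda>t. indicator A t * h1_inner \<Omega> 1 (e n t) x)"
        using integrable_mult_indicator[OF A H10.ip_integrable[OF e xc, of n]] by simp
      have i2: "integrable ?M (\<lambda>t. \<delta> * (1 + dirichlet_form \<Omega> (e n t) (e n t)))"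
        using iD[of n] integrable_const_time[of T 1] by (intro integrable_mult_right Bochner_Integration.integrable_add)
      have i3: "integrable ?M (\<lambda>t. N * nrm (L2 \<Omega>) (e n t))"
        by (intro integrable_mult_right L2.L2_time_integrable_nrm eL)
      have "\<bar>LINT t|?M. indicator A t * h1_inner \<Omega> 1 (e n t) x\<bar> \<le> (LINT t|?M. norm (indicator A t * h1_inner \<Omega> 1 (e n t) x))"
        using integral_norm_bound[of ?M "\<lambda>t. indicator A t * h1_inner \<Omega> 1 (e n t) x"] by simp
      also have "\<dots> \<le> (LINT t|?M. \<delta> * (1 + dirichlet_form \<Omega> (e n t) (e n t)) + N * nrm (L2 \<Omega>) (e n t))"
      proof (rule integral_mono_AE)
        show "AE t in ?M. norm (indicator A t * h1_inner \<Omega> 1 (e n t) x) \<le> \<delta> * (1 + dirichlet_form \<Omega> (e n t) (e n t)) + N * nrm (L2 \<Omega>) (e n t)"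
          using L2_time_AE[OF e[of n]]
        proof eventually_elim
          fix t assume "e n t \<in> car (H10 \<Omega>)"
          from pt[OF this] show "norm (indicator A t * h1_inner \<Omega> 1 (e n t) x) \<le> \<delta> * (1 + dirichlet_form \<Omega> (e n t) (e n t)) + N * nrm (L2 \<Omega>) (e n t)"
            using abs_ge_zero[of "h1_inner \<Omega> 1 (e n t) x"] by (auto simp: indicator_def simp del: abs_ge_zero)
        qed
      qed (intro integrable_norm i1 Bochner_Integration.integrable_add i2 i3)+
      also have "\<dots> = \<delta> * (LINT t|?M. 1 + dirichlet_form \<Omega> (e n t) (e n t)) + N * a n"
        unfolding a_def using i2 i3 by simp
      also have "(LINT t|?M. 1 + dirichlet_form \<Omega> (e n t) (e n t)) = T + (LINT t|?M. dirichlet_form \<Omega> (e n t) (e n t))"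
        using iD[of n] integrable_const_time[of T 1] T by (simp add: measure_restrict_space)
      also have "\<delta> * (T + (LINT t|?M. dirichlet_form \<Omega> (e n t) (e n t))) \<le> \<delta> * (T + \<bar>C\<bar> + 1)"
        using n(2) \<delta> by (intro mult_left_mono) auto
      also have "\<delta> * (T + \<bar>C\<bar> + 1) = r / 2"
        using T by (simp add: \<delta>_def field_simps add_pos_nonneg)
      finally show "norm ((LINT t|?M. indicator A t * h1_inner \<Omega> 1 (e n t) x) - 0) < r" using n(1) by simp
    qed
    then show "\<exists>N. \<forall>n\<ge>N. norm ((LINT t|?M. indicator A t * h1_inner \<Omega> 1 (e n t) x) - 0) < r"
      by (simp add: eventually_sequentially)
  qed
qed

text \<open>
  Time derivatives that stay bounded converge weakly to zero if the functions do: move the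
  derivative onto a smooth function of time, and approximate indicator functions by these.
\<close>

lemma weak_null_time_deriv:
  fixes e q :: "nat \<Rightarrow> real \<Rightarrow> 'a \<Rightarrow> 'b::euclidean_space"
  assumes T: "T > 0" and e: "\<And>n. e n \<in> car (L2_time T (L2 \<Omega>))" and q: "\<And>n. q n \<in> car (L2_time T (L2 \<Omega>))"
    and parts: "\<And>n x \<phi>. x \<in> car (L2 \<Omega>) \<Longrightarrow> \<phi> \<in> test_functions {0<..<T} \<Longrightarrow>
      (LINT t|time_measure T. deriv \<phi> t * L2_inner \<Omega> (e n t) x) = - (LINT t|time_measure T. \<phi> t * L2_inner \<Omega> (q n t) x)"
    and bd: "\<forall>\<^sub>F n in sequentially. (LINT t|time_measure T. L2_inner \<Omega> (q n t) (q n t)) \<le> C"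
    and null: "(\<lambda>n. LINT t|time_measure T. L2_inner \<Omega> (e n t) (e n t)) \<longlonglongrightarrow> 0"
    and F: "F \<in> car (dual (L2_time T (L2 \<Omega>)))"
  shows "(\<lambda>n. F (q n)) \<longlonglongrightarrow> 0"
proof (rule L2.L2_time_weak_null[OF q bd _ F])
  let ?M = "time_measure T" and ?I = "{0<..<T}"
  have I: "open ?I" "?I \<in> lmeasurable" by auto
  fix x :: "'a \<Rightarrow> 'b" and A assume x: "x \<in> car (L2 \<Omega>)" and A: "A \<in> sets ?M"
  have xc: "(\<lambda>_. x) \<in> car (L2_time T (L2 \<Omega>))"
    using x integrable_const_time[of T]
    by (auto simp: L2_time_iff strongly_measurable_def intro!: exI[of _ "\<lambda>_ _. x"])
  define N where "N = L2_inner \<Omega> x x"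
  have N: "0 \<le> N" unfolding N_def by (rule L2.ip_nonneg[OF x])
  define f where "f n t = L2_inner \<Omega> (e n t) x" for n t
  define g where "g n t = L2_inner \<Omega> (q n t) x" for n t
  have scal: "(\<lambda>t. L2_inner \<Omega> (h t) x) \<in> car (L2 ?I)"
    "L2_inner ?I (\<lambda>t. L2_inner \<Omega> (h t) x) (\<lambda>t. L2_inner \<Omega> (h t) x) \<le> N * (LINT t|?M. L2_inner \<Omega> (h t) (h t))"
    if h: "h \<in> car (L2_time T (L2 \<Omega>))" for h
  proof -
    have m: "(\<lambda>t. L2_inner \<Omega> (h t) x) \<in> borel_measurable ?M" using L2.ip_integrable[OF h xc] by auto
    have i: "integrable ?M (\<lambda>t. N * L2_inner \<Omega> (h t) (h t))" using L2.ip_integrable[OF h h] by simp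
    have le: "AE t in ?M. (norm (L2_inner \<Omega> (h t) x))\<^sup>2 \<le> N * L2_inner \<Omega> (h t) (h t)"
      using L2_time_AE[OF h]
    proof eventually_elim
      fix t assume "h t \<in> car (L2 \<Omega>)"
      from L2.cauchy_schwarz_sq[OF this x] show "(norm (L2_inner \<Omega> (h t) x))\<^sup>2 \<le> N * L2_inner \<Omega> (h t) (h t)"
        by (simp add: N_def mult.commute)
    qed
    show c: "(\<lambda>t. L2_inner \<Omega> (h t) x) \<in> car (L2 ?I)" by (rule L2_I[OF m i le])
    have "(LINT t|?M. (norm (L2_inner \<Omega> (h t) x))\<^sup>2) \<le> (LINT t|?M. N * L2_inner \<Omega> (h t) (h t))"
      using c by (intro integral_mono_AE[OF _ i le]) (simp add: L2_iff)
    then show "L2_inner ?I (\<lambda>t. L2_inner \<Omega> (h t) x) (\<lambda>t. L2_inner \<Omega> (h t) x) \<le> N * (LINT t|?M. L2_inner \<Omega> (h t) (h t))"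
      by (simp add: L2_inner_self)
  qed
  note fc = scal(1)[OF e, folded f_def] and fn = scal(2)[OF e, folded f_def]
  note gc = scal(1)[OF q, folded g_def] and gn = scal(2)[OF q, folded g_def]
  have test: "(\<lambda>n. L2_inner ?I (\<phi> :: real \<Rightarrow> real) (g n)) \<longlonglongrightarrow> 0" if \<phi>: "\<phi> \<in> test_functions ?I" for \<phi>
  proof -
    have \<phi>d: "deriv \<phi> \<in> car (L2 ?I)"
      using test_function_derivative_L2[OF \<phi>, of ?I 1] by (simp add: deriv_eq_frechet_derivative[OF \<phi>])
    have eq: "L2_inner ?I \<phi> (g n) = - L2_inner ?I (deriv \<phi>) (f n)" for n
      using parts[OF x \<phi>, of n] by (simp add: L2_inner_def f_def g_def)
    have "(\<lambda>n. sqrt (L2_inner ?I (deriv \<phi>) (deriv \<phi>)) * sqrt (N * (LINT t|?M. L2_inner \<Omega> (e n t) (e n t)))) \<longlonglongrightarrow>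
        sqrt (L2_inner ?I (deriv \<phi>) (deriv \<phi>)) * sqrt (N * 0)"
      by (intro tendsto_intros null)
    then have lim: "(\<lambda>n. sqrt (L2_inner ?I (deriv \<phi>) (deriv \<phi>)) * sqrt (N * (LINT t|?M. L2_inner \<Omega> (e n t) (e n t)))) \<longlonglongrightarrow> 0" by simp
    have "\<bar>L2_inner ?I \<phi> (g n)\<bar> \<le> sqrt (L2_inner ?I (deriv \<phi>) (deriv \<phi>)) * sqrt (N * (LINT t|?M. L2_inner \<Omega> (e n t) (e n t)))" for n
    proof -
      have "\<bar>L2_inner ?I (deriv \<phi>) (f n)\<bar> \<le> sqrt (L2_inner ?I (deriv \<phi>) (deriv \<phi>)) * sqrt (L2_inner ?I (f n) (f n))"
        by (rule L2.cauchy_schwarz[OF \<phi>d fc])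
      also have "\<dots> \<le> sqrt (L2_inner ?I (deriv \<phi>) (deriv \<phi>)) * sqrt (N * (LINT t|?M. L2_inner \<Omega> (e n t) (e n t)))"
        by (intro mult_left_mono real_sqrt_le_mono fn) (simp add: L2.ip_nonneg[OF \<phi>d])
      finally show ?thesis by (simp add: eq)
    qed
    then have "(\<lambda>n. \<bar>L2_inner ?I \<phi> (g n)\<bar>) \<longlonglongrightarrow> 0"
      by (intro tendsto_sandwich[OF always_eventually always_eventually tendsto_const lim]) auto
    then show ?thesis using tendsto_rabs_zero_iff by blast
  qed
  have ind: "(indicator A :: real \<Rightarrow> real) \<in> car (L2 ?I)"
  proof -
    have "(indicator A :: real \<Rightarrow> real) \<in> borel_measurable ?M" using A by simp
    moreover have "(\<lambda>t. (norm (indicator A t :: real))\<^sup>2) = indicator A" by (auto simp: indicator_def)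
    moreover have "integrable ?M (indicator A :: real \<Rightarrow> real)"
      using integrable_mult_indicator[OF A integrable_const_time[of T 1]] by simp
    ultimately show ?thesis by (simp add: L2_iff)
  qed
  show "(\<lambda>n. LINT t|?M. indicator A t * L2_inner \<Omega> (q n t) x) \<longlonglongrightarrow> 0"
  proof (rule LIMSEQ_I)
    fix r :: real assume r: "r > 0"
    define k where "k = sqrt (N * \<bar>C\<bar>) + 1"
    have k: "k > 0" 
    proof -
      have "0 \<le> sqrt (N * \<bar>C\<bar>)" using N by simp
      then show ?thesis unfolding k_def by linarith
    qed
    obtain \<phi> where \<phi>: "\<phi> \<in> test_functions ?I" "L2_inner ?I (indicator A - \<phi>) (indicator A - \<phi>) < (r / (2 * k))\<^sup>2"
      using test_functions_dense_L2[OF I ind, of "(r / (2 * k))\<^sup>2"] r k by auto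
    have \<phi>c: "\<phi> \<in> car (L2 ?I)" by (rule test_function_L2[OF \<phi>(1)]) simp
    have "\<forall>\<^sub>F n in sequentially. \<bar>L2_inner ?I \<phi> (g n)\<bar> < r / 2"
      using tendstoD[OF test[OF \<phi>(1)], of "r / 2"] r unfolding dist_real_def by simp
    then have "\<forall>\<^sub>F n in sequentially. norm ((LINT t|?M. indicator A t * L2_inner \<Omega> (q n t) x) - 0) < r"
      using bd
    proof eventually_elim
      fix n assume n: "\<bar>L2_inner ?I \<phi> (g n)\<bar> < r / 2" "(LINT t|?M. L2_inner \<Omega> (q n t) (q n t)) \<le> C"
      have d: "indicator A - \<phi> \<in> car (L2 ?I)" by (rule L2.mem_diff[OF ind \<phi>c])
      have "\<bar>L2_inner ?I (indicator A - \<phi>) (g n)\<bar> \<le> sqrt (L2_inner ?I (indicator A - \<phi>) (indicator A - \<phi>)) * sqrt (L2_inner ?I (g n) (g n))"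
        by (rule L2.cauchy_schwarz[OF d gc])
      also have "\<dots> \<le> (r / (2 * k)) * k"
      proof (rule mult_mono)
        show "sqrt (L2_inner ?I (indicator A - \<phi>) (indicator A - \<phi>)) \<le> r / (2 * k)"
          using \<phi>(2) r k by (intro real_le_lsqrt) (auto simp: L2.ip_nonneg[OF d])
        have "L2_inner ?I (g n) (g n) \<le> N * \<bar>C\<bar>"
          using gn[of n] mult_left_mono[of "LINT t|?M. L2_inner \<Omega> (q n t) (q n t)" "\<bar>C\<bar>" N] n(2) N by linarith
        then show "sqrt (L2_inner ?I (g n) (g n)) \<le> k"
          unfolding k_def using real_sqrt_le_mono[of "L2_inner ?I (g n) (g n)" "N * \<bar>C\<bar>"] by linarith
      qed (use r k L2.ip_nonneg[OF gc] in auto)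
      also have "\<dots> = r / 2" using k by simp
      finally have "\<bar>L2_inner ?I (indicator A - \<phi>) (g n)\<bar> \<le> r / 2" .
      moreover have "L2_inner ?I (indicator A - \<phi>) (g n) = L2_inner ?I (indicator A) (g n) - L2_inner ?I \<phi> (g n)"
        by (rule L2.ip_diff_left[OF ind \<phi>c gc])
      ultimately have "\<bar>L2_inner ?I (indicator A) (g n)\<bar> < r" using n(1) by linarith
      then show "norm ((LINT t|?M. indicator A t * L2_inner \<Omega> (q n t) x) - 0) < r"
        by (simp add: L2_inner_def g_def)
    qed
    then show "\<exists>N. \<forall>n\<ge>N. norm ((LINT t|?M. indicator A t * L2_inner \<Omega> (q n t) x) - 0) < r"
      by (simp add: eventually_sequentially)
  qed
qed

lemma weak_time_deriv_inner_diff: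
  assumes v: "has_weak_time_deriv T (L2 \<Omega>) v w" "v \<in> car (L2_time T (L2 \<Omega>))" "w \<in> car (L2_time T (L2 \<Omega>))"
    and v': "has_weak_time_deriv T (L2 \<Omega>) v' w'" "v' \<in> car (L2_time T (L2 \<Omega>))" "w' \<in> car (L2_time T (L2 \<Omega>))"
    and x: "x \<in> car (L2 \<Omega>)" and \<phi>: "\<phi> \<in> test_functions {0<..<T}"
  shows "(LINT t|time_measure T. deriv \<phi> t * L2_inner \<Omega> ((v - v') t) x) = - (LINT t|time_measure T. \<phi> t * L2_inner \<Omega> ((w - w') t) x)"
proof -
  let ?M = "time_measure T"
  have F: "(\<lambda>f. L2_inner \<Omega> f x) \<in> car (dual (L2 \<Omega>))"
    by (rule bdd_bilin_dual(1)[OF L2.bdd_bilin_ip L2.seminormed_axioms L2.seminormed_axioms x])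
  note int = L2.dual_L2_time[OF F]
  have one: "(LINT t|?M. deriv \<phi> t * L2_inner \<Omega> (f t) x) = - (LINT t|?M. \<phi> t * L2_inner \<Omega> (g t) x)"
    if f: "has_weak_time_deriv T (L2 \<Omega>) f g" "f \<in> car (L2_time T (L2 \<Omega>))" "g \<in> car (L2_time T (L2 \<Omega>))" for f g
    by (rule weak_time_deriv_dual[OF L2.seminormed_axioms f(1) F L2_time_AE[OF f(2)] L2_time_AE[OF f(3)] \<phi>])
       (use int[OF f(2)] int[OF f(3)] in auto)
  have split: "(LINT t|?M. \<theta> t * L2_inner \<Omega> ((f - g) t) x) = (LINT t|?M. \<theta> t * L2_inner \<Omega> (f t) x) - (LINT t|?M. \<theta> t * L2_inner \<Omega> (g t) x)"
    if f: "f \<in> car (L2_time T (L2 \<Omega>))" and g: "g \<in> car (L2_time T (L2 \<Omega>))"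
      and \<theta>: "\<theta> \<in> borel_measurable ?M" "\<And>t. \<bar>\<theta> t\<bar> \<le> K" for f g \<theta> K
  proof -
    have i: "integrable ?M (\<lambda>t. \<theta> t * L2_inner \<Omega> (h t) x)" if h: "h \<in> car (L2_time T (L2 \<Omega>))" for h
    proof (rule Bochner_Integration.integrable_bound[OF integrable_mult_right[OF int[OF h], of K]])
      show "AE t in ?M. norm (\<theta> t * L2_inner \<Omega> (h t) x) \<le> norm (K * L2_inner \<Omega> (h t) x)"
        by (intro AE_I2) (auto simp: abs_mult intro!: mult_right_mono order_trans[OF \<theta>(2)])
    qed (use \<theta>(1) int[OF h] in auto)
    have "(LINT t|?M. \<theta> t * L2_inner \<Omega> (f t) x - \<theta> t * L2_inner \<Omega> (g t) x) = (LINT t|?M. \<theta> t * L2_inner \<Omega> ((f - g) t) x)"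
    proof (rule LINT_weighted_eq_AE(2))
      show "AE t in ?M. \<theta> t * L2_inner \<Omega> (f t) x - \<theta> t * L2_inner \<Omega> (g t) x = \<theta> t * L2_inner \<Omega> ((f - g) t) x"
        using L2_time_AE[OF f] L2_time_AE[OF g] by eventually_elim (simp add: L2.ip_diff_left x right_diff_distrib)
    qed (use i[OF f] i[OF g] in simp)
    then show ?thesis using i[OF f] i[OF g] by simp
  qed
  note p = test_function_props[OF \<phi>]
  obtain K where K: "\<And>t. \<bar>\<phi> t\<bar> \<le> K" using bounded_of_compact_support[OF p(1,4,6)] by blast
  have dc: "continuous_on UNIV (deriv \<phi>)" unfolding deriv_eq_frechet_derivative[OF \<phi>] using p(3)[of 1] by simp
  obtain K' where K': "\<And>t. \<bar>deriv \<phi> t\<bar> \<le> K'"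
    using bounded_of_compact_support[OF dc p(4)] p(7) unfolding deriv_eq_frechet_derivative[OF \<phi>] by blast
  show ?thesis
    unfolding split[OF v(2) v'(2) borel_measurable_deriv_test[OF \<phi>] K']
      split[OF v(3) v'(3) borel_measurable_test_function(2)[OF \<phi>] K] one[OF v] one[OF v'] by simp
qed

lemma cattaneo_converges_to_heat:
  assumes T: "T > 0" and \<tau>: "\<And>i. \<tau> i > 0" "\<tau> \<longlonglongrightarrow> 0"
    and u: "u \<in> car (L2_time T (L2 \<Omega>))" and y0: "y0 \<in> car (H10 \<Omega>)" and y1: "y1 \<in> car (L2 \<Omega>)"
    and sol: "\<And>i. cattaneo_weak_solution \<Omega> T (\<tau> i) u y0 y1 (z i)" and heat: "heat_weak_solution \<Omega> T u y0 y"
  shows "converges_in (L2_time T (L2 \<Omega>)) z y"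
    and "converges_weakly_in (L2_time T (H10 \<Omega>)) z y"
    and "converges_weakly_in (L2_time T (L2 \<Omega>)) (\<lambda>i. time_d1 \<Omega> T (z i)) (time_d1 \<Omega> T y)"
proof -
  let ?M = "time_measure T"
  have Wz: "z i \<in> W_space \<Omega> T" for i
    using sol[of i] by (simp add: cattaneo_weak_solution_def Y_space_props(1))
  have Wy: "y \<in> W_space \<Omega> T" using heat by (simp add: heat_weak_solution_def)
  note zp = W_space_props[OF Wz] and yp = W_space_props[OF Wy]
  define e where "e i = z i - y" for i
  define q where "q i = time_d1 \<Omega> T (z i) - time_d1 \<Omega> T y" for i
  have eH: "e i \<in> car (L2_time T (H10 \<Omega>))" for i
    unfolding e_def by (rule subspace_diff[OF H10.subspace_L2_time zp(1) yp(1)])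
  have eL: "e i \<in> car (L2_time T (L2 \<Omega>))" for i by (rule H10_time_L2[OF eH])
  have qL: "q i \<in> car (L2_time T (L2 \<Omega>))" for i
    unfolding q_def by (rule subspace_diff[OF L2.subspace_L2_time zp(3) yp(3)])
  interpret LL: semi_inner_sp "L2_time T (L2 \<Omega>)" "\<lambda>f g. LINT t|?M. L2_inner \<Omega> (f t) (g t)"
    by (rule L2.semi_inner_sp_L2_time)
  define E where "E = (T + 1) * (L2_inner \<Omega> y1 y1 + dirichlet_form \<Omega> y0 y0 + (LINT t|?M. L2_inner \<Omega> (u t) (u t)))"
  define P where "P = (LINT t|?M. L2_inner \<Omega> (time_d1 \<Omega> T y t) (time_d1 \<Omega> T y t))"
  define G where "G = (LINT t|?M. dirichlet_form \<Omega> (y t) (y t))"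
  have small: "\<forall>\<^sub>F i in sequentially. \<tau> i < 1/2"
    by (rule order_tendstoD(2)[OF \<tau>(2)]) simp
  have bounds: "(LINT t|?M. L2_inner \<Omega> (time_d1 \<Omega> T (z i) t) (time_d1 \<Omega> T (z i) t)) \<le> E"
    "(LINT t|?M. L2_inner \<Omega> (q i t) (q i t)) \<le> 2 * E + 2 * P"
    "(LINT t|?M. dirichlet_form \<Omega> (e i t) (e i t)) \<le> 2 * E + 2 * G"
    "(LINT t|?M. L2_inner \<Omega> (e i t) (e i t)) \<le> 2 * \<tau> i * ((T + 1) * E + T * (2 * E + 2 * P))"
    if i: "\<tau> i < 1/2" for i
  proof -
    have "\<tau> i * L2_inner \<Omega> y1 y1 \<le> 1 * L2_inner \<Omega> y1 y1"
      using i by (intro mult_right_mono L2.ip_nonneg[OF y1]) simp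
    then have EE: "(T + 1) * (\<tau> i * L2_inner \<Omega> y1 y1 + dirichlet_form \<Omega> y0 y0 + (LINT t|?M. L2_inner \<Omega> (u t) (u t))) \<le> E"
      unfolding E_def using T by (intro mult_left_mono) auto
    note en = order_trans[OF energy_estimate(1)[OF T \<tau>(1) u y0 y1 sol] EE]
      order_trans[OF energy_estimate(2)[OF T \<tau>(1) u y0 y1 sol] EE]
    show 1: "(LINT t|?M. L2_inner \<Omega> (time_d1 \<Omega> T (z i) t) (time_d1 \<Omega> T (z i) t)) \<le> E" by (rule en(1))
    show 2: "(LINT t|?M. L2_inner \<Omega> (q i t) (q i t)) \<le> 2 * E + 2 * P"
      using LL.ip_diff_le[OF zp(3)[of i] yp(3)] 1 unfolding q_def P_def by linarith
    note id = bdd_bilin_integrable[OF H10.seminormed_axioms H10.seminormed_axioms bdd_bilin_dirichlet]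
    have "(LINT t|?M. dirichlet_form \<Omega> (e i t) (e i t)) \<le> (LINT t|?M. 2 * dirichlet_form \<Omega> (z i t) (z i t) + 2 * dirichlet_form \<Omega> (y t) (y t))"
    proof (rule integral_mono_AE[OF id[OF eH eH]])
      show "AE t in ?M. dirichlet_form \<Omega> (e i t) (e i t) \<le> 2 * dirichlet_form \<Omega> (z i t) (z i t) + 2 * dirichlet_form \<Omega> (y t) (y t)"
        using L2_time_AE[OF zp(1)[of i]] L2_time_AE[OF yp(1)]
        by eventually_elim (use dir.ip_diff_le in \<open>simp add: e_def\<close>)
    qed (use id[OF zp(1)[of i] zp(1)[of i]] id[OF yp(1) yp(1)] in simp)
    also have "\<dots> = 2 * (LINT t|?M. dirichlet_form \<Omega> (z i t) (z i t)) + 2 * G"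
      using id[OF zp(1)[of i] zp(1)[of i]] id[OF yp(1) yp(1)] by (simp add: G_def)
    finally show "(LINT t|?M. dirichlet_form \<Omega> (e i t) (e i t)) \<le> 2 * E + 2 * G" using en(2) by linarith
    have "(LINT t|?M. L2_inner \<Omega> (e i t) (e i t)) \<le> 2 * \<tau> i * ((T + 1) * (LINT t|?M. L2_inner \<Omega> (time_d1 \<Omega> T (z i) t) (time_d1 \<Omega> T (z i) t))
      + T * (LINT t|?M. L2_inner \<Omega> (q i t) (q i t)))"
      using error_estimate[OF T \<tau>(1) _ u H10_L2[OF y0] sol heat, of i] i by (simp add: e_def q_def)
    also have "\<dots> \<le> 2 * \<tau> i * ((T + 1) * E + T * (2 * E + 2 * P))"
      using T \<tau>(1)[of i] 1 2 by (intro mult_left_mono add_mono) auto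
    finally show "(LINT t|?M. L2_inner \<Omega> (e i t) (e i t)) \<le> 2 * \<tau> i * ((T + 1) * E + T * (2 * E + 2 * P))" .
  qed
  have null: "(\<lambda>i. LINT t|?M. L2_inner \<Omega> (e i t) (e i t)) \<longlonglongrightarrow> 0"
  proof (rule tendsto_sandwich[OF always_eventually _ tendsto_const])
    have "(\<lambda>i. 2 * \<tau> i * ((T + 1) * E + T * (2 * E + 2 * P))) \<longlonglongrightarrow> 2 * 0 * ((T + 1) * E + T * (2 * E + 2 * P))"
      by (intro tendsto_intros \<tau>)
    then show "(\<lambda>i. 2 * \<tau> i * ((T + 1) * E + T * (2 * E + 2 * P))) \<longlonglongrightarrow> 0" by simp
    show "\<forall>\<^sub>F i in sequentially. (LINT t|?M. L2_inner \<Omega> (e i t) (e i t)) \<le> 2 * \<tau> i * ((T + 1) * E + T * (2 * E + 2 * P))"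
      using small by eventually_elim (rule bounds(4))
  qed (use LL.ip_nonneg[OF eL] in simp)
  show "converges_in (L2_time T (L2 \<Omega>)) z y"
    unfolding converges_in_def
  proof (intro conjI allI zp(2) yp(2))
    show "(\<lambda>n. nrm (L2_time T (L2 \<Omega>)) (z n - y)) \<longlonglongrightarrow> 0"
      using tendsto_real_sqrt[OF null] LL.nrm_ip[OF eL] by (simp add: e_def)
  qed
  show "converges_weakly_in (L2_time T (H10 \<Omega>)) z y"
  proof (rule converges_weaklyI[OF _ zp(1) yp(1)])
    show "seminormed (L2_time T (H10 \<Omega>))"
      using semi_inner_sp.axioms(1)[OF H10.semi_inner_sp_L2_time] semi_inner.seminormedI semi_inner_sp.nrm_ip[OF H10.semi_inner_sp_L2_time]
      by blast
    fix F assume F: "F \<in> car (dual (L2_time T (H10 \<Omega>)))"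
    have "\<forall>\<^sub>F i in sequentially. (LINT t|?M. dirichlet_form \<Omega> (e i t) (e i t)) \<le> 2 * E + 2 * G"
      using small by eventually_elim (rule bounds(3))
    from weak_null_L2H10[OF T eH this null F] show "(\<lambda>i. F (z i - y)) \<longlonglongrightarrow> 0" unfolding e_def .
  qed
  show "converges_weakly_in (L2_time T (L2 \<Omega>)) (\<lambda>i. time_d1 \<Omega> T (z i)) (time_d1 \<Omega> T y)"
  proof (rule converges_weaklyI[OF LL.seminormed_axioms zp(3) yp(3)])
    fix F :: "(real \<Rightarrow> 'a \<Rightarrow> real) \<Rightarrow> real"
    assume F: "F \<in> car (dual (L2_time T (L2 \<Omega>)))"
    have bd: "\<forall>\<^sub>F i in sequentially. (LINT t|?M. L2_inner \<Omega> (q i t) (q i t)) \<le> 2 * E + 2 * P"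
      using small by eventually_elim (rule bounds(2))
    have parts: "(LINT t|?M. deriv \<phi> t * L2_inner \<Omega> (e i t) x) = - (LINT t|?M. \<phi> t * L2_inner \<Omega> (q i t) x)"
      if x: "x \<in> car (L2 \<Omega>)" and \<phi>: "\<phi> \<in> test_functions {0<..<T}" for i x \<phi>
      by (rule weak_time_deriv_inner_diff[OF zp(4,2,3) yp(4,2,3) x \<phi>, folded e_def q_def])
    from weak_null_time_deriv[OF T eL qL parts bd null F]
    show "(\<lambda>i. F (time_d1 \<Omega> T (z i) - time_d1 \<Omega> T y)) \<longlonglongrightarrow> 0" unfolding q_def .
  qed
qed

end

theorem theorem3p2:
  fixes \<Omega> :: "'a::euclidean_space set"
    and T :: real
    and \<tau> :: "nat \<Rightarrow> real"
    and u :: "real \<Rightarrow> 'a \<Rightarrow> real"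
    and y0 y1 :: "'a \<Rightarrow> real"
    and y\<tau> :: "nat \<Rightarrow> real \<Rightarrow> 'a \<Rightarrow> real"
    and y :: "real \<Rightarrow> 'a \<Rightarrow> real"
  assumes "bounded_lipschitz_domain \<Omega>"
    and "T > 0"
    and "\<forall>i. \<tau> i > 0"
    and "\<tau> \<longlonglongrightarrow> 0"
    and "u \<in> car (L2L2 \<Omega> T)"
    and "y0 \<in> car (H10 \<Omega>)"
    and "y1 \<in> car (L2 \<Omega>)"
    and "\<forall>i. cattaneo_weak_solution \<Omega> T (\<tau> i) u y0 y1 (y\<tau> i)"
    and "heat_weak_solution \<Omega> T u y0 y"
  shows "converges_in (L2L2 \<Omega> T) y\<tau> y
    \<and> converges_weakly_in (L2H10 \<Omega> T) y\<tau> y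
    \<and> converges_weakly_in (L2L2 \<Omega> T) (\<lambda>i. time_d1 \<Omega> T (y\<tau> i)) (time_d1 \<Omega> T y)"
proof -
  have "open \<Omega>" "bounded \<Omega>" using assms(1) by (simp_all add: bounded_lipschitz_domain_def)
  then interpret bounded_open_set \<Omega>
    by unfold_locales (auto intro: lmeasurable_open)
  show ?thesis
    by (intro conjI cattaneo_converges_to_heat[where u = u]) (use assms in auto)
qed

end
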